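(* Let $\alpha=(\alpha_i)_{i\ge1}\in(0,\infty)^{\mathbb N}$ with $|\alpha|_1=\sum_{i\ge1}\alpha_i<\infty$ and let $\alpha_\infty>0$. Then: (1) The sequence of probability measures $\mu^{(n)}_{\alpha,\alpha_\infty}$ ($n\ge1$, defined in the context) converges weakly to a probability measure $\mu^{(\infty)}_{\alpha,\alpha_\infty}$ on $\Delta^{(\infty)}$. (2) The form $$\mathcal E^{(\infty)}_{\alpha,\alpha_\infty}(f,g)=\int_{\Delta^{(\infty)}}\Big\{(1-|x|_1)\sum_{n=1}^\infty x_n(\partial_nf)(\partial_ng)\Big\}(x)\,\mu^{(\infty)}_{\alpha,\alpha_\infty}(dx),\qquad f,g\in\mathscr FC^1,$$ is closable in $L^2(\mu^{(\infty)}_{\alpha,\alpha_\infty})$ and its closure is a symmetric Dirichlet form. Its generator $(L^{(\infty)}_{\alpha,\alpha_\infty},\mathcal D(L^{(\infty)}_{\alpha,\alpha_\infty}))$ satisfies $\mathscr FC^2\subset\mathcal D(L^{(\infty)}_{\alpha,\alpha_\infty})$ and $$L^{(\infty)}_{\alpha,\alpha_\infty}f(x)=\sum_{n=1}^\infty\Big(x_n(1-|x|_1)\partial_n^2f(x)+\{\alpha_n(1-|x|_1)-\alpha_\infty x_n\}\partial_nf(x)\Big),\qquad f\in\mathscr FC^2.$$ (3) The spectral gap of $L^{(\infty)}_{\alpha,\alpha_\infty}$ equals $\alpha_\infty$. Consequently the associated Markov semigroup $P^{\alpha,\alpha_\infty}_t$ satisfies $\|P^{\alpha,\alpha_\infty}_t-\mu^{(\infty)}_{\alpha,\alpha_\infty}\|_{L^2(\mu^{(\infty)}_{\alpha,\alpha_\infty})}\le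 e^{-\alpha_\infty t}$ for $t\ge0$ (operator norm, $\mu^{(\infty)}_{\alpha,\alpha_\infty}$ acting as $f\mapsto\mu^{(\infty)}_{\alpha,\alpha_\infty}(f)$), and the sharp Poincaré inequality $$\mu^{(\infty)}_{\alpha,\alpha_\infty}(f^2)\le\frac1{\alpha_\infty}\mathcal E^{(\infty)}_{\alpha,\alpha_\infty}(f,f),\qquad f\in\mathscr FC^1,\ \mu^{(\infty)}_{\alpha,\alpha_\infty}(f)=0$$ holds.
   Context: $\Delta^{(\infty)}=\{x\in[0,1]^{\mathbb N}:\ |x|_1=\sum_{i\ge1}x_i\le1\}$ with the metric $|x-y|_1$. For $N\ge1$ and $\beta\in(0,\infty)^{N+1}$, $\mu^{(N)}_\beta$ is the Dirichlet distribution on $\Delta^{(N)}=\{x\in[0,1]^N:\sum_{i=1}^N x_i\le1\}$ with density $\frac{\Gamma(\sum_{i=1}^{N+1}\beta_i)}{\prod_{i=1}^{N+1}\Gamma(\beta_i)}(1-\sum_{i\le N}x_i)^{\beta_{N+1}-1}\prod_{i=1}^N x_i^{\beta_i-1}$. Set $\alpha^{(n)}=(\alpha_1,\dots,\alpha_{n-1},\sum_{i\ge n}\alpha_i,\alpha_\infty)\in(0,\infty)^{n+1}$ and $\mu^{(n)}_{\alpha,\alpha_\infty}(dx)=\mu^{(n)}_{\alpha^{(n)}}(dx_1,\dots,dx_n)\prod_{i>n}\delta_0(dx_i)$, a probability measure on $\Delta^{(\infty)}$. For $k\in\{1,2\}$, $\mathscr FC^k$ is the class of cylinder functions $f(x)=g(x_1,\dots,x_m)$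 with $m\in\mathbb N$ and $g\in C^k(\mathbb R^m)$; $\partial_n=\partial/\partial x_n$. The spectral gap of a nonpositive self-adjoint generator $L$ with Dirichlet form $\mathcal E$ and invariant probability $\mu$ is $\inf\{\mathcal E(f,f):\mu(f)=0,\mu(f^2)=1\}$. *)

theory Defs
  imports "HOL-Probability.Probability"
begin

text \<open>Points of the infinite simplex are sequences x :: nat => real, indexed from 0
  (coordinate x i corresponds to the paper's coordinate x_(i+1)).\<close>

type_synonym pt = "nat \<Rightarrow> real"

definition Msp :: "pt measure" where
  "Msp = Pi\<^sub>M UNIV (\<lambda>_. borel)"

definition Delta_inf :: "pt set" where
  "Delta_inf = {x. (\<forall>i. 0 \<le> x i \<and> x i \<le> 1) \<and> summable x \<and> suminf x \<le> 1}"

definition l1dist :: "pt \<Rightarrow> pt \<Rightarrow> real" where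
  "l1dist x y = (\<Sum>i. \<bar>x i - y i\<bar>)"

definition l1_continuous_on :: "pt set \<Rightarrow> (pt \<Rightarrow> real) \<Rightarrow> bool" where
  "l1_continuous_on S f \<longleftrightarrow>
     (\<forall>x\<in>S. \<forall>e>0. \<exists>d>0. \<forall>y\<in>S. l1dist x y < d \<longrightarrow> \<bar>f y - f x\<bar> < e)"

definition weak_conv_Delta :: "(nat \<Rightarrow> pt measure) \<Rightarrow> pt measure \<Rightarrow> bool" where
  "weak_conv_Delta \<mu>s \<mu> \<longleftrightarrow>
     (\<forall>f. f \<in> borel_measurable Msp \<longrightarrow> bounded (f ` Delta_inf) \<longrightarrow>
          l1_continuous_on Delta_inf f \<longrightarrow>
          (\<lambda>n. \<integral>x. f x \<partial>(\<mu>s n)) \<longlonglongrightarrow> (\<integral>x. f x \<partial>\<mu>))"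

definition dir_dens :: "nat \<Rightarrow> (nat \<Rightarrow> real) \<Rightarrow> pt \<Rightarrow> real" where
  "dir_dens N \<beta> x =
     (if (\<forall>i<N. 0 < x i) \<and> (\<Sum>i<N. x i) < 1 then
        Gamma (\<Sum>i\<le>N. \<beta> i) / (\<Prod>i\<le>N. Gamma (\<beta> i))
        * (1 - (\<Sum>i<N. x i)) powr (\<beta> N - 1) * (\<Prod>i<N. x i powr (\<beta> i - 1))
      else 0)"

definition ext0 :: "nat \<Rightarrow> pt \<Rightarrow> pt" where
  "ext0 N x = (\<lambda>i. if i < N then x i else 0)"

definition dirichlet :: "nat \<Rightarrow> (nat \<Rightarrow> real) \<Rightarrow> pt measure" where
  "dirichlet N \<beta> =
     distr (density (Pi\<^sub>M {..<N} (\<lambda>_. lborel)) (\<lambda>x. ennreal (dir_dens N \<beta> x))) Msp (ext0 N)"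

definition alpha_vec :: "nat \<Rightarrow> (nat \<Rightarrow> real) \<Rightarrow> real \<Rightarrow> nat \<Rightarrow> real" where
  "alpha_vec n \<alpha> ainf i =
     (if i < n - 1 then \<alpha> i else if i = n - 1 then (\<Sum>j. \<alpha> (j + (n - 1))) else ainf)"

definition mu_n :: "nat \<Rightarrow> (nat \<Rightarrow> real) \<Rightarrow> real \<Rightarrow> pt measure" where
  "mu_n n \<alpha> ainf = dirichlet n (alpha_vec n \<alpha> ainf)"

definition partial :: "nat \<Rightarrow> (pt \<Rightarrow> real) \<Rightarrow> pt \<Rightarrow> real" where
  "partial i f x = deriv (\<lambda>t. f (x(i := t))) (x i)"

definition partial_exists :: "nat \<Rightarrow> (pt \<Rightarrow> real) \<Rightarrow> bool" where
  "partial_exists i f \<longleftrightarrow> (\<forall>x. (\<lambda>t. f (x(i := t))) differentiable (at (x i)))"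

definition depends_on_first :: "nat \<Rightarrow> (pt \<Rightarrow> real) \<Rightarrow> bool" where
  "depends_on_first m f \<longleftrightarrow> (\<forall>x y. (\<forall>i<m. x i = y i) \<longrightarrow> f x = f y)"

text \<open>Cylinder functions f(x) = g(x_1,...,x_m) with g in C^1(R^m), resp. C^2(R^m)
  (C^k = all partial derivatives of order <= k exist and are continuous).
  For functions depending only on the first m coordinates, continuity in the product
  topology of nat => real is exactly continuity of g on R^m.\<close>
definition FC1 :: "(pt \<Rightarrow> real) set" where
  "FC1 = {f. \<exists>m. depends_on_first m f \<and> continuous_on UNIV f \<and>
              (\<forall>i<m. partial_exists i f \<and> continuous_on UNIV (partial i f))}"

definition FC2 :: "(pt \<Rightarrow> real) set" where
  "FC2 = {f. \<exists>m. depends_on_first m f \<and> continuous_on UNIV f \<and>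
              (\<forall>i<m. partial_exists i f \<and> continuous_on UNIV (partial i f) \<and>
                 (\<forall>j<m. partial_exists j (partial i f) \<and>
                        continuous_on UNIV (partial j (partial i f))))}"

definition Einf :: "pt measure \<Rightarrow> (pt \<Rightarrow> real) \<Rightarrow> (pt \<Rightarrow> real) \<Rightarrow> real" where
  "Einf \<mu> f g = (\<integral>x. (1 - suminf x) * (\<Sum>n. x n * partial n f x * partial n g x) \<partial>\<mu>)"

definition Lop :: "(nat \<Rightarrow> real) \<Rightarrow> real \<Rightarrow> (pt \<Rightarrow> real) \<Rightarrow> pt \<Rightarrow> real" where
  "Lop \<alpha> ainf f x =
     (\<Sum>n. x n * (1 - suminf x) * partial n (partial n f) x
          + (\<alpha> n * (1 - suminf x) - ainf * x n) * partial n f x)"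

definition L2 :: "pt measure \<Rightarrow> (pt \<Rightarrow> real) set" where
  "L2 \<mu> = {f. f \<in> borel_measurable \<mu> \<and> integrable \<mu> (\<lambda>x. (f x)\<^sup>2)}"

definition E_cauchy :: "((pt \<Rightarrow> real) \<Rightarrow> (pt \<Rightarrow> real) \<Rightarrow> real) \<Rightarrow> (nat \<Rightarrow> pt \<Rightarrow> real) \<Rightarrow> bool" where
  "E_cauchy E fs \<longleftrightarrow>
     (\<forall>e>0. \<exists>N. \<forall>k\<ge>N. \<forall>l\<ge>N. E (\<lambda>x. fs k x - fs l x) (\<lambda>x. fs k x - fs l x) < e)"

definition closable :: "pt measure \<Rightarrow> (pt \<Rightarrow> real) set \<Rightarrow>
    ((pt \<Rightarrow> real) \<Rightarrow> (pt \<Rightarrow> real) \<Rightarrow> real) \<Rightarrow> bool" where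
  "closable \<mu> C E \<longleftrightarrow>
     (\<forall>fs. (\<forall>k. fs k \<in> C) \<longrightarrow> (\<lambda>k. \<integral>x. (fs k x)\<^sup>2 \<partial>\<mu>) \<longlonglongrightarrow> 0 \<longrightarrow> E_cauchy E fs \<longrightarrow>
          (\<lambda>k. E (fs k) (fs k)) \<longlonglongrightarrow> 0)"

definition approx_seq :: "pt measure \<Rightarrow> (pt \<Rightarrow> real) set \<Rightarrow>
    ((pt \<Rightarrow> real) \<Rightarrow> (pt \<Rightarrow> real) \<Rightarrow> real) \<Rightarrow> (nat \<Rightarrow> pt \<Rightarrow> real) \<Rightarrow> (pt \<Rightarrow> real) \<Rightarrow> bool" where
  "approx_seq \<mu> C E fs u \<longleftrightarrow>
     (\<forall>k. fs k \<in> C) \<and> (\<lambda>k. \<integral>x. (fs k x - u x)\<^sup>2 \<partial>\<mu>) \<longlonglongrightarrow> 0 \<and> E_cauchy E fs"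

definition closure_dom :: "pt measure \<Rightarrow> (pt \<Rightarrow> real) set \<Rightarrow>
    ((pt \<Rightarrow> real) \<Rightarrow> (pt \<Rightarrow> real) \<Rightarrow> real) \<Rightarrow> (pt \<Rightarrow> real) set" where
  "closure_dom \<mu> C E = {u \<in> L2 \<mu>. \<exists>fs. approx_seq \<mu> C E fs u}"

definition closure_form :: "pt measure \<Rightarrow> (pt \<Rightarrow> real) set \<Rightarrow>
    ((pt \<Rightarrow> real) \<Rightarrow> (pt \<Rightarrow> real) \<Rightarrow> real) \<Rightarrow> (pt \<Rightarrow> real) \<Rightarrow> (pt \<Rightarrow> real) \<Rightarrow> real" where
  "closure_form \<mu> C E u v =
     (THE c. \<forall>fs gs. approx_seq \<mu> C E fs u \<longrightarrow> approx_seq \<mu> C E gs v \<longrightarrow>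
               (\<lambda>k. E (fs k) (gs k)) \<longlonglongrightarrow> c)"

definition dirichlet_form :: "pt measure \<Rightarrow> (pt \<Rightarrow> real) set \<Rightarrow>
    ((pt \<Rightarrow> real) \<Rightarrow> (pt \<Rightarrow> real) \<Rightarrow> real) \<Rightarrow> bool" where
  "dirichlet_form \<mu> D E \<longleftrightarrow>
     D \<subseteq> L2 \<mu> \<and>
     (\<forall>u\<in>D. \<forall>v\<in>D. \<forall>a b. (\<lambda>x. a * u x + b * v x) \<in> D) \<and>
     (\<forall>u\<in>L2 \<mu>. \<forall>e>0. \<exists>v\<in>D. (\<integral>x. (u x - v x)\<^sup>2 \<partial>\<mu>) < e) \<and>
     (\<forall>u\<in>D. \<forall>v\<in>D. E u v = E v u) \<and>
     (\<forall>u\<in>D. \<forall>v\<in>D. \<forall>w\<in>D. \<forall>a b. E (\<lambda>x. a * u x + b * v x) w = a * E u w + b * E v w) \<and>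
     (\<forall>u\<in>D. 0 \<le> E u u) \<and>
     (\<forall>us. (\<forall>k. us k \<in> D) \<longrightarrow>
        (\<forall>e>0. \<exists>N. \<forall>k\<ge>N. \<forall>l\<ge>N.
            E (\<lambda>x. us k x - us l x) (\<lambda>x. us k x - us l x)
            + (\<integral>x. (us k x - us l x)\<^sup>2 \<partial>\<mu>) < e) \<longrightarrow>
        (\<exists>u\<in>D. (\<lambda>k. E (\<lambda>x. us k x - u x) (\<lambda>x. us k x - u x)
                      + (\<integral>x. (us k x - u x)\<^sup>2 \<partial>\<mu>)) \<longlonglongrightarrow> 0)) \<and>
     (\<forall>u\<in>D. (\<lambda>x. min 1 (max 0 (u x))) \<in> D \<and>
             E (\<lambda>x. min 1 (max 0 (u x))) (\<lambda>x. min 1 (max 0 (u x))) \<le> E u u)"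

text \<open>u is in the domain of the generator L of (D, E) and L u = w (mu-a.e.).\<close>
definition generator_rel :: "pt measure \<Rightarrow> (pt \<Rightarrow> real) set \<Rightarrow>
    ((pt \<Rightarrow> real) \<Rightarrow> (pt \<Rightarrow> real) \<Rightarrow> real) \<Rightarrow> (pt \<Rightarrow> real) \<Rightarrow> (pt \<Rightarrow> real) \<Rightarrow> bool" where
  "generator_rel \<mu> D E u w \<longleftrightarrow>
     u \<in> D \<and> w \<in> L2 \<mu> \<and> (\<forall>v\<in>D. E u v = - (\<integral>x. w x * v x \<partial>\<mu>))"

definition spectral_gap :: "pt measure \<Rightarrow> (pt \<Rightarrow> real) set \<Rightarrow>
    ((pt \<Rightarrow> real) \<Rightarrow> (pt \<Rightarrow> real) \<Rightarrow> real) \<Rightarrow> real" where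
  "spectral_gap \<mu> D E =
     Inf {E f f | f. f \<in> D \<and> (\<integral>x. f x \<partial>\<mu>) = 0 \<and> (\<integral>x. (f x)\<^sup>2 \<partial>\<mu>) = 1}"

text \<open>P is the strongly continuous semigroup on L^2(mu) (acting on functions, modulo
  mu-a.e. equality) whose generator is the generator L of (D, E), i.e. P_t = e^(tL).\<close>
definition semigroup_of :: "pt measure \<Rightarrow> (pt \<Rightarrow> real) set \<Rightarrow>
    ((pt \<Rightarrow> real) \<Rightarrow> (pt \<Rightarrow> real) \<Rightarrow> real) \<Rightarrow> (real \<Rightarrow> (pt \<Rightarrow> real) \<Rightarrow> pt \<Rightarrow> real) \<Rightarrow> bool" where
  "semigroup_of \<mu> D E P \<longleftrightarrow>
     (\<forall>t\<ge>0. \<forall>f\<in>L2 \<mu>. P t f \<in> L2 \<mu>) \<and>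
     (\<forall>t\<ge>0. \<forall>f\<in>L2 \<mu>. \<forall>g\<in>L2 \<mu>. (AE x in \<mu>. f x = g x) \<longrightarrow> (AE x in \<mu>. P t f x = P t g x)) \<and>
     (\<forall>t\<ge>0. \<forall>f\<in>L2 \<mu>. \<forall>g\<in>L2 \<mu>. \<forall>a b.
         AE x in \<mu>. P t (\<lambda>y. a * f y + b * g y) x = a * P t f x + b * P t g x) \<and>
     (\<forall>t\<ge>0. \<exists>K. \<forall>f\<in>L2 \<mu>. (\<integral>x. (P t f x)\<^sup>2 \<partial>\<mu>) \<le> K * (\<integral>x. (f x)\<^sup>2 \<partial>\<mu>)) \<and>
     (\<forall>f\<in>L2 \<mu>. AE x in \<mu>. P 0 f x = f x) \<and>
     (\<forall>s\<ge>0. \<forall>t\<ge>0. \<forall>f\<in>L2 \<mu>. AE x in \<mu>. P (s + t) f x = P s (P t f) x) \<and>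
     (\<forall>f\<in>L2 \<mu>. ((\<lambda>t. \<integral>x. (P t f x - f x)\<^sup>2 \<partial>\<mu>) \<longlongrightarrow> 0) (at_right 0)) \<and>
     (\<forall>u\<in>L2 \<mu>. \<forall>w\<in>L2 \<mu>. generator_rel \<mu> D E u w \<longleftrightarrow>
         ((\<lambda>h. \<integral>x. ((P h u x - u x) / h - w x)\<^sup>2 \<partial>\<mu>) \<longlongrightarrow> 0) (at_right 0))"

end

theory Submission imports Defs "HOL-Computational_Algebra.Primes" begin

text \<open>The limit measure is the law of the stick-breaking sequence with independent
  \<open>Beta(\<alpha>\<^sub>i, b\<^sub>i\<^sub>+\<^sub>1)\<close> fractions, where \<open>b\<^sub>i\<close> is \<open>\<alpha>\<^sub>\<infinity>\<close> plus the tail sum of \<open>\<alpha>\<close> from \<open>i\<close> on; its finite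
  marginals are Dirichlet, which yields the integration by parts formula
  \<open>\<integral>x\<^sub>n(1 - |x|) \<partial>\<^sub>nF = - \<integral>(\<alpha>\<^sub>n(1 - |x|) - \<alpha>\<^sub>\<infinity> x\<^sub>n) F\<close>. Enlarge the polynomials in the coordinates by the
  function \<open>|x|\<close>. Ordering the monomials in \<open>|x|, x\<^sub>1, x\<^sub>2, \<dots>\<close> by a prime code makes the generator
  triangular, with diagonal entries \<open>- \<lambda>\<^sub>N\<close> such that \<open>\<lambda>\<^sub>N \<ge> \<alpha>\<^sub>\<infinity>\<close> except for the constant, so Gram--Schmidt gives an
  orthonormal basis of eigenfunctions. By Stone--Weierstrass and integration by parts,
  \<open>\<E>(f, f) = \<Sum>\<^sub>i \<lambda>\<^sub>i \<langle>f, e\<^sub>i\<rangle>\<^sup>2\<close> for every C1 cylinder function, and closability, the Dirichlet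
  property, the generator, the semigroup and the gap are read off this spectral representation. The
  gap is attained at \<open>x\<^sub>1 / \<alpha>\<^sub>1 - x\<^sub>2 / \<alpha>\<^sub>2\<close>. A semigroup with the given generator is determined by
  its action on the eigenfunctions, so the decay estimate holds for all of them.\<close>

subsection \<open>The Hilbert space of square-integrable functions\<close>

text \<open>The drift of a coordinate contains \<open>1 - |x|\<close>, which is not a cylinder
  function, so polynomials in the coordinates alone are not invariant under the generator; with
  \<open>|x|\<close> adjoined they are. Since \<open>|x|\<close> is not in \<open>FC1\<close>, the
  argument uses the class \<open>grad\<close> of bounded limits that carry their derivatives, and a
  weak generator defined by testing. A total eigensystem in L2 by itself yields only a Bessel
  inequality for the energy: a priori the form closure of the polynomials could be smaller than that
  of the C1 cylinder functions. Equality is the decisive point. The residual of an eigenfunction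
  expansion is bounded in energy and null in L2, and integration by parts turns this into vanishing
  of its energy pairing with the function itself. Each variable attached to a monomial adds
  \<open>ainf\<close> and further nonnegative terms to the eigenvalue, so the lower bound
  \<open>ainf\<close> holds from degree one on.\<close>

lemma quadratic_nonneg_imp:
  fixes A B C :: real
  assumes "\<And>t. 0 \<le> A * t\<^sup>2 + 2 * B * t + C" "0 \<le> A"
  shows "B\<^sup>2 \<le> A * C"
proof (cases "A = 0")
  case True
  have "B = 0"
  proof (rule ccontr)
    assume "B \<noteq> 0"
    \<comment> \<open>At this point the linear function \<open>2 * B * t + C\<close> takes the value
      -1.\<close>
    with assms(1)[of "- (C + 1) / (2 * B)"] True show False by simp
  qed
  then show ?thesis using True by simp
next
  case False
  then have "0 < A" using assms by simp
  have "0 \<le> A * (A * (- B / A)\<^sup>2 + 2 * B * (- B / A) + C)"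
    using assms(1)[of "- B / A"] assms(2) by (rule mult_nonneg_nonneg[rotated])
  also have "\<dots> = A * C - B\<^sup>2"
    using False by (simp add: field_simps power2_eq_square)
  finally show ?thesis by simp
qed

text \<open>Elements of \<open>L2\<close> are functions, not classes, so this is a semi-inner
  product; two vectors coincide when the norm of their difference vanishes, as in
  \<open>l2norm_diff_eq_0_iff\<close>.\<close>

definition l2ip :: "pt measure \<Rightarrow> (pt \<Rightarrow> real) \<Rightarrow> (pt \<Rightarrow> real) \<Rightarrow> real" where
  "l2ip \<mu> f g = (\<integral>x. f x * g x \<partial>\<mu>)"

definition l2norm :: "pt measure \<Rightarrow> (pt \<Rightarrow> real) \<Rightarrow> real" where
  "l2norm \<mu> f = sqrt (\<integral>x. (f x)\<^sup>2 \<partial>\<mu>)"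

lemma l2norm_nonneg [simp]: "0 \<le> l2norm \<mu> f"
  by (simp add: l2norm_def)

lemma l2norm_sq: "(l2norm \<mu> f)\<^sup>2 = (\<integral>x. (f x)\<^sup>2 \<partial>\<mu>)"
  by (simp add: l2norm_def)

lemma l2ip_same: "l2ip \<mu> f f = (l2norm \<mu> f)\<^sup>2"
  unfolding l2norm_sq l2ip_def by (simp add: power2_eq_square)

lemma l2ip_commute: "l2ip \<mu> f g = l2ip \<mu> g f"
  by (simp add: l2ip_def mult.commute)

lemma L2_measurable [measurable_dest]: "f \<in> L2 \<mu> \<Longrightarrow> f \<in> borel_measurable \<mu>"
  by (simp add: L2_def)

lemma L2_integrable_mult:
  assumes "f \<in> L2 \<mu>" "g \<in> L2 \<mu>"
  shows "integrable \<mu> (\<lambda>x. f x * g x)"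
proof (rule Bochner_Integration.integrable_bound[of _ "\<lambda>x. (f x)\<^sup>2 + (g x)\<^sup>2"])
  show "integrable \<mu> (\<lambda>x. (f x)\<^sup>2 + (g x)\<^sup>2)"
    using assms by (auto simp: L2_def)
  show "(\<lambda>x. f x * g x) \<in> borel_measurable \<mu>"
    using assms by (auto simp: L2_def)
  have "\<bar>a * b\<bar> \<le> a\<^sup>2 + b\<^sup>2" for a b :: real
  proof -
    have "2 * (\<bar>a\<bar> * \<bar>b\<bar>) \<le> a\<^sup>2 + b\<^sup>2"
      using sum_squares_bound[of "\<bar>a\<bar>" "\<bar>b\<bar>"] by simp
    moreover have "0 \<le> \<bar>a\<bar> * \<bar>b\<bar>" by simp
    ultimately show ?thesis unfolding abs_mult by linarith
  qed
  then show "AE x in \<mu>. norm (f x * g x) \<le> norm ((f x)\<^sup>2 + (g x)\<^sup>2)"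
    by auto
qed

lemma L2_lincomb:
  assumes "f \<in> L2 \<mu>" "g \<in> L2 \<mu>"
  shows "(\<lambda>x. a * f x + b * g x) \<in> L2 \<mu>"
proof -
  have "integrable \<mu> (\<lambda>x. a\<^sup>2 * (f x)\<^sup>2 + b\<^sup>2 * (g x)\<^sup>2 + 2 * a * b * (f x * g x))"
    using assms L2_integrable_mult[OF assms] by (auto simp: L2_def)
  moreover have "(\<lambda>x. a\<^sup>2 * (f x)\<^sup>2 + b\<^sup>2 * (g x)\<^sup>2 + 2 * a * b * (f x * g x)) = (\<lambda>x. (a * f x + b * g x)\<^sup>2)"
    by (auto simp: power2_eq_square algebra_simps)
  ultimately show ?thesis using assms by (auto simp: L2_def)
qed

lemma L2_add [intro]: "f \<in> L2 \<mu> \<Longrightarrow> g \<in> L2 \<mu> \<Longrightarrow> (\<lambda>x. f x + g x) \<in> L2 \<mu>"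
  using L2_lincomb[of f \<mu> g 1 1] by simp
lemma L2_diff [intro]: "f \<in> L2 \<mu> \<Longrightarrow> g \<in> L2 \<mu> \<Longrightarrow> (\<lambda>x. f x - g x) \<in> L2 \<mu>"
  using L2_lincomb[of f \<mu> g 1 "-1"] by simp
lemma L2_cmult [intro]: "f \<in> L2 \<mu> \<Longrightarrow> (\<lambda>x. a * f x) \<in> L2 \<mu>"
  using L2_lincomb[of f \<mu> f a 0] by simp
lemma L2_zero [simp, intro]: "(\<lambda>x. 0) \<in> L2 \<mu>"
  by (simp add: L2_def)
lemma L2_sum [intro]:
  "(\<And>i. i \<in> I \<Longrightarrow> f i \<in> L2 \<mu>) \<Longrightarrow> (\<lambda>x. \<Sum>i\<in>I. f i x) \<in> L2 \<mu>"
  by (induction I rule: infinite_finite_induct) auto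

lemma l2ip_lin_left:
  assumes "f \<in> L2 \<mu>" "g \<in> L2 \<mu>" "h \<in> L2 \<mu>"
  shows "l2ip \<mu> (\<lambda>x. a * f x + b * g x) h = a * l2ip \<mu> f h + b * l2ip \<mu> g h"
  using L2_integrable_mult[OF assms(1,3)] L2_integrable_mult[OF assms(2,3)]
  by (simp add: l2ip_def algebra_simps)

lemma l2ip_diff_left:
  assumes "f \<in> L2 \<mu>" "g \<in> L2 \<mu>" "h \<in> L2 \<mu>"
  shows "l2ip \<mu> (\<lambda>x. f x - g x) h = l2ip \<mu> f h - l2ip \<mu> g h"
  using l2ip_lin_left[OF assms, of 1 "-1"] by simp

lemma l2ip_sum_left:
  assumes "\<And>i. i \<in> I \<Longrightarrow> f i \<in> L2 \<mu>" "h \<in> L2 \<mu>"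
  shows "l2ip \<mu> (\<lambda>x. \<Sum>i\<in>I. c i * f i x) h = (\<Sum>i\<in>I. c i * l2ip \<mu> (f i) h)"
proof -
  have *: "(\<lambda>x. (\<Sum>i\<in>I. c i * f i x) * h x) = (\<lambda>x. \<Sum>i\<in>I. c i * (f i x * h x))"
    by (auto simp: sum_distrib_right mult.assoc)
  show ?thesis unfolding l2ip_def *
    using assms L2_integrable_mult by (subst Bochner_Integration.integral_sum) auto
qed

lemma l2norm_sq_lin:
  assumes "f \<in> L2 \<mu>" "g \<in> L2 \<mu>"
  shows "(l2norm \<mu> (\<lambda>x. a * f x + b * g x))\<^sup>2 =
    a\<^sup>2 * (l2norm \<mu> f)\<^sup>2 + 2 * a * b * l2ip \<mu> f g + b\<^sup>2 * (l2norm \<mu> g)\<^sup>2"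
proof -
  let ?h = "\<lambda>x. a * f x + b * g x"
  have h: "?h \<in> L2 \<mu>" by (rule L2_lincomb[OF assms])
  have 1: "l2ip \<mu> ?h ?h = a * l2ip \<mu> f ?h + b * l2ip \<mu> g ?h"
    by (rule l2ip_lin_left[OF assms h])
  have 2: "l2ip \<mu> f ?h = a * l2ip \<mu> f f + b * l2ip \<mu> f g"
    using l2ip_lin_left[OF assms assms(1), of a b]
    by (simp only: l2ip_commute[of \<mu> ?h f] l2ip_commute[of \<mu> g f])
  have 3: "l2ip \<mu> g ?h = a * l2ip \<mu> f g + b * l2ip \<mu> g g"
    using l2ip_lin_left[OF assms assms(2), of a b]
    by (simp only: l2ip_commute[of \<mu> ?h g])
  show ?thesis
    unfolding l2ip_same[symmetric] 1 2 3 by (simp add: power2_eq_square algebra_simps)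
qed

lemma l2_cauchy_schwarz_sq:
  assumes "f \<in> L2 \<mu>" "g \<in> L2 \<mu>"
  shows "(l2ip \<mu> f g)\<^sup>2 \<le> (l2norm \<mu> f)\<^sup>2 * (l2norm \<mu> g)\<^sup>2"
proof (rule quadratic_nonneg_imp)
  fix t
  show "0 \<le> (l2norm \<mu> f)\<^sup>2 * t\<^sup>2 + 2 * l2ip \<mu> f g * t + (l2norm \<mu> g)\<^sup>2"
    using l2norm_sq_lin[OF assms, of t 1] zero_le_power2[of "l2norm \<mu> (\<lambda>x. t * f x + 1 * g x)"]
    by (simp add: algebra_simps)
qed simp

lemma l2_cauchy_schwarz:
  assumes "f \<in> L2 \<mu>" "g \<in> L2 \<mu>"
  shows "\<bar>l2ip \<mu> f g\<bar> \<le> l2norm \<mu> f * l2norm \<mu> g"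
  using l2_cauchy_schwarz_sq[OF assms]
  by (metis abs_le_square_iff abs_mult abs_of_nonneg l2norm_nonneg power_mult_distrib)

lemma l2norm_cmult: "l2norm \<mu> (\<lambda>x. a * f x) = \<bar>a\<bar> * l2norm \<mu> f"
  by (simp add: l2norm_def power_mult_distrib real_sqrt_mult)

lemma l2norm_triangle:
  assumes "f \<in> L2 \<mu>" "g \<in> L2 \<mu>"
  shows "l2norm \<mu> (\<lambda>x. f x + g x) \<le> l2norm \<mu> f + l2norm \<mu> g"
proof (rule power2_le_imp_le)
  show "(l2norm \<mu> (\<lambda>x. f x + g x))\<^sup>2 \<le> (l2norm \<mu> f + l2norm \<mu> g)\<^sup>2"
    using l2norm_sq_lin[OF assms, of 1 1] l2_cauchy_schwarz[OF assms]
    by (simp add: power2_sum)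
qed simp

lemma l2norm_minus_commute: "l2norm \<mu> (\<lambda>x. f x - g x) = l2norm \<mu> (\<lambda>x. g x - f x)"
  by (simp add: l2norm_def power2_commute)

lemma l2norm_triangle_diff:
  assumes "f \<in> L2 \<mu>" "g \<in> L2 \<mu>" "h \<in> L2 \<mu>"
  shows "l2norm \<mu> (\<lambda>x. f x - h x) \<le> l2norm \<mu> (\<lambda>x. f x - g x) + l2norm \<mu> (\<lambda>x. g x - h x)"
  using l2norm_triangle[of "\<lambda>x. f x - g x" \<mu> "\<lambda>x. g x - h x"] assms by auto

lemma l2norm_triangle_ineq4:
  assumes "f \<in> L2 \<mu>" "g \<in> L2 \<mu>"
  shows "l2norm \<mu> (\<lambda>x. f x - g x) \<le> l2norm \<mu> f + l2norm \<mu> g"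
  using l2norm_triangle[of f \<mu> "\<lambda>x. (-1) * g x"] assms L2_cmult[of g \<mu> "-1"] l2norm_cmult[of \<mu> "-1" g]
  by simp

lemma l2norm_cong_AE:
  assumes "AE x in \<mu>. f x = g x" "f \<in> borel_measurable \<mu>" "g \<in> borel_measurable \<mu>"
  shows "l2norm \<mu> f = l2norm \<mu> g"
  unfolding l2norm_def using assms by (intro arg_cong[where f=sqrt] integral_cong_AE) auto

lemma l2ip_cong_AE:
  assumes "AE x in \<mu>. f x = g x" "f \<in> L2 \<mu>" "g \<in> L2 \<mu>" "h \<in> L2 \<mu>"
  shows "l2ip \<mu> f h = l2ip \<mu> g h"
  unfolding l2ip_def using assms by (intro integral_cong_AE) (auto simp: L2_def)

lemma l2norm_eq_0_iff:
  assumes "f \<in> L2 \<mu>"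
  shows "l2norm \<mu> f = 0 \<longleftrightarrow> (AE x in \<mu>. f x = 0)"
  using assms by (simp add: l2norm_def L2_def integral_nonneg_eq_0_iff_AE)

lemma l2norm_diff_eq_0_iff:
  assumes "f \<in> L2 \<mu>" "g \<in> L2 \<mu>"
  shows "l2norm \<mu> (\<lambda>x. f x - g x) = 0 \<longleftrightarrow> (AE x in \<mu>. f x = g x)"
  using l2norm_eq_0_iff[OF L2_diff[OF assms]] by simp

lemma l2norm_tendsto_0_iff:
  "((\<lambda>k. l2norm \<mu> (f k)) \<longlongrightarrow> 0) F \<longleftrightarrow> ((\<lambda>k. \<integral>x. (f k x)\<^sup>2 \<partial>\<mu>) \<longlongrightarrow> 0) F"
proof
  assume "((\<lambda>k. l2norm \<mu> (f k)) \<longlongrightarrow> 0) F"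
  from tendsto_power[OF this, of 2] show "((\<lambda>k. \<integral>x. (f k x)\<^sup>2 \<partial>\<mu>) \<longlongrightarrow> 0) F"
    by (simp add: l2norm_sq)
next
  assume "((\<lambda>k. \<integral>x. (f k x)\<^sup>2 \<partial>\<mu>) \<longlongrightarrow> 0) F"
  from tendsto_real_sqrt[OF this] show "((\<lambda>k. l2norm \<mu> (f k)) \<longlongrightarrow> 0) F"
    by (simp add: l2norm_def)
qed

lemma l2ip_tendsto:
  assumes "\<And>k. f k \<in> L2 \<mu>" "u \<in> L2 \<mu>" "g \<in> L2 \<mu>" "((\<lambda>k. l2norm \<mu> (\<lambda>x. f k x - u x)) \<longlongrightarrow> 0) F"
  shows "((\<lambda>k. l2ip \<mu> (f k) g) \<longlongrightarrow> l2ip \<mu> u g) F"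
proof -
  have "((\<lambda>k. l2ip \<mu> (f k) g - l2ip \<mu> u g) \<longlongrightarrow> 0) F"
  proof (rule Lim_null_comparison)
    show "\<forall>\<^sub>F k in F. norm (l2ip \<mu> (f k) g - l2ip \<mu> u g) \<le> l2norm \<mu> (\<lambda>x. f k x - u x) * l2norm \<mu> g"
      using l2_cauchy_schwarz[OF L2_diff[OF assms(1,2)] assms(3)] assms
      by (auto simp: l2ip_diff_left)
    show "((\<lambda>k. l2norm \<mu> (\<lambda>x. f k x - u x) * l2norm \<mu> g) \<longlongrightarrow> 0) F"
      using tendsto_mult_left_zero[OF assms(4)] by simp
  qed
  then show ?thesis by (rule Lim_null[THEN iffD2])
qed

section \<open>Completeness of L2 over a probability measure\<close>

locale pt_prob_space = prob_space M for M :: "pt measure"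
begin

lemma L2_integrable: "f \<in> L2 M \<Longrightarrow> integrable M f"
  by (rule square_integrable_imp_integrable) (auto simp: L2_def)

lemma L2_const [simp, intro]: "(\<lambda>x. c) \<in> L2 M"
  by (simp add: L2_def)

lemma L2_bounded:
  assumes "f \<in> borel_measurable M" "AE x in M. \<bar>f x\<bar> \<le> B"
  shows "f \<in> L2 M"
  unfolding L2_def
proof (safe intro!: assms integrable_const_bound[of _ "B\<^sup>2"])
  show "AE x in M. norm ((f x)\<^sup>2) \<le> B\<^sup>2"
    using assms(2) by eventually_elim (simp add: abs_le_square_iff[symmetric])
qed (use assms in auto)

lemma l2norm_bound:
  assumes "f \<in> borel_measurable M" "AE x in M. \<bar>f x\<bar> \<le> B"
  shows "l2norm M f \<le> B"
proof -
  have "0 \<le> B"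
  proof (rule ccontr)
    assume "\<not> 0 \<le> B"
    then have "\<not> \<bar>f x\<bar> \<le> B" for x by simp
    with assms(2) have "AE x in M. False" by simp
    then show False by simp
  qed
  have "(\<integral>x. (f x)\<^sup>2 \<partial>M) \<le> (\<integral>x. B\<^sup>2 \<partial>M)"
  proof (rule integral_mono_AE)
    show "integrable M (\<lambda>x. (f x)\<^sup>2)" using L2_bounded[OF assms] by (simp add: L2_def)
    show "AE x in M. (f x)\<^sup>2 \<le> B\<^sup>2"
      using assms(2) by eventually_elim (simp add: abs_le_square_iff[symmetric])
  qed auto
  then show ?thesis using \<open>0 \<le> B\<close> by (simp add: l2norm_def real_le_lsqrt prob_space)
qed

lemma l1_le_l2norm:
  assumes "f \<in> L2 M"
  shows "(\<integral>x. \<bar>f x\<bar> \<partial>M) \<le> l2norm M f"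
proof -
  have "(\<lambda>x. \<bar>f x\<bar>) \<in> L2 M" using assms by (auto simp: L2_def)
  from l2_cauchy_schwarz[OF this L2_const[of 1]] show ?thesis
    by (auto simp: l2ip_def l2norm_def prob_space)
qed

text \<open>The Riesz--Fischer argument: along a fast subsequence the increments are summable in L1,
  hence almost everywhere, which gives a pointwise limit; Fatou's lemma then bounds the distance to
  it for the whole sequence.\<close>

lemma L2_complete:
  assumes u: "\<And>k. u k \<in> L2 M"
    and cauchy: "\<And>e. 0 < e \<Longrightarrow> \<exists>N. \<forall>k\<ge>N. \<forall>l\<ge>N. l2norm M (\<lambda>x. u k x - u l x) < e"
  obtains v where "v \<in> L2 M" "(\<lambda>k. l2norm M (\<lambda>x. u k x - v x)) \<longlonglongrightarrow> 0"
proof -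
  have "\<exists>N. \<forall>k\<ge>N. \<forall>l\<ge>N. l2norm M (\<lambda>x. u k x - u l x) < (1/2)^i" for i
    by (rule cauchy) simp
  then obtain N where N: "\<And>i k l. k \<ge> N i \<Longrightarrow> l \<ge> N i \<Longrightarrow> l2norm M (\<lambda>x. u k x - u l x) < (1/2)^i"
    by metis
  \<comment> \<open>Summing the thresholds makes \<open>r\<close> monotone and at least
    \<open>N i\<close>; adding \<open>i\<close> makes it unbounded.\<close>
  define r where "r i = (\<Sum>j\<le>i. N j) + i" for i
  have r_ge: "r i \<ge> N i" for i
    unfolding r_def by (simp add: member_le_sum trans_le_add1)
  have r_mono: "r i \<le> r (Suc i)" for i by (simp add: r_def)
  have r_id: "i \<le> r i" for i by (simp add: r_def)
  define w where "w i = (\<lambda>x. \<bar>u (r (Suc i)) x - u (r i) x\<bar>)" for i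
  have wL2: "(\<lambda>x. u (r (Suc i)) x - u (r i) x) \<in> L2 M" for i using u by auto
  have w_int: "(\<integral>x. w i x \<partial>M) \<le> (1/2)^i" for i
    unfolding w_def
    using l1_le_l2norm[OF wL2[of i]] N[of i "r (Suc i)" "r i"] r_ge[of i] r_mono[of i] by linarith
  have um [measurable]: "u k \<in> borel_measurable M" for k using u by (simp add: L2_def)
  have wm [measurable]: "w i \<in> borel_measurable M" for i unfolding w_def by measurable
  have w_integrable: "integrable M (w i)" for i
    unfolding w_def using L2_integrable[OF wL2] by auto
  have "(\<integral>\<^sup>+x. (\<Sum>i. ennreal (w i x)) \<partial>M) = (\<Sum>i. \<integral>\<^sup>+x. ennreal (w i x) \<partial>M)"
    by (rule nn_integral_suminf) measurable
  also have "\<dots> = (\<Sum>i. ennreal (\<integral>x. w i x \<partial>M))"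
    using w_integrable by (intro suminf_cong nn_integral_eq_integral) (auto simp: w_def)
  also have "\<dots> \<le> (\<Sum>i. ennreal ((1/2)^i))"
    using w_int by (intro suminf_le) (auto intro: ennreal_leI)
  also have "\<dots> = ennreal (\<Sum>i. (1/2)^i)"
    by (rule suminf_ennreal2) (auto intro: summable_geometric)
  also have "\<dots> < \<infinity>" by simp
  finally have "AE x in M. (\<Sum>i. ennreal (w i x)) \<noteq> \<infinity>"
    by (intro nn_integral_noteq_infinite) auto
  then have AEs: "AE x in M. convergent (\<lambda>i. u (r i) x)"
  proof eventually_elim
    case (elim x)
    then have "summable (\<lambda>i. w i x)"
      by (intro summable_suminf_not_top) (auto simp: w_def)
    then have "summable (\<lambda>i. u (r (Suc i)) x - u (r i) x)"
      unfolding w_def by (rule summable_rabs_cancel)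
    then have "convergent (\<lambda>n. \<Sum>i<n. u (r (Suc i)) x - u (r i) x)"
      by (simp add: summable_iff_convergent)
    then have "convergent (\<lambda>n. u (r n) x - u (r 0) x)"
      using sum_lessThan_telescope[of "\<lambda>i. u (r i) x"] by simp
    from convergent_add[OF this convergent_const[of "u (r 0) x"]] show ?case by simp
  qed
  define v where "v x = lim (\<lambda>i. u (r i) x)" for x
  have vm [measurable]: "v \<in> borel_measurable M" unfolding v_def by measurable
  have AEv: "AE x in M. (\<lambda>i. u (r i) x) \<longlonglongrightarrow> v x"
    using AEs by eventually_elim (simp add: v_def convergent_LIMSEQ_iff)
  \<comment> \<open>Fatou along the subsequence, stated in \<open>ennreal\<close> because
    \<open>v\<close> is not yet known to be in \<open>L2\<close>: the case \<open>e = 1\<close> is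
    what shows \<open>u k - v\<close>, and hence \<open>v\<close>, to be square-integrable.\<close>
  have key: "(\<integral>\<^sup>+x. ennreal ((u k x - v x)\<^sup>2) \<partial>M) \<le> ennreal (e\<^sup>2)"
    if "0 < e" and NN: "\<And>l. l \<ge> n \<Longrightarrow> l2norm M (\<lambda>x. u k x - u l x) \<le> e" for k e n
  proof -
    have "(\<integral>\<^sup>+x. ennreal ((u k x - v x)\<^sup>2) \<partial>M) = (\<integral>\<^sup>+x. liminf (\<lambda>i. ennreal ((u k x - u (r i) x)\<^sup>2)) \<partial>M)"
    proof (rule nn_integral_cong_AE)
      show "AE x in M. ennreal ((u k x - v x)\<^sup>2) = liminf (\<lambda>i. ennreal ((u k x - u (r i) x)\<^sup>2))"
        using AEv
      proof eventually_elim
        case (elim x)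
        have "(\<lambda>i. ennreal ((u k x - u (r i) x)\<^sup>2)) \<longlonglongrightarrow> ennreal ((u k x - v x)\<^sup>2)"
          using elim by (intro tendsto_intros)
        from lim_imp_Liminf[OF trivial_limit_sequentially this] show ?case by (rule sym)
      qed
    qed
    also have "\<dots> \<le> liminf (\<lambda>i. \<integral>\<^sup>+x. ennreal ((u k x - u (r i) x)\<^sup>2) \<partial>M)"
      by (rule nn_integral_liminf) measurable
    also have "\<dots> \<le> ennreal (e\<^sup>2)"
    proof (rule Liminf_le)
      show "\<forall>\<^sub>F i in sequentially. (\<integral>\<^sup>+x. ennreal ((u k x - u (r i) x)\<^sup>2) \<partial>M) \<le> ennreal (e\<^sup>2)"
      proof (rule eventually_sequentiallyI[of n])
        fix i assume "n \<le> i"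
        then have "l2norm M (\<lambda>x. u k x - u (r i) x) \<le> e" using r_id[of i] by (intro NN) simp
        then have "(\<integral>x. (u k x - u (r i) x)\<^sup>2 \<partial>M) \<le> e\<^sup>2"
          unfolding l2norm_sq[symmetric] by (rule power_mono) simp
        moreover have "(\<integral>\<^sup>+x. ennreal ((u k x - u (r i) x)\<^sup>2) \<partial>M) = ennreal (\<integral>x. (u k x - u (r i) x)\<^sup>2 \<partial>M)"
          using L2_diff[OF u[of k] u[of "r i"]] by (intro nn_integral_eq_integral) (auto simp: L2_def)
        ultimately show "(\<integral>\<^sup>+x. ennreal ((u k x - u (r i) x)\<^sup>2) \<partial>M) \<le> ennreal (e\<^sup>2)"
          by (simp add: ennreal_leI)
      qed
    qed simp
    finally show ?thesis .
  qed
  have diffL2: "(\<lambda>x. u k x - v x) \<in> L2 M" if "k \<ge> N 0" for k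
  proof -
    have "(\<integral>\<^sup>+x. ennreal ((u k x - v x)\<^sup>2) \<partial>M) \<le> ennreal (1\<^sup>2)"
      using N[of 0 k] that by (intro key[of _ "N 0"]) (auto intro: less_imp_le)
    then have "integrable M (\<lambda>x. (u k x - v x)\<^sup>2)"
      by (intro integrableI_nonneg) (auto simp: le_less_trans)
    then show ?thesis by (simp add: L2_def)
  qed
  have vL2: "v \<in> L2 M"
    using L2_diff[OF u[of "N 0"] diffL2[of "N 0"]] by simp
  have "(\<lambda>k. l2norm M (\<lambda>x. u k x - v x)) \<longlonglongrightarrow> 0"
  proof (rule LIMSEQ_I)
    fix e :: real assume "0 < e"
    from cauchy[of "e/2"] \<open>0 < e\<close> obtain n where n: "\<And>k l. k \<ge> n \<Longrightarrow> l \<ge> n \<Longrightarrow> l2norm M (\<lambda>x. u k x - u l x) < e/2"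
      by auto
    have "norm (l2norm M (\<lambda>x. u k x - v x) - 0) < e" if "k \<ge> n" for k
    proof -
      have "(\<integral>\<^sup>+x. ennreal ((u k x - v x)\<^sup>2) \<partial>M) \<le> ennreal ((e/2)\<^sup>2)"
        using n[OF that] \<open>0 < e\<close> by (intro key[of _ n]) (auto intro: less_imp_le)
      moreover have "(\<integral>\<^sup>+x. ennreal ((u k x - v x)\<^sup>2) \<partial>M) = ennreal (\<integral>x. (u k x - v x)\<^sup>2 \<partial>M)"
        using L2_diff[OF u[of k] vL2] by (intro nn_integral_eq_integral) (auto simp: L2_def)
      ultimately have "(\<integral>x. (u k x - v x)\<^sup>2 \<partial>M) \<le> (e/2)\<^sup>2"
        by (simp add: ennreal_le_iff)
      then have "l2norm M (\<lambda>x. u k x - v x) \<le> e/2"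
        unfolding l2norm_def using \<open>0 < e\<close> by (intro real_le_lsqrt) auto
      then show ?thesis using \<open>0 < e\<close> by simp
    qed
    then show "\<exists>no. \<forall>n\<ge>no. norm (l2norm M (\<lambda>x. u n x - v x) - 0) < e" by blast
  qed
  with vL2 show thesis by (rule that)
qed

end

subsection \<open>Orthonormal systems and spectral forms\<close>

text \<open>Vanishing vectors are allowed in the system: Gram--Schmidt produces one for each monomial that
  depends linearly on its predecessors.\<close>

locale orthonormal_system = pt_prob_space M for M +
  fixes e :: "nat \<Rightarrow> pt \<Rightarrow> real"
  assumes e_L2 [simp, intro]: "\<And>i. e i \<in> L2 M"
    and e_orth: "\<And>i j. i \<noteq> j \<Longrightarrow> l2ip M (e i) (e j) = 0"
    and e_unit: "\<And>i. l2ip M (e i) (e i) = 0 \<or> l2ip M (e i) (e i) = 1"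
    and e_total: "\<And>f. f \<in> L2 M \<Longrightarrow> (\<And>i. l2ip M f (e i) = 0) \<Longrightarrow> l2norm M f = 0"
begin

definition coef :: "(pt \<Rightarrow> real) \<Rightarrow> nat \<Rightarrow> real" where
  "coef f i = l2ip M f (e i)"

text \<open>This is 0 for the vanishing vectors and 1 for the others. Carried as a factor, it lets
  one formula serve both kinds of vector.\<close>

definition nrm :: "nat \<Rightarrow> real" where
  "nrm i = l2ip M (e i) (e i)"

lemma nrm_cases: "nrm i = 0 \<or> nrm i = 1"
  unfolding nrm_def by (rule e_unit)

lemma coef_lin:
  "f \<in> L2 M \<Longrightarrow> g \<in> L2 M \<Longrightarrow> coef (\<lambda>x. a * f x + b * g x) i = a * coef f i + b * coef g i"
  unfolding coef_def by (rule l2ip_lin_left) auto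

lemma coef_diff: "f \<in> L2 M \<Longrightarrow> g \<in> L2 M \<Longrightarrow> coef (\<lambda>x. f x - g x) i = coef f i - coef g i"
  unfolding coef_def by (rule l2ip_diff_left) auto

lemma coef_cmult: "f \<in> L2 M \<Longrightarrow> coef (\<lambda>x. a * f x) i = a * coef f i"
  using coef_lin[of f f a 0] by simp

lemma coef_cong_AE: "AE x in M. f x = g x \<Longrightarrow> f \<in> L2 M \<Longrightarrow> g \<in> L2 M \<Longrightarrow> coef f i = coef g i"
  unfolding coef_def by (rule l2ip_cong_AE) auto

text \<open>By Cauchy--Schwarz no function has a nonzero coefficient at a vanishing vector.\<close>

lemma coef_nrm:
  assumes "f \<in> L2 M" shows "coef f i * nrm i = coef f i"
proof (cases "nrm i = 0")
  case True
  then have "(coef f i)\<^sup>2 \<le> 0"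
    using l2_cauchy_schwarz_sq[OF assms e_L2[of i]]
    unfolding coef_def nrm_def l2ip_same by simp
  then show ?thesis by simp
next
  case False
  then show ?thesis using nrm_cases[of i] by auto
qed

lemma coef_e: "coef (e j) i = (if i = j then nrm i else 0)"
  by (auto simp: coef_def nrm_def e_orth)

lemma coef_sum: "finite I \<Longrightarrow> coef (\<lambda>x. \<Sum>i\<in>I. c i * e i x) j = (if j \<in> I then c j * nrm j else 0)"
proof -
  assume I: "finite I"
  have "coef (\<lambda>x. \<Sum>i\<in>I. c i * e i x) j = (\<Sum>i\<in>I. c i * coef (e i) j)"
    unfolding coef_def by (rule l2ip_sum_left) auto
  also have "\<dots> = (\<Sum>i\<in>I. if i = j then c j * nrm j else 0)"
    by (rule sum.cong) (auto simp: coef_e)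
  finally show ?thesis using I by simp
qed

lemma L2_lincomb_e [simp, intro]: "(\<lambda>x. \<Sum>i\<in>I. c i * e i x) \<in> L2 M"
  by (intro L2_sum L2_cmult) auto

lemma l2ip_sum_e:
  "f \<in> L2 M \<Longrightarrow> l2ip M f (\<lambda>x. \<Sum>i\<in>I. c i * e i x) = (\<Sum>i\<in>I. c i * coef f i)"
  unfolding l2ip_commute[of M f] coef_def by (subst l2ip_sum_left) auto

lemma l2norm_sum_e:
  "finite I \<Longrightarrow> (l2norm M (\<lambda>x. \<Sum>i\<in>I. c i * e i x))\<^sup>2 = (\<Sum>i\<in>I. (c i)\<^sup>2 * nrm i)"
proof -
  assume I: "finite I"
  have "(l2norm M (\<lambda>x. \<Sum>i\<in>I. c i * e i x))\<^sup>2 = (\<Sum>i\<in>I. c i * coef (\<lambda>x. \<Sum>i\<in>I. c i * e i x) i)"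
    unfolding l2ip_same[symmetric] by (rule l2ip_sum_e) auto
  also have "\<dots> = (\<Sum>i\<in>I. (c i)\<^sup>2 * nrm i)"
    by (rule sum.cong) (auto simp: coef_sum I power2_eq_square)
  finally show ?thesis .
qed

lemma l2norm_diff_partial:
  assumes "f \<in> L2 M"
  shows "(l2norm M (\<lambda>x. f x - (\<Sum>i<n. coef f i * e i x)))\<^sup>2 = (l2norm M f)\<^sup>2 - (\<Sum>i<n. (coef f i)\<^sup>2)"
proof -
  have c: "(coef f i)\<^sup>2 * nrm i = (coef f i)\<^sup>2" for i
    using coef_nrm[OF assms, of i] by (metis mult.assoc power2_eq_square)
  have "(l2norm M (\<lambda>x. \<Sum>i<n. coef f i * e i x))\<^sup>2 = (\<Sum>i<n. (coef f i)\<^sup>2)"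
    using l2norm_sum_e[OF finite_lessThan, of "coef f" n] by (simp only: c)
  moreover have "l2ip M f (\<lambda>x. \<Sum>i<n. coef f i * e i x) = (\<Sum>i<n. (coef f i)\<^sup>2)"
    using l2ip_sum_e[OF assms, of "coef f" "{..<n}"] by (simp add: power2_eq_square)
  ultimately show ?thesis
    using l2norm_sq_lin[OF assms L2_lincomb_e[of "coef f" "{..<n}"], of 1 "-1"] by simp
qed

lemma bessel:
  assumes "f \<in> L2 M" shows "summable (\<lambda>i. (coef f i)\<^sup>2)"
proof (rule summableI_nonneg_bounded[of _ "(l2norm M f)\<^sup>2"])
  show "(\<Sum>i<n. (coef f i)\<^sup>2) \<le> (l2norm M f)\<^sup>2" for n
    using l2norm_diff_partial[OF assms, of n] zero_le_power2[of "l2norm M (\<lambda>x. f x - (\<Sum>i<n. coef f i * e i x))"]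
    by linarith
qed simp

text \<open>The condition \<open>cn\<close> excludes nonzero coefficients at vanishing vectors,
  where no function could realize them.\<close>

lemma riesz_fischer:
  assumes c: "summable (\<lambda>i. (c i)\<^sup>2)" and cn: "\<And>i. c i * nrm i = c i"
  obtains u where "u \<in> L2 M" "\<And>i. coef u i = c i"
    "(\<lambda>n. l2norm M (\<lambda>x. (\<Sum>i<n. c i * e i x) - u x)) \<longlonglongrightarrow> 0"
proof -
  let ?S = "\<lambda>n x. \<Sum>i<n. c i * e i x"
  have cn2: "(c i)\<^sup>2 * nrm i = (c i)\<^sup>2" for i
    using cn[of i] by (metis mult.assoc power2_eq_square)
  have diff: "(l2norm M (\<lambda>x. ?S m x - ?S n x))\<^sup>2 = (\<Sum>i\<in>{n..<m}. (c i)\<^sup>2)" if "n \<le> m" for m n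
  proof -
    have "?S m x - ?S n x = (\<Sum>i\<in>{n..<m}. c i * e i x)" for x
      using sum_diff_nat_ivl[of 0 n m "\<lambda>i. c i * e i x"] that by (simp add: lessThan_atLeast0)
    then show ?thesis using l2norm_sum_e[of "{n..<m}" c] by (simp add: cn2)
  qed
  have cauchy: "\<exists>N. \<forall>k\<ge>N. \<forall>l\<ge>N. l2norm M (\<lambda>x. ?S k x - ?S l x) < \<epsilon>" if "0 < \<epsilon>" for \<epsilon>
  proof -
    have "\<exists>N. \<forall>m\<ge>N. \<forall>n. norm (\<Sum>i\<in>{m..<n}. (c i)\<^sup>2) < \<epsilon>\<^sup>2"
      using c[unfolded summable_Cauchy] \<open>0 < \<epsilon>\<close> by simp
    then obtain N where N: "\<And>m n. m \<ge> N \<Longrightarrow> norm (\<Sum>i\<in>{m..<n}. (c i)\<^sup>2) < \<epsilon>\<^sup>2" by auto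
    have A: "l2norm M (\<lambda>x. ?S k x - ?S l x) < \<epsilon>" if "l \<ge> N" "l \<le> k" for k l
    proof -
      have "(l2norm M (\<lambda>x. ?S k x - ?S l x))\<^sup>2 < \<epsilon>\<^sup>2"
        using N[OF that(1), of k] unfolding diff[OF that(2)] by simp
      then show ?thesis using \<open>0 < \<epsilon>\<close> by (simp add: power_less_imp_less_base)
    qed
    have "l2norm M (\<lambda>x. ?S k x - ?S l x) < \<epsilon>" if "k \<ge> N" "l \<ge> N" for k l
      using A[of l k] A[of k l] that l2norm_minus_commute[of M "?S k" "?S l"] by (cases "l \<le> k") auto
    then show ?thesis by blast
  qed
  obtain u where u: "u \<in> L2 M" "(\<lambda>n. l2norm M (\<lambda>x. ?S n x - u x)) \<longlonglongrightarrow> 0"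
    using L2_complete[of ?S, OF _ cauchy] by auto
  have "coef u i = c i" for i
  proof -
    have "(\<lambda>n. coef (?S n) i) \<longlonglongrightarrow> coef u i"
      unfolding coef_def by (rule l2ip_tendsto) (use u in auto)
    moreover have "(\<lambda>n. coef (?S n) i) \<longlonglongrightarrow> c i"
      by (rule tendsto_eventually) (auto simp: coef_sum cn eventually_sequentially intro!: exI[of _ "Suc i"])
    ultimately show ?thesis by (rule LIMSEQ_unique)
  qed
  with u show thesis using that by blast
qed

lemma coef_eq_imp_norm_diff:
  assumes "f \<in> L2 M" "g \<in> L2 M" "\<And>i. coef f i = coef g i"
  shows "l2norm M (\<lambda>x. f x - g x) = 0"
proof (rule e_total)
  show "l2ip M (\<lambda>x. f x - g x) (e i) = 0" for i
    using coef_diff[OF assms(1,2), of i] assms(3)[of i] by (simp add: coef_def)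
qed (use assms in auto)

lemma coef_eq_imp_AE:
  assumes "f \<in> L2 M" "g \<in> L2 M" "\<And>i. coef f i = coef g i"
  shows "AE x in M. f x = g x"
  using coef_eq_imp_norm_diff[OF assms] l2norm_diff_eq_0_iff[OF assms(1,2)] by simp

text \<open>The Riesz--Fischer limit has the coefficients of \<open>f\<close>, and totality
  identifies the two almost everywhere.\<close>

lemma partial_tendsto:
  assumes f: "f \<in> L2 M"
  shows "(\<lambda>n. l2norm M (\<lambda>x. (\<Sum>i<n. coef f i * e i x) - f x)) \<longlonglongrightarrow> 0"
proof -
  obtain u where u: "u \<in> L2 M" "\<And>i. coef u i = coef f i"
    "(\<lambda>n. l2norm M (\<lambda>x. (\<Sum>i<n. coef f i * e i x) - u x)) \<longlonglongrightarrow> 0"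
    using riesz_fischer[OF bessel[OF f] coef_nrm[OF f]] by blast
  have AEu: "AE x in M. u x = f x" by (rule coef_eq_imp_AE) (use u f in auto)
  have "l2norm M (\<lambda>x. (\<Sum>i<n. coef f i * e i x) - u x) = l2norm M (\<lambda>x. (\<Sum>i<n. coef f i * e i x) - f x)" for n
  proof (rule l2norm_cong_AE)
    show "AE x in M. (\<Sum>i<n. coef f i * e i x) - u x = (\<Sum>i<n. coef f i * e i x) - f x"
      using AEu by eventually_elim simp
    show "(\<lambda>x. (\<Sum>i<n. coef f i * e i x) - u x) \<in> borel_measurable M"
      using L2_measurable[OF L2_diff[OF L2_lincomb_e u(1)]] .
    show "(\<lambda>x. (\<Sum>i<n. coef f i * e i x) - f x) \<in> borel_measurable M"
      using L2_measurable[OF L2_diff[OF L2_lincomb_e f]] .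
  qed
  with u(3) show ?thesis by simp
qed

lemma parseval:
  assumes f: "f \<in> L2 M"
  shows "(\<lambda>i. (coef f i)\<^sup>2) sums (l2norm M f)\<^sup>2"
proof -
  have "(\<lambda>n. (l2norm M (\<lambda>x. f x - (\<Sum>i<n. coef f i * e i x)))\<^sup>2) \<longlonglongrightarrow> 0\<^sup>2"
    using partial_tendsto[OF f] unfolding l2norm_minus_commute[of M f] by (rule tendsto_power)
  then have "(\<lambda>n. (l2norm M f)\<^sup>2 - ((l2norm M f)\<^sup>2 - (\<Sum>i<n. (coef f i)\<^sup>2))) \<longlonglongrightarrow> (l2norm M f)\<^sup>2 - 0"
    unfolding l2norm_diff_partial[OF f] by (intro tendsto_diff) auto
  then show ?thesis by (simp add: sums_def)
qed

lemma parseval_ip: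
  assumes f: "f \<in> L2 M" and g: "g \<in> L2 M"
  shows "(\<lambda>i. coef f i * coef g i) sums l2ip M f g"
proof -
  have "(\<lambda>i. (1/2) * ((coef (\<lambda>x. 1 * f x + 1 * g x) i)\<^sup>2 - (coef f i)\<^sup>2 - (coef g i)\<^sup>2)) sums
     ((1/2) * ((l2norm M (\<lambda>x. 1 * f x + 1 * g x))\<^sup>2 - (l2norm M f)\<^sup>2 - (l2norm M g)\<^sup>2))"
    by (intro sums_mult sums_diff parseval L2_lincomb f g)
  then show ?thesis
    unfolding coef_lin[OF f g] l2norm_sq_lin[OF f g] by (simp add: power2_sum)
qed

end

text \<open>The input for diagonalizing a closure. \<open>E_spec\<close> is the Parseval identity on
  the core \<open>C\<close>. The vectors \<open>e i\<close> may lie outside \<open>C\<close>, so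
  \<open>e_approx\<close> asks that each be a limit of core elements whose energies converge to the
  right value. \<open>E_contraction\<close> is the unit contraction up to a uniform error, since a
  clipped C1 function is in general no longer C1.\<close>

locale spectral_form = orthonormal_system +
  fixes lam :: "nat \<Rightarrow> real" and C :: "(pt \<Rightarrow> real) set"
    and E :: "(pt \<Rightarrow> real) \<Rightarrow> (pt \<Rightarrow> real) \<Rightarrow> real"
  assumes lam_nonneg: "\<And>i. 0 \<le> lam i"
    and C_L2: "\<And>f. f \<in> C \<Longrightarrow> f \<in> L2 M"
    and C_lin: "\<And>f g a b. f \<in> C \<Longrightarrow> g \<in> C \<Longrightarrow> (\<lambda>x. a * f x + b * g x) \<in> C"
    and E_spec: "\<And>f g. f \<in> C \<Longrightarrow> g \<in> C \<Longrightarrow> (\<lambda>i. lam i * coef f i * coef g i) sums E f g"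
    and e_approx: "\<And>i. \<exists>gs. (\<forall>k. gs k \<in> C) \<and> (\<lambda>k. l2norm M (\<lambda>x. gs k x - e i x)) \<longlonglongrightarrow> 0 \<and>
          (\<lambda>k. E (gs k) (gs k)) \<longlonglongrightarrow> lam i * nrm i"
    and E_contraction: "\<And>f \<epsilon>. f \<in> C \<Longrightarrow> 0 < \<epsilon> \<Longrightarrow>
          \<exists>g\<in>C. E g g \<le> E f f \<and> (\<forall>x. \<bar>g x - min 1 (max 0 (f x))\<bar> \<le> \<epsilon>)"
begin

section \<open>The maximal diagonal form and its closedness\<close>

definition D :: "(pt \<Rightarrow> real) set" where
  "D = {u \<in> L2 M. summable (\<lambda>i. lam i * (coef u i)\<^sup>2)}"

definition q :: "(pt \<Rightarrow> real) \<Rightarrow> (pt \<Rightarrow> real) \<Rightarrow> real" where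
  "q u v = (\<Sum>i. lam i * coef u i * coef v i)"

lemma D_L2: "u \<in> D \<Longrightarrow> u \<in> L2 M" by (simp add: D_def)

lemma D_summable:
  assumes "u \<in> D" "v \<in> D" shows "summable (\<lambda>i. lam i * coef u i * coef v i)"
proof (rule summable_comparison_test'[where N=0])
  show "summable (\<lambda>i. lam i * (coef u i)\<^sup>2 + lam i * (coef v i)\<^sup>2)"
    using assms by (intro summable_add) (auto simp: D_def)
  fix i
  have "2 * (\<bar>coef u i\<bar> * \<bar>coef v i\<bar>) \<le> (coef u i)\<^sup>2 + (coef v i)\<^sup>2"
    using sum_squares_bound[of "\<bar>coef u i\<bar>" "\<bar>coef v i\<bar>"] by simp
  moreover have "0 \<le> \<bar>coef u i\<bar> * \<bar>coef v i\<bar>" by simp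
  ultimately have "\<bar>coef u i\<bar> * \<bar>coef v i\<bar> \<le> (coef u i)\<^sup>2 + (coef v i)\<^sup>2" by linarith
  from mult_left_mono[OF this lam_nonneg[of i]]
  show "norm (lam i * coef u i * coef v i) \<le> lam i * (coef u i)\<^sup>2 + lam i * (coef v i)\<^sup>2"
    using lam_nonneg[of i] by (simp add: abs_mult algebra_simps)
qed

lemma q_sums: "u \<in> D \<Longrightarrow> v \<in> D \<Longrightarrow> (\<lambda>i. lam i * coef u i * coef v i) sums q u v"
  unfolding q_def by (intro summable_sums D_summable)

lemma q_sums_sq: "u \<in> D \<Longrightarrow> (\<lambda>i. lam i * (coef u i)\<^sup>2) sums q u u"
  using q_sums[of u u] by (simp add: power2_eq_square mult.assoc)

lemma D_lin: assumes "u \<in> D" "v \<in> D" shows "(\<lambda>x. a * u x + b * v x) \<in> D"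
proof -
  have L: "u \<in> L2 M" "v \<in> L2 M" using assms by (auto simp: D_def)
  have "summable (\<lambda>i. a\<^sup>2 * (lam i * coef u i * coef u i) + 2 * a * b * (lam i * coef u i * coef v i)
      + b\<^sup>2 * (lam i * coef v i * coef v i))"
    using assms by (intro summable_add summable_mult D_summable)
  then show ?thesis
    unfolding D_def using L
    by (simp add: coef_lin L2_lincomb power2_eq_square algebra_simps)
qed

lemma D_diff: "u \<in> D \<Longrightarrow> v \<in> D \<Longrightarrow> (\<lambda>x. u x - v x) \<in> D"
  using D_lin[of u v 1 "-1"] by simp

lemma D_add: "u \<in> D \<Longrightarrow> v \<in> D \<Longrightarrow> (\<lambda>x. u x + v x) \<in> D"
  using D_lin[of u v 1 1] by simp

lemma q_commute: "q u v = q v u"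
  by (simp add: q_def mult.commute mult.left_commute)

lemma q_nonneg: "u \<in> D \<Longrightarrow> 0 \<le> q u u"
  unfolding q_def by (rule suminf_nonneg[OF D_summable]) (auto simp: lam_nonneg mult.assoc)

lemma q_lin_left:
  assumes "u \<in> D" "v \<in> D" "w \<in> D"
  shows "q (\<lambda>x. a * u x + b * v x) w = a * q u w + b * q v w"
proof -
  have "(\<lambda>i. a * (lam i * coef u i * coef w i) + b * (lam i * coef v i * coef w i)) sums (a * q u w + b * q v w)"
    by (intro sums_add sums_mult q_sums assms)
  moreover have "(\<lambda>i. lam i * coef (\<lambda>x. a * u x + b * v x) i * coef w i) sums q (\<lambda>x. a * u x + b * v x) w"
    by (intro q_sums D_lin assms)
  ultimately show ?thesis
    using assms by (simp add: coef_lin D_L2 algebra_simps sums_unique2)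
qed

lemma q_diff_left: "u \<in> D \<Longrightarrow> v \<in> D \<Longrightarrow> w \<in> D \<Longrightarrow> q (\<lambda>x. u x - v x) w = q u w - q v w"
  using q_lin_left[of u v w 1 "-1"] by simp

lemma q_sq_lin:
  assumes "u \<in> D" "v \<in> D"
  shows "q (\<lambda>x. a * u x + b * v x) (\<lambda>x. a * u x + b * v x) = a\<^sup>2 * q u u + 2 * a * b * q u v + b\<^sup>2 * q v v"
proof -
  let ?h = "\<lambda>x. a * u x + b * v x"
  have h: "?h \<in> D" by (rule D_lin[OF assms])
  have 1: "q ?h ?h = a * q u ?h + b * q v ?h" by (rule q_lin_left[OF assms h])
  have 2: "q u ?h = a * q u u + b * q u v"
    using q_lin_left[OF assms assms(1), of a b] by (simp only: q_commute[of ?h u] q_commute[of v u])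
  have 3: "q v ?h = a * q u v + b * q v v"
    using q_lin_left[OF assms assms(2), of a b] by (simp only: q_commute[of ?h v])
  show ?thesis unfolding 1 2 3 by (simp add: power2_eq_square algebra_simps)
qed

lemma q_cauchy_schwarz:
  assumes "u \<in> D" "v \<in> D" shows "\<bar>q u v\<bar> \<le> sqrt (q u u) * sqrt (q v v)"
proof -
  have "(q u v)\<^sup>2 \<le> q u u * q v v"
  proof (rule quadratic_nonneg_imp)
    show "0 \<le> q u u * t\<^sup>2 + 2 * q u v * t + q v v" for t
      using q_sq_lin[OF assms, of t 1] q_nonneg[OF D_lin[OF assms, of t 1]] by (simp add: algebra_simps)
  qed (rule q_nonneg[OF assms(1)])
  then show ?thesis by (metis real_sqrt_abs real_sqrt_le_iff real_sqrt_mult)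
qed

lemma q_add_le:
  assumes "u \<in> D" "v \<in> D"
  shows "q (\<lambda>x. u x + v x) (\<lambda>x. u x + v x) \<le> 2 * q u u + 2 * q v v"
  using q_sq_lin[OF assms, of 1 1] q_sq_lin[OF assms, of 1 "-1"] q_nonneg[OF D_diff[OF assms]] by simp

lemma q_minus_commute:
  assumes "u \<in> D" "v \<in> D"
  shows "q (\<lambda>x. u x - v x) (\<lambda>x. u x - v x) = q (\<lambda>x. v x - u x) (\<lambda>x. v x - u x)"
  using q_sq_lin[OF assms, of 1 "-1"] q_sq_lin[OF assms, of "-1" 1] by simp

lemma C_D: "f \<in> C \<Longrightarrow> f \<in> D"
  using E_spec[of f f] C_L2[of f] by (auto simp: D_def power2_eq_square mult.assoc sums_iff)

lemma E_eq_q: "f \<in> C \<Longrightarrow> g \<in> C \<Longrightarrow> E f g = q f g"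
  using E_spec[of f g] q_sums[of f g] C_D by (auto intro: sums_unique2)

lemma C_diff: "f \<in> C \<Longrightarrow> g \<in> C \<Longrightarrow> (\<lambda>x. f x - g x) \<in> C"
  using C_lin[of f g 1 "-1"] by simp

text \<open>Lower semicontinuity: finite partial sums converge with the coefficients, each is at
  most \<open>q (f k) (f k)\<close> because the terms are nonnegative, and the bound passes to the
  full series.\<close>

lemma form_lsc:
  assumes f: "\<And>k. f k \<in> D" and u: "u \<in> L2 M" and c: "\<And>i. (\<lambda>k. coef (f k) i) \<longlonglongrightarrow> coef u i"
    and B: "\<forall>\<^sub>F k in sequentially. q (f k) (f k) \<le> B"
  shows "u \<in> D" "q u u \<le> B"
proof -
  have part: "(\<Sum>i<n. lam i * (coef u i)\<^sup>2) \<le> B" for n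
  proof (rule tendsto_upperbound)
    show "(\<lambda>k. \<Sum>i<n. lam i * (coef (f k) i)\<^sup>2) \<longlonglongrightarrow> (\<Sum>i<n. lam i * (coef u i)\<^sup>2)"
      by (intro tendsto_intros c)
    show "\<forall>\<^sub>F k in sequentially. (\<Sum>i<n. lam i * (coef (f k) i)\<^sup>2) \<le> B"
      using B
    proof eventually_elim
      case (elim k)
      have "(\<Sum>i<n. lam i * (coef (f k) i)\<^sup>2) \<le> q (f k) (f k)"
        unfolding sums_unique[OF q_sums_sq[OF f]]
        by (rule sum_le_suminf) (use q_sums_sq[OF f] in \<open>auto simp: sums_iff lam_nonneg\<close>)
      with elim show ?case by simp
    qed
  qed simp
  have sm: "summable (\<lambda>i. lam i * (coef u i)\<^sup>2)"
    by (rule summableI_nonneg_bounded[OF _ part]) (simp add: lam_nonneg)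
  then show uD: "u \<in> D" using u by (simp add: D_def)
  show "q u u \<le> B"
    unfolding sums_unique[OF q_sums_sq[OF uD]] by (rule suminf_le_const[OF sm part])
qed

text \<open>Lower semicontinuity is applied to \<open>f k - f l\<close> with \<open>k\<close> fixed
  and \<open>l\<close> tending to infinity.\<close>

lemma form_closed:
  assumes f: "\<And>k. f k \<in> D" and u: "u \<in> L2 M" and c: "\<And>i. (\<lambda>k. coef (f k) i) \<longlonglongrightarrow> coef u i"
    and cauchy: "\<And>\<epsilon>. 0 < \<epsilon> \<Longrightarrow> \<exists>N. \<forall>k\<ge>N. \<forall>l\<ge>N. q (\<lambda>x. f k x - f l x) (\<lambda>x. f k x - f l x) < \<epsilon>"
  shows "u \<in> D" "(\<lambda>k. q (\<lambda>x. f k x - u x) (\<lambda>x. f k x - u x)) \<longlonglongrightarrow> 0"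
proof -
  have key: "(\<lambda>x. f k x - u x) \<in> D \<and> q (\<lambda>x. f k x - u x) (\<lambda>x. f k x - u x) \<le> \<epsilon>"
    if N: "\<And>l. l \<ge> N \<Longrightarrow> q (\<lambda>x. f k x - f l x) (\<lambda>x. f k x - f l x) < \<epsilon>" for k N \<epsilon>
  proof -
    have 1: "(\<lambda>l. coef (\<lambda>x. f k x - f l x) i) \<longlonglongrightarrow> coef (\<lambda>x. f k x - u x) i" for i
      using c[of i] by (simp add: coef_diff D_L2 f u) (intro tendsto_intros)
    have 2: "\<forall>\<^sub>F l in sequentially. q (\<lambda>x. f k x - f l x) (\<lambda>x. f k x - f l x) \<le> \<epsilon>"
      using N by (intro eventually_sequentiallyI[of N]) (auto intro: less_imp_le)
    show ?thesis
      using form_lsc[of "\<lambda>l x. f k x - f l x", OF D_diff[OF f f] L2_diff[OF D_L2[OF f] u] 1 2] by simp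
  qed
  obtain N1 where N1: "\<And>k l. k \<ge> N1 \<Longrightarrow> l \<ge> N1 \<Longrightarrow> q (\<lambda>x. f k x - f l x) (\<lambda>x. f k x - f l x) < 1"
    using cauchy[of 1] by auto
  have "(\<lambda>x. f N1 x - u x) \<in> D" using key[of N1 N1 1] N1 by auto
  from D_diff[OF f[of N1] this] show "u \<in> D" by simp
  then have D: "(\<lambda>x. f k x - u x) \<in> D" for k by (rule D_diff[OF f])
  show "(\<lambda>k. q (\<lambda>x. f k x - u x) (\<lambda>x. f k x - u x)) \<longlonglongrightarrow> 0"
  proof (rule LIMSEQ_I)
    fix \<epsilon> :: real assume "0 < \<epsilon>"
    then obtain N where N: "\<And>k l. k \<ge> N \<Longrightarrow> l \<ge> N \<Longrightarrow> q (\<lambda>x. f k x - f l x) (\<lambda>x. f k x - f l x) < \<epsilon>/2"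
      using cauchy[of "\<epsilon>/2"] by auto
    have "norm (q (\<lambda>x. f k x - u x) (\<lambda>x. f k x - u x) - 0) < \<epsilon>" if "k \<ge> N" for k
      using key[of N k "\<epsilon>/2"] N[OF that] q_nonneg[OF D[of k]] \<open>0 < \<epsilon>\<close> by auto
    then show "\<exists>no. \<forall>n\<ge>no. norm (q (\<lambda>x. f n x - u x) (\<lambda>x. f n x - u x) - 0) < \<epsilon>" by blast
  qed
qed

section \<open>Approximation by the core in the form norm\<close>

lemma coef_tendsto:
  assumes "\<And>k. f k \<in> L2 M" "u \<in> L2 M" "((\<lambda>k. l2norm M (\<lambda>x. f k x - u x)) \<longlongrightarrow> 0) F"
  shows "((\<lambda>k. coef (f k) i) \<longlongrightarrow> coef u i) F"
  unfolding coef_def by (rule l2ip_tendsto) (use assms in auto)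

lemma approx_seqD:
  assumes a: "approx_seq M C E fs u" and u: "u \<in> L2 M"
  shows "u \<in> D" "(\<lambda>k. q (\<lambda>x. fs k x - u x) (\<lambda>x. fs k x - u x)) \<longlonglongrightarrow> 0"
    "(\<lambda>k. l2norm M (\<lambda>x. fs k x - u x)) \<longlonglongrightarrow> 0"
proof -
  have C: "fs k \<in> C" for k using a by (simp add: approx_seq_def)
  show l: "(\<lambda>k. l2norm M (\<lambda>x. fs k x - u x)) \<longlonglongrightarrow> 0"
    using a by (simp add: approx_seq_def l2norm_tendsto_0_iff)
  have c: "(\<lambda>k. coef (fs k) i) \<longlonglongrightarrow> coef u i" for i
    by (rule coef_tendsto[OF C_L2[OF C] u l])
  have ca: "\<exists>N. \<forall>k\<ge>N. \<forall>l\<ge>N. q (\<lambda>x. fs k x - fs l x) (\<lambda>x. fs k x - fs l x) < \<epsilon>" if "0 < \<epsilon>" for \<epsilon>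
    using a that C_diff[OF C C] by (simp add: approx_seq_def E_cauchy_def E_eq_q)
  show "u \<in> D" "(\<lambda>k. q (\<lambda>x. fs k x - u x) (\<lambda>x. fs k x - u x)) \<longlonglongrightarrow> 0"
    using form_closed[of fs, OF C_D[OF C] u c ca] by auto
qed

text \<open>The squared form norm. With squares, the factor 2 in \<open>N1_add\<close> takes the
  place of the triangle inequality, whence the quarters of \<open>\<epsilon>\<close> below.\<close>

definition N1 :: "(pt \<Rightarrow> real) \<Rightarrow> real" where
  "N1 u = (l2norm M u)\<^sup>2 + q u u"

lemma N1_add: "u \<in> D \<Longrightarrow> v \<in> D \<Longrightarrow> N1 (\<lambda>x. u x + v x) \<le> 2 * N1 u + 2 * N1 v"
proof -
  assume uv: "u \<in> D" "v \<in> D"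
  have "(l2norm M (\<lambda>x. u x + v x))\<^sup>2 \<le> 2 * (l2norm M u)\<^sup>2 + 2 * (l2norm M v)\<^sup>2"
    using l2norm_sq_lin[OF D_L2[OF uv(1)] D_L2[OF uv(2)], of 1 1]
      l2norm_sq_lin[OF D_L2[OF uv(1)] D_L2[OF uv(2)], of 1 "-1"]
      zero_le_power2[of "l2norm M (\<lambda>x. 1 * u x + -1 * v x)"] by simp
  with q_add_le[OF uv] show ?thesis by (simp add: N1_def)
qed

definition appr :: "(pt \<Rightarrow> real) \<Rightarrow> bool" where
  "appr u \<longleftrightarrow> u \<in> D \<and> (\<forall>\<epsilon>>0. \<exists>g\<in>C. N1 (\<lambda>x. g x - u x) < \<epsilon>)"

lemma appr_imp_D: "appr u \<Longrightarrow> u \<in> D"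
  unfolding appr_def by (rule conjunct1)

lemma apprE:
  assumes "appr u" "0 < \<epsilon>" obtains g where "g \<in> C" "N1 (\<lambda>x. g x - u x) < \<epsilon>"
  using assms unfolding appr_def by blast

text \<open>Convergence in L2 together with convergence of the energies forces convergence in the
  form norm: the cross term \<open>q (gs k) (e i)\<close> is just \<open>lam i\<close> times a
  coefficient, so it converges as well and the square expands to a null sequence.\<close>

lemma appr_e: "appr (e i)"
proof -
  have s: "(\<lambda>j. lam j * (coef (e i) j)\<^sup>2) sums (lam i * (nrm i)\<^sup>2)"
    using sums_single[of i "\<lambda>j. lam j * (nrm j)\<^sup>2"]
    by (rule sums_cong[THEN iffD1, rotated]) (auto simp: coef_e)
  have eD: "e i \<in> D" using s by (simp add: D_def sums_iff)
  have qe: "q (e i) (e i) = lam i * nrm i"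
    using sums_unique2[OF q_sums_sq[OF eD] s] nrm_cases[of i] by auto
  obtain gs where gs: "\<And>k. gs k \<in> C" "(\<lambda>k. l2norm M (\<lambda>x. gs k x - e i x)) \<longlonglongrightarrow> 0"
          "(\<lambda>k. E (gs k) (gs k)) \<longlonglongrightarrow> lam i * nrm i" using e_approx[of i] by auto
  have qg: "q (gs k) (e i) = lam i * coef (gs k) i" for k
  proof -
    have "(\<lambda>j. lam j * coef (gs k) j * coef (e i) j) sums (lam i * coef (gs k) i * nrm i)"
      using sums_single[of i "\<lambda>j. lam j * coef (gs k) j * nrm j"] by (simp add: coef_e if_distrib cong: if_cong)
    from sums_unique2[OF q_sums[OF C_D[OF gs(1)] eD] this] show ?thesis
      using coef_nrm[OF C_L2[OF gs(1)[of k]], of i] by (simp add: mult.assoc)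
  qed
  have "(\<lambda>k. q (\<lambda>x. gs k x - e i x) (\<lambda>x. gs k x - e i x)) = (\<lambda>k. E (gs k) (gs k) - 2 * (lam i * coef (gs k) i) + lam i * nrm i)"
    using q_sq_lin[OF C_D[OF gs(1)] eD, where a=1 and b="-1"] by (simp add: qg qe E_eq_q gs(1))
  moreover have "\<dots> \<longlonglongrightarrow> lam i * nrm i - 2 * (lam i * coef (e i) i) + lam i * nrm i"
    by (intro tendsto_intros gs coef_tendsto[OF C_L2[OF gs(1)] e_L2 gs(2)])
  ultimately have "(\<lambda>k. (l2norm M (\<lambda>x. gs k x - e i x))\<^sup>2 + q (\<lambda>x. gs k x - e i x) (\<lambda>x. gs k x - e i x)) \<longlonglongrightarrow> 0\<^sup>2 + 0"
    by (intro tendsto_intros gs) (simp add: coef_e)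
  then have t: "(\<lambda>k. N1 (\<lambda>x. gs k x - e i x)) \<longlonglongrightarrow> 0" by (simp add: N1_def)
  have "\<exists>g\<in>C. N1 (\<lambda>x. g x - e i x) < \<epsilon>" if "0 < \<epsilon>" for \<epsilon>
  proof -
    from eventually_happens'[OF sequentially_bot order_tendstoD(2)[OF t that]]
    obtain k where "N1 (\<lambda>x. gs k x - e i x) < \<epsilon>" by blast
    with gs(1) show ?thesis by blast
  qed
  with eD show ?thesis by (simp add: appr_def)
qed

lemma appr_add:
  assumes "appr u" "appr v" shows "appr (\<lambda>x. u x + v x)"
  unfolding appr_def
proof (intro conjI allI impI)
  have uv: "u \<in> D" "v \<in> D" by (rule appr_imp_D[OF assms(1)], rule appr_imp_D[OF assms(2)])
  then show "(\<lambda>x. u x + v x) \<in> D" by (rule D_add)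
  fix \<epsilon> :: real assume "0 < \<epsilon>"
  then have e4: "0 < \<epsilon>/4" by simp
  obtain g h where gh: "g \<in> C" "h \<in> C" "N1 (\<lambda>x. g x - u x) < \<epsilon>/4" "N1 (\<lambda>x. h x - v x) < \<epsilon>/4"
    by (rule apprE[OF assms(1) e4], rule apprE[OF assms(2) e4])
  have "N1 (\<lambda>x. (g x - u x) + (h x - v x)) < \<epsilon>"
    using N1_add[OF D_diff[OF C_D[OF gh(1)] uv(1)] D_diff[OF C_D[OF gh(2)] uv(2)]] gh(3,4) by linarith
  then have "N1 (\<lambda>x. (g x + h x) - (u x + v x)) < \<epsilon>" by (simp add: algebra_simps)
  moreover have "(\<lambda>x. g x + h x) \<in> C" using C_lin[OF gh(1,2), of 1 1] by simp
  ultimately show "\<exists>g\<in>C. N1 (\<lambda>x. g x - (u x + v x)) < \<epsilon>" by (rule bexI)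
qed

lemma N1_cmult: "u \<in> D \<Longrightarrow> N1 (\<lambda>x. a * u x) = a\<^sup>2 * N1 u"
  using q_sq_lin[of u u a 0] by (simp add: N1_def l2norm_cmult power_mult_distrib algebra_simps)

lemma N1_nonneg: "u \<in> D \<Longrightarrow> 0 \<le> N1 u"
  using q_nonneg by (simp add: N1_def)

lemma appr_cmult:
  assumes "appr u" shows "appr (\<lambda>x. a * u x)"
  unfolding appr_def
proof (intro conjI allI impI)
  have u: "u \<in> D" using assms by (rule appr_imp_D)
  then show "(\<lambda>x. a * u x) \<in> D" using D_lin[of u u a 0] by simp
  fix \<epsilon> :: real assume "0 < \<epsilon>"
  moreover have "0 < a\<^sup>2 + 1" by (simp add: add_nonneg_pos)
  ultimately obtain g where g: "g \<in> C" "N1 (\<lambda>x. g x - u x) < \<epsilon> / (a\<^sup>2 + 1)"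
    using apprE[OF assms, of "\<epsilon> / (a\<^sup>2 + 1)"] by (metis divide_pos_pos)
  have gu: "(\<lambda>x. g x - u x) \<in> D" by (rule D_diff[OF C_D[OF g(1)] u])
  have "N1 (\<lambda>x. a * (g x - u x)) \<le> (a\<^sup>2 + 1) * N1 (\<lambda>x. g x - u x)"
    unfolding N1_cmult[OF gu] using N1_nonneg[OF gu] by (simp add: mult_right_mono)
  also have "\<dots> < \<epsilon>" using g(2) \<open>0 < a\<^sup>2 + 1\<close> by (simp add: pos_less_divide_eq mult.commute)
  finally have "N1 (\<lambda>x. a * g x - a * u x) < \<epsilon>" by (simp add: algebra_simps)
  moreover have "(\<lambda>x. a * g x) \<in> C" using C_lin[OF g(1) g(1), of a 0] by simp
  ultimately show "\<exists>g\<in>C. N1 (\<lambda>x. g x - a * u x) < \<epsilon>" by (rule bexI)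
qed

lemma appr_partial: "appr (\<lambda>x. \<Sum>i<n. c i * e i x)"
proof (induction n)
  case 0
  show ?case using appr_cmult[OF appr_e[of 0], of 0] by simp
next
  case (Suc n)
  from appr_add[OF this appr_cmult[OF appr_e]] show ?case by simp
qed

text \<open>The remainder keeps exactly the coefficients with index at least \<open>n\<close>, so
  its energy is a tail of the convergent series for \<open>q u u\<close>.\<close>

lemma N1_partial_tendsto:
  assumes u: "u \<in> D"
  shows "(\<lambda>n. N1 (\<lambda>x. (\<Sum>i<n. coef u i * e i x) - u x)) \<longlonglongrightarrow> 0"
proof -
  let ?S = "\<lambda>n x. \<Sum>i<n. coef u i * e i x"
  have SD: "?S n \<in> D" for n by (rule appr_imp_D[OF appr_partial])
  have q: "q (\<lambda>x. ?S n x - u x) (\<lambda>x. ?S n x - u x) = q u u - (\<Sum>i<n. lam i * (coef u i)\<^sup>2)" for n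
  proof -
    have c: "coef (\<lambda>x. ?S n x - u x) i = (if i < n then 0 else - coef u i)" for i
      using coef_nrm[OF D_L2[OF u], of i] by (simp add: coef_diff D_L2[OF u] coef_sum)
    have A: "(\<lambda>i. if i < n then 0 else lam i * (coef u i)\<^sup>2) sums q (\<lambda>x. ?S n x - u x) (\<lambda>x. ?S n x - u x)"
      using q_sums_sq[OF D_diff[OF SD u], of n] by (rule sums_cong[THEN iffD1, rotated]) (simp add: c)
    have B: "(\<lambda>i. lam i * (coef u i)\<^sup>2 - (if i < n then lam i * (coef u i)\<^sup>2 else 0)) sums
       (q u u - (\<Sum>i\<in>{..<n}. lam i * (coef u i)\<^sup>2))"
      using sums_If_finite_set[of "{..<n}" "\<lambda>i. lam i * (coef u i)\<^sup>2"] by (intro sums_diff q_sums_sq u) simp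
    have C: "(\<lambda>i. lam i * (coef u i)\<^sup>2 - (if i < n then lam i * (coef u i)\<^sup>2 else 0)) =
        (\<lambda>i. if i < n then 0 else lam i * (coef u i)\<^sup>2)" by auto
    show ?thesis by (rule sums_unique2[OF A B[unfolded C]])
  qed
  have 1: "(\<lambda>n. \<Sum>i<n. lam i * (coef u i)\<^sup>2) \<longlonglongrightarrow> q u u"
    using q_sums_sq[OF u] by (simp add: sums_def)
  have "(\<lambda>n. (l2norm M (\<lambda>x. ?S n x - u x))\<^sup>2 + (q u u - (\<Sum>i<n. lam i * (coef u i)\<^sup>2))) \<longlonglongrightarrow> 0\<^sup>2 + (q u u - q u u)"
    by (intro tendsto_intros partial_tendsto D_L2[OF u] 1)
  then show ?thesis by (simp add: N1_def q)
qed

lemma appr_D: "u \<in> D \<Longrightarrow> appr u"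
  unfolding appr_def
proof (intro conjI allI impI)
  fix \<epsilon> :: real assume u: "u \<in> D" and "0 < \<epsilon>"
  then have "\<forall>\<^sub>F n in sequentially. N1 (\<lambda>x. (\<Sum>i<n. coef u i * e i x) - u x) < \<epsilon>/4"
    by (intro order_tendstoD(2)[OF N1_partial_tendsto]) auto
  then have "\<exists>n. N1 (\<lambda>x. (\<Sum>i<n. coef u i * e i x) - u x) < \<epsilon>/4"
    by (rule eventually_happens'[OF sequentially_bot])
  then obtain n where n: "N1 (\<lambda>x. (\<Sum>i<n. coef u i * e i x) - u x) < \<epsilon>/4" by (rule exE)
  let ?S = "\<lambda>x. \<Sum>i<n. coef u i * e i x"
  have S: "appr ?S" by (rule appr_partial)
  have e4: "0 < \<epsilon>/4" using \<open>0 < \<epsilon>\<close> by simp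
  obtain g where g: "g \<in> C" "N1 (\<lambda>x. g x - ?S x) < \<epsilon>/4"
    by (rule apprE[OF S e4])
  have SD: "?S \<in> D" using S by (rule appr_imp_D)
  have "N1 (\<lambda>x. (g x - ?S x) + (?S x - u x)) \<le> 2 * N1 (\<lambda>x. g x - ?S x) + 2 * N1 (\<lambda>x. ?S x - u x)"
    by (rule N1_add[OF D_diff[OF C_D[OF g(1)] SD] D_diff[OF SD u]])
  with n g(2) have "N1 (\<lambda>x. g x - u x) < \<epsilon>" by simp
  with g(1) show "\<exists>g\<in>C. N1 (\<lambda>x. g x - u x) < \<epsilon>" by blast
qed

lemma approx_seq_exists:
  assumes u: "u \<in> D" shows "\<exists>fs. approx_seq M C E fs u"
proof -
  have "\<exists>g\<in>C. N1 (\<lambda>x. g x - u x) < inverse (real (Suc k))" for k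
    by (rule apprE[OF appr_D[OF u], of "inverse (real (Suc k))"]) (simp, blast)
  then obtain g where g: "\<And>k. g k \<in> C" "\<And>k. N1 (\<lambda>x. g k x - u x) < inverse (real (Suc k))" by metis
  note gC = C_D[OF g(1)]
  have gD: "(\<lambda>x. g k x - u x) \<in> D" for k by (rule D_diff[OF gC u])
  have N0: "(\<lambda>k. N1 (\<lambda>x. g k x - u x)) \<longlonglongrightarrow> 0"
    by (rule tendsto_sandwich[OF _ _ tendsto_const LIMSEQ_inverse_real_of_nat])
       (use N1_nonneg[OF gD] g(2) in \<open>auto intro: less_imp_le always_eventually\<close>)
  have a: "(\<lambda>k. \<integral>x. (g k x - u x)\<^sup>2 \<partial>M) \<longlonglongrightarrow> 0"
    by (rule tendsto_sandwich[OF _ _ tendsto_const N0])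
       (use q_nonneg[OF gD] in \<open>auto simp: N1_def l2norm_sq\<close>)
  have q0: "q (\<lambda>x. g k x - u x) (\<lambda>x. g k x - u x) \<le> N1 (\<lambda>x. g k x - u x)" for k by (simp add: N1_def)
  have "E_cauchy E g"
    unfolding E_cauchy_def
  proof (intro allI impI)
    fix \<epsilon> :: real assume "0 < \<epsilon>"
    then have "\<forall>\<^sub>F k in sequentially. N1 (\<lambda>x. g k x - u x) < \<epsilon>/4"
      by (intro order_tendstoD(2)[OF N0]) simp
    then obtain N where N: "\<And>k. k \<ge> N \<Longrightarrow> N1 (\<lambda>x. g k x - u x) < \<epsilon>/4" by (auto simp: eventually_sequentially)
    have "E (\<lambda>x. g k x - g l x) (\<lambda>x. g k x - g l x) < \<epsilon>" if "k \<ge> N" "l \<ge> N" for k l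
    proof -
      have "E (\<lambda>x. g k x - g l x) (\<lambda>x. g k x - g l x) = q (\<lambda>x. (g k x - u x) + (u x - g l x)) (\<lambda>x. (g k x - u x) + (u x - g l x))"
        using C_diff[OF g(1) g(1)] by (simp add: E_eq_q)
      also have "\<dots> \<le> 2 * q (\<lambda>x. g k x - u x) (\<lambda>x. g k x - u x) + 2 * q (\<lambda>x. u x - g l x) (\<lambda>x. u x - g l x)"
        by (intro q_add_le D_diff gC u)
      also have "q (\<lambda>x. u x - g l x) (\<lambda>x. u x - g l x) = q (\<lambda>x. g l x - u x) (\<lambda>x. g l x - u x)"
        by (intro q_minus_commute gC u)
      finally show ?thesis using q0[of k] q0[of l] N[OF that(1)] N[OF that(2)] by linarith
    qed
    then show "\<exists>N. \<forall>k\<ge>N. \<forall>l\<ge>N. E (\<lambda>x. g k x - g l x) (\<lambda>x. g k x - g l x) < \<epsilon>" by blast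
  qed
  with g(1) a show ?thesis by (auto simp: approx_seq_def)
qed

lemma closure_dom_eq: "closure_dom M C E = D"
  using approx_seqD(1) approx_seq_exists D_L2 by (auto simp: closure_dom_def)

text \<open>Both errors tend to 0 in \<open>q\<close>, and Cauchy--Schwarz for \<open>q\<close>
  controls the mixed terms. In particular the limit does not depend on the sequences, as the
  description in \<open>closure_form\<close> requires.\<close>

lemma approx_form_tendsto:
  assumes "approx_seq M C E fs u" "approx_seq M C E gs v" "u \<in> D" "v \<in> D"
  shows "(\<lambda>k. E (fs k) (gs k)) \<longlonglongrightarrow> q u v"
proof -
  have C: "fs k \<in> C" "gs k \<in> C" for k using assms by (auto simp: approx_seq_def)
  note D = C_D[OF C(1)] C_D[OF C(2)] assms(3,4)
  let ?a = "\<lambda>k. q (\<lambda>x. fs k x - u x) (\<lambda>x. fs k x - u x)" and ?b = "\<lambda>k. q (\<lambda>x. gs k x - v x) (\<lambda>x. gs k x - v x)"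
  have a: "?a \<longlonglongrightarrow> 0" and b: "?b \<longlonglongrightarrow> 0"
    using approx_seqD(2)[OF assms(1)] approx_seqD(2)[OF assms(2)] D_L2[OF assms(3)] D_L2[OF assms(4)] by auto
  have eq: "E (fs k) (gs k) - q u v = q (\<lambda>x. fs k x - u x) (\<lambda>x. gs k x - v x) + q (\<lambda>x. fs k x - u x) v + q u (\<lambda>x. gs k x - v x)" for k
  proof -
    have r: "q w (\<lambda>x. gs k x - v x) = q w (gs k) - q w v" if "w \<in> D" for w
      using q_diff_left[OF D(2,4) that, of k] by (simp only: q_commute[of w])
    show ?thesis
      unfolding r[OF D(3)] r[OF D_diff[OF D(1,3)]] q_diff_left[OF D(1,3) D(2)] q_diff_left[OF D(1,3) D(4)]
      by (simp add: E_eq_q C)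
  qed
  have "(\<lambda>k. E (fs k) (gs k) - q u v) \<longlonglongrightarrow> 0"
  proof (rule Lim_null_comparison)
    show "\<forall>\<^sub>F k in sequentially. norm (E (fs k) (gs k) - q u v) \<le>
       sqrt (?a k) * sqrt (?b k) + sqrt (?a k) * sqrt (q v v) + sqrt (q u u) * sqrt (?b k)"
    proof (rule always_eventually, rule allI)
      fix k
      show "norm (E (fs k) (gs k) - q u v) \<le>
       sqrt (?a k) * sqrt (?b k) + sqrt (?a k) * sqrt (q v v) + sqrt (q u u) * sqrt (?b k)"
        unfolding eq
        using q_cauchy_schwarz[OF D_diff[OF D(1,3)] D_diff[OF D(2,4)], of k k]
          q_cauchy_schwarz[OF D_diff[OF D(1,3)] D(4), of k] q_cauchy_schwarz[OF D(3) D_diff[OF D(2,4)], of k]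
        by (auto simp: abs_le_iff)
    qed
    have "(\<lambda>k. sqrt (?a k) * sqrt (?b k) + sqrt (?a k) * sqrt (q v v) + sqrt (q u u) * sqrt (?b k)) \<longlonglongrightarrow>
       sqrt 0 * sqrt 0 + sqrt 0 * sqrt (q v v) + sqrt (q u u) * sqrt 0"
      by (intro tendsto_intros a b)
    then show "(\<lambda>k. sqrt (?a k) * sqrt (?b k) + sqrt (?a k) * sqrt (q v v) + sqrt (q u u) * sqrt (?b k)) \<longlonglongrightarrow> 0"
      by simp
  qed
  then show ?thesis by (rule Lim_null[THEN iffD2])
qed

text \<open>Uniqueness rests on the existence of approximating sequences for both arguments: without
  them every number would satisfy the condition under \<open>THE\<close>.\<close>

lemma closure_form_eq:
  assumes "u \<in> D" "v \<in> D" shows "closure_form M C E u v = q u v"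
  unfolding closure_form_def
proof (rule the_equality)
  show "\<forall>fs gs. approx_seq M C E fs u \<longrightarrow> approx_seq M C E gs v \<longrightarrow> (\<lambda>k. E (fs k) (gs k)) \<longlonglongrightarrow> q u v"
    using approx_form_tendsto assms by blast
  fix c assume "\<forall>fs gs. approx_seq M C E fs u \<longrightarrow> approx_seq M C E gs v \<longrightarrow> (\<lambda>k. E (fs k) (gs k)) \<longlonglongrightarrow> c"
  then show "c = q u v"
    using approx_form_tendsto assms approx_seq_exists LIMSEQ_unique by meson
qed

text \<open>A sequence that is null in L2 and Cauchy in energy is an approximating sequence of the
  zero function.\<close>

lemma closable_form: "closable M C E"
  unfolding closable_def
proof (intro allI impI)
  fix fs assume fs: "\<forall>k. fs k \<in> C" "(\<lambda>k. \<integral>x. (fs k x)\<^sup>2 \<partial>M) \<longlonglongrightarrow> 0" "E_cauchy E fs"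
  then have "approx_seq M C E fs (\<lambda>x. 0)" by (simp add: approx_seq_def)
  from approx_seqD(2)[OF this] fs(1) show "(\<lambda>k. E (fs k) (fs k)) \<longlonglongrightarrow> 0"
    by (simp add: E_eq_q)
qed

text \<open>Clipping to the unit interval is 1-Lipschitz, so the smoothed contractions
  \<open>g k\<close> of an approximating sequence converge in L2 to the clipped \<open>u\<close>,
  without any control on energy differences. Their energies are eventually below every
  \<open>B > q u u\<close>, and lower semicontinuity transfers this to the limit.\<close>

lemma contraction_D:
  assumes u: "u \<in> D"
  shows "(\<lambda>x. min 1 (max 0 (u x))) \<in> D \<and> q (\<lambda>x. min 1 (max 0 (u x))) (\<lambda>x. min 1 (max 0 (u x))) \<le> q u u"
proof -
  obtain f where f: "approx_seq M C E f u" using approx_seq_exists[OF u] by blast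
  have fC: "f k \<in> C" for k using f by (simp add: approx_seq_def)
  have "\<exists>g\<in>C. E g g \<le> E (f k) (f k) \<and> (\<forall>x. \<bar>g x - min 1 (max 0 (f k x))\<bar> \<le> inverse (real (Suc k)))" for k
    by (rule E_contraction[OF fC]) simp
  then obtain g where g: "\<And>k. g k \<in> C" "\<And>k. E (g k) (g k) \<le> E (f k) (f k)"
    "\<And>k x. \<bar>g k x - min 1 (max 0 (f k x))\<bar> \<le> inverse (real (Suc k))" by metis
  let ?v = "\<lambda>x. min 1 (max 0 (u x))"
  have uL: "u \<in> L2 M" using u by (rule D_L2)
  have vL: "?v \<in> L2 M" by (rule L2_bounded[of _ 1]) (use L2_measurable[OF uL] in auto)
  have fuL: "(\<lambda>x. \<bar>f k x - u x\<bar>) \<in> L2 M" for k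
    using L2_diff[OF C_L2[OF fC[of k]] uL] by (auto simp: L2_def)
  have le: "l2norm M (\<lambda>x. g k x - ?v x) \<le> inverse (real (Suc k)) + l2norm M (\<lambda>x. f k x - u x)" for k
  proof -
    have ptw: "\<bar>g k x - ?v x\<bar> \<le> inverse (real (Suc k)) + \<bar>f k x - u x\<bar>" for x
      using g(3)[of k x] by linarith
    have "l2norm M (\<lambda>x. g k x - ?v x) \<le> l2norm M (\<lambda>x. inverse (real (Suc k)) + \<bar>f k x - u x\<bar>)"
      unfolding l2norm_def
    proof (intro real_sqrt_le_mono integral_mono)
      show "integrable M (\<lambda>x. (g k x - ?v x)\<^sup>2)" using L2_diff[OF C_L2[OF g(1)] vL] by (simp add: L2_def)
      show "integrable M (\<lambda>x. (inverse (real (Suc k)) + \<bar>f k x - u x\<bar>)\<^sup>2)"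
        using L2_add[OF L2_const fuL] by (simp add: L2_def)
      show "(g k x - ?v x)\<^sup>2 \<le> (inverse (real (Suc k)) + \<bar>f k x - u x\<bar>)\<^sup>2" for x
        using power_mono[OF ptw[of x], of 2] by simp
    qed
    also have "\<dots> \<le> l2norm M (\<lambda>x. inverse (real (Suc k))) + l2norm M (\<lambda>x. \<bar>f k x - u x\<bar>)"
      by (rule l2norm_triangle[OF L2_const fuL])
    also have "l2norm M (\<lambda>x. \<bar>f k x - u x\<bar>) = l2norm M (\<lambda>x. f k x - u x)" by (simp add: l2norm_def)
    also have "l2norm M (\<lambda>x. inverse (real (Suc k))) \<le> inverse (real (Suc k))"
      by (rule l2norm_bound) auto
    finally show ?thesis by simp
  qed
  have "(\<lambda>k. inverse (real (Suc k)) + l2norm M (\<lambda>x. f k x - u x)) \<longlonglongrightarrow> 0 + 0"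
    by (intro tendsto_add LIMSEQ_inverse_real_of_nat approx_seqD(3)[OF f uL])
  then have "(\<lambda>k. inverse (real (Suc k)) + l2norm M (\<lambda>x. f k x - u x)) \<longlonglongrightarrow> 0" by simp
  from Lim_null_comparison[OF always_eventually this, of "\<lambda>k. l2norm M (\<lambda>x. g k x - ?v x)"] le
  have gv: "(\<lambda>k. l2norm M (\<lambda>x. g k x - ?v x)) \<longlonglongrightarrow> 0" by simp
  have c: "(\<lambda>k. coef (g k) i) \<longlonglongrightarrow> coef ?v i" for i by (rule coef_tendsto[OF C_L2[OF g(1)] vL gv])
  have ev: "\<forall>\<^sub>F k in sequentially. q (g k) (g k) \<le> B" if "q u u < B" for B
    using order_tendstoD(2)[OF approx_form_tendsto[OF f f u u] that]
    by eventually_elim (use g(2) in \<open>metis E_eq_q g(1) less_imp_le order_trans\<close>)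
  have *: "?v \<in> D \<and> q ?v ?v \<le> B" if "q u u < B" for B
    using form_lsc[of g, OF C_D[OF g(1)] vL c ev[OF that]] by blast
  show ?thesis using *[of "q u u + 1"] * by (auto intro: dense_ge)
qed

lemma D_complete:
  fixes us :: "nat \<Rightarrow> pt \<Rightarrow> real"
  assumes us: "\<And>k. us k \<in> D"
    and cauchy: "\<And>\<epsilon>. 0 < \<epsilon> \<Longrightarrow> \<exists>N. \<forall>k\<ge>N. \<forall>l\<ge>N. N1 (\<lambda>x. us k x - us l x) < \<epsilon>"
  shows "\<exists>u\<in>D. (\<lambda>k. N1 (\<lambda>x. us k x - u x)) \<longlonglongrightarrow> 0"
proof -
  note DD = D_diff[OF us us]
  have l2: "\<exists>N. \<forall>k\<ge>N. \<forall>l\<ge>N. l2norm M (\<lambda>x. us k x - us l x) < \<epsilon>" if "0 < \<epsilon>" for \<epsilon>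
  proof -
    obtain N where N: "\<And>k l. k\<ge>N \<Longrightarrow> l\<ge>N \<Longrightarrow> N1 (\<lambda>x. us k x - us l x) < \<epsilon>\<^sup>2"
      using cauchy[OF zero_less_power[OF \<open>0 < \<epsilon>\<close>, of 2]] by blast
    have "l2norm M (\<lambda>x. us k x - us l x) < \<epsilon>" if "k \<ge> N" "l \<ge> N" for k l
    proof -
      have "(l2norm M (\<lambda>x. us k x - us l x))\<^sup>2 < \<epsilon>\<^sup>2"
        using N[OF that] q_nonneg[OF DD[of k l]] by (simp add: N1_def)
      then show ?thesis using \<open>0 < \<epsilon>\<close> by (simp add: power_less_imp_less_base)
    qed
    then show ?thesis by blast
  qed
  obtain u where u: "u \<in> L2 M" "(\<lambda>k. l2norm M (\<lambda>x. us k x - u x)) \<longlonglongrightarrow> 0"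
    using L2_complete[of us, OF D_L2[OF us] l2] by auto
  have ca: "\<exists>N. \<forall>k\<ge>N. \<forall>l\<ge>N. q (\<lambda>x. us k x - us l x) (\<lambda>x. us k x - us l x) < \<epsilon>" if "0 < \<epsilon>" for \<epsilon>
  proof -
    obtain N where N: "\<And>k l. k\<ge>N \<Longrightarrow> l\<ge>N \<Longrightarrow> N1 (\<lambda>x. us k x - us l x) < \<epsilon>"
      using cauchy[OF \<open>0 < \<epsilon>\<close>] by blast
    have "q (\<lambda>x. us k x - us l x) (\<lambda>x. us k x - us l x) < \<epsilon>" if "k \<ge> N" "l \<ge> N" for k l
      using N[OF that] zero_le_power2[of "l2norm M (\<lambda>x. us k x - us l x)"] unfolding N1_def by linarith
    then show ?thesis by blast
  qed
  note cl = form_closed[of us, OF us u(1) coef_tendsto[OF D_L2[OF us] u] ca]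
  have "(\<lambda>k. (l2norm M (\<lambda>x. us k x - u x))\<^sup>2 + q (\<lambda>x. us k x - u x) (\<lambda>x. us k x - u x)) \<longlonglongrightarrow> 0\<^sup>2 + 0"
    by (intro tendsto_intros u cl)
  then show ?thesis using cl(1) by (auto simp: N1_def)
qed

lemma D_dense:
  assumes u: "u \<in> L2 M" and "0 < \<epsilon>"
  shows "\<exists>v\<in>D. (\<integral>x. (u x - v x)\<^sup>2 \<partial>M) < \<epsilon>"
proof -
  have "(\<lambda>n. (l2norm M (\<lambda>x. u x - (\<Sum>i<n. coef u i * e i x)))\<^sup>2) \<longlonglongrightarrow> 0\<^sup>2"
    using partial_tendsto[OF u] unfolding l2norm_minus_commute[of M u] by (rule tendsto_power)
  then have "\<forall>\<^sub>F n in sequentially. (l2norm M (\<lambda>x. u x - (\<Sum>i<n. coef u i * e i x)))\<^sup>2 < \<epsilon>"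
    using \<open>0 < \<epsilon>\<close> by (intro order_tendstoD(2)) auto
  then have "\<exists>n. (l2norm M (\<lambda>x. u x - (\<Sum>i<n. coef u i * e i x)))\<^sup>2 < \<epsilon>"
    by (rule eventually_happens'[OF sequentially_bot])
  then obtain n where "(l2norm M (\<lambda>x. u x - (\<Sum>i<n. coef u i * e i x)))\<^sup>2 < \<epsilon>" by (rule exE)
  moreover have "(\<lambda>x. \<Sum>i<n. coef u i * e i x) \<in> D" by (rule appr_imp_D[OF appr_partial])
  ultimately show ?thesis unfolding l2norm_sq by (rule bexI)
qed

section \<open>The closure is a Dirichlet form with diagonal generator\<close>

abbreviation "Ebar \<equiv> closure_form M C E"

lemma dirichlet_form_closure: "dirichlet_form M (closure_dom M C E) Ebar"
  unfolding dirichlet_form_def closure_dom_eq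
proof (intro conjI)
  show "D \<subseteq> L2 M" using D_L2 by blast
  show "\<forall>u\<in>D. \<forall>v\<in>D. \<forall>a b. (\<lambda>x. a * u x + b * v x) \<in> D" using D_lin by blast
  show "\<forall>u\<in>L2 M. \<forall>e>0. \<exists>v\<in>D. (\<integral>x. (u x - v x)\<^sup>2 \<partial>M) < e" using D_dense by blast
  show "\<forall>u\<in>D. \<forall>v\<in>D. Ebar u v = Ebar v u" by (simp add: closure_form_eq q_commute)
  show "\<forall>u\<in>D. \<forall>v\<in>D. \<forall>w\<in>D. \<forall>a b. Ebar (\<lambda>x. a * u x + b * v x) w = a * Ebar u w + b * Ebar v w"
    by (simp add: closure_form_eq q_lin_left D_lin)
  show "\<forall>u\<in>D. 0 \<le> Ebar u u" by (simp add: closure_form_eq q_nonneg)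
  show "\<forall>us. (\<forall>k. us k \<in> D) \<longrightarrow>
        (\<forall>e>0. \<exists>N. \<forall>k\<ge>N. \<forall>l\<ge>N.
            Ebar (\<lambda>x. us k x - us l x) (\<lambda>x. us k x - us l x)
            + (\<integral>x. (us k x - us l x)\<^sup>2 \<partial>M) < e) \<longrightarrow>
        (\<exists>u\<in>D. (\<lambda>k. Ebar (\<lambda>x. us k x - u x) (\<lambda>x. us k x - u x)
                      + (\<integral>x. (us k x - u x)\<^sup>2 \<partial>M)) \<longlonglongrightarrow> 0)"
  proof (intro allI impI)
    fix us :: "nat \<Rightarrow> pt \<Rightarrow> real" assume us: "\<forall>k. us k \<in> D"
      "\<forall>e>0. \<exists>N. \<forall>k\<ge>N. \<forall>l\<ge>N. Ebar (\<lambda>x. us k x - us l x) (\<lambda>x. us k x - us l x)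
            + (\<integral>x. (us k x - us l x)\<^sup>2 \<partial>M) < e"
    have eq: "Ebar (\<lambda>x. us k x - v x) (\<lambda>x. us k x - v x) + (\<integral>x. (us k x - v x)\<^sup>2 \<partial>M) = N1 (\<lambda>x. us k x - v x)"
      if "v \<in> D" for k v
      using us(1) that by (simp add: N1_def l2norm_sq closure_form_eq D_diff)
    have "\<exists>u\<in>D. (\<lambda>k. N1 (\<lambda>x. us k x - u x)) \<longlonglongrightarrow> 0"
      using us by (intro D_complete) (auto simp: eq)
    then show "\<exists>u\<in>D. (\<lambda>k. Ebar (\<lambda>x. us k x - u x) (\<lambda>x. us k x - u x)
                      + (\<integral>x. (us k x - u x)\<^sup>2 \<partial>M)) \<longlonglongrightarrow> 0"
      by (auto simp: eq)
  qed
  show "\<forall>u\<in>D. (\<lambda>x. min 1 (max 0 (u x))) \<in> D \<and>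
       Ebar (\<lambda>x. min 1 (max 0 (u x))) (\<lambda>x. min 1 (max 0 (u x))) \<le> Ebar u u"
    using contraction_D by (simp add: closure_form_eq)
qed

lemma e_D: "e i \<in> D" by (rule appr_imp_D[OF appr_e])

lemma D_if_coef:
  assumes "u \<in> L2 M" "w \<in> L2 M" "\<And>i. coef w i = - lam i * coef u i"
  shows "u \<in> D"
proof -
  have "(\<lambda>i. - (coef w i * coef u i)) sums (- l2ip M w u)"
    by (intro sums_minus parseval_ip assms)
  then show ?thesis using assms by (auto simp: D_def sums_iff power2_eq_square mult.assoc)
qed

text \<open>Testing against the eigenvectors determines the coefficients of \<open>w\<close>.
  Conversely the coefficient relation already puts \<open>u\<close> into \<open>D\<close>, because
  \<open>lam i * (coef u i)^2\<close> is minus the product of two square-summable sequences.\<close>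

lemma generator_rel_iff:
  "generator_rel M (closure_dom M C E) Ebar u w \<longleftrightarrow>
     u \<in> L2 M \<and> w \<in> L2 M \<and> (\<forall>i. coef w i = - lam i * coef u i)"
  unfolding generator_rel_def closure_dom_eq
proof safe
  assume u: "u \<in> D" and w: "w \<in> L2 M" and *: "\<forall>v\<in>D. Ebar u v = - (\<integral>x. w x * v x \<partial>M)"
  show "u \<in> L2 M" using u by (rule D_L2)
  fix i
  have "(\<lambda>j. lam j * coef u j * coef (e i) j) sums (lam i * coef u i * nrm i)"
    using sums_single[of i "\<lambda>j. lam j * coef u j * nrm j"] by (simp add: coef_e if_distrib cong: if_cong)
  from sums_unique2[OF q_sums[OF u e_D] this] have "q u (e i) = lam i * coef u i"
    using coef_nrm[OF D_L2[OF u], of i] by (simp add: mult.assoc)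
  moreover have "q u (e i) = - coef w i"
    using * e_D[of i] by (simp add: closure_form_eq u coef_def l2ip_def)
  ultimately show "coef w i = - lam i * coef u i" by simp
next
  assume u: "u \<in> L2 M" and w: "w \<in> L2 M" and *: "\<forall>i. coef w i = - lam i * coef u i"
  show uD: "u \<in> D" using D_if_coef u w * by blast
  fix v assume v: "v \<in> D"
  have "(\<lambda>i. - (coef w i * coef v i)) sums (- l2ip M w v)"
    using v by (intro sums_minus parseval_ip w D_L2)
  with * have "(\<lambda>i. lam i * coef u i * coef v i) sums (- l2ip M w v)" by (simp add: mult.assoc)
  from sums_unique2[OF q_sums[OF uD v] this] show "Ebar u v = - (\<integral>x. w x * v x \<partial>M)"
    by (simp add: closure_form_eq uD v l2ip_def)
qed

end

subsection \<open>The semigroup of a spectral form\<close>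

lemma tendsto_suminf_dominated:
  fixes a :: "'b \<Rightarrow> nat \<Rightarrow> real"
  assumes "summable b" "\<And>i. ((\<lambda>t. a t i) \<longlongrightarrow> c i) F"
    and "\<forall>\<^sub>F t in F. \<forall>i. norm (a t i) \<le> b i" and "F \<noteq> bot"
  shows "((\<lambda>t. \<Sum>i. a t i) \<longlongrightarrow> (\<Sum>i. c i)) F"
proof -
  have "eventually (\<lambda>(i, t). norm (a t i) \<le> b i) (at_top \<times>\<^sub>F F)"
    unfolding eventually_prod_filter using assms(3)
    by (intro exI[of _ "\<lambda>_. True"] exI[of _ "\<lambda>t. \<forall>i. norm (a t i) \<le> b i"]) auto
  from tannerys_theorem[OF assms(2) this assms(1,4)] show ?thesis by blast
qed

section \<open>The uniform boundedness principle\<close>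

context pt_prob_space
begin

lemma l2norm_cmult_AE:
  assumes T: "\<And>f. f \<in> L2 M \<Longrightarrow> T f \<in> L2 M"
    and lin: "\<And>f g a b. f \<in> L2 M \<Longrightarrow> g \<in> L2 M \<Longrightarrow>
        AE x in M. T (\<lambda>y. a * f y + b * g y) x = a * T f x + b * T g x"
    and f: "f \<in> L2 M" and g: "g \<in> L2 M"
  shows "l2norm M (T (\<lambda>y. a * f y + b * g y)) = l2norm M (\<lambda>x. a * T f x + b * T g x)"
proof (rule l2norm_cong_AE[OF lin[OF f g]])
  show "T (\<lambda>y. a * f y + b * g y) \<in> borel_measurable M"
    by (rule L2_measurable[OF T[OF L2_lincomb[OF f g]]])
  show "(\<lambda>x. a * T f x + b * T g x) \<in> borel_measurable M"
    by (rule L2_measurable[OF L2_lincomb[OF T[OF f] T[OF g]]])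
qed

text \<open>Sokal's gliding-hump argument: no Baire category is needed.\<close>

lemma uniform_boundedness:
  fixes T :: "nat \<Rightarrow> (pt \<Rightarrow> real) \<Rightarrow> pt \<Rightarrow> real"
  assumes T: "\<And>n f. f \<in> L2 M \<Longrightarrow> T n f \<in> L2 M"
    and lin: "\<And>n f g a b. f \<in> L2 M \<Longrightarrow> g \<in> L2 M \<Longrightarrow>
        AE x in M. T n (\<lambda>y. a * f y + b * g y) x = a * T n f x + b * T n g x"
    and bdd: "\<And>n. \<exists>K. \<forall>f\<in>L2 M. l2norm M (T n f) \<le> K * l2norm M f"
    and ptw: "\<And>f. f \<in> L2 M \<Longrightarrow> \<exists>B. \<forall>n. l2norm M (T n f) \<le> B"
  shows "\<exists>K. \<forall>n. \<forall>f\<in>L2 M. l2norm M (T n f) \<le> K * l2norm M f"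
proof (rule ccontr)
  assume contra: "\<not> ?thesis"
  define S where "S n = {l2norm M (T n f) | f. f \<in> L2 M \<and> l2norm M f \<le> 1}" for n
  define K where "K n = Sup (S n)" for n
  have Tlin: "l2norm M (T n (\<lambda>y. a * f y + b * g y)) = l2norm M (\<lambda>x. a * T n f x + b * T n g x)"
    if "f \<in> L2 M" "g \<in> L2 M" for n f g a b
    by (rule l2norm_cmult_AE[of "T n"], erule T, erule (1) lin, rule that, rule that)
  have bS: "bdd_above (S n)" for n
  proof -
    obtain k where k: "\<And>f. f \<in> L2 M \<Longrightarrow> l2norm M (T n f) \<le> k * l2norm M f" using bdd[of n] by blast
    show ?thesis
    proof (rule bdd_aboveI[of _ "\<bar>k\<bar>"])
      fix s assume "s \<in> S n"
      then obtain f where f: "f \<in> L2 M" "l2norm M f \<le> 1" "s = l2norm M (T n f)" by (auto simp: S_def)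
      have "k * l2norm M f \<le> \<bar>k\<bar> * 1"
        using f(2) by (intro mult_mono) auto
      with k[OF f(1)] f(3) show "s \<le> \<bar>k\<bar>" by simp
    qed
  qed
  have le: "l2norm M (T n f) \<le> K n * l2norm M f" if f: "f \<in> L2 M" for n f
  proof (cases "l2norm M f = 0")
    case True
    obtain k where "l2norm M (T n f) \<le> k * l2norm M f" using bdd[of n] f by blast
    then show ?thesis using True by simp
  next
    case False
    then have p: "0 < l2norm M f" by (simp add: order_less_le)
    let ?c = "1 / l2norm M f"
    have 1: "l2norm M (T n (\<lambda>x. ?c * f x + 0 * f x)) \<le> K n"
      unfolding K_def
    proof (rule cSup_upper[OF _ bS])
      have "(\<lambda>x. ?c * f x + 0 * f x) \<in> L2 M" by (rule L2_lincomb[OF f f])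
      moreover have "l2norm M (\<lambda>x. ?c * f x + 0 * f x) \<le> 1"
        using p l2norm_cmult[of M ?c f] by simp
      ultimately show "l2norm M (T n (\<lambda>x. ?c * f x + 0 * f x)) \<in> S n" unfolding S_def by blast
    qed
    have 2: "l2norm M (T n (\<lambda>x. ?c * f x + 0 * f x)) = ?c * l2norm M (T n f)"
      unfolding Tlin[OF f f] using l2norm_cmult[of M ?c "T n f"] p by simp
    show ?thesis using 1[unfolded 2] p by (simp add: pos_divide_le_eq)
  qed
  have big: "\<exists>n. 4 ^ m < K n" for m :: nat
  proof (rule ccontr)
    assume "\<not> ?thesis"
    then have "K n \<le> 4 ^ m" for n by (auto simp: not_less)
    then have "l2norm M (T n f) \<le> 4 ^ m * l2norm M f" if "f \<in> L2 M" for n f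
      using le[OF that, of n] by (meson l2norm_nonneg mult_right_mono order_trans)
    with contra show False by blast
  qed
  then obtain \<nu> where \<nu>: "\<And>m. 4 ^ m < K (\<nu> m)" by metis
  have Kpos: "0 < K (\<nu> m)" for m
    by (rule less_trans[OF _ \<nu>]) simp
  \<comment> \<open>Half the difference of \<open>x + r f\<close> and \<open>x - r f\<close> is
    \<open>r f\<close>, so one of the two has an image of norm at least \<open>r\<close> times that
    of \<open>T f\<close>. Here \<open>r = (1/3)^m\<close>, and \<open>f\<close> is taken from the
    unit ball so as to reach 2/3 of the supremum.\<close>
  have step: "\<exists>y. y \<in> L2 M \<and> l2norm M (\<lambda>z. y z - x z) \<le> (1/3)^m \<and> 2/3 * (1/3)^m * K (\<nu> m) \<le> l2norm M (T (\<nu> m) y)"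
    if x: "x \<in> L2 M" for x m
  proof -
    let ?T = "T (\<nu> m)"
    have Kp: "0 < K (\<nu> m)" by (rule Kpos)
    have "S (\<nu> m) \<noteq> {}" unfolding S_def using L2_zero by (auto intro!: exI[of _ "\<lambda>x. 0"] simp: l2norm_def)
    then have "\<exists>s\<in>S (\<nu> m). 2/3 * K (\<nu> m) < s"
      using Kp less_cSup_iff[OF _ bS, of "\<nu> m" "2/3 * K (\<nu> m)"] by (simp add: K_def)
    then obtain f where f: "f \<in> L2 M" "l2norm M f \<le> 1" "2/3 * K (\<nu> m) < l2norm M (?T f)"
      by (auto simp: S_def)
    let ?r = "(1/3)^m :: real"
    let ?p = "\<lambda>z. 1 * x z + ?r * f z" and ?q = "\<lambda>z. 1 * x z + (- ?r) * f z"
    have pq: "?p \<in> L2 M" "?q \<in> L2 M" by (rule L2_lincomb[OF x f(1)])+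
    have "l2norm M (\<lambda>z. (1 * ?T x z + ?r * ?T f z) - (1 * ?T x z + (- ?r) * ?T f z)) \<le>
        l2norm M (\<lambda>z. 1 * ?T x z + ?r * ?T f z) + l2norm M (\<lambda>z. 1 * ?T x z + (- ?r) * ?T f z)"
      by (intro l2norm_triangle_ineq4 L2_lincomb T x f)
    then have "l2norm M (\<lambda>z. (2 * ?r) * ?T f z) \<le> l2norm M (?T ?p) + l2norm M (?T ?q)"
      unfolding Tlin[OF x f(1)] by (simp add: algebra_simps)
    then have "2 * ?r * l2norm M (?T f) \<le> l2norm M (?T ?p) + l2norm M (?T ?q)"
      unfolding l2norm_cmult by simp
    then have "?r * l2norm M (?T f) \<le> l2norm M (?T ?p) \<or> ?r * l2norm M (?T f) \<le> l2norm M (?T ?q)"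
      by linarith
    moreover have "2/3 * ?r * K (\<nu> m) \<le> ?r * l2norm M (?T f)"
      using mult_left_mono[of "2/3 * K (\<nu> m)" "l2norm M (?T f)" ?r] f(3) by simp
    moreover have "l2norm M (\<lambda>z. ?p z - x z) \<le> ?r"
      using f(2) l2norm_cmult[of M ?r f] by (simp add: mult_left_le)
    moreover have "l2norm M (\<lambda>z. ?q z - x z) \<le> ?r"
      using f(2) l2norm_cmult[of M "- ?r" f] by (simp add: mult_left_le)
    ultimately show ?thesis using pq by (meson order_trans)
  qed
  have "\<exists>X. \<forall>m. X m \<in> L2 M \<and> (l2norm M (\<lambda>z. X (Suc m) z - X m z) \<le> (1/3)^m \<and>
      2/3 * (1/3)^m * K (\<nu> m) \<le> l2norm M (T (\<nu> m) (X (Suc m))))"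
    by (rule dependent_nat_choice[of "\<lambda>m y. y \<in> L2 M"
      "\<lambda>m x y. l2norm M (\<lambda>z. y z - x z) \<le> (1/3)^m \<and> 2/3 * (1/3)^m * K (\<nu> m) \<le> l2norm M (T (\<nu> m) y)"])
       (use step L2_zero in blast)+
  then obtain X where X: "\<And>m. X m \<in> L2 M" "\<And>m. l2norm M (\<lambda>z. X (Suc m) z - X m z) \<le> (1/3)^m"
      "\<And>m. 2/3 * (1/3)^m * K (\<nu> m) \<le> l2norm M (T (\<nu> m) (X (Suc m)))" by blast
  have dist: "l2norm M (\<lambda>z. X (m + k) z - X m z) \<le> 3/2 * (1/3)^m * (1 - (1/3)^k)" for m k
  proof (induction k)
    case 0
    show ?case by (simp add: l2norm_def)
  next
    case (Suc k)
    have "l2norm M (\<lambda>z. X (m + Suc k) z - X m z) \<le> l2norm M (\<lambda>z. X (Suc (m + k)) z - X (m + k) z) + l2norm M (\<lambda>z. X (m + k) z - X m z)"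
      using l2norm_triangle_diff[OF X(1)[of "Suc (m + k)"] X(1)[of "m + k"] X(1)[of m]] by simp
    also have "\<dots> \<le> (1/3)^(m+k) + 3/2 * (1/3)^m * (1 - (1/3)^k)"
      using X(2)[of "m + k"] Suc by (intro add_mono)
    also have "\<dots> = 3/2 * (1/3)^m * (1 - (1/3)^Suc k)"
      by (simp add: power_add field_simps)
    finally show ?case .
  qed
  have dist': "l2norm M (\<lambda>z. X (m + k) z - X m z) \<le> 3/2 * (1/3)^m" for m k
    by (rule order_trans[OF dist]) (simp add: mult_left_le)
  have cauchy: "\<exists>N. \<forall>k\<ge>N. \<forall>l\<ge>N. l2norm M (\<lambda>z. X k z - X l z) < \<epsilon>" if "0 < \<epsilon>" for \<epsilon>
  proof -
    have "(\<lambda>m. 3 * (1/3)^m) \<longlonglongrightarrow> 3 * (0::real)"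
      by (intro tendsto_mult_left LIMSEQ_power_zero) simp
    then have "\<forall>\<^sub>F m in sequentially. 3 * (1/3)^m < \<epsilon>"
      using that by (intro order_tendstoD(2)) auto
    then obtain N where N: "3 * (1/3)^N < \<epsilon>" by (auto simp: eventually_sequentially)
    have "l2norm M (\<lambda>z. X k z - X l z) < \<epsilon>" if "k \<ge> N" "l \<ge> N" for k l
    proof -
      have a: "l2norm M (\<lambda>z. X k z - X N z) \<le> 3/2 * (1/3)^N" using dist'[of N "k - N"] that by simp
      have b: "l2norm M (\<lambda>z. X N z - X l z) \<le> 3/2 * (1/3)^N"
        using dist'[of N "l - N"] that l2norm_minus_commute[of M "X N" "X l"] by simp
      show ?thesis using l2norm_triangle_diff[OF X(1)[of k] X(1)[of N] X(1)[of l]] a b N by linarith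
    qed
    then show ?thesis by blast
  qed
  obtain v where v: "v \<in> L2 M" "(\<lambda>k. l2norm M (\<lambda>z. X k z - v z)) \<longlonglongrightarrow> 0"
    using L2_complete[of X, OF X(1) cauchy] by blast
  have dv: "l2norm M (\<lambda>z. X m z - v z) \<le> 3/2 * (1/3)^m" for m
  proof (rule LIMSEQ_le)
    show "(\<lambda>k. l2norm M (\<lambda>z. X m z - v z)) \<longlonglongrightarrow> l2norm M (\<lambda>z. X m z - v z)" by simp
    have "(\<lambda>k. 3/2 * (1/3)^m + l2norm M (\<lambda>z. X (k + m) z - v z)) \<longlonglongrightarrow> 3/2 * (1/3)^m + 0"
      by (intro tendsto_add tendsto_const LIMSEQ_ignore_initial_segment[OF v(2)])
    then show "(\<lambda>k. 3/2 * (1/3)^m + l2norm M (\<lambda>z. X (k + m) z - v z)) \<longlonglongrightarrow> 3/2 * (1/3)^m" by simp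
    have "l2norm M (\<lambda>z. X m z - v z) \<le> 3/2 * (1/3)^m + l2norm M (\<lambda>z. X (k + m) z - v z)" for k
      using l2norm_triangle_diff[OF X(1)[of m] X(1)[of "k + m"] v(1)] dist'[of m k]
        l2norm_minus_commute[of M "X m" "X (k + m)"] by (simp add: add.commute)
    then show "\<exists>N. \<forall>n\<ge>N. l2norm M (\<lambda>z. X m z - v z) \<le> 3/2 * (1/3)^m + l2norm M (\<lambda>z. X (n + m) z - v z)"
      by blast
  qed
  obtain B where B: "\<And>n. l2norm M (T n v) \<le> B" using ptw[OF v(1)] by blast
  \<comment> \<open>The hump contributes at least 2/3 of \<open>(1/3)^m * K (\<nu> m)\<close>, and
    the later corrections cost at most 1/2 of that quantity, which leaves 1/6; since
    \<open>4 ^ m < K (\<nu> m)\<close>, this grows like \<open>(4/3)^m\<close>.\<close>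
  have low: "1/6 * (4/3)^m \<le> B" for m
  proof -
    let ?T = "T (\<nu> m)" and ?x = "X (Suc m)"
    have "l2norm M (\<lambda>z. 1 * ?T ?x z + (-1) * ?T v z) = l2norm M (?T (\<lambda>z. 1 * ?x z + (-1) * v z))"
      by (rule Tlin[OF X(1) v(1), symmetric])
    also have "\<dots> \<le> K (\<nu> m) * l2norm M (\<lambda>z. 1 * ?x z + (-1) * v z)"
      by (rule le[OF L2_lincomb[OF X(1) v(1)]])
    also have "\<dots> \<le> K (\<nu> m) * (3/2 * (1/3)^Suc m)"
      using dv[of "Suc m"] Kpos[of m] by (intro mult_left_mono) auto
    finally have "l2norm M (\<lambda>z. ?T ?x z - ?T v z) \<le> K (\<nu> m) * (1/2 * (1/3)^m)" by simp
    moreover have "l2norm M (?T ?x) \<le> l2norm M (\<lambda>z. ?T ?x z - ?T v z) + l2norm M (?T v)"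
      using l2norm_triangle[OF L2_diff[OF T[OF X(1)[of "Suc m"], of "\<nu> m"] T[OF v(1), of "\<nu> m"]] T[OF v(1), of "\<nu> m"]] by simp
    ultimately have "2/3 * (1/3)^m * K (\<nu> m) \<le> K (\<nu> m) * (1/2 * (1/3)^m) + B"
      using X(3)[of m] B[of "\<nu> m"] by linarith
    then have 1: "1/6 * (1/3)^m * K (\<nu> m) \<le> B" by (simp add: algebra_simps)
    have "1/6 * (1/3)^m * 4^m \<le> 1/6 * (1/3)^m * K (\<nu> m)"
      using \<nu>[of m] by (intro mult_left_mono) auto
    moreover have "(1/3)^m * 4^m = (4/3 :: real)^m" by (simp add: power_mult_distrib[symmetric])
    ultimately show ?thesis using 1 by (metis mult.assoc order_trans)
  qed
  obtain m where "6 * B + 1 < (4/3 :: real)^m" using real_arch_pow[of "4/3" "6 * B + 1"] by auto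
  with low[of m] show False by simp
qed

end

section \<open>Every semigroup with this generator acts diagonally\<close>

context spectral_form
begin

abbreviation "Dom \<equiv> closure_dom M C E"

lemma semigroup_ofD:
  assumes "semigroup_of M Dom Ebar P"
  shows "\<And>t f. 0 \<le> t \<Longrightarrow> f \<in> L2 M \<Longrightarrow> P t f \<in> L2 M"
    "\<And>t f g. 0 \<le> t \<Longrightarrow> f \<in> L2 M \<Longrightarrow> g \<in> L2 M \<Longrightarrow> AE x in M. f x = g x \<Longrightarrow> AE x in M. P t f x = P t g x"
    "\<And>t f g a b. 0 \<le> t \<Longrightarrow> f \<in> L2 M \<Longrightarrow> g \<in> L2 M \<Longrightarrow> AE x in M. P t (\<lambda>y. a * f y + b * g y) x = a * P t f x + b * P t g x"
    "\<And>t. 0 \<le> t \<Longrightarrow> \<exists>K. \<forall>f\<in>L2 M. l2norm M (P t f) \<le> K * l2norm M f"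
    "\<And>f. f \<in> L2 M \<Longrightarrow> AE x in M. P 0 f x = f x"
    "\<And>s t f. 0 \<le> s \<Longrightarrow> 0 \<le> t \<Longrightarrow> f \<in> L2 M \<Longrightarrow> AE x in M. P (s + t) f x = P s (P t f) x"
    "\<And>f. f \<in> L2 M \<Longrightarrow> ((\<lambda>t. l2norm M (\<lambda>x. P t f x - f x)) \<longlongrightarrow> 0) (at_right 0)"
    "\<And>u w. u \<in> L2 M \<Longrightarrow> w \<in> L2 M \<Longrightarrow> (\<forall>i. coef w i = - lam i * coef u i) \<longleftrightarrow>
      ((\<lambda>h. l2norm M (\<lambda>x. (P h u x - u x) / h - w x)) \<longlongrightarrow> 0) (at_right 0)"
proof -
  note A = assms[unfolded semigroup_of_def]
  note A1 = A[THEN conjunct1] and A' = A[THEN conjunct2]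
  note A2 = A'[THEN conjunct1] and A' = A'[THEN conjunct2]
  note A3 = A'[THEN conjunct1] and A' = A'[THEN conjunct2]
  note A4 = A'[THEN conjunct1] and A' = A'[THEN conjunct2]
  note A5 = A'[THEN conjunct1] and A' = A'[THEN conjunct2]
  note A6 = A'[THEN conjunct1] and A' = A'[THEN conjunct2]
  note A7 = A'[THEN conjunct1] and A8 = A'[THEN conjunct2]
  show "P t f \<in> L2 M" if "0 \<le> t" "f \<in> L2 M" for t f
    using A1[rule_format, OF that] .
  show "AE x in M. P t f x = P t g x" if "0 \<le> t" "f \<in> L2 M" "g \<in> L2 M" "AE x in M. f x = g x" for t f g
    using A2[rule_format, OF that] .
  show "AE x in M. P t (\<lambda>y. a * f y + b * g y) x = a * P t f x + b * P t g x"
    if "0 \<le> t" "f \<in> L2 M" "g \<in> L2 M" for t f g a b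
    using A3[rule_format, OF that] .
  show "AE x in M. P 0 f x = f x" if "f \<in> L2 M" for f
    using A5[rule_format, OF that] .
  show "AE x in M. P (s + t) f x = P s (P t f) x" if "0 \<le> s" "0 \<le> t" "f \<in> L2 M" for s t f
    using A6[rule_format, OF that] .
  show "\<exists>K. \<forall>f\<in>L2 M. l2norm M (P t f) \<le> K * l2norm M f" if "0 \<le> t" for t
  proof -
    have "\<exists>K. \<forall>f\<in>L2 M. (\<integral>x. (P t f x)\<^sup>2 \<partial>M) \<le> K * (\<integral>x. (f x)\<^sup>2 \<partial>M)" by (rule A4[rule_format, OF that])
    then obtain K where K: "\<And>f. f \<in> L2 M \<Longrightarrow> (\<integral>x. (P t f x)\<^sup>2 \<partial>M) \<le> K * (\<integral>x. (f x)\<^sup>2 \<partial>M)" by blast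
    have "l2norm M (P t f) \<le> sqrt \<bar>K\<bar> * l2norm M f" if f: "f \<in> L2 M" for f
    proof -
      have "K * (\<integral>x. (f x)\<^sup>2 \<partial>M) \<le> \<bar>K\<bar> * (\<integral>x. (f x)\<^sup>2 \<partial>M)"
        by (intro mult_right_mono) auto
      then show ?thesis
        unfolding l2norm_def real_sqrt_mult[symmetric] by (intro real_sqrt_le_mono order_trans[OF K[OF f]])
    qed
    then show ?thesis by blast
  qed
  show "((\<lambda>t. l2norm M (\<lambda>x. P t f x - f x)) \<longlongrightarrow> 0) (at_right 0)" if "f \<in> L2 M" for f
    unfolding l2norm_tendsto_0_iff by (rule A7[rule_format, OF that])
  show "(\<forall>i. coef w i = - lam i * coef u i) \<longleftrightarrow>
      ((\<lambda>h. l2norm M (\<lambda>x. (P h u x - u x) / h - w x)) \<longlongrightarrow> 0) (at_right 0)" if "u \<in> L2 M" "w \<in> L2 M" for u w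
  proof -
    have "generator_rel M Dom Ebar u w \<longleftrightarrow>
         ((\<lambda>h. \<integral>x. ((P h u x - u x) / h - w x)\<^sup>2 \<partial>M) \<longlongrightarrow> 0) (at_right 0)"
      by (rule A8[rule_format, OF that])
    then show ?thesis unfolding l2norm_tendsto_0_iff generator_rel_iff using that by simp
  qed
qed

text \<open>\<open>semigroup_of\<close> bounds each \<open>P t\<close> separately, with no
  uniformity in \<open>t\<close>. Along a sequence of times tending to 0, strong continuity bounds
  every orbit, and the uniform boundedness principle turns this into a single operator bound,
  contradicting the choice of bad times.\<close>

lemma semigroup_bounded_near_0:
  assumes P: "semigroup_of M Dom Ebar P"
  shows "\<exists>\<delta>>0. \<exists>K\<ge>1. \<forall>h. 0 \<le> h \<and> h \<le> \<delta> \<longrightarrow> (\<forall>f\<in>L2 M. l2norm M (P h f) \<le> K * l2norm M f)"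
proof (rule ccontr)
  note S = semigroup_ofD[OF P]
  assume contra: "\<not> ?thesis"
  have "\<exists>h f. 0 \<le> h \<and> h \<le> 1 / Suc n \<and> f \<in> L2 M \<and> Suc n * l2norm M f < l2norm M (P h f)" for n
  proof (rule ccontr)
    assume "\<not> ?thesis"
    then have "0 < 1 / real (Suc n) \<and> 1 \<le> real (Suc n) \<and> (\<forall>h. 0 \<le> h \<and> h \<le> 1 / real (Suc n) \<longrightarrow>
       (\<forall>f\<in>L2 M. l2norm M (P h f) \<le> real (Suc n) * l2norm M f))" by (force simp: not_less)
    with contra show False by blast
  qed
  then obtain h f where hf: "\<And>n. 0 \<le> h n" "\<And>n. h n \<le> 1 / Suc n" "\<And>n. f n \<in> L2 M"
      "\<And>n. Suc n * l2norm M (f n) < l2norm M (P (h n) (f n))" by metis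
  have h0: "h \<longlonglongrightarrow> 0"
    by (rule tendsto_sandwich[OF _ _ tendsto_const LIMSEQ_inverse_real_of_nat])
       (use hf(1,2) in \<open>auto simp: inverse_eq_divide\<close>)
  have ptw: "\<exists>B. \<forall>n. l2norm M (P (h n) g) \<le> B" if g: "g \<in> L2 M" for g
  proof -
    let ?\<phi> = "\<lambda>t. l2norm M (\<lambda>x. P t g x - g x)"
    \<comment> \<open>A chosen time may be 0, which \<open>at_right 0\<close> excludes; since the
      quantity vanishes there, the limit can be taken along the closed half-line.\<close>
    have "l2norm M (\<lambda>x. P 0 g x - g x) = 0"
      using S(5)[OF g] l2norm_diff_eq_0_iff[OF S(1)[OF _ g, of 0] g] by simp
    then have "(?\<phi> \<longlongrightarrow> ?\<phi> 0) (at_right 0)" using S(7)[OF g] by simp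
    then have "(?\<phi> \<longlongrightarrow> ?\<phi> 0) (at 0 within {0..})"
      by (simp add: at_within_Ici_at_right)
    then have "continuous (at 0 within {0..}) ?\<phi>" by (simp add: continuous_within)
    then have "(\<lambda>n. ?\<phi> (h n)) \<longlonglongrightarrow> ?\<phi> 0"
      using continuous_within_tendsto_compose'[of 0 "{0..}" ?\<phi> h sequentially] hf(1) h0 by simp
    then have "Bseq (\<lambda>n. ?\<phi> (h n))" by (rule convergent_imp_Bseq[OF convergentI])
    then obtain B where B: "\<And>n. ?\<phi> (h n) \<le> B" by (auto simp: Bseq_def)
    have "l2norm M (P (h n) g) \<le> B + l2norm M g" for n
      using l2norm_triangle[OF L2_diff[OF S(1)[OF hf(1) g] g] g, of n] B[of n] by simp
    then show ?thesis by blast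
  qed
  have "\<exists>K. \<forall>n. \<forall>f\<in>L2 M. l2norm M (P (h n) f) \<le> K * l2norm M f"
    by (rule uniform_boundedness[of "\<lambda>n. P (h n)", OF S(1)[OF hf(1)] S(3)[OF hf(1)] S(4)[OF hf(1)] ptw])
  then obtain K where K: "\<And>n f. f \<in> L2 M \<Longrightarrow> l2norm M (P (h n) f) \<le> K * l2norm M f" by blast
  obtain n where n: "K < real (Suc n)" using reals_Archimedean2[of K] by (metis less_Suc_eq of_nat_less_iff order.strict_trans)
  have "K * l2norm M (f n) \<le> Suc n * l2norm M (f n)" using n by (intro mult_right_mono) auto
  with hf(4)[of n] K[OF hf(3), of n n] show False by linarith
qed

lemma semigroup_bounded:
  assumes P: "semigroup_of M Dom Ebar P"
  shows "\<exists>K\<ge>1. \<forall>s. 0 \<le> s \<and> s \<le> t \<longrightarrow> (\<forall>f\<in>L2 M. l2norm M (P s f) \<le> K * l2norm M f)"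
proof -
  note S = semigroup_ofD[OF P]
  obtain \<delta> K where K: "0 < \<delta>" "1 \<le> K" "\<And>h f. 0 \<le> h \<Longrightarrow> h \<le> \<delta> \<Longrightarrow> f \<in> L2 M \<Longrightarrow> l2norm M (P h f) \<le> K * l2norm M f"
    using semigroup_bounded_near_0[OF P] by blast
  have *: "0 \<le> s \<Longrightarrow> s \<le> real n * \<delta> \<Longrightarrow> f \<in> L2 M \<Longrightarrow> l2norm M (P s f) \<le> K ^ Suc n * l2norm M f" for n s f
  proof (induction n arbitrary: s)
    case 0
    then show ?case using K by simp
  next
    case (Suc n)
    show ?case
    proof (cases "s \<le> \<delta>")
      case True
      have "1 \<le> K ^ Suc n" using K(2) by (rule one_le_power)
      then have "K * 1 \<le> K * K ^ Suc n" using K(2) by (intro mult_left_mono) auto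
      then have "K * l2norm M f \<le> K ^ Suc (Suc n) * l2norm M f" by (intro mult_right_mono) auto
      then show ?thesis using K(3)[OF Suc(2) True Suc(4)] by linarith
    next
      case False
      then have s: "0 \<le> s - \<delta>" "s - \<delta> \<le> real n * \<delta>" using Suc(3) by (auto simp: algebra_simps)
      have "l2norm M (P s f) = l2norm M (P \<delta> (P (s - \<delta>) f))"
      proof (rule l2norm_cong_AE)
        show "AE x in M. P s f x = P \<delta> (P (s - \<delta>) f) x"
          using S(6)[of \<delta> "s - \<delta>" f] K(1) s Suc(4) by simp
        show "P s f \<in> borel_measurable M" by (rule L2_measurable[OF S(1)[OF Suc(2,4)]])
        show "P \<delta> (P (s - \<delta>) f) \<in> borel_measurable M"
          by (rule L2_measurable[OF S(1)[OF less_imp_le[OF K(1)] S(1)[OF s(1) Suc(4)]]])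
      qed
      also have "\<dots> \<le> K * l2norm M (P (s - \<delta>) f)"
        by (rule K(3)[OF less_imp_le[OF K(1)] order_refl S(1)[OF s(1) Suc(4)]])
      also have "\<dots> \<le> K * (K ^ Suc n * l2norm M f)"
        using K(2) by (intro mult_left_mono Suc.IH[OF s Suc(4)]) auto
      finally show ?thesis by simp
    qed
  qed
  obtain n where "t / \<delta> \<le> real n" using real_arch_simple by blast
  then have n: "t \<le> real n * \<delta>" using K(1) by (simp add: field_simps)
  have "1 \<le> K ^ Suc n" using K(2) by (rule one_le_power)
  with *[of _ n] n show ?thesis by (intro exI[of _ "K ^ Suc n"]) (meson order_trans)
qed

text \<open>\<open>exp (lam i * s) * P s (e i)\<close> is constant in \<open>s\<close>: over a step
  of length \<open>h\<close> it changes by at most a constant times \<open>r h\<close>, and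
  \<open>r h\<close> is of smaller order than \<open>h\<close> because \<open>e i\<close> is an
  eigenvector of the generator. Adding up the \<open>Suc n\<close> steps of length
  \<open>t / Suc n\<close> gives 0 in the limit. Only the right derivative at time 0 and local
  boundedness enter.\<close>

lemma semigroup_eigen:
  assumes P: "semigroup_of M Dom Ebar P" and t: "0 \<le> t"
  shows "l2norm M (\<lambda>x. P t (e i) x - exp (- lam i * t) * e i x) = 0"
proof (cases "t = 0")
  case True
  then show ?thesis
    using semigroup_ofD(5)[OF P e_L2[of i]] l2norm_diff_eq_0_iff[OF semigroup_ofD(1)[OF P _ e_L2, of 0] e_L2] by simp
next
  case False
  with t have t0: "0 < t" by simp
  note S = semigroup_ofD[OF P]
  let ?e = "e i" and ?l = "lam i"
  obtain K where K: "1 \<le> K" "\<And>s f. 0 \<le> s \<Longrightarrow> s \<le> t \<Longrightarrow> f \<in> L2 M \<Longrightarrow> l2norm M (P s f) \<le> K * l2norm M f"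
    using semigroup_bounded[OF P, of t] by blast
  define r where "r h = l2norm M (\<lambda>x. exp (?l * h) * P h ?e x - ?e x)" for h
  define v where "v h k = (\<lambda>x. exp (?l * h) ^ k * P (real k * h) ?e x)" for h k
  have vL: "v h k \<in> L2 M" if "0 \<le> h" for h k
    unfolding v_def using that by (intro L2_cmult S(1)) auto
  have step: "l2norm M (\<lambda>x. v h (Suc k) x - v h k x) \<le> exp (?l * t) * K * r h"
    if h: "0 \<le> h" "real (Suc k) * h \<le> t" for h k
  proof -
    have kh: "0 \<le> real k * h" "real k * h \<le> t" using h by (auto simp: algebra_simps)
    let ?a = "exp (?l * h)"
    have gL: "(\<lambda>x. ?a * P h ?e x + (-1) * ?e x) \<in> L2 M" by (intro L2_lincomb S(1) h e_L2)
    have A: "AE x in M. v h (Suc k) x - v h k x = ?a ^ k * P (real k * h) (\<lambda>x. ?a * P h ?e x + (-1) * ?e x) x"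
      using S(3)[OF kh(1) S(1)[OF h(1) e_L2[of i]] e_L2[of i], of ?a "-1"] S(6)[OF kh(1) h(1) e_L2[of i]]
    proof eventually_elim
      case (elim x)
      have "real (Suc k) * h = real k * h + h" by (simp add: algebra_simps)
      then show ?case unfolding v_def elim(1) using elim(2) by (simp add: algebra_simps)
    qed
    have "l2norm M (\<lambda>x. v h (Suc k) x - v h k x) = l2norm M (\<lambda>x. ?a ^ k * P (real k * h) (\<lambda>x. ?a * P h ?e x + (-1) * ?e x) x)"
      by (rule l2norm_cong_AE[OF A]) (intro L2_measurable L2_diff vL h L2_cmult S(1) gL kh)+
    also have "\<dots> = ?a ^ k * l2norm M (P (real k * h) (\<lambda>x. ?a * P h ?e x + (-1) * ?e x))"
      by (simp add: l2norm_cmult)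
    also have "\<dots> \<le> exp (?l * t) * (K * r h)"
    proof (rule mult_mono)
      have "?a ^ k = exp (?l * (real k * h))" by (simp add: exp_of_nat_mult[symmetric] mult.commute mult.left_commute)
      also have "\<dots> \<le> exp (?l * t)" using kh lam_nonneg[of i] by (simp add: mult_left_mono)
      finally show "?a ^ k \<le> exp (?l * t)" .
      show "l2norm M (P (real k * h) (\<lambda>x. ?a * P h ?e x + (-1) * ?e x)) \<le> K * r h"
        using K(2)[OF kh gL] by (simp add: r_def)
    qed auto
    finally show ?thesis by (simp add: mult.assoc)
  qed
  have tele: "l2norm M (\<lambda>x. v h k x - v h 0 x) \<le> real k * (exp (?l * t) * K * r h)"
    if h: "0 \<le> h" "real k * h \<le> t" for h k
    using h(2)
  proof (induction k)
    case 0
    show ?case by (simp add: l2norm_def)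
  next
    case (Suc k)
    then have "real k * h \<le> t" using h(1) by (simp add: algebra_simps)
    from Suc.IH[OF this] step[OF h(1) Suc.prems]
      l2norm_triangle_diff[OF vL[OF h(1), of "Suc k"] vL[OF h(1), of k] vL[OF h(1), of 0]]
    show ?case by (simp add: algebra_simps)
  qed
  \<comment> \<open>The two summands are the errors of the difference quotients of \<open>P\<close>
    and of the exponential; both vanish as \<open>h\<close> tends to 0, which makes
    \<open>r h\<close> of smaller order than \<open>h\<close>.\<close>
  define g where "g h = exp (?l * h) * l2norm M (\<lambda>x. (P h ?e x - ?e x) / h - (- ?l) * ?e x)
     + \<bar>(exp (?l * h) - 1) / h - ?l * exp (?l * h)\<bar> * l2norm M ?e" for h
  have rg: "r h \<le> h * g h" if "0 < h" for h
  proof -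
    have L: "(\<lambda>x. (P h ?e x - ?e x) / h - (- ?l) * ?e x) \<in> L2 M"
      using L2_lincomb[OF S(1)[OF less_imp_le[OF that] e_L2[of i]] e_L2[of i], of "1/h" "-1/h + ?l"] that
      by (simp add: field_simps)
    have pw: "exp (?l * h) * P h ?e x - ?e x = h * (exp (?l * h) * ((P h ?e x - ?e x) / h - (- ?l) * ?e x)) +
        h * (((exp (?l * h) - 1) / h - ?l * exp (?l * h)) * ?e x)" for x
      using that by (simp add: field_simps)
    have "r h = l2norm M (\<lambda>x. h * (exp (?l * h) * ((P h ?e x - ?e x) / h - (- ?l) * ?e x)) +
        h * (((exp (?l * h) - 1) / h - ?l * exp (?l * h)) * ?e x))"
      unfolding r_def by (rule arg_cong[where f="l2norm M"]) (rule ext, rule pw)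
    also have "\<dots> \<le> l2norm M (\<lambda>x. h * (exp (?l * h) * ((P h ?e x - ?e x) / h - (- ?l) * ?e x))) +
        l2norm M (\<lambda>x. h * (((exp (?l * h) - 1) / h - ?l * exp (?l * h)) * ?e x))"
      by (intro l2norm_triangle L2_cmult L e_L2)
    also have "\<dots> = h * g h"
      using that unfolding l2norm_cmult g_def by (simp add: distrib_left)
    finally show ?thesis .
  qed
  have "coef (\<lambda>x. - ?l * ?e x) j = - lam j * coef ?e j" for j
    unfolding coef_cmult[OF e_L2] coef_e by simp
  then have G1: "((\<lambda>h. l2norm M (\<lambda>x. (P h ?e x - ?e x) / h - (- ?l) * ?e x)) \<longlongrightarrow> 0) (at_right 0)"
    using S(8)[OF e_L2[of i] L2_cmult[OF e_L2[of i], of "- ?l"]] by simp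
  have "((\<lambda>h. exp (?l * h)) has_real_derivative ?l) (at 0)"
    by (auto intro!: derivative_eq_intros)
  then have G2: "((\<lambda>h. (exp (?l * h) - 1) / h) \<longlongrightarrow> ?l) (at_right 0)"
    unfolding has_field_derivative_iff by (simp add: tendsto_within_subset[of _ _ 0 UNIV])
  have E0: "((\<lambda>h. exp (?l * h)) \<longlongrightarrow> exp (?l * 0)) (at_right 0)" by (intro tendsto_intros)
  have "(g \<longlongrightarrow> exp (?l * 0) * 0 + \<bar>?l - ?l * exp (?l * 0)\<bar> * l2norm M ?e) (at_right 0)"
    unfolding g_def by (intro tendsto_intros G1 G2)
  then have g0: "(g \<longlongrightarrow> 0) (at_right 0)" by simp
  have fl: "filterlim (\<lambda>n. t / real (Suc n)) (at_right 0) sequentially"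
    unfolding filterlim_at
  proof
    show "\<forall>\<^sub>F n in sequentially. t / real (Suc n) \<in> {0<..} \<and> t / real (Suc n) \<noteq> 0" using t0 by simp
    show "(\<lambda>n. t / real (Suc n)) \<longlonglongrightarrow> 0"
      using tendsto_mult_left[OF LIMSEQ_inverse_real_of_nat, of t] by (simp add: divide_inverse)
  qed
  have gn: "(\<lambda>n. exp (?l * t) * K * t * g (t / real (Suc n))) \<longlonglongrightarrow> exp (?l * t) * K * t * 0"
    by (intro tendsto_mult_left filterlim_compose[OF g0 fl])
  let ?d = "l2norm M (\<lambda>x. exp (?l * t) * P t ?e x - ?e x)"
  have bound: "?d \<le> exp (?l * t) * K * t * g (t / real (Suc n))" for n
  proof -
    let ?h = "t / real (Suc n)"
    have h: "0 < ?h" "real (Suc n) * ?h = t" using t0 by auto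
    have "AE x in M. P 0 ?e x = ?e x" by (rule S(5)) simp
    then have A: "AE x in M. exp (?l * t) * P t ?e x - ?e x = v ?h (Suc n) x - v ?h 0 x"
    proof eventually_elim
      case (elim x)
      have "exp (?l * ?h) ^ Suc n = exp (?l * t)"
        using h(2) by (metis exp_of_nat_mult mult.left_commute)
      then show ?case using elim h(2) by (simp add: v_def del: power_Suc of_nat_Suc)
    qed
    have "?d = l2norm M (\<lambda>x. v ?h (Suc n) x - v ?h 0 x)"
      by (rule l2norm_cong_AE[OF A]) (intro L2_measurable L2_diff L2_cmult vL S(1) t e_L2 less_imp_le[OF h(1)])+
    also have "\<dots> \<le> real (Suc n) * (exp (?l * t) * K * r ?h)"
      by (rule tele) (use h in auto)
    also have "\<dots> \<le> real (Suc n) * (exp (?l * t) * K * (?h * g ?h))"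
      using K(1) by (intro mult_left_mono rg h) auto
    also have "\<dots> = exp (?l * t) * K * (real (Suc n) * ?h) * g ?h" by (simp only: mult_ac)
    finally show ?thesis unfolding h(2) .
  qed
  have "?d \<le> 0"
    using gn bound by (intro LIMSEQ_le_const[of "\<lambda>n. exp (?l * t) * K * t * g (t / real (Suc n))"]) auto
  then have d0: "?d = 0" using l2norm_nonneg[of M "\<lambda>x. exp (?l * t) * P t ?e x - ?e x"] by linarith
  have "l2norm M (\<lambda>x. P t ?e x - exp (- ?l * t) * ?e x) = l2norm M (\<lambda>x. exp (- ?l * t) * (exp (?l * t) * P t ?e x - ?e x))"
    by (rule arg_cong[where f="l2norm M"]) (auto simp: algebra_simps exp_minus mult.assoc[symmetric])
  also have "\<dots> = 0" unfolding l2norm_cmult d0 by simp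
  finally show ?thesis .
qed

text \<open>The eigenvectors settle finite combinations, and boundedness of \<open>P t\<close>
  carries the formula to the limit of the partial sums. Thus \<open>P t f\<close> is determined
  almost everywhere.\<close>

lemma semigroup_coef:
  assumes P: "semigroup_of M Dom Ebar P" and t: "0 \<le> t" and f: "f \<in> L2 M"
  shows "coef (P t f) i = exp (- lam i * t) * coef f i"
proof -
  note S = semigroup_ofD[OF P]
  let ?S = "\<lambda>n x. \<Sum>j<n. coef f j * e j x"
  have PS: "P t (?S n) \<in> L2 M" for n by (rule S(1)[OF t L2_lincomb_e])
  have eig: "coef (P t (e j)) i = exp (- lam j * t) * coef (e j) i" for j
  proof -
    have "AE x in M. P t (e j) x = exp (- lam j * t) * e j x"
      using semigroup_eigen[OF P t, of j] l2norm_diff_eq_0_iff[OF S(1)[OF t e_L2] L2_cmult[OF e_L2]] by blast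
    from coef_cong_AE[OF this S(1)[OF t e_L2] L2_cmult[OF e_L2]] show ?thesis unfolding coef_cmult[OF e_L2] .
  qed
  have lin: "coef (P t (\<lambda>y. a * f y + b * g y)) i = a * coef (P t f) i + b * coef (P t g) i"
    if "f \<in> L2 M" "g \<in> L2 M" for f g a b
    using coef_cong_AE[OF S(3)[OF t that] S(1)[OF t L2_lincomb[OF that]] L2_lincomb[OF S(1)[OF t that(1)] S(1)[OF t that(2)]]]
      coef_lin[OF S(1)[OF t that(1)] S(1)[OF t that(2)]] by simp
  have part: "coef (P t (?S n)) i = (\<Sum>j<n. coef f j * exp (- lam j * t) * coef (e j) i)" for n
  proof (induction n)
    case 0
    show ?case using lin[OF L2_zero L2_zero, of 0 0] by simp
  next
    case (Suc n)
    have "coef (P t (?S (Suc n))) i = coef (P t (\<lambda>y. 1 * ?S n y + coef f n * e n y)) i" by simp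
    also have "\<dots> = 1 * coef (P t (?S n)) i + coef f n * coef (P t (e n)) i"
      by (rule lin[OF L2_lincomb_e e_L2])
    finally show ?case unfolding Suc eig by simp
  qed
  have ev: "coef (P t (?S n)) i = exp (- lam i * t) * coef f i" if "i < n" for n
  proof -
    have "(\<Sum>j<n. coef f j * exp (- lam j * t) * coef (e j) i) = (\<Sum>j<n. if j = i then coef f i * exp (- lam i * t) * nrm i else 0)"
      by (rule sum.cong) (auto simp: coef_e)
    also have "\<dots> = coef f i * exp (- lam i * t) * nrm i" using that by simp
    also have "\<dots> = exp (- lam i * t) * (coef f i * nrm i)" by (simp only: mult_ac)
    finally show ?thesis unfolding part coef_nrm[OF f] .
  qed
  obtain K where K: "\<And>f. f \<in> L2 M \<Longrightarrow> l2norm M (P t f) \<le> K * l2norm M f" using S(4)[OF t] by blast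
  have "(\<lambda>n. l2norm M (\<lambda>x. P t (?S n) x - P t f x)) \<longlonglongrightarrow> 0"
  proof (rule Lim_null_comparison)
    show "(\<lambda>n. K * l2norm M (\<lambda>x. ?S n x - f x)) \<longlonglongrightarrow> 0"
      using tendsto_mult_left[OF partial_tendsto[OF f], of K] by simp
    have "l2norm M (\<lambda>x. P t (?S n) x - P t f x) \<le> K * l2norm M (\<lambda>x. ?S n x - f x)" for n
    proof -
      have "l2norm M (P t (\<lambda>y. 1 * ?S n y + (-1) * f y)) = l2norm M (\<lambda>x. 1 * P t (?S n) x + (-1) * P t f x)"
        by (rule l2norm_cmult_AE[of "P t"], erule S(1)[OF t], erule (1) S(3)[OF t], rule L2_lincomb_e, rule f)
      with K[OF L2_diff[OF L2_lincomb_e[of "coef f" "{..<n}"] f]] show ?thesis by simp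
    qed
    then show "\<forall>\<^sub>F n in sequentially. norm (l2norm M (\<lambda>x. P t (?S n) x - P t f x)) \<le> K * l2norm M (\<lambda>x. ?S n x - f x)"
      by simp
  qed
  from coef_tendsto[of "\<lambda>n. P t (?S n)", OF PS S(1)[OF t f] this]
  have "(\<lambda>n. coef (P t (?S n)) i) \<longlonglongrightarrow> coef (P t f) i" .
  moreover have "(\<lambda>n. coef (P t (?S n)) i) \<longlonglongrightarrow> exp (- lam i * t) * coef f i"
    by (rule tendsto_eventually) (use ev in \<open>auto simp: eventually_sequentially intro!: exI[of _ "Suc i"]\<close>)
  ultimately show ?thesis by (rule LIMSEQ_unique)
qed

section \<open>Existence of the semigroup\<close>

definition synth :: "(nat \<Rightarrow> real) \<Rightarrow> pt \<Rightarrow> real" where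
  "synth c = (SOME u. u \<in> L2 M \<and> (\<forall>i. coef u i = c i))"

lemma synth:
  assumes "summable (\<lambda>i. (c i)\<^sup>2)" "\<And>i. c i * nrm i = c i"
  shows "synth c \<in> L2 M" "coef (synth c) i = c i"
proof -
  have "\<exists>u. u \<in> L2 M \<and> (\<forall>i. coef u i = c i)"
    by (rule riesz_fischer[of c, OF assms]) blast
  from someI_ex[OF this] show "synth c \<in> L2 M" "coef (synth c) i = c i"
    unfolding synth_def by blast+
qed

text \<open>\<open>synth\<close> merely chooses some function with the given coefficients, so
  linearity, the semigroup law and the other identities hold almost everywhere and are proved by
  comparing coefficients.\<close>

definition heat :: "real \<Rightarrow> (pt \<Rightarrow> real) \<Rightarrow> pt \<Rightarrow> real" where
  "heat t f = synth (\<lambda>i. exp (- lam i * t) * coef f i)"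

lemma exp_lam_le_1: "0 \<le> t \<Longrightarrow> exp (- lam i * t) \<le> 1"
  using lam_nonneg[of i] by simp

lemma heat:
  assumes t: "0 \<le> t" and f: "f \<in> L2 M"
  shows "heat t f \<in> L2 M" "coef (heat t f) i = exp (- lam i * t) * coef f i"
proof -
  have le: "(exp (- lam i * t) * coef f i)\<^sup>2 \<le> (coef f i)\<^sup>2" for i
    using exp_lam_le_1[OF t, of i] by (simp add: power_mult_distrib mult_left_le_one_le power_le_one)
  have "summable (\<lambda>i. (exp (- lam i * t) * coef f i)\<^sup>2)"
    by (rule summable_comparison_test'[OF bessel[OF f], of 0]) (use le in simp)
  moreover have "exp (- lam i * t) * coef f i * nrm i = exp (- lam i * t) * coef f i" for i
    using coef_nrm[OF f, of i] by (simp add: mult.assoc)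
  ultimately show "heat t f \<in> L2 M" "coef (heat t f) i = exp (- lam i * t) * coef f i"
    unfolding heat_def by (rule synth)+
qed

text \<open>The bound is uniform in \<open>h\<close>: multiplied by the coefficients of
  \<open>u\<close>, it makes those of \<open>w\<close> a square-summable dominating sequence for the
  difference quotients.\<close>

lemma exp_decay_quotient_le:
  fixes l h :: real assumes "0 \<le> l" "0 < h" shows "\<bar>(exp (- l * h) - 1) / h + l\<bar> \<le> l"
proof -
  have 1: "1 - l * h \<le> exp (- l * h)" using exp_ge_add_one_self[of "- l * h"] by simp
  have 2: "exp (- l * h) \<le> 1" using assms by simp
  have "0 \<le> (exp (- l * h) - 1 + l * h) / h" using 1 assms by simp
  moreover have "(exp (- l * h) - 1 + l * h) / h \<le> (l * h) / h" using 2 assms by (intro divide_right_mono) auto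
  ultimately show ?thesis using assms by (simp add: add_divide_distrib)
qed

lemma heat_semigroup: "semigroup_of M Dom Ebar heat"
  unfolding semigroup_of_def
proof (intro conjI allI impI ballI)
  fix t f assume t: "(0::real) \<le> t" and f: "f \<in> L2 M"
  show "heat t f \<in> L2 M" by (rule heat[OF t f])
next
  fix t f g assume t: "(0::real) \<le> t" and f: "f \<in> L2 M" and g: "g \<in> L2 M" and fg: "AE x in M. f x = g x"
  show "AE x in M. heat t f x = heat t g x"
    by (rule coef_eq_imp_AE) (auto simp: heat[OF t f] heat[OF t g] coef_cong_AE[OF fg f g])
next
  fix t f g a b assume t: "(0::real) \<le> t" and f: "f \<in> L2 M" and g: "g \<in> L2 M"
  have L: "(\<lambda>y. a * f y + b * g y) \<in> L2 M" by (rule L2_lincomb[OF f g])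
  show "AE x in M. heat t (\<lambda>y. a * f y + b * g y) x = a * heat t f x + b * heat t g x"
  proof (rule coef_eq_imp_AE)
    show "heat t (\<lambda>y. a * f y + b * g y) \<in> L2 M" by (rule heat[OF t L])
    show "(\<lambda>x. a * heat t f x + b * heat t g x) \<in> L2 M" by (intro L2_lincomb heat t f g)
    show "coef (heat t (\<lambda>y. a * f y + b * g y)) i = coef (\<lambda>x. a * heat t f x + b * heat t g x) i" for i
      unfolding heat(2)[OF t L] coef_lin[OF heat(1)[OF t f] heat(1)[OF t g]] heat(2)[OF t f] heat(2)[OF t g] coef_lin[OF f g]
      by (simp add: algebra_simps)
  qed
next
  fix t assume t: "(0::real) \<le> t"
  have "(\<integral>x. (heat t f x)\<^sup>2 \<partial>M) \<le> 1 * (\<integral>x. (f x)\<^sup>2 \<partial>M)" if f: "f \<in> L2 M" for f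
    unfolding l2norm_sq[symmetric] sums_unique[OF parseval[OF f]] sums_unique[OF parseval[OF heat(1)[OF t f]]]
  proof (simp, rule suminf_le)
    show "(coef (heat t f) i)\<^sup>2 \<le> (coef f i)\<^sup>2" for i
      using exp_lam_le_1[OF t, of i] by (simp add: heat[OF t f] power_mult_distrib mult_left_le_one_le power_le_one)
  qed (intro bessel heat t f)+
  then show "\<exists>K. \<forall>f\<in>L2 M. (\<integral>x. (heat t f x)\<^sup>2 \<partial>M) \<le> K * (\<integral>x. (f x)\<^sup>2 \<partial>M)" by blast
next
  fix f assume f: "f \<in> L2 M"
  show "AE x in M. heat 0 f x = f x"
    by (rule coef_eq_imp_AE) (auto simp: heat[OF _ f] f)
next
  fix s t f assume s: "(0::real) \<le> s" and t: "(0::real) \<le> t" and f: "f \<in> L2 M"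
  have st: "0 \<le> s + t" using s t by simp
  show "AE x in M. heat (s + t) f x = heat s (heat t f) x"
  proof (rule coef_eq_imp_AE)
    show "heat (s + t) f \<in> L2 M" by (rule heat[OF st f])
    show "heat s (heat t f) \<in> L2 M" by (intro heat s t f)
    show "coef (heat (s + t) f) i = coef (heat s (heat t f)) i" for i
      unfolding heat(2)[OF st f] heat(2)[OF s heat(1)[OF t f]] heat(2)[OF t f]
      by (simp add: exp_add[symmetric] algebra_simps)
  qed
next
  fix f assume f: "f \<in> L2 M"
  have eq: "(\<integral>x. (heat t f x - f x)\<^sup>2 \<partial>M) = (\<Sum>i. ((exp (- lam i * t) - 1) * coef f i)\<^sup>2)" if t: "0 \<le> t" for t
    unfolding l2norm_sq[symmetric] sums_unique[OF parseval[OF L2_diff[OF heat(1)[OF t f] f]]]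
      coef_diff[OF heat(1)[OF t f] f] heat(2)[OF t f] by (simp add: algebra_simps)
  have "((\<lambda>t. \<Sum>i. ((exp (- lam i * t) - 1) * coef f i)\<^sup>2) \<longlongrightarrow> (\<Sum>i. 0)) (at_right 0)"
  proof (rule tendsto_suminf_dominated[OF _ _ _ trivial_limit_at_right_real])
    show "summable (\<lambda>i. (coef f i)\<^sup>2)" by (rule bessel[OF f])
    show "((\<lambda>t. ((exp (- lam i * t) - 1) * coef f i)\<^sup>2) \<longlongrightarrow> 0) (at_right 0)" for i
    proof -
      have "((\<lambda>t. ((exp (- lam i * t) - 1) * coef f i)\<^sup>2) \<longlongrightarrow> ((exp (- lam i * 0) - 1) * coef f i)\<^sup>2) (at_right 0)"
        by (intro tendsto_intros)
      then show ?thesis by simp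
    qed
    show "\<forall>\<^sub>F t in at_right 0. \<forall>i. norm (((exp (- lam i * t) - 1) * coef f i)\<^sup>2) \<le> (coef f i)\<^sup>2"
      unfolding eventually_at_filter
    proof (rule always_eventually, intro allI impI)
      fix t :: real and i assume "t \<noteq> 0" "t \<in> {0<..}"
      then have "\<bar>exp (- lam i * t) - 1\<bar> \<le> 1" using exp_lam_le_1[of t i] exp_gt_zero[of "- lam i * t"] by (auto simp: abs_le_iff)
      then have "(exp (- lam i * t) - 1)\<^sup>2 \<le> 1" by (simp add: abs_square_le_1)
      then show "norm (((exp (- lam i * t) - 1) * coef f i)\<^sup>2) \<le> (coef f i)\<^sup>2"
        by (simp add: power_mult_distrib mult_left_le_one_le)
    qed
  qed
  then show "((\<lambda>t. \<integral>x. (heat t f x - f x)\<^sup>2 \<partial>M) \<longlongrightarrow> 0) (at_right 0)"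
    by (rule Lim_transform_eventually[OF _ eventually_at_rightI[of 0 1], THEN tendsto_eq_rhs]) (auto simp: eq)
next
  fix u w assume u: "u \<in> L2 M" and w: "w \<in> L2 M"
  have L: "(\<lambda>x. (heat h u x - u x) / h - w x) \<in> L2 M" if "0 < h" for h
    using L2_diff[OF L2_cmult[OF L2_diff[OF heat(1)[of h, OF less_imp_le[OF that] u] u], of "1/h"] w] by simp
  have c: "coef (\<lambda>x. (heat h u x - u x) / h - w x) i = (exp (- lam i * h) - 1) / h * coef u i - coef w i" if h: "0 < h" for h i
  proof -
    note hh = heat[OF less_imp_le[OF h] u]
    note L1 = L2_diff[OF hh(1) u]
    have "coef (\<lambda>x. 1 / h * (heat h u x - u x) - w x) i = 1 / h * (exp (- lam i * h) * coef u i - coef u i) - coef w i"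
      by (simp only: coef_diff[OF L2_cmult[OF L1] w] coef_cmult[OF L1] coef_diff[OF hh(1) u] hh(2))
    then show ?thesis by (simp add: algebra_simps diff_divide_distrib)
  qed
  have eq: "(\<integral>x. ((heat h u x - u x) / h - w x)\<^sup>2 \<partial>M) = (\<Sum>i. ((exp (- lam i * h) - 1) / h * coef u i - coef w i)\<^sup>2)" if h: "0 < h" for h
    unfolding l2norm_sq[symmetric] sums_unique[OF parseval[OF L[OF h]]] c[OF h] ..
  have der: "((\<lambda>h. (exp (- lam i * h) - 1) / h) \<longlongrightarrow> - lam i) (at_right 0)" for i
  proof -
    have "((\<lambda>h. exp (- lam i * h)) has_real_derivative - lam i) (at 0)"
      by (auto intro!: derivative_eq_intros)
    then show ?thesis
      unfolding has_field_derivative_iff by (simp add: tendsto_within_subset[of _ _ 0 UNIV])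
  qed
  show "generator_rel M Dom Ebar u w = ((\<lambda>h. \<integral>x. ((heat h u x - u x) / h - w x)\<^sup>2 \<partial>M) \<longlongrightarrow> 0) (at_right 0)"
    unfolding generator_rel_iff
  proof
    assume "u \<in> L2 M \<and> w \<in> L2 M \<and> (\<forall>i. coef w i = - lam i * coef u i)"
    then have cw: "\<And>i. coef w i = - lam i * coef u i" by blast
    have "((\<lambda>h. \<Sum>i. ((exp (- lam i * h) - 1) / h * coef u i - coef w i)\<^sup>2) \<longlongrightarrow> (\<Sum>i. 0)) (at_right 0)"
    proof (rule tendsto_suminf_dominated[OF _ _ _ trivial_limit_at_right_real])
      show "summable (\<lambda>i. (coef w i)\<^sup>2)" by (rule bessel[OF w])
      show "((\<lambda>h. ((exp (- lam i * h) - 1) / h * coef u i - coef w i)\<^sup>2) \<longlongrightarrow> 0) (at_right 0)" for i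
      proof -
        have "((\<lambda>h. ((exp (- lam i * h) - 1) / h * coef u i - coef w i)\<^sup>2) \<longlongrightarrow> (- lam i * coef u i - coef w i)\<^sup>2) (at_right 0)"
          by (intro tendsto_intros der)
        then show ?thesis by (simp add: cw)
      qed
      show "\<forall>\<^sub>F h in at_right 0. \<forall>i. norm (((exp (- lam i * h) - 1) / h * coef u i - coef w i)\<^sup>2) \<le> (coef w i)\<^sup>2"
        unfolding eventually_at_filter
      proof (rule always_eventually, intro allI impI)
        fix h :: real and i assume "h \<noteq> 0" "h \<in> {0<..}"
        then have "\<bar>(exp (- lam i * h) - 1) / h + lam i\<bar> \<le> \<bar>lam i\<bar>"
          using exp_decay_quotient_le[OF lam_nonneg[of i], of h] by simp
        then have "((exp (- lam i * h) - 1) / h + lam i)\<^sup>2 \<le> (lam i)\<^sup>2" by (rule abs_le_square_iff[THEN iffD1])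
        then have "((exp (- lam i * h) - 1) / h + lam i)\<^sup>2 * (coef u i)\<^sup>2 \<le> (lam i)\<^sup>2 * (coef u i)\<^sup>2"
          by (rule mult_right_mono) simp
        moreover have "(exp (- lam i * h) - 1) / h * coef u i - coef w i = ((exp (- lam i * h) - 1) / h + lam i) * coef u i"
          by (simp add: cw distrib_right)
        ultimately show "norm (((exp (- lam i * h) - 1) / h * coef u i - coef w i)\<^sup>2) \<le> (coef w i)\<^sup>2"
          by (simp add: power_mult_distrib cw)
      qed
    qed
    then show "((\<lambda>h. \<integral>x. ((heat h u x - u x) / h - w x)\<^sup>2 \<partial>M) \<longlongrightarrow> 0) (at_right 0)"
      by (rule Lim_transform_eventually[OF _ eventually_at_rightI[of 0 1], THEN tendsto_eq_rhs]) (auto simp: eq)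
  next
    assume lim: "((\<lambda>h. \<integral>x. ((heat h u x - u x) / h - w x)\<^sup>2 \<partial>M) \<longlongrightarrow> 0) (at_right 0)"
    have "coef w i = - lam i * coef u i" for i
    proof -
      have 1: "((\<lambda>h. (exp (- lam i * h) - 1) / h * coef u i - coef w i) \<longlongrightarrow> - lam i * coef u i - coef w i) (at_right 0)"
        by (intro tendsto_intros der)
      have 2: "((\<lambda>h. (exp (- lam i * h) - 1) / h * coef u i - coef w i) \<longlongrightarrow> 0) (at_right 0)"
      proof (rule Lim_null_comparison)
        show "((\<lambda>h. l2norm M (\<lambda>x. (heat h u x - u x) / h - w x)) \<longlongrightarrow> 0) (at_right 0)"
          using lim by (simp add: l2norm_tendsto_0_iff)
        show "\<forall>\<^sub>F h in at_right 0. norm ((exp (- lam i * h) - 1) / h * coef u i - coef w i) \<le> l2norm M (\<lambda>x. (heat h u x - u x) / h - w x)"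
        proof (rule eventually_at_rightI[of 0 1])
          fix h :: real assume "h \<in> {0<..<1}"
          then have h: "0 < h" by simp
          have "((exp (- lam i * h) - 1) / h * coef u i - coef w i)\<^sup>2 \<le> (l2norm M (\<lambda>x. (heat h u x - u x) / h - w x))\<^sup>2"
            unfolding c[OF h, symmetric] sums_unique[OF parseval[OF L[OF h]]]
            using sum_le_suminf[OF bessel[OF L[OF h]], of "{i}"] by simp
          then show "norm ((exp (- lam i * h) - 1) / h * coef u i - coef w i) \<le> l2norm M (\<lambda>x. (heat h u x - u x) / h - w x)"
            using power2_le_iff_abs_le[of "l2norm M (\<lambda>x. (heat h u x - u x) / h - w x)"] by simp
        qed simp
      qed
      from tendsto_unique[OF _ 1 2] show ?thesis by simp
    qed
    with u w show "u \<in> L2 M \<and> w \<in> L2 M \<and> (\<forall>i. coef w i = - lam i * coef u i)" by blast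
  qed
qed

section \<open>Decay, Poincare inequality and spectral gap\<close>

lemma semigroup_decay:
  assumes P: "semigroup_of M Dom Ebar P" and t: "0 \<le> t" and f: "f \<in> L2 M"
    and i0: "AE x in M. e i0 x = 1" "lam i0 = 0"
    and gap: "\<And>i. i \<noteq> i0 \<Longrightarrow> nrm i \<noteq> 0 \<Longrightarrow> a \<le> lam i"
  shows "l2norm M (\<lambda>x. P t f x - (\<integral>y. f y \<partial>M)) \<le> exp (- a * t) * l2norm M f"
proof -
  note S = semigroup_ofD[OF P]
  let ?c = "\<integral>y. f y \<partial>M"
  have m: "coef f i0 = ?c"
    unfolding coef_def l2ip_def using i0(1) L2_measurable[OF f] L2_measurable[OF e_L2]
    by (intro integral_cong_AE) auto
  have Pf: "P t f \<in> L2 M" by (rule S(1)[OF t f])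
  have one: "coef (\<lambda>x. ?c) i = ?c * coef (e i0) i" for i
  proof -
    have "AE x in M. ?c = ?c * e i0 x" using i0(1) by eventually_elim simp
    from coef_cong_AE[OF this L2_const L2_cmult[OF e_L2]] show ?thesis unfolding coef_cmult[OF e_L2] .
  qed
  \<comment> \<open>Subtracting the mean cancels the coefficient of the constant eigenvector
    \<open>e i0\<close>; at any other index either the vector vanishes or the gap applies.\<close>
  have c: "(coef (\<lambda>x. P t f x - ?c) i)\<^sup>2 \<le> (exp (- a * t))\<^sup>2 * (coef f i)\<^sup>2" for i
  proof (cases "i = i0")
    case True
    have cn: "?c * nrm i0 = ?c" using coef_nrm[OF f, of i0] unfolding m .
    then show ?thesis unfolding True coef_diff[OF Pf L2_const] semigroup_coef[OF P t f] one coef_e i0(2) m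
      by (simp add: cn)
  next
    case False
    show ?thesis
    proof (cases "nrm i = 0")
      case True
      then have "coef f i = 0" using coef_nrm[OF f, of i] by simp
      then show ?thesis using False by (simp add: coef_diff[OF Pf L2_const] semigroup_coef[OF P t f] one coef_e)
    next
      case nz: False
      have "exp (- lam i * t) \<le> exp (- a * t)" using gap[OF False nz] t by (simp add: mult_right_mono)
      then have "(exp (- lam i * t))\<^sup>2 * (coef f i)\<^sup>2 \<le> (exp (- a * t))\<^sup>2 * (coef f i)\<^sup>2"
        by (intro mult_right_mono power_mono) auto
      then show ?thesis using False
        by (simp add: coef_diff[OF Pf L2_const] semigroup_coef[OF P t f] one coef_e power_mult_distrib)
    qed
  qed
  have "(l2norm M (\<lambda>x. P t f x - ?c))\<^sup>2 \<le> (\<Sum>i. (exp (- a * t))\<^sup>2 * (coef f i)\<^sup>2)"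
    unfolding sums_unique[OF parseval[OF L2_diff[OF Pf L2_const]]]
    by (rule suminf_le[OF c bessel[OF L2_diff[OF Pf L2_const]] summable_mult[OF bessel[OF f]]])
  also have "\<dots> = (exp (- a * t) * l2norm M f)\<^sup>2"
    using sums_unique[OF sums_mult[OF parseval[OF f]]] by (simp add: power_mult_distrib)
  finally show ?thesis by (rule power2_le_imp_le) simp
qed

lemma poincare_D:
  assumes f: "f \<in> D" and mean: "(\<integral>x. f x \<partial>M) = 0"
    and i0: "AE x in M. e i0 x = 1"
    and gap: "\<And>i. i \<noteq> i0 \<Longrightarrow> nrm i \<noteq> 0 \<Longrightarrow> a \<le> lam i"
  shows "a * (l2norm M f)\<^sup>2 \<le> q f f"
proof -
  have m: "coef f i0 = 0"
    unfolding coef_def l2ip_def mean[symmetric] using i0(1) L2_measurable[OF D_L2[OF f]] L2_measurable[OF e_L2]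
    by (intro integral_cong_AE) auto
  have le: "a * (coef f i)\<^sup>2 \<le> lam i * (coef f i)\<^sup>2" for i
  proof (cases "coef f i = 0")
    case False
    then have "i \<noteq> i0" "nrm i \<noteq> 0" using m coef_nrm[OF D_L2[OF f], of i] by auto
    then show ?thesis using gap by (intro mult_right_mono) auto
  qed simp
  show ?thesis
    by (rule sums_le[OF le sums_mult[OF parseval[OF D_L2[OF f]]] q_sums_sq[OF f]])
qed

lemma spectral_gap_eq:
  assumes i0: "AE x in M. e i0 x = 1"
    and gap: "\<And>i. i \<noteq> i0 \<Longrightarrow> nrm i \<noteq> 0 \<Longrightarrow> a \<le> lam i"
    and f: "f \<in> D" "(\<integral>x. f x \<partial>M) = 0" "l2norm M f \<noteq> 0" "q f f = a * (l2norm M f)\<^sup>2"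
  shows "spectral_gap M Dom Ebar = a"
  unfolding spectral_gap_def closure_dom_eq
proof (rule cInf_eq_minimum)
  let ?g = "\<lambda>x. (1 / l2norm M f) * f x + 0 * f x"
  have g: "?g \<in> D" by (rule D_lin[OF f(1) f(1)])
  have p: "0 < l2norm M f" using f(3) l2norm_nonneg[of M f] by linarith
  have 1: "(\<integral>x. ?g x \<partial>M) = 0" using f(2) by simp
  have "l2norm M ?g = 1" using p l2norm_cmult[of M "1 / l2norm M f" f] by simp
  then have 2: "(\<integral>x. (?g x)\<^sup>2 \<partial>M) = 1" unfolding l2norm_sq[symmetric] by simp
  have "q ?g ?g = (1 / l2norm M f)\<^sup>2 * q f f"
    using q_sq_lin[OF f(1) f(1), of "1 / l2norm M f" 0] by simp
  then have 3: "Ebar ?g ?g = a" using p f(4) by (simp only: closure_form_eq[OF g g]) (simp add: power2_eq_square)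
  show "a \<in> {Ebar f f |f. f \<in> D \<and> expectation f = 0 \<and> (\<integral>x. (f x)\<^sup>2 \<partial>M) = 1}"
    using g 1 2 3 by blast
  fix y assume "y \<in> {Ebar f f |f. f \<in> D \<and> expectation f = 0 \<and> (\<integral>x. (f x)\<^sup>2 \<partial>M) = 1}"
  then obtain h where h: "y = Ebar h h" "h \<in> D" "expectation h = 0" "(\<integral>x. (h x)\<^sup>2 \<partial>M) = 1" by blast
  show "a \<le> y" using poincare_D[OF h(2,3) i0 gap] h by (simp add: l2norm_sq closure_form_eq)
qed

end

subsection \<open>The simplex inside the Hilbert cube\<close>

lemma sets_Msp: "sets Msp = sets borel"
  unfolding Msp_def by (rule sets_PiM_equal_borel)

lemma space_Msp [simp]: "space Msp = UNIV"
  by (simp add: Msp_def space_PiM)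

lemma borel_measurable_Msp_continuous: "continuous_on UNIV f \<Longrightarrow> f \<in> borel_measurable Msp"
  by (simp add: measurable_cong_sets[OF sets_Msp refl] borel_measurable_continuous_onI)

lemma coord_measurable [measurable]: "(\<lambda>x. x i) \<in> borel_measurable Msp"
  unfolding Msp_def by measurable

text \<open>Compact in the product topology, the one in which cylinder functions are continuous; it
  supplies their bounds and the domain for Stone--Weierstrass.\<close>

definition cube :: "pt set" where "cube = {x. \<forall>i. 0 \<le> x i \<and> x i \<le> 1}"

lemma compact_cube: "compact cube"
proof -
  have "cube = PiE UNIV (\<lambda>_. {0..1})" by (auto simp: cube_def PiE_def Pi_def)
  moreover have "compactin (product_topology (\<lambda>_. euclidean) UNIV) (PiE UNIV (\<lambda>_::nat. {0..1::real}))"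
    unfolding compactin_PiE by simp
  ultimately show ?thesis by (simp add: euclidean_product_topology)
qed

lemma Delta_subset_cube: "Delta_inf \<subseteq> cube"
  by (auto simp: Delta_inf_def cube_def)

text \<open>Summability is traded for countably many conditions on finitely many coordinates each,
  which gives measurability of the simplex.\<close>

lemma Delta_inf_eq: "Delta_inf = {x. (\<forall>i. 0 \<le> x i \<and> x i \<le> 1) \<and> (\<forall>n. (\<Sum>i<n. x i) \<le> 1)}"
proof -
  have "summable x \<and> suminf x \<le> 1 \<longleftrightarrow> (\<forall>n. (\<Sum>i<n. x i) \<le> 1)" if "\<And>i. 0 \<le> x i" for x :: pt
  proof
    assume "summable x \<and> suminf x \<le> 1"
    then show "\<forall>n. (\<Sum>i<n. x i) \<le> 1"
      using sum_le_suminf[of x "{..<n}" for n] that by (meson finite_lessThan order_trans)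
  next
    assume *: "\<forall>n. (\<Sum>i<n. x i) \<le> 1"
    then have "summable x" by (intro summableI_nonneg_bounded[of x 1] that) auto
    then show "summable x \<and> suminf x \<le> 1" using * by (auto intro: suminf_le_const)
  qed
  then show ?thesis unfolding Delta_inf_def by blast
qed

lemma Delta_inf_sets [measurable]: "Delta_inf \<in> sets Msp"
proof -
  have "{x \<in> space Msp. (\<forall>i. 0 \<le> x i \<and> x i \<le> 1) \<and> (\<forall>n. (\<Sum>i<n. x i) \<le> 1)} \<in> sets Msp"
    by measurable
  then show ?thesis by (simp add: Delta_inf_eq)
qed

lemma Delta_infD:
  assumes "x \<in> Delta_inf"
  shows "0 \<le> x i" "x i \<le> 1" "summable x" "suminf x \<le> 1" "0 \<le> suminf x" "(\<Sum>i<n. x i) \<le> suminf x"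
proof -
  show a: "0 \<le> x i" for i using assms by (simp add: Delta_inf_def)
  show "x i \<le> 1" "summable x" "suminf x \<le> 1" using assms by (auto simp: Delta_inf_def)
  then show "0 \<le> suminf x" "(\<Sum>i<n. x i) \<le> suminf x" using a by (auto intro: suminf_nonneg sum_le_suminf)
qed

lemma bounded_on_cube:
  fixes f :: "pt \<Rightarrow> real"
  assumes "continuous_on UNIV f"
  shows "\<exists>B>0. \<forall>x\<in>cube. \<bar>f x\<bar> \<le> B"
proof -
  have "bounded (f ` cube)"
    by (intro compact_imp_bounded compact_continuous_image compact_cube continuous_on_subset[OF assms]) auto
  then show ?thesis by (auto simp: bounded_pos)
qed

subsection \<open>Cylinder functions\<close>

lemma depends_on_first_mono: "depends_on_first m f \<Longrightarrow> m \<le> k \<Longrightarrow> depends_on_first k f"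
  by (simp add: depends_on_first_def)

lemma depends_on_firstD: "depends_on_first m f \<Longrightarrow> (\<And>i. i < m \<Longrightarrow> x i = y i) \<Longrightarrow> f x = f y"
  by (simp add: depends_on_first_def)

lemma depends_on_first_combine:
  assumes "depends_on_first m f" "depends_on_first k g"
  shows "depends_on_first (max m k) (\<lambda>x. h (f x) (g x))"
  unfolding depends_on_first_def
proof (intro allI impI)
  fix x y :: pt assume *: "\<forall>i<max m k. x i = y i"
  have "f x = f y" by (rule depends_on_firstD[OF assms(1)]) (use * in simp)
  moreover have "g x = g y" by (rule depends_on_firstD[OF assms(2)]) (use * in simp)
  ultimately show "h (f x) (g x) = h (f y) (g y)" by simp
qed

lemma depends_on_first_upd:
  assumes "depends_on_first m f" "m \<le> n" shows "f (x(n := t)) = f x"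
  by (rule depends_on_firstD[OF assms(1)]) (use assms(2) in auto)

lemma partial_eq_0:
  assumes "depends_on_first m f" "m \<le> n" shows "partial n f = (\<lambda>x. 0)"
  by (rule ext) (simp add: partial_def depends_on_first_upd[OF assms])

lemma partial_exists_out:
  assumes "depends_on_first m f" "m \<le> n" shows "partial_exists n f"
  by (simp add: partial_exists_def depends_on_first_upd[OF assms])

lemma partial_depends:
  assumes "depends_on_first m f" shows "depends_on_first m (partial n f)"
proof (cases "n < m")
  case True
  show ?thesis unfolding depends_on_first_def
  proof (intro allI impI)
    fix x y :: pt assume *: "\<forall>i<m. x i = y i"
    have "(\<lambda>t. f (x(n := t))) = (\<lambda>t. f (y(n := t)))"
      by (rule ext, rule depends_on_firstD[OF assms]) (use * in auto)
    then show "partial n f x = partial n f y" using * True by (simp add: partial_def)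
  qed
next
  case False
  then show ?thesis using partial_eq_0[OF assms] by (simp add: depends_on_first_def)
qed

lemma FC1_iff:
  "f \<in> FC1 \<longleftrightarrow> (\<exists>m. depends_on_first m f) \<and> continuous_on UNIV f \<and>
     (\<forall>i. partial_exists i f \<and> continuous_on UNIV (partial i f))"
proof
  assume "f \<in> FC1"
  then obtain m where m: "depends_on_first m f" "continuous_on UNIV f"
    "\<And>i. i < m \<Longrightarrow> partial_exists i f \<and> continuous_on UNIV (partial i f)" by (auto simp: FC1_def)
  have "partial_exists i f \<and> continuous_on UNIV (partial i f)" for i
    using m(3)[of i] partial_exists_out[OF m(1), of i] partial_eq_0[OF m(1), of i] by (cases "i < m") auto
  with m show "(\<exists>m. depends_on_first m f) \<and> continuous_on UNIV f \<and>
     (\<forall>i. partial_exists i f \<and> continuous_on UNIV (partial i f))" by blast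
qed (auto simp: FC1_def)

lemma partial_has_derivative:
  assumes "partial_exists i f"
  shows "((\<lambda>t. f (x(i := t))) has_real_derivative partial i f (x(i := t))) (at t)"
proof -
  have "(\<lambda>s. f ((x(i := t))(i := s))) differentiable (at ((x(i := t)) i))"
    using assms unfolding partial_exists_def by blast
  then have "(\<lambda>s. f (x(i := s))) differentiable (at t)" by simp
  then have "((\<lambda>s. f (x(i := s))) has_real_derivative deriv (\<lambda>s. f (x(i := s))) t) (at t)"
    by (simp add: DERIV_deriv_iff_real_differentiable)
  then show ?thesis by (simp add: partial_def)
qed

lemma partial_has_derivative_at:
  assumes "partial_exists i f"
  shows "((\<lambda>t. f (x(i := t))) has_real_derivative partial i f x) (at (x i))"
  using partial_has_derivative[OF assms, of x "x i"] by simp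

lemma partialI:
  assumes "\<And>x. ((\<lambda>t. f (x(i := t))) has_real_derivative d x) (at (x i))"
  shows "partial_exists i f" "partial i f = d"
proof -
  show "partial_exists i f"
    unfolding partial_exists_def using assms real_differentiable_def by blast
  show "partial i f = d"
    by (rule ext) (simp add: partial_def DERIV_imp_deriv[OF assms])
qed

lemma FC1D:
  assumes "f \<in> FC1"
  shows "continuous_on UNIV f" "partial_exists i f" "continuous_on UNIV (partial i f)"
    "f \<in> borel_measurable Msp" "partial i f \<in> borel_measurable Msp"
  using assms by (auto simp: FC1_iff intro: borel_measurable_Msp_continuous)

lemma FC1_dep:
  assumes "f \<in> FC1"
  shows "\<exists>m. depends_on_first m f \<and> (\<forall>k. depends_on_first m (partial k f)) \<and> (\<forall>n\<ge>m. partial n f = (\<lambda>x. 0))"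
  using assms partial_depends partial_eq_0 unfolding FC1_iff by metis

text \<open>One bound serves all \<open>n\<close> because only finitely many partial derivatives are
  nonzero.\<close>

lemma FC1_bounded:
  assumes "f \<in> FC1"
  shows "\<exists>B>0. (\<forall>x\<in>cube. \<bar>f x\<bar> \<le> B) \<and> (\<forall>n. \<forall>x\<in>cube. \<bar>partial n f x\<bar> \<le> B)"
proof -
  obtain m where m: "\<forall>n\<ge>m. partial n f = (\<lambda>x. 0)" using FC1_dep[OF assms] by blast
  obtain B where B: "0 < B" "\<forall>x\<in>cube. \<bar>f x\<bar> \<le> B" using bounded_on_cube[OF FC1D(1)[OF assms]] by blast
  have "\<exists>C. 0 < C \<and> (\<forall>x\<in>cube. \<bar>partial n f x\<bar> \<le> C)" for n
    using bounded_on_cube[OF FC1D(3)[OF assms, of n]] by blast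
  then obtain C where C: "\<And>n. 0 < C n" "\<And>n x. x \<in> cube \<Longrightarrow> \<bar>partial n f x\<bar> \<le> C n" by metis
  have "\<bar>partial n f x\<bar> \<le> B + (\<Sum>n<m. C n)" if "x \<in> cube" for n x
  proof (cases "n < m")
    case True
    have "C n \<le> (\<Sum>n<m. C n)" using True C(1) by (intro member_le_sum) (auto intro: less_imp_le)
    then show ?thesis using C(2)[OF that, of n] B(1) by linarith
  next
    case False
    then show ?thesis using m B(1) C(1) by (simp add: sum_nonneg less_imp_le add_nonneg_nonneg)
  qed
  moreover have "0 \<le> (\<Sum>n<m. C n)" using C(1) by (simp add: sum_nonneg less_imp_le)
  ultimately show ?thesis using B by (intro exI[of _ "B + (\<Sum>n<m. C n)"]) (auto intro: order_trans)
qed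

lemma FC1I:
  assumes "depends_on_first m f" "continuous_on UNIV f"
    and d: "\<And>i x. ((\<lambda>t. f (x(i := t))) has_real_derivative d i x) (at (x i))"
    and c: "\<And>i. continuous_on UNIV (d i)"
  shows "f \<in> FC1" "partial i f = d i"
  using partialI[OF d] c assms(1,2) by (auto simp: FC1_iff)

lemma FC1_const: "(\<lambda>x. c) \<in> FC1" "partial i (\<lambda>x. c) = (\<lambda>x. 0)"
  by (rule FC1I[of 0 _ "\<lambda>_ _. 0"], auto simp: depends_on_first_def)+

lemma FC1_coord: "(\<lambda>x. x n) \<in> FC1" "partial i (\<lambda>x. x n) = (\<lambda>x. if i = n then 1 else 0)"
proof -
  have d: "((\<lambda>t. (x(i := t)) n) has_real_derivative (if i = n then 1 else 0)) (at (x i))" for i and x :: pt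
    by (auto intro!: derivative_eq_intros)
  show "(\<lambda>x. x n) \<in> FC1" "partial i (\<lambda>x. x n) = (\<lambda>x. if i = n then 1 else 0)"
    by (rule FC1I[of "Suc n", OF _ _ d]; auto simp: depends_on_first_def intro!: continuous_intros)+
qed

lemma FC1_lin:
  assumes "f \<in> FC1" "g \<in> FC1"
  shows "(\<lambda>x. a * f x + b * g x) \<in> FC1"
    "partial i (\<lambda>x. a * f x + b * g x) = (\<lambda>x. a * partial i f x + b * partial i g x)"
proof -
  obtain m k where mk: "depends_on_first m f" "depends_on_first k g"
    using assms unfolding FC1_iff by blast
  have d: "((\<lambda>t. a * f (x(i := t)) + b * g (x(i := t))) has_real_derivative a * partial i f x + b * partial i g x) (at (x i))" for i x
    using partial_has_derivative_at[OF FC1D(2)[OF assms(1)], of x i] partial_has_derivative_at[OF FC1D(2)[OF assms(2)], of x i]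
    by (intro DERIV_add DERIV_cmult)
  have "depends_on_first (max m k) (\<lambda>x. a * f x + b * g x)"
    by (rule depends_on_first_combine[OF mk])
  then show "(\<lambda>x. a * f x + b * g x) \<in> FC1"
    "partial i (\<lambda>x. a * f x + b * g x) = (\<lambda>x. a * partial i f x + b * partial i g x)"
    by (rule FC1I[OF _ _ d]; intro continuous_on_add continuous_on_mult continuous_on_const FC1D(1,3)[OF assms(1)] FC1D(1,3)[OF assms(2)])+
qed

lemma FC1_mult:
  assumes "f \<in> FC1" "g \<in> FC1"
  shows "(\<lambda>x. f x * g x) \<in> FC1"
    "partial i (\<lambda>x. f x * g x) = (\<lambda>x. f x * partial i g x + partial i f x * g x)"
proof -
  obtain m k where mk: "depends_on_first m f" "depends_on_first k g"
    using assms unfolding FC1_iff by blast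
  have d: "((\<lambda>t. f (x(i := t)) * g (x(i := t))) has_real_derivative f x * partial i g x + partial i f x * g x) (at (x i))" for i x
    using DERIV_mult[OF partial_has_derivative_at[OF FC1D(2)[OF assms(1)], of x i] partial_has_derivative_at[OF FC1D(2)[OF assms(2)], of x i]]
    by (simp add: add.commute mult.commute)
  have "depends_on_first (max m k) (\<lambda>x. f x * g x)"
    by (rule depends_on_first_combine[OF mk])
  then show "(\<lambda>x. f x * g x) \<in> FC1"
    "partial i (\<lambda>x. f x * g x) = (\<lambda>x. f x * partial i g x + partial i f x * g x)"
    by (rule FC1I[OF _ _ d]; intro continuous_on_add continuous_on_mult FC1D(1,3)[OF assms(1)] FC1D(1,3)[OF assms(2)])+
qed

lemma FC1_compose:
  assumes "f \<in> FC1" and \<psi>: "\<And>t. (\<psi> has_real_derivative \<psi>' t) (at t)" and c: "continuous_on UNIV \<psi>'"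
  shows "(\<lambda>x. \<psi> (f x)) \<in> FC1" "partial i (\<lambda>x. \<psi> (f x)) = (\<lambda>x. \<psi>' (f x) * partial i f x)"
proof -
  obtain m where m: "depends_on_first m f" using assms(1) unfolding FC1_iff by blast
  have d: "((\<lambda>t. \<psi> (f (x(i := t)))) has_real_derivative \<psi>' (f x) * partial i f x) (at (x i))" for i x
    using DERIV_chain2[OF \<psi> partial_has_derivative_at[OF FC1D(2)[OF assms(1)], of x i]] by simp
  have "continuous_on UNIV \<psi>" using \<psi> by (intro DERIV_continuous_on[of UNIV \<psi> \<psi>']) (auto intro: has_field_derivative_at_within)
  then have cc: "continuous_on UNIV (\<lambda>x. \<psi> (f x))" by (rule continuous_on_compose2[OF _ FC1D(1)[OF assms(1)]]) auto
  have cd: "continuous_on UNIV (\<lambda>x. \<psi>' (f x) * partial i f x)" for i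
    by (intro continuous_on_mult continuous_on_compose2[OF c FC1D(1)[OF assms(1)]] FC1D(3)[OF assms(1)]) auto
  have "depends_on_first m (\<lambda>x. \<psi> (f x))"
    using depends_on_first_combine[OF m m, of "\<lambda>a b. \<psi> a"] by simp
  then show "(\<lambda>x. \<psi> (f x)) \<in> FC1" "partial i (\<lambda>x. \<psi> (f x)) = (\<lambda>x. \<psi>' (f x) * partial i f x)"
    by (rule FC1I[OF _ cc d cd])+
qed

lemma FC2_FC1:
  assumes "f \<in> FC2"
  shows "f \<in> FC1" "partial i f \<in> FC1"
proof -
  obtain m where m: "depends_on_first m f" "continuous_on UNIV f"
    "\<And>i. i < m \<Longrightarrow> partial_exists i f \<and> continuous_on UNIV (partial i f)"
    "\<And>i j. i < m \<Longrightarrow> j < m \<Longrightarrow> partial_exists j (partial i f) \<and> continuous_on UNIV (partial j (partial i f))"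
    using assms unfolding FC2_def by blast
  show "f \<in> FC1" unfolding FC1_def using m by blast
  show "partial i f \<in> FC1"
  proof (cases "i < m")
    case True
    then show ?thesis unfolding FC1_def using m(3,4) partial_depends[OF m(1)] by blast
  next
    case False
    then show ?thesis using partial_eq_0[OF m(1), of i] FC1_const[of 0] by simp
  qed
qed

subsection \<open>Polynomials in the coordinates\<close>

inductive_set cpoly :: "(pt \<Rightarrow> real) set" where
  const: "(\<lambda>x. c) \<in> cpoly"
| coord: "(\<lambda>x. x i) \<in> cpoly"
| add: "f \<in> cpoly \<Longrightarrow> g \<in> cpoly \<Longrightarrow> (\<lambda>x. f x + g x) \<in> cpoly"
| mult: "f \<in> cpoly \<Longrightarrow> g \<in> cpoly \<Longrightarrow> (\<lambda>x. f x * g x) \<in> cpoly"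

lemma cpoly_FC1: "f \<in> cpoly \<Longrightarrow> f \<in> FC1"
proof (induction rule: cpoly.induct)
  case (add f g)
  then show ?case using FC1_lin(1)[of f g 1 1] by simp
qed (auto intro: FC1_const FC1_coord FC1_mult)

lemma cpoly_approx:
  assumes "continuous_on UNIV f" "0 < \<epsilon>"
  shows "\<exists>p\<in>cpoly. \<forall>x\<in>cube. \<bar>f x - p x\<bar> < \<epsilon>"
proof -
  interpret function_ring_on cpoly cube
  proof
    show "compact cube" by (rule compact_cube)
    show "continuous_on cube f" if "f \<in> cpoly" for f
      by (rule continuous_on_subset[OF FC1D(1)[OF cpoly_FC1[OF that]] subset_UNIV])
    show "\<exists>f\<in>cpoly. f x \<noteq> f y" if "x \<in> cube" "y \<in> cube" "x \<noteq> y" for x y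
    proof -
      obtain i where "x i \<noteq> y i" using \<open>x \<noteq> y\<close> unfolding fun_eq_iff by auto
      then show ?thesis by (intro bexI[of _ "\<lambda>z. z i"]) (simp, rule cpoly.coord)
    qed
  qed (erule cpoly.add cpoly.mult, assumption | rule cpoly.const)+
  show ?thesis
    by (rule Stone_Weierstrass_basic[OF continuous_on_subset[OF assms(1)] assms(2)]) simp
qed

text \<open>The contraction is smoothed by \<open>(sqrt (t\<^sup>2 + \<epsilon>\<^sup>2) + t) / 2\<close>, a C1 substitute for \<open>max 0 t\<close>
  whose derivative is increasing from 0 to 1.\<close>

lemma smooth_unit_contraction:
  assumes "0 < (\<epsilon>::real)"
  obtains \<psi> \<psi>' where "\<And>t. (\<psi> has_real_derivative \<psi>' t) (at t)" "continuous_on UNIV \<psi>'"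
    "\<And>t. 0 \<le> \<psi>' t \<and> \<psi>' t \<le> 1" "\<And>t. \<bar>\<psi> t - min 1 (max 0 t)\<bar> \<le> \<epsilon>"
proof -
  define \<phi> where "\<phi> t = (sqrt (t\<^sup>2 + \<epsilon>\<^sup>2) + t) / 2" for t
  define \<phi>' where "\<phi>' t = (t / sqrt (t\<^sup>2 + \<epsilon>\<^sup>2) + 1) / 2" for t
  have pos: "0 < t\<^sup>2 + \<epsilon>\<^sup>2" for t using assms by (simp add: add_nonneg_pos)
  have d: "(\<phi> has_real_derivative \<phi>' t) (at t)" for t
    unfolding \<phi>_def \<phi>'_def using pos[of t] by (auto intro!: derivative_eq_intros simp: field_simps)
  have c: "continuous_on UNIV \<phi>'"
    unfolding \<phi>'_def using pos by (intro continuous_intros) (auto simp: less_imp_neq[symmetric])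
  have gt: "\<bar>t\<bar> \<le> sqrt (t\<^sup>2 + \<epsilon>\<^sup>2)" for t by (rule real_le_rsqrt) simp
  have le: "sqrt (t\<^sup>2 + \<epsilon>\<^sup>2) \<le> \<bar>t\<bar> + \<epsilon>" for t
    using assms by (intro real_le_lsqrt) (auto simp: power2_sum)
  have \<phi>: "max 0 t \<le> \<phi> t \<and> \<phi> t \<le> max 0 t + \<epsilon> / 2" for t
    unfolding \<phi>_def using gt[of t] le[of t] by (auto simp: max_def abs_if split: if_splits)
  have r: "\<bar>t / sqrt (t\<^sup>2 + \<epsilon>\<^sup>2)\<bar> \<le> 1" for t
    using gt[of t] pos[of t] by (simp add: abs_divide)
  have \<phi>'01: "0 \<le> \<phi>' t \<and> \<phi>' t \<le> 1" for t
  proof -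
    have *: "0 \<le> (y + 1) / 2 \<and> (y + 1) / 2 \<le> 1" if "\<bar>y\<bar> \<le> 1" for y :: real
      using that by (auto simp: abs_le_iff)
    show ?thesis unfolding \<phi>'_def by (rule *[OF r])
  qed
  have mono: "s / sqrt (s\<^sup>2 + \<epsilon>\<^sup>2) \<le> t / sqrt (t\<^sup>2 + \<epsilon>\<^sup>2)" if "s \<le> t" for s t
  proof (rule DERIV_nonneg_imp_nondecreasing[OF that])
    fix x
    let ?w = "sqrt (x\<^sup>2 + \<epsilon>\<^sup>2)"
    have w: "0 < ?w" "?w * ?w = x\<^sup>2 + \<epsilon>\<^sup>2" using pos[of x] by auto
    have "((\<lambda>x. x / sqrt (x\<^sup>2 + \<epsilon>\<^sup>2)) has_real_derivative (1 * ?w - x * (x / ?w)) / (?w * ?w)) (at x)"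
      using pos[of x] by (auto intro!: derivative_eq_intros simp: field_simps)
    moreover have "0 \<le> (1 * ?w - x * (x / ?w)) / (?w * ?w)"
    proof -
      have "x * (x / ?w) \<le> ?w"
        using w by (simp add: field_simps power2_eq_square)
      then show ?thesis using w(1) by simp
    qed
    ultimately show "\<exists>y. ((\<lambda>x. x / sqrt (x\<^sup>2 + \<epsilon>\<^sup>2)) has_real_derivative y) (at x) \<and> 0 \<le> y" by blast
  qed
  show thesis
  \<comment> \<open>The clipped value \<open>min 1 (max 0 t)\<close> is
    \<open>max 0 t - max 0 (t - 1)\<close>; subtracting the shifted \<open>\<phi>\<close> imitates
    this, and monotonicity of \<open>\<phi>'\<close> keeps the derivative between 0 and 1.\<close>
  proof (rule that[of "\<lambda>t. \<phi> t - \<phi> (t - 1)" "\<lambda>t. \<phi>' t - \<phi>' (t - 1)"])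
    show "((\<lambda>t. \<phi> t - \<phi> (t - 1)) has_real_derivative \<phi>' t - \<phi>' (t - 1)) (at t)" for t
    proof (rule DERIV_diff[OF d])
      have "((\<lambda>t. t - 1) has_real_derivative 1) (at t)"
        using DERIV_diff[OF DERIV_ident DERIV_const] by simp
      from DERIV_chain2[OF d this] show "((\<lambda>t. \<phi> (t - 1)) has_real_derivative \<phi>' (t - 1)) (at t)" by simp
    qed
    show "continuous_on UNIV (\<lambda>t. \<phi>' t - \<phi>' (t - 1))"
      by (intro continuous_intros c continuous_on_compose2[OF c]) auto
    show "0 \<le> \<phi>' t - \<phi>' (t - 1) \<and> \<phi>' t - \<phi>' (t - 1) \<le> 1" for t
    proof -
      have "\<phi>' (t - 1) \<le> \<phi>' t"
        unfolding \<phi>'_def by (intro divide_right_mono add_right_mono mono) auto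
      then show ?thesis using \<phi>'01[of t] \<phi>'01[of "t - 1"] by linarith
    qed
    show "\<bar>\<phi> t - \<phi> (t - 1) - min 1 (max 0 t)\<bar> \<le> \<epsilon>" for t
      using \<phi>[of t] \<phi>[of "t - 1"] by (auto simp: max_def min_def abs_le_iff split: if_splits)
  qed
qed

subsection \<open>Beta distributions\<close>

definition beta_dens :: "real \<Rightarrow> real \<Rightarrow> real \<Rightarrow> real" where
  "beta_dens a b t = (if 0 < t \<and> t < 1 then t powr (a - 1) * (1 - t) powr (b - 1) / Beta a b else 0)"

definition beta_measure :: "real \<Rightarrow> real \<Rightarrow> real measure" where
  "beta_measure a b = density lborel (\<lambda>t. ennreal (beta_dens a b t))"

lemma beta_dens_measurable [measurable]: "beta_dens a b \<in> borel_measurable borel"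
proof -
  have "(\<lambda>t. beta_dens a b t) \<in> borel_measurable borel"
    unfolding beta_dens_def by measurable
  then show ?thesis by simp
qed

lemma sets_beta_measure [measurable_cong, simp]: "sets (beta_measure a b) = sets borel"
  by (simp add: beta_measure_def)

lemma space_beta_measure [simp]: "space (beta_measure a b) = UNIV"
  by (simp add: beta_measure_def)

lemma Beta_pos: "0 < a \<Longrightarrow> 0 < b \<Longrightarrow> 0 < Beta a (b::real)"
  by (simp add: Beta_def Gamma_real_pos)

lemma beta_dens_nonneg: "0 < a \<Longrightarrow> 0 < b \<Longrightarrow> 0 \<le> beta_dens a b t"
  using Beta_pos[of a b] by (simp add: beta_dens_def)

lemma beta_dens_has_bochner_integral:
  assumes "0 < a" "0 < b" shows "has_bochner_integral lborel (beta_dens a b) 1"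
proof -
  let ?f = "\<lambda>t. t powr (a - 1) * (1 - t) powr (b - 1)"
  have eq: "beta_dens a b = (\<lambda>t. indicator {0..1} t * ?f t / Beta a b)"
    by (rule ext) (auto simp: beta_dens_def indicator_def)
  have int: "set_integrable lborel {0..1} ?f" by (rule integrable_Beta[OF assms])
  have "(LINT t:{0..1}|lborel. ?f t) = integral {0..1} ?f"
    by (rule set_borel_integral_eq_integral(2)[OF int])
  also have "\<dots> = Beta a b" by (rule integral_unique[OF has_integral_Beta_real[OF assms]])
  finally have "has_bochner_integral lborel (\<lambda>t. indicator {0..1} t * ?f t) (Beta a b)"
    using int by (simp add: has_bochner_integral_iff set_integrable_def set_lebesgue_integral_def)
  from has_bochner_integral_divide_zero[OF this, of "Beta a b"] show ?thesis
    using Beta_pos[OF assms] by (simp add: eq)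
qed

lemma prob_space_beta_measure:
  assumes "0 < a" "0 < b" shows "prob_space (beta_measure a b)"
proof
  have "emeasure (beta_measure a b) (space (beta_measure a b)) = (\<integral>\<^sup>+t. ennreal (beta_dens a b t) \<partial>lborel)"
    unfolding beta_measure_def by (simp add: emeasure_density)
  also have "\<dots> = ennreal 1"
    using beta_dens_has_bochner_integral[OF assms] beta_dens_nonneg[OF assms]
    by (subst nn_integral_eq_integral) (auto simp: has_bochner_integral_iff)
  finally show "emeasure (beta_measure a b) (space (beta_measure a b)) = 1" by simp
qed

lemma AE_beta_measure: "AE t in beta_measure a b. 0 < t \<and> t < 1"
  unfolding beta_measure_def by (subst AE_density) (auto simp: beta_dens_def)

text \<open>Size biasing: \<open>t\<close> times the density with parameters \<open>a, b\<close> is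
  \<open>a / (a + b)\<close> times the density with parameters \<open>a + 1, b\<close>.\<close>

lemma beta_mean:
  assumes "0 < a" "0 < b"
  shows "integrable (beta_measure a b) (\<lambda>t. t)" "(\<integral>t. t \<partial>beta_measure a b) = a / (a + b)"
proof -
  interpret prob_space "beta_measure a b" by (rule prob_space_beta_measure[OF assms])
  show "integrable (beta_measure a b) (\<lambda>t. t)"
  proof (rule integrable_const_bound[of _ 1])
    show "AE t in beta_measure a b. norm t \<le> 1" using AE_beta_measure[of a b] by eventually_elim auto
    show "(\<lambda>t. t) \<in> borel_measurable (beta_measure a b)" by (rule measurable_ident_sets) simp
  qed
  have G: "Gamma (a + 1) = a * Gamma a" "Gamma (a + 1 + b) = (a + b) * Gamma (a + b)"
    using Gamma_plus1[of a] Gamma_plus1[of "a + b"] assms nonpos_Ints_nonpos[of a] nonpos_Ints_nonpos[of "a + b"]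
    by (auto simp: ac_simps)
  have p: "0 < Gamma a" "0 < Gamma b" "0 < Gamma (a + b)" using assms by (auto intro: Gamma_real_pos)
  have eq: "beta_dens a b t * t = a / (a + b) * beta_dens (a + 1) b t" for t
  proof (cases "0 < t \<and> t < 1")
    case True
    have "t powr (a - 1) * t = t powr a" using powr_mult_base[of t "a - 1"] True by (simp add: mult.commute)
    moreover have "1 / Beta a b = a / (a + b) * (1 / Beta (a + 1) b)"
    proof -
      have *: "1 / (G1 * G2 / G3) = a / c * (1 / (a * G1 * G2 / (c * G3)))"
        if "G1 \<noteq> 0" "G2 \<noteq> 0" "G3 \<noteq> 0" "a \<noteq> 0" "c \<noteq> 0" for G1 G2 G3 a c :: real
        using that by (simp add: field_simps)
      show ?thesis unfolding Beta_def G by (rule *) (use p assms in linarith)+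
    qed
    ultimately have "t powr (a - 1) * t * (1 - t) powr (b - 1) * (1 / Beta a b) =
       t powr a * (1 - t) powr (b - 1) * (a / (a + b) * (1 / Beta (a + 1) b))" by simp
    then show ?thesis using True by (simp add: beta_dens_def mult_ac)
  qed (auto simp: beta_dens_def)
  have "(\<integral>t. t \<partial>beta_measure a b) = (\<integral>t. beta_dens a b t * t \<partial>lborel)"
    unfolding beta_measure_def using beta_dens_nonneg[OF assms] by (subst integral_density) auto
  also have "\<dots> = a / (a + b) * (\<integral>t. beta_dens (a + 1) b t \<partial>lborel)" unfolding eq by simp
  also have "(\<integral>t. beta_dens (a + 1) b t \<partial>lborel) = 1"
    using beta_dens_has_bochner_integral[of "a + 1" b] assms by (simp add: has_bochner_integral_iff)
  finally show "(\<integral>t. t \<partial>beta_measure a b) = a / (a + b)" by simp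
qed

subsection \<open>One step of stick breaking for finite Dirichlet laws\<close>

lemma measurable_Msp_I:
  assumes "\<And>i. (\<lambda>x. f x i) \<in> borel_measurable N" shows "f \<in> measurable N Msp"
proof -
  have "(\<lambda>x i. f x i) \<in> measurable N Msp"
    unfolding Msp_def by (rule measurable_PiM_single') (use assms in auto)
  then show ?thesis by simp
qed

lemma ext0_measurable [measurable]: "ext0 N \<in> measurable Msp Msp"
  by (rule measurable_Msp_I) (simp add: ext0_def)

lemma ext0_measurable_PiM [measurable]: "ext0 N \<in> measurable (Pi\<^sub>M {..<N} (\<lambda>_. lborel)) Msp"
proof (rule measurable_Msp_I)
  fix i
  show "(\<lambda>x. ext0 N x i) \<in> borel_measurable (Pi\<^sub>M {..<N} (\<lambda>_. lborel))"
    using measurable_component_singleton[of i "{..<N}" "\<lambda>_. lborel :: real measure"]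
    by (cases "i < N") (auto simp: ext0_def)
qed

lemma dir_dens_pos:
  assumes "\<And>i. i < N \<Longrightarrow> 0 < x i" "(\<Sum>i<N. x i) < 1"
  shows "dir_dens N \<beta> x = Gamma (\<Sum>i\<le>N. \<beta> i) / (\<Prod>i\<le>N. Gamma (\<beta> i))
        * (1 - (\<Sum>i<N. x i)) powr (\<beta> N - 1) * (\<Prod>i<N. x i powr (\<beta> i - 1))"
  unfolding dir_dens_def by (rule if_P) (use assms in blast)

lemma dir_dens_zero:
  assumes "\<not> ((\<forall>i<N. 0 < x i) \<and> (\<Sum>i<N. x i) < 1)"
  shows "dir_dens N \<beta> x = 0"
  unfolding dir_dens_def by (rule if_not_P) (rule assms)

lemma dir_dens_measurable [measurable]: "dir_dens N \<beta> \<in> borel_measurable Msp"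
proof -
  have "(\<lambda>x. dir_dens N \<beta> x) = (\<lambda>x. if (\<forall>i\<in>{..<N}. 0 < x i) \<and> (\<Sum>i<N. x i) < 1 then
        Gamma (\<Sum>i\<le>N. \<beta> i) / (\<Prod>i\<le>N. Gamma (\<beta> i))
        * (1 - (\<Sum>i<N. x i)) powr (\<beta> N - 1) * (\<Prod>i<N. x i powr (\<beta> i - 1))
      else 0)" unfolding dir_dens_def by (simp only: Ball_def lessThan_iff)
  also have "\<dots> \<in> borel_measurable Msp" by measurable
  finally show ?thesis by simp
qed

lemma dir_dens_cong:
  assumes "\<And>i. i \<le> N \<Longrightarrow> \<beta> i = \<gamma> i" "\<And>i. i < N \<Longrightarrow> x i = y i"
  shows "dir_dens N \<beta> x = dir_dens N \<gamma> y"
proof -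
  have 1: "(\<forall>i<N. 0 < x i) = (\<forall>i<N. 0 < y i)" using assms(2) by auto
  have 2: "(\<Sum>i<N. x i) = (\<Sum>i<N. y i)" by (rule sum.cong) (use assms in auto)
  have 3: "(\<Sum>i\<le>N. \<beta> i) = (\<Sum>i\<le>N. \<gamma> i)" by (rule sum.cong) (use assms in auto)
  have 4: "(\<Prod>i\<le>N. Gamma (\<beta> i)) = (\<Prod>i\<le>N. Gamma (\<gamma> i))" by (rule prod.cong) (use assms in auto)
  have 5: "(\<Prod>i<N. x i powr (\<beta> i - 1)) = (\<Prod>i<N. y i powr (\<gamma> i - 1))" by (rule prod.cong) (use assms in auto)
  show ?thesis unfolding dir_dens_def 1 2 3 4 5 assms(1)[OF order_refl] by (rule refl)
qed

lemma dir_dens_ext0: "dir_dens N \<beta> (ext0 N x) = dir_dens N \<beta> x"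
  by (rule dir_dens_cong) (auto simp: ext0_def)

lemma dir_dens_measurable_PiM [measurable]: "dir_dens N \<beta> \<in> borel_measurable (Pi\<^sub>M {..<N} (\<lambda>_. lborel))"
proof -
  have "(\<lambda>x. dir_dens N \<beta> (ext0 N x)) \<in> borel_measurable (Pi\<^sub>M {..<N} (\<lambda>_. lborel))" by measurable
  then show ?thesis by (simp add: dir_dens_ext0)
qed

lemma dir_dens_nonneg:
  assumes "\<And>i. i \<le> N \<Longrightarrow> 0 < \<beta> i" shows "0 \<le> dir_dens N \<beta> x"
proof -
  have "0 < (\<Sum>i\<le>N. \<beta> i)" using assms by (intro sum_pos) auto
  then have "0 < Gamma (\<Sum>i\<le>N. \<beta> i)" by (rule Gamma_real_pos)
  moreover have "0 < (\<Prod>i\<le>N. Gamma (\<beta> i))" using assms by (intro prod_pos) (auto intro: Gamma_real_pos)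
  ultimately have "0 \<le> Gamma (\<Sum>i\<le>N. \<beta> i) / (\<Prod>i\<le>N. Gamma (\<beta> i))" by simp
  then have "0 \<le> Gamma (\<Sum>i\<le>N. \<beta> i) / (\<Prod>i\<le>N. Gamma (\<beta> i))
        * (1 - (\<Sum>i<N. x i)) powr (\<beta> N - 1) * (\<Prod>i<N. x i powr (\<beta> i - 1))"
    by (intro mult_nonneg_nonneg prod_nonneg) auto
  then show ?thesis unfolding dir_dens_def by (simp only: if_split order_refl simp_thms)
qed

lemma dirichlet_cong:
  assumes "\<And>i. i \<le> N \<Longrightarrow> \<beta> i = \<gamma> i" shows "dirichlet N \<beta> = dirichlet N \<gamma>"
proof -
  have "dir_dens N \<beta> = dir_dens N \<gamma>"
    by (rule ext) (rule dir_dens_cong, auto simp: assms)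
  then show ?thesis by (simp add: dirichlet_def)
qed

lemma sets_dirichlet [simp, measurable_cong]: "sets (dirichlet N \<beta>) = sets Msp"
  by (simp add: dirichlet_def)

lemma nn_integral_dirichlet:
  assumes [measurable]: "h \<in> borel_measurable Msp"
  shows "(\<integral>\<^sup>+x. h x \<partial>dirichlet N \<beta>) = (\<integral>\<^sup>+x. ennreal (dir_dens N \<beta> x) * h (ext0 N x) \<partial>Pi\<^sub>M {..<N} (\<lambda>_. lborel))"
  unfolding dirichlet_def by (subst nn_integral_distr) (auto simp: nn_integral_density)

text \<open>One stick-breaking step. Finite Dirichlet laws, the marginals of \<open>mu\<close> and
  the measures \<open>mu_n\<close> are all images under this map, which is what makes them
  comparable.\<close>

definition break_off :: "nat \<Rightarrow> real \<times> pt \<Rightarrow> pt" where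
  "break_off N = (\<lambda>(t, x). (ext0 N x)(N := (1 - (\<Sum>i<N. x i)) * t))"

lemma break_off_measurable [measurable]: "break_off N \<in> measurable (borel \<Otimes>\<^sub>M Msp) Msp"
proof (rule measurable_Msp_I)
  fix i
  have "(\<lambda>p. break_off N p i) = (\<lambda>p. if i = N then (1 - (\<Sum>i<N. snd p i)) * fst p else if i < N then snd p i else 0)"
    by (auto simp: break_off_def ext0_def)
  also have "\<dots> \<in> borel_measurable (borel \<Otimes>\<^sub>M Msp)" by measurable
  finally show "(\<lambda>p. break_off N p i) \<in> borel_measurable (borel \<Otimes>\<^sub>M Msp)" .
qed

lemma break_off_ext0: "break_off N (t, ext0 N x) = break_off N (t, x)"
  by (auto simp: break_off_def ext0_def)

lemma upd_measurable [measurable]: "(\<lambda>y. x(N := y)) \<in> measurable borel Msp"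
proof (rule measurable_Msp_I)
  show "(\<lambda>y. (x(N := y)) i) \<in> borel_measurable borel" for i by (cases "i = N") auto
qed

text \<open>The density factorizes under the substitution \<open>y = s * t\<close>, whose Jacobian
  is the factor \<open>s\<close> on the left: the last two parameters merge into their sum, and the
  split between them is Beta distributed.\<close>

lemma dir_dens_step:
  assumes \<beta>: "\<And>i. i \<le> Suc N \<Longrightarrow> 0 < \<beta> i"
    and x: "\<And>i. i < N \<Longrightarrow> 0 < x i" and s: "0 < s" "s = 1 - (\<Sum>i<N. x i)"
  shows "s * dir_dens (Suc N) \<beta> (x(N := s * t)) =
    dir_dens N (\<beta>(N := \<beta> N + \<beta> (Suc N))) x * beta_dens (\<beta> N) (\<beta> (Suc N)) t"
proof (cases "0 < t \<and> t < 1")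
  case True
  then have t: "0 < t" "t < 1" by auto
  let ?x = "x(N := s * t)" and ?\<beta> = "\<beta>(N := \<beta> N + \<beta> (Suc N))"
  let ?a = "\<beta> N" and ?b = "\<beta> (Suc N)"
  let ?P = "\<Prod>i<N. x i powr (\<beta> i - 1)" and ?Q = "\<Prod>i<N. Gamma (\<beta> i)"
  have ab: "0 < ?a" "0 < ?b" using \<beta> by auto
  have sum: "(\<Sum>i<N. ?x i) = 1 - s" "(\<Sum>i<Suc N. ?x i) = 1 - s * (1 - t)" using s(2) by (auto simp: algebra_simps)
  have c1: "\<And>i. i < Suc N \<Longrightarrow> 0 < ?x i" "(\<Sum>i<Suc N. ?x i) < 1"
    unfolding sum using x s t by (auto simp: less_Suc_eq)
  have c2: "(\<Sum>i<N. x i) < 1" using s by auto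
  have P: "(\<Prod>i<Suc N. ?x i powr (\<beta> i - 1)) = ?P * (s * t) powr (?a - 1)" by simp
  have P': "(\<Prod>i<N. x i powr (?\<beta> i - 1)) = ?P" by (rule prod.cong) auto
  have Q: "(\<Prod>i\<le>Suc N. Gamma (\<beta> i)) = ?Q * Gamma ?a * Gamma ?b"
    by (simp add: atMost_Suc lessThan_Suc_atMost[symmetric] mult_ac)
  have Q': "(\<Prod>i\<le>N. Gamma (?\<beta> i)) = ?Q * Gamma (?a + ?b)"
    by (simp add: lessThan_Suc_atMost[symmetric])
  have S: "(\<Sum>i\<le>N. ?\<beta> i) = (\<Sum>i\<le>Suc N. \<beta> i)"
    by (simp add: lessThan_Suc_atMost[symmetric])
  have pw: "s * ((s * (1 - t)) powr (?b - 1) * (s * t) powr (?a - 1)) =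
      s powr (?a + ?b - 1) * (t powr (?a - 1) * (1 - t) powr (?b - 1))"
  proof -
    have "s * (s powr (?b - 1) * s powr (?a - 1)) = s powr (?a + ?b - 1)"
      using s(1) powr_mult_base[of s "?b - 1 + (?a - 1)"] by (simp add: powr_add[symmetric] algebra_simps)
    then show ?thesis using s(1) t by (simp add: powr_mult mult_ac)
  qed
  have D1: "dir_dens (Suc N) \<beta> ?x = Gamma (\<Sum>i\<le>Suc N. \<beta> i) / (\<Prod>i\<le>Suc N. Gamma (\<beta> i))
      * (1 - (\<Sum>i<Suc N. ?x i)) powr (\<beta> (Suc N) - 1) * (\<Prod>i<Suc N. ?x i powr (\<beta> i - 1))"
    by (rule dir_dens_pos) (use c1 in blast)+
  have D2: "dir_dens N ?\<beta> x = Gamma (\<Sum>i\<le>N. ?\<beta> i) / (\<Prod>i\<le>N. Gamma (?\<beta> i))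
      * (1 - (\<Sum>i<N. x i)) powr (?\<beta> N - 1) * (\<Prod>i<N. x i powr (?\<beta> i - 1))"
    by (rule dir_dens_pos) (use x c2 in blast)+
  have "s * dir_dens (Suc N) \<beta> ?x = Gamma (\<Sum>i\<le>Suc N. \<beta> i) / (?Q * Gamma ?a * Gamma ?b) * ?P *
      (s * ((s * (1 - t)) powr (?b - 1) * (s * t) powr (?a - 1)))"
    unfolding D1 P Q sum by (simp add: mult_ac)
  also have "\<dots> = (Gamma (\<Sum>i\<le>Suc N. \<beta> i) / (?Q * Gamma (?a + ?b)) * s powr (?a + ?b - 1) * ?P) *
      (t powr (?a - 1) * (1 - t) powr (?b - 1) / Beta ?a ?b)"
  proof -
    have *: "A / (Q * Ga * Gb) * P * (S * X) = (A / (Q * Gab) * S * P) * (X / (Ga * Gb / Gab))"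
      if "Gab \<noteq> 0" for A Q Ga Gb P S X Gab :: real
      using that by (simp add: mult_ac)
    have "Gamma (?a + ?b) \<noteq> 0" using Gamma_real_pos[of "?a + ?b"] ab by linarith
    then show ?thesis unfolding pw Beta_def by (rule *)
  qed
  also have "\<dots> = dir_dens N ?\<beta> x * beta_dens ?a ?b t"
    unfolding D2 P' Q' S beta_dens_def using t s(2) by simp
  finally show ?thesis .
next
  case False
  let ?x = "x(N := s * t)"
  have sum: "(\<Sum>i<N. ?x i) = 1 - s" "(\<Sum>i<Suc N. ?x i) = 1 - s * (1 - t)" using s(2) by (auto simp: algebra_simps)
  have "\<not> ((\<forall>i<Suc N. 0 < ?x i) \<and> (\<Sum>i<Suc N. ?x i) < 1)"
  proof
    assume *: "(\<forall>i<Suc N. 0 < ?x i) \<and> (\<Sum>i<Suc N. ?x i) < 1"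
    then have "0 < s * t" "0 < s * (1 - t)" unfolding sum by auto
    then show False using False s(1) by (simp add: zero_less_mult_iff)
  qed
  then have "dir_dens (Suc N) \<beta> ?x = 0" by (rule dir_dens_zero)
  then show ?thesis using False by (auto simp: beta_dens_def)
qed

text \<open>Inside the open simplex this is an affine substitution in the last coordinate; elsewhere
  both densities vanish.\<close>

lemma dir_dens_step_nn:
  assumes \<beta>: "\<And>i. i \<le> Suc N \<Longrightarrow> 0 < \<beta> i" and [measurable]: "h \<in> borel_measurable Msp"
  shows "(\<integral>\<^sup>+y. ennreal (dir_dens (Suc N) \<beta> (x(N := y))) * h (ext0 (Suc N) (x(N := y))) \<partial>lborel) =
    ennreal (dir_dens N (\<beta>(N := \<beta> N + \<beta> (Suc N))) x) *
      (\<integral>\<^sup>+t. h (break_off N (t, ext0 N x)) \<partial>beta_measure (\<beta> N) (\<beta> (Suc N)))"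
proof -
  let ?\<beta> = "\<beta>(N := \<beta> N + \<beta> (Suc N))"
  define s where "s = 1 - (\<Sum>i<N. x i)"
  have \<beta>': "0 < ?\<beta> i" if "i \<le> N" for i
    using \<beta>[of i] \<beta>[of N] \<beta>[of "Suc N"] that by simp
  have nD': "0 \<le> dir_dens N ?\<beta> y" for y by (rule dir_dens_nonneg) (rule \<beta>')
  have nD: "0 \<le> dir_dens (Suc N) \<beta> y" for y by (rule dir_dens_nonneg) (rule \<beta>)
  have nB: "0 \<le> beta_dens (\<beta> N) (\<beta> (Suc N)) t" for t by (rule beta_dens_nonneg; rule \<beta>; simp)
  have pair [measurable]: "(\<lambda>t. (t, ext0 N x)) \<in> measurable borel (borel \<Otimes>\<^sub>M Msp)"
    by (rule measurable_Pair[OF measurable_ident_sets[OF refl] measurable_const]) simp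
  have hb [measurable]: "(\<lambda>t. h (break_off N (t, ext0 N x))) \<in> borel_measurable borel"
    by (rule measurable_compose[OF measurable_compose[OF pair break_off_measurable] assms(2)])
  have hd [measurable]: "(\<lambda>t. ennreal (beta_dens (\<beta> N) (\<beta> (Suc N)) t)) \<in> borel_measurable borel"
    by (rule measurable_compose[OF beta_dens_measurable measurable_ennreal])
  have hy [measurable]: "(\<lambda>y. ennreal (dir_dens (Suc N) \<beta> (x(N := y))) * h (ext0 (Suc N) (x(N := y)))) \<in> borel_measurable borel"
    by (intro borel_measurable_times_ennreal measurable_compose[OF measurable_compose[OF upd_measurable dir_dens_measurable] measurable_ennreal]
       measurable_compose[OF measurable_compose[OF upd_measurable ext0_measurable] assms(2)])
  have R: "(\<integral>\<^sup>+t. h (break_off N (t, ext0 N x)) \<partial>beta_measure (\<beta> N) (\<beta> (Suc N))) =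
    (\<integral>\<^sup>+t. ennreal (beta_dens (\<beta> N) (\<beta> (Suc N)) t) * h (break_off N (t, ext0 N x)) \<partial>lborel)"
    unfolding beta_measure_def by (rule nn_integral_density) (use hb hd in simp_all)
  show ?thesis
  proof (cases "(\<forall>i<N. 0 < x i) \<and> 0 < s")
    case True
    then have xs: "\<And>i. i < N \<Longrightarrow> 0 < x i" "0 < s" by auto
    have "(\<integral>\<^sup>+y. ennreal (dir_dens (Suc N) \<beta> (x(N := y))) * h (ext0 (Suc N) (x(N := y))) \<partial>lborel) =
       ennreal s * (\<integral>\<^sup>+t. ennreal (dir_dens (Suc N) \<beta> (x(N := 0 + s * t))) * h (ext0 (Suc N) (x(N := 0 + s * t))) \<partial>lborel)"
      using xs(2) by (subst nn_integral_real_affine[OF hy, where c=s and t=0]) auto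
    also have "\<dots> = (\<integral>\<^sup>+t. ennreal s * (ennreal (dir_dens (Suc N) \<beta> (x(N := s * t))) * h (ext0 (Suc N) (x(N := s * t)))) \<partial>lborel)"
    proof -
      have "(\<lambda>t. 0 + s * t) \<in> borel_measurable borel" by measurable
      from measurable_compose[OF this hy]
      have "(\<lambda>t. ennreal (dir_dens (Suc N) \<beta> (x(N := 0 + s * t))) * h (ext0 (Suc N) (x(N := 0 + s * t)))) \<in> borel_measurable lborel"
        by simp
      from nn_integral_cmult[OF this, of "ennreal s"] show ?thesis by simp
    qed
    also have "\<dots> = (\<integral>\<^sup>+t. ennreal (dir_dens N ?\<beta> x) * (ennreal (beta_dens (\<beta> N) (\<beta> (Suc N)) t) * h (break_off N (t, ext0 N x))) \<partial>lborel)"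
    proof (rule nn_integral_cong)
      fix t
      have e: "ext0 (Suc N) (x(N := s * t)) = break_off N (t, ext0 N x)"
        by (auto simp: ext0_def break_off_def s_def less_Suc_eq)
      have "ennreal s * ennreal (dir_dens (Suc N) \<beta> (x(N := s * t))) =
        ennreal (dir_dens N ?\<beta> x) * ennreal (beta_dens (\<beta> N) (\<beta> (Suc N)) t)"
        using dir_dens_step[of N \<beta> x s t, OF \<beta> xs(1) xs(2) s_def] xs(2) nD nD' nB by (simp add: ennreal_mult[symmetric])
      then show "ennreal s * (ennreal (dir_dens (Suc N) \<beta> (x(N := s * t))) * h (ext0 (Suc N) (x(N := s * t)))) =
        ennreal (dir_dens N ?\<beta> x) * (ennreal (beta_dens (\<beta> N) (\<beta> (Suc N)) t) * h (break_off N (t, ext0 N x)))"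
        unfolding e by (simp add: mult.assoc[symmetric])
    qed
    also have "\<dots> = ennreal (dir_dens N ?\<beta> x) * (\<integral>\<^sup>+t. ennreal (beta_dens (\<beta> N) (\<beta> (Suc N)) t) * h (break_off N (t, ext0 N x)) \<partial>lborel)"
      by (rule nn_integral_cmult) (use hb hd in simp)
    finally show ?thesis unfolding R .
  next
    case False
    have 1: "dir_dens N ?\<beta> x = 0" by (rule dir_dens_zero) (use False in \<open>auto simp: s_def\<close>)
    have 2: "dir_dens (Suc N) \<beta> (x(N := y)) = 0" for y
    proof -
      have "\<not> ((\<forall>i<Suc N. 0 < (x(N := y)) i) \<and> (\<Sum>i<Suc N. (x(N := y)) i) < 1)"
      proof
        assume *: "(\<forall>i<Suc N. 0 < (x(N := y)) i) \<and> (\<Sum>i<Suc N. (x(N := y)) i) < 1"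
        then have "0 < (x(N := y)) N" by blast
        then have y: "0 < y" by simp
        have "\<forall>i<N. 0 < x i" using * by (metis fun_upd_other less_Suc_eq less_irrefl)
        moreover have "(\<Sum>i<N. x i) + y < 1" using * by simp
        ultimately show False using False y by (simp add: s_def)
      qed
      then show ?thesis by (rule dir_dens_zero)
    qed
    show ?thesis unfolding 1 2 by simp
  qed
qed

text \<open>Fubini in the last coordinate. That the smaller Dirichlet law is a probability measure
  is taken as a hypothesis, because in the applications it comes for free: that law is a marginal of
  \<open>mu\<close>.\<close>

lemma dirichlet_Suc:
  assumes \<beta>: "\<And>i. i \<le> Suc N \<Longrightarrow> 0 < \<beta> i"
    and p: "prob_space (dirichlet N (\<beta>(N := \<beta> N + \<beta> (Suc N))))" (is "prob_space ?D")
  shows "dirichlet (Suc N) \<beta> = distr (beta_measure (\<beta> N) (\<beta> (Suc N)) \<Otimes>\<^sub>M ?D) Msp (break_off N)"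
proof (rule measure_eqI)
  let ?B = "beta_measure (\<beta> N) (\<beta> (Suc N))"
  interpret D: prob_space ?D by (rule p)
  interpret B: prob_space ?B by (rule prob_space_beta_measure) (use \<beta> in auto)
  interpret BD: pair_sigma_finite ?B ?D ..
  interpret product_sigma_finite "\<lambda>_::nat. lborel :: real measure" ..
  have sD: "sets (?B \<Otimes>\<^sub>M ?D) = sets (borel \<Otimes>\<^sub>M Msp)" by (rule sets_pair_measure_cong) auto
  show "sets (dirichlet (Suc N) \<beta>) = sets (distr (?B \<Otimes>\<^sub>M ?D) Msp (break_off N))" by simp
  fix A assume "A \<in> sets (dirichlet (Suc N) \<beta>)"
  then have A [measurable]: "A \<in> sets Msp" by simp
  let ?h = "indicator A :: pt \<Rightarrow> ennreal"
  have "emeasure (dirichlet (Suc N) \<beta>) A = (\<integral>\<^sup>+x. ?h x \<partial>dirichlet (Suc N) \<beta>)" by simp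
  also have "\<dots> = (\<integral>\<^sup>+x. ennreal (dir_dens (Suc N) \<beta> x) * ?h (ext0 (Suc N) x) \<partial>Pi\<^sub>M {..<Suc N} (\<lambda>_. lborel))"
    by (rule nn_integral_dirichlet) measurable
  also have "\<dots> = (\<integral>\<^sup>+x. (\<integral>\<^sup>+y. ennreal (dir_dens (Suc N) \<beta> (x(N := y))) * ?h (ext0 (Suc N) (x(N := y))) \<partial>lborel) \<partial>Pi\<^sub>M {..<N} (\<lambda>_. lborel))"
    unfolding lessThan_Suc by (rule product_nn_integral_insert) (auto simp flip: lessThan_Suc)
  also have "\<dots> = (\<integral>\<^sup>+x. ennreal (dir_dens N (\<beta>(N := \<beta> N + \<beta> (Suc N))) x) *
      (\<integral>\<^sup>+t. ?h (break_off N (t, ext0 N x)) \<partial>?B) \<partial>Pi\<^sub>M {..<N} (\<lambda>_. lborel))"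
    by (rule nn_integral_cong, rule dir_dens_step_nn[OF \<beta>]) auto
  also have "\<dots> = (\<integral>\<^sup>+x. (\<integral>\<^sup>+t. ?h (break_off N (t, x)) \<partial>?B) \<partial>?D)"
    by (rule nn_integral_dirichlet[symmetric]) measurable
  also have "\<dots> = (\<integral>\<^sup>+p. ?h (break_off N p) \<partial>(?B \<Otimes>\<^sub>M ?D))"
    by (rule BD.nn_integral_snd) (simp add: measurable_cong_sets[OF sD refl])
  also have "\<dots> = (\<integral>\<^sup>+x. ?h x \<partial>distr (?B \<Otimes>\<^sub>M ?D) Msp (break_off N))"
    by (rule nn_integral_distr[symmetric]) (simp_all add: measurable_cong_sets[OF sD refl])
  finally show "emeasure (dirichlet (Suc N) \<beta>) A = emeasure (distr (?B \<Otimes>\<^sub>M ?D) Msp (break_off N)) A"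
    by simp
qed

subsection \<open>Integration by parts for finite Dirichlet laws\<close>

text \<open>The function \<open>y powr p * (a - y) powr r * F y\<close> is an antiderivative that
  vanishes at both ends because \<open>p\<close> and \<open>r\<close> are positive. The integrand
  may be unbounded near the ends, hence the fundamental theorem in its interior form.\<close>

lemma dirichlet_1d_ibp:
  fixes F F' :: "real \<Rightarrow> real"
  assumes p: "0 < p" "0 < r" and a: "0 < a"
    and F: "\<And>y. (F has_real_derivative F' y) (at y)"
  defines "f \<equiv> \<lambda>y. if 0 < y \<and> y < a then (a - y) powr (r - 1) * y powr (p - 1) *
      (y * (a - y) * F' y + (p * (a - y) - r * y) * F y) else 0"
  shows "(\<integral>y. f y \<partial>lborel) = 0"
\<comment> \<open>A non-integrable function has Bochner integral 0 by convention, so that case holds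
  trivially; the same split occurs in \<open>dirichlet_ibp\<close>.\<close>
proof (cases "integrable lborel f")
  case True
  define H where "H y = y powr p * (a - y) powr r * F y" for y
  have Fc: "continuous_on {0..a} F" using F by (intro DERIV_continuous_on) (auto intro: has_field_derivative_at_within)
  have "continuous_on {0..a} H"
    unfolding H_def using p by (intro continuous_intros continuous_on_powr' Fc) auto
  moreover have "(H has_vector_derivative f y) (at y)" if "y \<in> {0<..<a}" for y
  proof -
    have y: "0 < y" "0 < a - y" using that by auto
    have d1: "((\<lambda>y. y powr p) has_real_derivative p * y powr (p - 1)) (at y)"
      by (rule has_real_derivative_powr[OF y(1)])
    have "((\<lambda>y. a - y) has_real_derivative -1) (at y)" by (auto intro!: derivative_eq_intros)
    from DERIV_chain2[OF has_real_derivative_powr[OF y(2)] this]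
    have d2: "((\<lambda>y. (a - y) powr r) has_real_derivative - (r * (a - y) powr (r - 1))) (at y)" by simp
    have e1: "y powr p = y * y powr (p - 1)" using powr_mult_base[of y "p - 1"] y by simp
    have e2: "(a - y) powr r = (a - y) * (a - y) powr (r - 1)" using powr_mult_base[of "a - y" "r - 1"] y by simp
    have "(H has_real_derivative (p * y powr (p - 1) * (a - y) powr r + - (r * (a - y) powr (r - 1)) * y powr p) * F y
        + F' y * (y powr p * (a - y) powr r)) (at y)"
      unfolding H_def by (rule DERIV_mult[OF DERIV_mult[OF d1 d2] F])
    also have "(p * y powr (p - 1) * (a - y) powr r + - (r * (a - y) powr (r - 1)) * y powr p) * F y
        + F' y * (y powr p * (a - y) powr r) = f y"
      unfolding f_def e1 e2 using that by (simp add: algebra_simps)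
    finally show ?thesis by (simp add: has_real_derivative_iff_has_vector_derivative)
  qed
  ultimately have "(f has_integral (H a - H 0)) {0..a}"
    using a by (intro fundamental_theorem_of_calculus_interior) auto
  then have "(f has_integral 0) {0..a}" by (simp add: H_def)
  then have "((\<lambda>y. if y \<in> {0..a} then f y else 0) has_integral 0) UNIV"
    by (simp only: has_integral_restrict_UNIV)
  moreover have "(\<lambda>y. if y \<in> {0..a} then f y else 0) = f" by (auto simp: f_def fun_eq_iff)
  ultimately have "(f has_integral 0) UNIV" by simp
  with has_integral_integral_lborel[OF True] show ?thesis by (rule has_integral_unique)
qed (rule not_integrable_integral_eq)

text \<open>With the other coordinates fixed, the density in coordinate \<open>n\<close> is a
  multiple of \<open>y powr (\<beta> n - 1) * (a - y) powr (\<beta> m - 1)\<close>, where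
  \<open>a\<close> is the mass they leave. The one-dimensional identity makes the inner integral of
  Fubini vanish for every choice of them.\<close>

lemma dirichlet_ibp:
  assumes \<beta>: "\<And>i. i \<le> m \<Longrightarrow> 0 < \<beta> i" and n: "n < m"
    and F: "F \<in> FC1"
  shows "(\<integral>x. x n * (1 - (\<Sum>i<m. x i)) * partial n F x + (\<beta> n * (1 - (\<Sum>i<m. x i)) - \<beta> m * x n) * F x \<partial>dirichlet m \<beta>) = 0"
proof -
  define K where "K x = x n * (1 - (\<Sum>i<m. x i)) * partial n F x + (\<beta> n * (1 - (\<Sum>i<m. x i)) - \<beta> m * x n) * F x" for x
  note [measurable] = FC1D(4)[OF F] FC1D(5)[OF F]
  have K [measurable]: "K \<in> borel_measurable Msp" unfolding K_def by measurable
  define \<Phi> where "\<Phi> x = dir_dens m \<beta> x * K (ext0 m x)" for x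
  define I where "I = {..<m} - {n}"
  have I: "{..<m} = insert n I" "finite I" "n \<notin> I" using n by (auto simp: I_def)
  have "(\<integral>x. K x \<partial>dirichlet m \<beta>) = (\<integral>x. \<Phi> x \<partial>Pi\<^sub>M {..<m} (\<lambda>_. lborel))"
    unfolding dirichlet_def \<Phi>_def using dir_dens_nonneg[of m \<beta>, OF \<beta>]
    by (subst integral_distr) (auto simp: integral_density)
  also have "\<dots> = 0"
  proof (cases "integrable (Pi\<^sub>M {..<m} (\<lambda>_. lborel)) \<Phi>")
    case True
    interpret product_sigma_finite "\<lambda>_::nat. lborel :: real measure" ..
    have inner: "(\<integral>y. \<Phi> (x(n := y)) \<partial>lborel) = 0" for x
    proof -
      let ?a = "1 - (\<Sum>i\<in>I. x i)"
      have sum: "(\<Sum>i<m. (x(n := y)) i) = y + (\<Sum>i\<in>I. x i)" for y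
      proof -
        have "(\<Sum>i\<in>I. (x(n := y)) i) = (\<Sum>i\<in>I. x i)" using I(3) by (intro sum.cong) auto
        then show ?thesis unfolding I(1) using I(2,3) by simp
      qed
      define z where "z = ext0 m x"
      have ez: "ext0 m (x(n := y)) = z(n := y)" for y using n by (auto simp: z_def ext0_def)
      have zs: "(\<Sum>i<m. (z(n := y)) i) = y + (\<Sum>i\<in>I. x i)" for y
        unfolding sum[symmetric] by (rule sum.cong) (auto simp: z_def ext0_def)
      have Kz: "K (z(n := y)) = y * (?a - y) * partial n F (z(n := y)) + (\<beta> n * (?a - y) - \<beta> m * y) * F (z(n := y))" for y
        unfolding K_def zs by (simp add: algebra_simps)
      have cond: "(\<forall>i<m. 0 < (x(n := y)) i) \<and> (\<Sum>i<m. (x(n := y)) i) < 1 \<longleftrightarrow> (\<forall>i\<in>I. 0 < x i) \<and> 0 < y \<and> y < ?a" for y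
        unfolding sum using n by (auto simp: I_def)
      show ?thesis
      proof (cases "(\<forall>i\<in>I. 0 < x i) \<and> 0 < ?a")
        case True
        let ?C = "Gamma (\<Sum>i\<le>m. \<beta> i) / (\<Prod>i\<le>m. Gamma (\<beta> i)) * (\<Prod>i\<in>I. x i powr (\<beta> i - 1))"
        let ?f = "\<lambda>y. if 0 < y \<and> y < ?a then (?a - y) powr (\<beta> m - 1) * y powr (\<beta> n - 1) *
          (y * (?a - y) * partial n F (z(n := y)) + (\<beta> n * (?a - y) - \<beta> m * y) * F (z(n := y))) else 0"
        have prod: "(\<Prod>i<m. (x(n := y)) i powr (\<beta> i - 1)) = y powr (\<beta> n - 1) * (\<Prod>i\<in>I. x i powr (\<beta> i - 1))" for y
        proof -
          have "(\<Prod>i\<in>I. (x(n := y)) i powr (\<beta> i - 1)) = (\<Prod>i\<in>I. x i powr (\<beta> i - 1))"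
            using I(3) by (intro prod.cong) auto
          then show ?thesis unfolding I(1) using I(2,3) by simp
        qed
        have "\<Phi> (x(n := y)) = ?C * ?f y" for y
        proof (cases "0 < y \<and> y < ?a")
          case y: True
          have c: "(\<forall>i<m. 0 < (x(n := y)) i) \<and> (\<Sum>i<m. (x(n := y)) i) < 1" using True y unfolding cond by blast
          have a: "1 - (y + (\<Sum>i\<in>I. x i)) = ?a - y" by simp
          have d: "dir_dens m \<beta> (x(n := y)) = ?C * ((?a - y) powr (\<beta> m - 1) * y powr (\<beta> n - 1))"
            by (subst dir_dens_pos) (use c in blast, use c in blast, simp only: prod sum a mult_ac times_divide_eq_left times_divide_eq_right)
          show ?thesis unfolding \<Phi>_def d ez Kz if_P[OF y] by (simp only: mult.assoc)
        next
          case y: False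
          then have c: "\<not> ((\<forall>i<m. 0 < (x(n := y)) i) \<and> (\<Sum>i<m. (x(n := y)) i) < 1)" unfolding cond by blast
          show ?thesis unfolding \<Phi>_def dir_dens_zero[OF c] if_not_P[OF y] by simp
        qed
        then have "(\<integral>y. \<Phi> (x(n := y)) \<partial>lborel) = ?C * (\<integral>y. ?f y \<partial>lborel)" by simp
        also have "(\<integral>y. ?f y \<partial>lborel) = 0"
          using True \<beta> n by (intro dirichlet_1d_ibp partial_has_derivative FC1D(2)[OF F]) auto
        finally show ?thesis by (simp only: mult_zero_right)
      next
        case False
        have "\<not> ((\<forall>i<m. 0 < (x(n := y)) i) \<and> (\<Sum>i<m. (x(n := y)) i) < 1)" for y
          unfolding cond using False by auto
        then have "\<Phi> (x(n := y)) = 0" for y unfolding \<Phi>_def by (simp add: dir_dens_zero)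
        then show ?thesis by simp
      qed
    qed
    have "(\<integral>x. \<Phi> x \<partial>Pi\<^sub>M {..<m} (\<lambda>_. lborel)) = (\<integral>x. (\<integral>y. \<Phi> (x(n := y)) \<partial>lborel) \<partial>Pi\<^sub>M I (\<lambda>_. lborel))"
      using True unfolding I(1) by (rule product_integral_insert[OF I(2,3)])
    then show ?thesis unfolding inner by simp
  qed (rule not_integrable_integral_eq)
  finally show ?thesis unfolding K_def .
qed

subsection \<open>The infinite Dirichlet law by stick breaking\<close>

definition stick :: "pt \<Rightarrow> pt" where
  "stick v i = v i * (\<Prod>j<i. 1 - v j)"

lemma sum_stick: "1 - (\<Sum>i<n. stick v i) = (\<Prod>j<n. 1 - v j)"
  by (induction n) (simp_all add: stick_def algebra_simps)

lemma stick_measurable [measurable]: "stick \<in> measurable Msp Msp"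
  by (rule measurable_Msp_I) (unfold stick_def, measurable)

lemma stick_in_Delta:
  assumes "\<And>i. 0 < v i \<and> v i < 1" shows "stick v \<in> Delta_inf"
proof -
  have p: "0 \<le> (\<Prod>j<n. 1 - v j)" "(\<Prod>j<n. 1 - v j) \<le> 1" for n
    using assms by (auto intro!: prod_nonneg prod_le_1 simp: less_imp_le)
  have "0 \<le> stick v i" "stick v i \<le> 1" for i
    unfolding stick_def using p[of i] assms[of i] by (auto intro: mult_le_one simp: less_imp_le)
  moreover have "(\<Sum>i<n. stick v i) \<le> 1" for n using sum_stick[of v n] p(1)[of n] by linarith
  ultimately show ?thesis by (simp add: Delta_inf_eq)
qed

locale simplex_params =
  fixes \<alpha> :: "nat \<Rightarrow> real" and ainf :: real
  assumes pos: "\<And>i. 0 < \<alpha> i" and summ: "summable \<alpha>" and ainf_pos: "0 < ainf"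
begin

definition tl :: "nat \<Rightarrow> real" where
  "tl N = (\<Sum>j. \<alpha> (j + N)) + ainf"

lemma tail_pos: "0 < (\<Sum>j. \<alpha> (j + N))"
  using summable_ignore_initial_segment[OF summ, of N] pos by (intro suminf_pos) auto

lemma tl_pos: "0 < tl N"
  using tail_pos[of N] ainf_pos by (simp add: tl_def)

lemma tl_Suc: "tl N = \<alpha> N + tl (Suc N)"
  using suminf_split_head[OF summable_ignore_initial_segment[OF summ, of N]] by (simp add: tl_def)

lemma tail_tendsto: "(\<lambda>N. \<Sum>j. \<alpha> (j + N)) \<longlonglongrightarrow> 0"
proof -
  have "(\<lambda>N. suminf \<alpha> - (\<Sum>i<N. \<alpha> i)) \<longlonglongrightarrow> suminf \<alpha> - suminf \<alpha>"
    by (intro tendsto_intros summable_LIMSEQ summ)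
  then show ?thesis by (simp add: suminf_minus_initial_segment[OF summ])
qed

lemma tl_tendsto: "tl \<longlonglongrightarrow> ainf"
  using tendsto_add[OF tail_tendsto tendsto_const[of ainf]] by (simp add: tl_def[abs_def])

definition V :: "nat \<Rightarrow> real measure" where
  "V i = beta_measure (\<alpha> i) (tl (Suc i))"

lemma prob_V: "prob_space (V i)"
  unfolding V_def by (rule prob_space_beta_measure[OF pos tl_pos])

lemma sets_V [measurable_cong, simp]: "sets (V i) = sets borel" by (simp add: V_def)

definition \<Omega> :: "pt measure" where "\<Omega> = Pi\<^sub>M UNIV V"

lemma sets_\<Omega> [measurable_cong, simp]: "sets \<Omega> = sets Msp"
  unfolding \<Omega>_def Msp_def by (rule sets_PiM_cong) auto

lemma prob_\<Omega>: "prob_space \<Omega>"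
  unfolding \<Omega>_def by (rule prob_space_PiM[OF prob_V])

lemma AE_\<Omega>: "AE v in \<Omega>. \<forall>i. 0 < v i \<and> v i < 1"
  unfolding AE_all_countable \<Omega>_def
proof
  fix i
  show "AE v in Pi\<^sub>M UNIV V. 0 < v i \<and> v i < 1"
    by (rule AE_PiM_component[OF prob_V UNIV_I, of "\<lambda>t. 0 < t \<and> t < 1"]) (unfold V_def, rule AE_beta_measure)
qed

text \<open>Takes the place of an independence argument: the fresh fraction \<open>t\<close> is
  independent of the whole of \<open>v\<close>, in particular of the pieces before
  \<open>N\<close>.\<close>

lemma \<Omega>_resample: "distr (V N \<Otimes>\<^sub>M \<Omega>) \<Omega> (\<lambda>(t, v). v(N := t)) = \<Omega>"
  using distr_pair_PiM_eq_PiM[of UNIV V N, OF prob_V prob_V] by (simp add: \<Omega>_def)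

definition mu :: "pt measure" where "mu = distr \<Omega> Msp stick"

lemma sets_mu [measurable_cong, simp]: "sets mu = sets Msp" by (simp add: mu_def)

lemma space_mu [simp]: "space mu = UNIV" by (simp add: mu_def)

lemma stick_measurable_\<Omega>: "stick \<in> measurable \<Omega> Msp"
  by (simp add: measurable_cong_sets[OF sets_\<Omega> refl])

lemma prob_mu: "prob_space mu"
  unfolding mu_def by (rule prob_space.prob_space_distr[OF prob_\<Omega> stick_measurable_\<Omega>])

sublocale mu: pt_prob_space mu
  using prob_mu by (simp add: pt_prob_space_def)

lemma AE_mu: "AE x in mu. x \<in> Delta_inf"
  unfolding mu_def
proof (subst AE_distr_iff[OF stick_measurable_\<Omega>])
  show "{x \<in> space Msp. x \<in> Delta_inf} \<in> sets Msp" by simp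
  show "AE x in \<Omega>. stick x \<in> Delta_inf" using AE_\<Omega> by eventually_elim (rule stick_in_Delta, blast)
qed

lemma emeasure_mu_Delta: "emeasure mu Delta_inf = 1"
  by (rule mu.emeasure_eq_1_AE[OF _ AE_mu]) simp

lemma break_off_measurable_mu: "break_off N \<in> measurable (V N \<Otimes>\<^sub>M mu) Msp"
proof -
  have s: "sets (V N \<Otimes>\<^sub>M mu) = sets (borel \<Otimes>\<^sub>M Msp)" by (rule sets_pair_measure_cong) simp_all
  show ?thesis unfolding measurable_cong_sets[OF s refl] by (rule break_off_measurable)
qed

text \<open>The first \<open>N\<close> sticks do not involve \<open>v N\<close>, so after
  resampling, piece \<open>N\<close> is the fresh fraction \<open>t\<close> of the mass left by an
  independent point of law \<open>mu\<close>.\<close>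

lemma marginal_Suc: "distr mu Msp (ext0 (Suc N)) = distr (V N \<Otimes>\<^sub>M mu) Msp (break_off N)"
proof -
  interpret VN: prob_space "V N" by (rule prob_V)
  interpret O: prob_space \<Omega> by (rule prob_\<Omega>)
  have s1: "sets (V N \<Otimes>\<^sub>M \<Omega>) = sets (borel \<Otimes>\<^sub>M Msp)" by (rule sets_pair_measure_cong) simp_all
  have upd: "(\<lambda>(t, v). v(N := t)) \<in> measurable (V N \<Otimes>\<^sub>M \<Omega>) \<Omega>"
  proof -
    have "(\<lambda>p. (snd p)(N := fst p)) \<in> measurable (borel \<Otimes>\<^sub>M Msp) Msp"
    proof (rule measurable_Msp_I)
      fix i show "(\<lambda>p. ((snd p)(N := fst p)) i) \<in> borel_measurable (borel \<Otimes>\<^sub>M Msp)"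
        by (cases "i = N") auto
    qed
    then show ?thesis
      by (simp add: measurable_cong_sets[OF s1 sets_\<Omega>] case_prod_unfold)
  qed
  have e1: "distr (V N) (V N) (\<lambda>t. t) = V N" by (rule distr_id)
  have mu_sf: "sigma_finite_measure (distr \<Omega> Msp stick)"
    using prob_mu unfolding mu_def by (simp add: prob_space_imp_sigma_finite)
  have pm: "V N \<Otimes>\<^sub>M mu = distr (V N \<Otimes>\<^sub>M \<Omega>) (V N \<Otimes>\<^sub>M Msp) (\<lambda>(t, v). (t, stick v))"
    using pair_measure_distr[OF measurable_ident stick_measurable_\<Omega> mu_sf, of "V N"] unfolding e1[unfolded id_def[symmetric]]
    by (simp add: mu_def id_def distr_id)
  have ps: "(\<lambda>(t, v). (t, stick v)) \<in> measurable (V N \<Otimes>\<^sub>M \<Omega>) (V N \<Otimes>\<^sub>M Msp)"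
    using stick_measurable_\<Omega> by measurable
  have bo: "break_off N \<in> measurable (V N \<Otimes>\<^sub>M Msp) Msp"
  proof -
    have s: "sets (V N \<Otimes>\<^sub>M Msp) = sets (borel \<Otimes>\<^sub>M Msp)" by (rule sets_pair_measure_cong) simp_all
    show ?thesis unfolding measurable_cong_sets[OF s refl] by (rule break_off_measurable)
  qed
  have es: "(\<lambda>v. ext0 (Suc N) (stick v)) \<in> measurable \<Omega> Msp"
    by (rule measurable_compose[OF stick_measurable_\<Omega> ext0_measurable])
  have "distr mu Msp (ext0 (Suc N)) = distr \<Omega> Msp (\<lambda>v. ext0 (Suc N) (stick v))"
    unfolding mu_def by (subst distr_distr[OF ext0_measurable stick_measurable_\<Omega>]) (simp add: comp_def)
  also have "\<dots> = distr (distr (V N \<Otimes>\<^sub>M \<Omega>) \<Omega> (\<lambda>(t, v). v(N := t))) Msp (\<lambda>v. ext0 (Suc N) (stick v))"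
    by (simp only: \<Omega>_resample)
  also have "\<dots> = distr (V N \<Otimes>\<^sub>M \<Omega>) Msp ((\<lambda>v. ext0 (Suc N) (stick v)) \<circ> (\<lambda>(t, v). v(N := t)))"
    by (rule distr_distr[OF es upd])
  also have "(\<lambda>v. ext0 (Suc N) (stick v)) \<circ> (\<lambda>(t, v). v(N := t)) = break_off N \<circ> (\<lambda>(t, v). (t, stick v))"
  proof (rule ext, clarsimp)
    fix t v
    have lt: "stick (v(N := t)) i = stick v i" if "i < N" for i
      unfolding stick_def using that by (intro arg_cong2[where f="(*)"] prod.cong) auto
    have "stick (v(N := t)) N = t * (\<Prod>j<N. 1 - v j)"
      unfolding stick_def by (intro arg_cong2[where f="(*)"] prod.cong) auto
    then have "stick (v(N := t)) N = (1 - (\<Sum>i<N. stick v i)) * t" by (simp add: sum_stick)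
    with lt show "ext0 (Suc N) (stick (v(N := t))) = break_off N (t, stick v)"
      by (auto simp: ext0_def break_off_def fun_eq_iff less_Suc_eq)
  qed
  also have "distr (V N \<Otimes>\<^sub>M \<Omega>) Msp (break_off N \<circ> (\<lambda>(t, v). (t, stick v))) =
     distr (distr (V N \<Otimes>\<^sub>M \<Omega>) (V N \<Otimes>\<^sub>M Msp) (\<lambda>(t, v). (t, stick v))) Msp (break_off N)"
    by (rule distr_distr[OF bo ps, symmetric])
  finally show ?thesis unfolding pm .
qed

text \<open>Parameters of the marginal on the first \<open>N\<close> coordinates; the last one,
  \<open>tl N\<close>, accounts for all mass outside them, whether it sits in later coordinates or
  is missing.\<close>

definition bvec :: "nat \<Rightarrow> nat \<Rightarrow> real" where
  "bvec N i = (if i < N then \<alpha> i else tl N)"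

lemma bvec_pos: "0 < bvec N i" using pos tl_pos by (simp add: bvec_def)

text \<open>Both sides below only see the first \<open>N\<close> coordinates of the old point, so the break-off
  step of the Dirichlet laws matches that of the stick-breaking construction.\<close>

lemma break_off_distr_ext0:
  assumes B: "prob_space B" "sets B = sets borel"
  shows "distr (B \<Otimes>\<^sub>M mu) Msp (break_off N) = distr (B \<Otimes>\<^sub>M distr mu Msp (ext0 N)) Msp (break_off N)"
proof -
  interpret B: prob_space B by (rule B(1))
  have em: "ext0 N \<in> measurable mu Msp" by (simp add: measurable_cong_sets[OF sets_mu refl])
  have sf: "sigma_finite_measure (distr mu Msp (ext0 N))"
    using mu.prob_space_distr[OF em] by (simp add: prob_space_imp_sigma_finite)
  have pm: "B \<Otimes>\<^sub>M distr mu Msp (ext0 N) = distr (B \<Otimes>\<^sub>M mu) (B \<Otimes>\<^sub>M Msp) (\<lambda>(t, x). (t, ext0 N x))"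
    using pair_measure_distr[OF measurable_ident em sf, of B] by (simp add: id_def distr_id)
  have ps: "(\<lambda>(t, x). (t, ext0 N x)) \<in> measurable (B \<Otimes>\<^sub>M mu) (B \<Otimes>\<^sub>M Msp)"
    using em by measurable
  have bo: "break_off N \<in> measurable (B \<Otimes>\<^sub>M Msp) Msp"
  proof -
    have s: "sets (B \<Otimes>\<^sub>M Msp) = sets (borel \<Otimes>\<^sub>M Msp)" by (rule sets_pair_measure_cong) (auto simp: B)
    show ?thesis unfolding measurable_cong_sets[OF s refl] by (rule break_off_measurable)
  qed
  have "distr (B \<Otimes>\<^sub>M distr mu Msp (ext0 N)) Msp (break_off N) =
      distr (B \<Otimes>\<^sub>M mu) Msp (break_off N \<circ> (\<lambda>(t, x). (t, ext0 N x)))"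
    unfolding pm by (rule distr_distr[OF bo ps])
  also have "break_off N \<circ> (\<lambda>(t, x). (t, ext0 N x)) = break_off N"
    by (rule ext) (auto simp: break_off_ext0)
  finally show ?thesis by simp
qed

lemma prob_marginal: "prob_space (distr mu Msp (ext0 N))"
  by (rule mu.prob_space_distr) (simp add: measurable_cong_sets[OF sets_mu refl])

lemma marginal: "distr mu Msp (ext0 N) = dirichlet N (bvec N)"
proof (induction N)
  case 0
  have e: "ext0 0 = (\<lambda>x i. 0)" by (auto simp: ext0_def)
  have d: "dir_dens 0 (bvec 0) x = 1" for x
    using Gamma_real_pos[OF tl_pos[of 0]] by (simp add: dir_dens_def bvec_def)
  have 1: "density (Pi\<^sub>M {..<0::nat} (\<lambda>_. lborel :: real measure)) (\<lambda>x. ennreal (dir_dens 0 (bvec 0) x)) = Pi\<^sub>M {} (\<lambda>_. lborel)"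
    by (simp add: d density_1)
  have p: "prob_space (Pi\<^sub>M {} (\<lambda>_::nat. lborel :: real measure))" by (rule prob_space_PiM) simp
  have "distr (Pi\<^sub>M {} (\<lambda>_::nat. lborel :: real measure)) Msp (\<lambda>x i. 0) = return Msp (\<lambda>i. 0)"
    by (rule prob_space.distr_const[OF p]) simp
  moreover have "distr mu Msp (\<lambda>x i. 0) = return Msp (\<lambda>i. 0)"
    by (rule mu.distr_const) simp
  ultimately show ?case unfolding dirichlet_def 1 unfolding e by simp
next
  case (Suc N)
  have c: "dirichlet N ((bvec (Suc N))(N := bvec (Suc N) N + bvec (Suc N) (Suc N))) = dirichlet N (bvec N)"
    by (rule dirichlet_cong) (auto simp: bvec_def tl_Suc[of N])
  have V: "beta_measure (bvec (Suc N) N) (bvec (Suc N) (Suc N)) = V N" by (simp add: bvec_def V_def)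
  have "dirichlet (Suc N) (bvec (Suc N)) = distr (V N \<Otimes>\<^sub>M dirichlet N (bvec N)) Msp (break_off N)"
    using dirichlet_Suc[of N "bvec (Suc N)"] prob_marginal[of N] unfolding c V Suc by (simp add: bvec_pos)
  also have "\<dots> = distr mu Msp (ext0 (Suc N))"
    unfolding marginal_Suc Suc[symmetric] by (rule break_off_distr_ext0[OF prob_V sets_V, symmetric])
  finally show ?case by simp
qed

text \<open>Merging the last two parameters of \<open>alpha_vec\<close> gives \<open>bvec n\<close>,
  so \<open>mu_n\<close> arises from a point of law \<open>mu\<close> by lumping everything from
  index \<open>n\<close> on into one Beta fraction. All \<open>mu_n\<close> thereby live on one
  coupled space with \<open>mu\<close>.\<close>

lemma mu_n_eq: "mu_n (Suc n) \<alpha> ainf = distr (beta_measure (\<Sum>j. \<alpha> (j + n)) ainf \<Otimes>\<^sub>M mu) Msp (break_off n)"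
proof -
  let ?a = "alpha_vec (Suc n) \<alpha> ainf" and ?B = "beta_measure (\<Sum>j. \<alpha> (j + n)) ainf"
  have p: "0 < ?a i" for i using pos tail_pos ainf_pos by (auto simp: alpha_vec_def)
  have c: "dirichlet n (?a(n := ?a n + ?a (Suc n))) = dirichlet n (bvec n)"
    by (rule dirichlet_cong) (auto simp: bvec_def alpha_vec_def tl_def)
  have B: "beta_measure (?a n) (?a (Suc n)) = ?B" by (simp add: alpha_vec_def)
  have "mu_n (Suc n) \<alpha> ainf = distr (?B \<Otimes>\<^sub>M dirichlet n (bvec n)) Msp (break_off n)"
    unfolding mu_n_def using dirichlet_Suc[of n ?a] prob_marginal[of n] unfolding c B marginal by (simp add: p)
  also have "\<dots> = distr (?B \<Otimes>\<^sub>M mu) Msp (break_off n)"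
    unfolding marginal[symmetric]
    by (rule break_off_distr_ext0[OF prob_space_beta_measure[OF tail_pos ainf_pos] sets_beta_measure, symmetric])
  finally show ?thesis .
qed

subsection \<open>Weak convergence\<close>

text \<open>Two changes make up the distance: the mass of \<open>x\<close> from index
  \<open>n\<close> on is dropped, and a piece of size at most \<open>t\<close> is inserted.\<close>

lemma break_off_in_Delta:
  assumes x: "x \<in> Delta_inf" and t: "0 \<le> t" "t \<le> 1"
  shows "break_off n (t, x) \<in> Delta_inf"
    "l1dist x (break_off n (t, x)) \<le> (suminf x - (\<Sum>i<n. x i)) + t"
proof -
  note D = Delta_infD[OF x]
  let ?s = "1 - (\<Sum>i<n. x i)"
  let ?y = "break_off n (t, x)"
  have s: "0 \<le> ?s" "?s \<le> 1" using D(4) D(6)[of n] D(1) by (auto simp: sum_nonneg)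
  have st: "0 \<le> ?s * t" "?s * t \<le> ?s" "?s * t \<le> t" using s t by (auto simp: mult_left_le mult_left_le_one_le)
  have y: "?y i = (if i < n then x i else if i = n then ?s * t else 0)" for i
    by (auto simp: break_off_def ext0_def)
  have ysum: "(\<Sum>i<k. ?y i) \<le> 1" for k
  proof -
    have "(\<Sum>i<k. ?y i) \<le> (\<Sum>i<max k (Suc n). ?y i)"
      using D(1) st by (intro sum_mono2) (auto simp: y)
    also have "\<dots> = (\<Sum>i<Suc n. ?y i)"
      by (rule sum.mono_neutral_right) (auto simp: y)
    also have "\<dots> = (\<Sum>i<n. x i) + ?s * t" by (simp add: y)
    also have "\<dots> \<le> 1" using st by linarith
    finally show ?thesis .
  qed
  show "?y \<in> Delta_inf" unfolding Delta_inf_eq using D(1,2) s st t ysum by (auto simp: y)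
  let ?z = "\<lambda>i. (if i < n then 0 else x i) + (if i = n then ?s * t else 0)"
  have su: "(\<lambda>i. if i < n then 0 else x i) sums (suminf x - (\<Sum>i<n. x i))"
  proof -
    have "(\<lambda>i. x i - (if i \<in> {..<n} then x i else 0)) sums (suminf x - (\<Sum>i<n. x i))"
      by (intro sums_diff summable_sums D sums_If_finite_set) simp
    then show ?thesis by (rule sums_cong[THEN iffD1, rotated]) auto
  qed
  have zs: "?z sums ((suminf x - (\<Sum>i<n. x i)) + ?s * t)"
    by (intro sums_add su sums_single)
  have le: "\<bar>x i - ?y i\<bar> \<le> ?z i" for i using D(1)[of i] st(1) by (auto simp: y)
  have "summable (\<lambda>i. \<bar>x i - ?y i\<bar>)"
    by (rule summable_comparison_test'[OF sums_summable[OF zs], of 0]) (use le in auto)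
  then have "l1dist x ?y \<le> (\<Sum>i. ?z i)" unfolding l1dist_def by (intro suminf_le le sums_summable[OF zs])
  also have "\<dots> = (suminf x - (\<Sum>i<n. x i)) + ?s * t" using zs by (rule sums_unique[symmetric])
  finally show "l1dist x ?y \<le> (suminf x - (\<Sum>i<n. x i)) + t" using st by linarith
qed

lemma weak_convergence: "weak_conv_Delta (\<lambda>n. mu_n (Suc n) \<alpha> ainf) mu"
  unfolding weak_conv_Delta_def
proof (intro allI impI)
  fix f assume f [measurable]: "f \<in> borel_measurable Msp" and bf: "bounded (f ` Delta_inf)"
    and cf: "l1_continuous_on Delta_inf f"
  obtain C where C: "0 < C" "\<And>x. x \<in> Delta_inf \<Longrightarrow> \<bar>f x\<bar> \<le> C" using bf by (auto simp: bounded_pos)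
  define a where "a n = (\<Sum>j. \<alpha> (j + n))" for n
  define B where "B n = beta_measure (a n) ainf" for n
  have a: "0 < a n" for n unfolding a_def by (rule tail_pos)
  have pB: "prob_space (B n)" for n unfolding B_def by (rule prob_space_beta_measure[OF a ainf_pos])
  have sB [measurable_cong, simp]: "sets (B n) = sets borel" for n by (simp add: B_def)
  have AEB: "AE t in B n. 0 < t \<and> t < 1" for n unfolding B_def by (rule AE_beta_measure)
  have sp: "sets (B n \<Otimes>\<^sub>M mu) = sets (borel \<Otimes>\<^sub>M Msp)" for n by (rule sets_pair_measure_cong) simp_all
  have bo: "break_off n \<in> measurable (B n \<Otimes>\<^sub>M mu) Msp" for n unfolding measurable_cong_sets[OF sp refl] by (rule break_off_measurable)
  have fb: "(\<lambda>p. f (break_off n p)) \<in> borel_measurable (B n \<Otimes>\<^sub>M mu)" for n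
    by (rule measurable_compose[OF bo f])
  have fx: "(\<lambda>t. f (break_off n (t, x))) \<in> borel_measurable borel" for n x
  proof -
    have "(\<lambda>t. (t, x)) \<in> measurable borel (borel \<Otimes>\<^sub>M Msp)"
      by (rule measurable_Pair[OF measurable_ident_sets[OF refl] measurable_const]) simp
    from measurable_compose[OF measurable_compose[OF this break_off_measurable] f] show ?thesis .
  qed
  \<comment> \<open>Integrating out the fraction first leaves functions on the fixed space of
    \<open>mu\<close>, so that dominated convergence applies.\<close>
  define G where "G n x = (\<integral>t. f (break_off n (t, x)) \<partial>B n)" for n x
  have int: "(\<integral>x. f x \<partial>mu_n (Suc n) \<alpha> ainf) = (\<integral>x. G n x \<partial>mu)" and Gm: "G n \<in> borel_measurable mu" for n
  proof -
    interpret B: prob_space "B n" by (rule pB)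
    interpret P: pair_prob_space "B n" mu by unfold_locales
    have "AE p in B n \<Otimes>\<^sub>M mu. \<bar>f (break_off n p)\<bar> \<le> C"
    proof -
      have "AE t in B n. AE x in mu. \<bar>f (break_off n (t, x))\<bar> \<le> C"
        using AEB[of n]
      proof eventually_elim
        case (elim t)
        show ?case using AE_mu by eventually_elim (intro C(2) break_off_in_Delta(1), use elim in auto)
      qed
      moreover have "{p \<in> space (B n \<Otimes>\<^sub>M mu). \<bar>f (break_off n p)\<bar> \<le> C} \<in> sets (B n \<Otimes>\<^sub>M mu)"
        using fb by measurable
      ultimately show ?thesis by (intro P.AE_pair_measure) auto
    qed
    then have i: "integrable (B n \<Otimes>\<^sub>M mu) (\<lambda>p. f (break_off n p))"
      by (intro P.integrable_const_bound[of _ C] fb) auto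
    show "G n \<in> borel_measurable mu"
      using borel_measurable_integrable[OF P.integrable_snd[of "\<lambda>t x. f (break_off n (t, x))"]] i
      by (simp add: G_def[abs_def])
    have "(\<integral>x. f x \<partial>mu_n (Suc n) \<alpha> ainf) = (\<integral>p. f (break_off n p) \<partial>(B n \<Otimes>\<^sub>M mu))"
      unfolding mu_n_eq B_def[symmetric] a_def[symmetric] by (rule integral_distr[OF bo f])
    also have "\<dots> = (\<integral>x. G n x \<partial>mu)"
      unfolding G_def using P.integral_snd[of "\<lambda>t x. f (break_off n (t, x))"] i by (simp add: case_prod_eta[symmetric] case_prod_unfold)
    finally show "(\<integral>x. f x \<partial>mu_n (Suc n) \<alpha> ainf) = (\<integral>x. G n x \<partial>mu)" .
  qed
  have Gb: "\<bar>G n x\<bar> \<le> C" if "x \<in> Delta_inf" for n x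
  proof -
    interpret B: prob_space "B n" by (rule pB)
    have AE: "AE t in B n. \<bar>f (break_off n (t, x))\<bar> \<le> C"
      using AEB[of n] by eventually_elim (intro C(2) break_off_in_Delta(1)[OF that], auto)
    have "\<bar>G n x\<bar> \<le> (\<integral>t. \<bar>f (break_off n (t, x))\<bar> \<partial>B n)" unfolding G_def by (rule integral_abs_bound)
    also have "\<dots> \<le> (\<integral>t. C \<partial>B n)"
      using AE fx[of n x] C(1) by (intro integral_mono_AE B.integrable_const_bound[of _ C]) (auto simp: measurable_cong_sets[OF sB refl])
    finally show ?thesis by (simp add: B.prob_space)
  qed
  have lim: "(\<lambda>n. G n x) \<longlonglongrightarrow> f x" if x: "x \<in> Delta_inf" for x
  proof (rule LIMSEQ_I)
    fix r :: real assume "0 < r"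
    then obtain d where d: "0 < d" "\<And>y. y \<in> Delta_inf \<Longrightarrow> l1dist x y < d \<Longrightarrow> \<bar>f y - f x\<bar> < r/2"
      using cf[unfolded l1_continuous_on_def, rule_format, OF x, of "r/2"] by auto
    \<comment> \<open>Markov's inequality in pointwise form: for \<open>t < d/2\<close> continuity
      at \<open>x\<close> applies, and otherwise the crude bound \<open>2 * C\<close> is at most
      \<open>2 * C * (2 / d) * t\<close>. The mean of \<open>t\<close> is
      \<open>a n / (a n + ainf)\<close>, which tends to 0.\<close>
    have bound: "\<bar>G n x - f x\<bar> \<le> r/2 + 2 * C * (2 / d) * (a n / (a n + ainf))"
      if small: "suminf x - (\<Sum>i<n. x i) < d/2" for n
    proof -
      interpret B: prob_space "B n" by (rule pB)
      have AE: "AE t in B n. \<bar>f (break_off n (t, x)) - f x\<bar> \<le> r/2 + 2 * C * (2 / d) * t"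
        using AEB[of n]
      proof eventually_elim
        case (elim t)
        have y: "break_off n (t, x) \<in> Delta_inf" by (rule break_off_in_Delta(1)[OF x]) (use elim in auto)
        have l: "l1dist x (break_off n (t, x)) \<le> (suminf x - (\<Sum>i<n. x i)) + t"
          by (rule break_off_in_Delta(2)[OF x]) (use elim in auto)
        have p: "0 \<le> 2 * C * (2 / d) * t" using C(1) d(1) elim by simp
        show ?case
        proof (cases "t < d/2")
          case True
          then have "l1dist x (break_off n (t, x)) < d" using l small by simp
          from d(2)[OF y this] p show ?thesis by linarith
        next
          case False
          have "\<bar>f (break_off n (t, x)) - f x\<bar> \<le> 2 * C * 1" using C(2)[OF y] C(2)[OF x] by linarith
          also have "\<dots> \<le> 2 * C * (2 / d * t)" using False d(1) C(1) by (intro mult_left_mono) (auto simp: field_simps)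
          finally show ?thesis using \<open>0 < r\<close> by simp
        qed
      qed
      have it: "integrable (B n) (\<lambda>t. t)" "(\<integral>t. t \<partial>B n) = a n / (a n + ainf)"
        unfolding B_def by (rule beta_mean[OF a ainf_pos])+
      have if1: "integrable (B n) (\<lambda>t. f (break_off n (t, x)))"
      proof (rule B.integrable_const_bound[of _ C])
        show "AE t in B n. norm (f (break_off n (t, x))) \<le> C"
          using AEB[of n]
        proof eventually_elim
          case (elim t)
          then show ?case using C(2)[OF break_off_in_Delta(1)[OF x, of t n]] by simp
        qed
        show "(\<lambda>t. f (break_off n (t, x))) \<in> borel_measurable (B n)"
          using fx[of n x] by (simp add: measurable_cong_sets[OF sB refl])
      qed
      have "G n x - f x = (\<integral>t. f (break_off n (t, x)) - f x \<partial>B n)"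
        unfolding G_def using if1 by (simp add: B.prob_space)
      then have "\<bar>G n x - f x\<bar> \<le> (\<integral>t. \<bar>f (break_off n (t, x)) - f x\<bar> \<partial>B n)"
        using integral_abs_bound[of "B n" "\<lambda>t. f (break_off n (t, x)) - f x"] by simp
      also have "\<dots> \<le> (\<integral>t. r/2 + 2 * C * (2 / d) * t \<partial>B n)"
        by (rule integral_mono_AE[OF _ _ AE]) (use if1 it in auto)
      also have "\<dots> = r/2 + 2 * C * (2 / d) * (a n / (a n + ainf))"
        using it by (simp add: B.prob_space)
      finally show ?thesis .
    qed
    have "(\<lambda>n. suminf x - (\<Sum>i<n. x i)) \<longlonglongrightarrow> suminf x - suminf x"
      by (intro tendsto_intros summable_LIMSEQ Delta_infD[OF x])
    then have e1: "\<forall>\<^sub>F n in sequentially. suminf x - (\<Sum>i<n. x i) < d/2"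
      using d(1) by (intro order_tendstoD(2)[of _ 0]) auto
    have "(\<lambda>n. 2 * C * (2 / d) * (a n / (a n + ainf))) \<longlonglongrightarrow> 2 * C * (2 / d) * (0 / (0 + ainf))"
      unfolding a_def using ainf_pos by (intro tendsto_intros tail_tendsto) auto
    then have e2: "\<forall>\<^sub>F n in sequentially. 2 * C * (2 / d) * (a n / (a n + ainf)) < r/2"
      using \<open>0 < r\<close> by (intro order_tendstoD(2)[of _ 0]) auto
    have "\<forall>\<^sub>F n in sequentially. norm (G n x - f x) < r"
      using e1 e2 by eventually_elim (use bound in fastforce)
    then show "\<exists>no. \<forall>n\<ge>no. norm (G n x - f x) < r" by (simp add: eventually_sequentially)
  qed
  show "(\<lambda>n. \<integral>x. f x \<partial>mu_n (Suc n) \<alpha> ainf) \<longlonglongrightarrow> (\<integral>x. f x \<partial>mu)"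
    unfolding int
  proof (rule integral_dominated_convergence[where w="\<lambda>_. C"])
    show "f \<in> borel_measurable mu" by (simp add: measurable_cong_sets[OF sets_mu refl])
    show "AE x in mu. (\<lambda>n. G n x) \<longlonglongrightarrow> f x" using AE_mu by eventually_elim (rule lim)
    show "AE x in mu. norm (G n x) \<le> C" for n using AE_mu by eventually_elim (simp add: Gb)
  qed (auto intro: Gm)
qed

subsection \<open>Integration by parts for the infinite Dirichlet law\<close>

lemma integral_ext0:
  fixes h :: "pt \<Rightarrow> real"
  assumes "h \<in> borel_measurable Msp"
  shows "(\<integral>x. h (ext0 N x) \<partial>mu) = (\<integral>x. h x \<partial>dirichlet N (bvec N))"
  unfolding marginal[symmetric]
  by (rule integral_distr[OF _ assms, symmetric]) (simp add: measurable_cong_sets[OF sets_mu refl])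

lemma depends_on_first_ext0: "depends_on_first m f \<Longrightarrow> f (ext0 m x) = f x"
  by (rule depends_on_firstD) (auto simp: ext0_def)

lemma rest_abs_le:
  assumes "x \<in> Delta_inf" shows "\<bar>1 - (\<Sum>i<m. x i)\<bar> \<le> 1"
proof -
  have "0 \<le> (\<Sum>i<m. x i)" using Delta_infD(1)[OF assms] by (intro sum_nonneg)
  then show ?thesis using Delta_infD(4)[OF assms] Delta_infD(6)[OF assms, of m] by simp
qed

text \<open>The fraction with law \<open>V M\<close> is independent of the first \<open>M\<close>
  coordinates, so it shrinks the remaining mass on average by
  \<open>1 - \<alpha> M / tl M = tl (Suc M) / tl M\<close>.\<close>

lemma rest_step:
  assumes h [measurable]: "h \<in> borel_measurable Msp" and dep: "depends_on_first M h"
    and bd: "\<And>x. x \<in> Delta_inf \<Longrightarrow> \<bar>h x\<bar> \<le> B"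
  shows "(\<integral>x. h x * (1 - (\<Sum>i<Suc M. x i)) \<partial>mu) = tl (Suc M) / tl M * (\<integral>x. h x * (1 - (\<Sum>i<M. x i)) \<partial>mu)"
proof -
  interpret VM: prob_space "V M" by (rule prob_V)
  interpret P: pair_prob_space "V M" mu by unfold_locales
  define \<Phi> where "\<Phi> y = h y * (1 - (\<Sum>i<Suc M. y i))" for y
  have \<Phi>m [measurable]: "\<Phi> \<in> borel_measurable Msp" unfolding \<Phi>_def by measurable
  have hm: "h \<in> borel_measurable mu" by (simp add: measurable_cong_sets[OF sets_mu refl])
  define k where "k x = h x * (1 - (\<Sum>i<M. x i))" for x
  have km: "k \<in> borel_measurable mu" unfolding k_def by (simp add: measurable_cong_sets[OF sets_mu refl])
  have B0: "0 \<le> B" using bd[of "\<lambda>i. 0"] by (auto simp: Delta_inf_def)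
  have kb: "AE x in mu. norm (k x) \<le> B"
    using AE_mu
  proof eventually_elim
    case (elim x)
    have "\<bar>h x\<bar> * \<bar>1 - (\<Sum>i<M. x i)\<bar> \<le> B * 1"
      using B0 by (intro mult_mono bd[OF elim] rest_abs_le[OF elim]) auto
    then show ?case by (simp add: k_def abs_mult)
  qed
  have ki: "integrable mu k" using kb by (intro mu.integrable_const_bound[of _ B] km) auto
  have eq: "\<Phi> (break_off M (t, x)) = (1 - t) * k x" for t x
  proof -
    have "h (break_off M (t, x)) = h x" by (rule depends_on_firstD[OF dep]) (auto simp: break_off_def ext0_def)
    moreover have "(\<Sum>i<Suc M. break_off M (t, x) i) = (\<Sum>i<M. x i) + (1 - (\<Sum>i<M. x i)) * t"
      by (simp add: break_off_def ext0_def)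
    ultimately show ?thesis unfolding \<Phi>_def k_def by (simp only:) (simp add: algebra_simps)
  qed
  have t1: "integrable (V M) (\<lambda>t. 1 - t)" "(\<integral>t. 1 - t \<partial>V M) = tl (Suc M) / tl M"
  proof -
    have t: "integrable (V M) (\<lambda>t. t)" "(\<integral>t. t \<partial>V M) = \<alpha> M / (\<alpha> M + tl (Suc M))"
      unfolding V_def by (rule beta_mean[OF pos tl_pos])+
    then show "integrable (V M) (\<lambda>t. 1 - t)" by simp
    have "(\<integral>t. 1 - t \<partial>V M) = 1 - \<alpha> M / (\<alpha> M + tl (Suc M))" using t by (simp add: VM.prob_space)
    then show "(\<integral>t. 1 - t \<partial>V M) = tl (Suc M) / tl M"
      using tl_pos[of M] tl_Suc[of M] by (simp add: field_simps)
  qed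
  have "(\<integral>x. \<Phi> x \<partial>mu) = (\<integral>x. \<Phi> (ext0 (Suc M) x) \<partial>mu)"
  proof (rule Bochner_Integration.integral_cong[OF refl])
    fix x
    have "h (ext0 (Suc M) x) = h x" by (rule depends_on_firstD[OF dep]) (auto simp: ext0_def)
    then show "\<Phi> x = \<Phi> (ext0 (Suc M) x)" unfolding \<Phi>_def by (simp add: ext0_def)
  qed
  also have "\<dots> = (\<integral>x. \<Phi> x \<partial>distr mu Msp (ext0 (Suc M)))"
    by (rule integral_distr[symmetric]) (auto simp: measurable_cong_sets[OF sets_mu refl])
  also have "\<dots> = (\<integral>p. \<Phi> (break_off M p) \<partial>(V M \<Otimes>\<^sub>M mu))"
    unfolding marginal_Suc by (rule integral_distr[OF break_off_measurable_mu \<Phi>m])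
  also have "\<dots> = (\<integral>p. (1 - fst p) * k (snd p) \<partial>(V M \<Otimes>\<^sub>M mu))"
    by (rule Bochner_Integration.integral_cong[OF refl]) (metis eq prod.collapse)
  also have "\<dots> = (\<integral>x. (\<integral>t. (1 - t) * k x \<partial>V M) \<partial>mu)"
  proof -
    have "integrable (V M \<Otimes>\<^sub>M mu) (\<lambda>(t, x). (1 - t) * k x)"
    proof (rule P.integrable_const_bound[of _ B])
      have tm: "(\<lambda>t. 1 - t) \<in> borel_measurable (V M)" using t1(1) by auto
      show m: "(\<lambda>(t, x). (1 - t) * k x) \<in> borel_measurable (V M \<Otimes>\<^sub>M mu)"
        unfolding case_prod_unfold
        by (intro borel_measurable_times measurable_compose[OF measurable_fst tm] measurable_compose[OF measurable_snd km])
      have "AE t in V M. AE x in mu. norm ((\<lambda>(t, x). (1 - t) * k x) (t, x)) \<le> B"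
        using AE_beta_measure[of "\<alpha> M" "tl (Suc M)", folded V_def]
      proof eventually_elim
        case (elim t)
        show ?case using kb
        proof eventually_elim
          case (elim x)
          have "\<bar>1 - t\<bar> * \<bar>k x\<bar> \<le> 1 * B" using elim \<open>0 < t \<and> t < 1\<close> by (intro mult_mono) auto
          then show ?case by (simp add: abs_mult)
        qed
      qed
      then show "AE p in V M \<Otimes>\<^sub>M mu. norm ((\<lambda>(t, x). (1 - t) * k x) p) \<le> B"
        by (intro P.AE_pair_measure) (use m in measurable)
    qed
    from P.integral_snd[OF this] show ?thesis by (simp add: case_prod_unfold)
  qed
  also have "\<dots> = tl (Suc M) / tl M * (\<integral>x. k x \<partial>mu)" using t1(2) by simp
  finally show ?thesis unfolding \<Phi>_def k_def .
qed

text \<open>Given the first \<open>m\<close> coordinates, the remaining mass \<open>1 - |x|\<close> has conditional mean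
  \<open>ainf / tl m\<close> times \<open>1 - x\<^sub>1 - \<dots> - x\<^sub>m\<close>.\<close>

lemma rest_mean:
  assumes h [measurable]: "h \<in> borel_measurable Msp" and dep: "depends_on_first m h"
    and bd: "\<And>x. x \<in> Delta_inf \<Longrightarrow> \<bar>h x\<bar> \<le> B"
  shows "(\<integral>x. h x * (1 - suminf x) \<partial>mu) = ainf / tl m * (\<integral>x. h x * (1 - (\<Sum>i<m. x i)) \<partial>mu)"
proof -
  let ?J = "\<lambda>M. \<integral>x. h x * (1 - (\<Sum>i<M. x i)) \<partial>mu"
  have B0: "0 \<le> B" using bd[of "\<lambda>i. 0"] by (auto simp: Delta_inf_def)
  have J: "?J (m + k) = tl (m + k) / tl m * ?J m" for k
  proof (induction k)
    case 0
    show ?case using tl_pos[of m] by simp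
  next
    case (Suc k)
    have "?J (Suc (m + k)) = tl (Suc (m + k)) / tl (m + k) * ?J (m + k)"
      by (rule rest_step[OF h depends_on_first_mono[OF dep] bd]) auto
    then show ?case unfolding Suc using tl_pos[of "m + k"] by simp
  qed
  have "(\<lambda>k. ?J (m + k)) \<longlonglongrightarrow> (\<integral>x. h x * (1 - suminf x) \<partial>mu)"
  proof (rule integral_dominated_convergence[where w="\<lambda>_. B"])
    show "(\<lambda>x. h x * (1 - suminf x)) \<in> borel_measurable mu" "(\<lambda>x. h x * (1 - (\<Sum>i<m + k. x i))) \<in> borel_measurable mu" for k
      by (simp_all add: measurable_cong_sets[OF sets_mu refl])
    show "AE x in mu. (\<lambda>k. h x * (1 - (\<Sum>i<m + k. x i))) \<longlonglongrightarrow> h x * (1 - suminf x)"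
      using AE_mu
    proof eventually_elim
      case (elim x)
      have "(\<lambda>k. \<Sum>i<k + m. x i) \<longlonglongrightarrow> suminf x"
        by (rule LIMSEQ_ignore_initial_segment[OF summable_LIMSEQ[OF Delta_infD(3)[OF elim]]])
      then show ?case by (intro tendsto_intros) (simp add: add.commute)
    qed
    show "AE x in mu. norm (h x * (1 - (\<Sum>i<m + k. x i))) \<le> B" for k
      using AE_mu
    proof eventually_elim
      case (elim x)
      have "\<bar>h x\<bar> * \<bar>1 - (\<Sum>i<m + k. x i)\<bar> \<le> B * 1"
        using B0 by (intro mult_mono bd[OF elim] rest_abs_le[OF elim]) auto
      then show ?case by (simp add: abs_mult)
    qed
  qed simp
  moreover have "(\<lambda>k. ?J (m + k)) \<longlonglongrightarrow> ainf / tl m * ?J m"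
  proof -
    have "(\<lambda>k. tl (k + m)) \<longlonglongrightarrow> ainf" by (rule LIMSEQ_ignore_initial_segment[OF tl_tendsto])
    then show ?thesis unfolding J using tl_pos[of m] by (intro tendsto_intros) (auto simp: add.commute)
  qed
  ultimately show ?thesis by (rule LIMSEQ_unique)
qed

text \<open>Both occurrences of \<open>1 - suminf x\<close> multiply the cylinder function
  \<open>h\<close>. By \<open>rest_mean\<close> they become the mass left by \<open>m\<close>
  coordinates, at the price of the factor \<open>ainf / tl m\<close>; pulling it out turns the
  coefficient \<open>ainf\<close> of \<open>x n\<close> into \<open>tl m\<close>, the last parameter
  of the marginal, and the finite-dimensional identity applies.\<close>

lemma ibp_FC1:
  assumes F: "F \<in> FC1"
  shows "(\<integral>x. x n * (1 - suminf x) * partial n F x + (\<alpha> n * (1 - suminf x) - ainf * x n) * F x \<partial>mu) = 0"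
proof -
  obtain m0 where m0: "depends_on_first m0 F" using F by (auto simp: FC1_iff)
  define m where "m = max m0 (Suc n)"
  have m: "depends_on_first m F" "n < m" using depends_on_first_mono[OF m0] by (auto simp: m_def)
  obtain B where B: "0 < B" "\<And>x. x \<in> cube \<Longrightarrow> \<bar>F x\<bar> \<le> B" "\<And>x. x \<in> cube \<Longrightarrow> \<bar>partial n F x\<bar> \<le> B"
    using FC1_bounded[OF F] by blast
  note [measurable] = FC1D(4)[OF F] FC1D(5)[OF F, of n]
  note mm = measurable_cong_sets[OF sets_mu refl]
  define h where "h x = x n * partial n F x + \<alpha> n * F x" for x
  have hm [measurable]: "h \<in> borel_measurable Msp" unfolding h_def by measurable
  have hd: "depends_on_first m h"
    unfolding depends_on_first_def h_def
    using depends_on_firstD[OF m(1)] depends_on_firstD[OF partial_depends[OF m(1), of n]] m(2) by metis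
  have hb: "\<bar>h x\<bar> \<le> B + \<alpha> n * B" if x: "x \<in> Delta_inf" for x
  proof -
    have c: "x \<in> cube" using x Delta_subset_cube by blast
    have "\<bar>x n * partial n F x\<bar> \<le> 1 * B" unfolding abs_mult using B(3)[OF c] Delta_infD(1,2)[OF x, of n] by (intro mult_mono) auto
    moreover have "\<bar>\<alpha> n * F x\<bar> \<le> \<alpha> n * B" unfolding abs_mult using B(2)[OF c] pos[of n] by (intro mult_mono) auto
    ultimately show ?thesis unfolding h_def by linarith
  qed
  have xF: "integrable mu (\<lambda>x. x n * F x)"
  proof (rule mu.integrable_const_bound[of _ B])
    show "AE x in mu. norm (x n * F x) \<le> B"
      using AE_mu
    proof eventually_elim
      case (elim x)
      have c: "x \<in> cube" using elim Delta_subset_cube by blast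
      have "\<bar>x n\<bar> * \<bar>F x\<bar> \<le> 1 * B" using B(1) B(2)[OF c] Delta_infD(1,2)[OF elim, of n] by (intro mult_mono) auto
      then show ?case by (simp add: abs_mult)
    qed
  qed (simp add: mm)
  have hR: "integrable mu (\<lambda>x. h x * R x)"
    if "R \<in> borel_measurable Msp" "\<And>x. x \<in> Delta_inf \<Longrightarrow> \<bar>R x\<bar> \<le> 1" for R
  proof (rule mu.integrable_const_bound[of _ "B + \<alpha> n * B"])
    note [measurable] = that(1)
    show "AE x in mu. norm (h x * R x) \<le> B + \<alpha> n * B"
      using AE_mu
    proof eventually_elim
      case (elim x)
      have "\<bar>h x\<bar> * \<bar>R x\<bar> \<le> (B + \<alpha> n * B) * 1"
        using hb[OF elim] that(2)[OF elim] B(1) pos[of n] by (intro mult_mono) (auto simp: less_imp_le)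
      then show ?case by (simp add: abs_mult)
    qed
    show "(\<lambda>x. h x * R x) \<in> borel_measurable mu" by (simp add: mm)
  qed
  have r1: "\<bar>1 - suminf x\<bar> \<le> 1" if "x \<in> Delta_inf" for x using Delta_infD(4,5)[OF that] by simp
  have r2: "\<bar>1 - (\<Sum>i<m. x i)\<bar> \<le> 1" if "x \<in> Delta_inf" for x
    by (rule rest_abs_le[OF that])
  have i1: "integrable mu (\<lambda>x. h x * (1 - suminf x))" by (rule hR) (auto intro: r1)
  have i2: "integrable mu (\<lambda>x. h x * (1 - (\<Sum>i<m. x i)))" by (rule hR) (auto intro: r2)
  have "(\<integral>x. x n * (1 - suminf x) * partial n F x + (\<alpha> n * (1 - suminf x) - ainf * x n) * F x \<partial>mu) =
      (\<integral>x. h x * (1 - suminf x) - ainf * (x n * F x) \<partial>mu)"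
    by (rule Bochner_Integration.integral_cong[OF refl]) (simp add: h_def algebra_simps)
  also have "\<dots> = (\<integral>x. h x * (1 - suminf x) \<partial>mu) - ainf * (\<integral>x. x n * F x \<partial>mu)"
    using i1 xF by simp
  also have "\<dots> = ainf / tl m * (\<integral>x. h x * (1 - (\<Sum>i<m. x i)) \<partial>mu) - ainf * (\<integral>x. x n * F x \<partial>mu)"
    using rest_mean[OF hm hd hb] by simp
  also have "\<dots> = ainf / tl m * ((\<integral>x. h x * (1 - (\<Sum>i<m. x i)) \<partial>mu) - tl m * (\<integral>x. x n * F x \<partial>mu))"
    using tl_pos[of m] by (simp add: field_simps)
  also have "(\<integral>x. h x * (1 - (\<Sum>i<m. x i)) \<partial>mu) - tl m * (\<integral>x. x n * F x \<partial>mu) =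
     (\<integral>x. h x * (1 - (\<Sum>i<m. x i)) - tl m * (x n * F x) \<partial>mu)"
    using i2 xF by simp
  also have "\<dots> = (\<integral>x. (\<lambda>x. x n * (1 - (\<Sum>i<m. x i)) * partial n F x + (bvec m n * (1 - (\<Sum>i<m. x i)) - bvec m m * x n) * F x) (ext0 m x) \<partial>mu)"
  proof (rule Bochner_Integration.integral_cong[OF refl])
    fix x
    have e: "(\<Sum>i<m. ext0 m x i) = (\<Sum>i<m. x i)" "ext0 m x n = x n" using m(2) by (auto simp: ext0_def)
    show "h x * (1 - (\<Sum>i<m. x i)) - tl m * (x n * F x) = (\<lambda>x. x n * (1 - (\<Sum>i<m. x i)) * partial n F x + (bvec m n * (1 - (\<Sum>i<m. x i)) - bvec m m * x n) * F x) (ext0 m x)"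
      using m(2) depends_on_first_ext0[OF m(1), of x] depends_on_first_ext0[OF partial_depends[OF m(1)], of n x]
      by (simp add: e h_def bvec_def algebra_simps)
  qed
  also have "\<dots> = (\<integral>x. x n * (1 - (\<Sum>i<m. x i)) * partial n F x + (bvec m n * (1 - (\<Sum>i<m. x i)) - bvec m m * x n) * F x \<partial>dirichlet m (bvec m))"
    by (rule integral_ext0) measurable
  also have "\<dots> = 0" by (rule dirichlet_ibp[OF bvec_pos m(2) F])
  finally show ?thesis by simp
qed

end

subsection \<open>Bounded limits of cylinder functions, with gradient\<close>

text \<open>The class contains functions such as \<open>suminf\<close> that are not cylindrical, with
  all partial derivatives of \<open>suminf\<close> equal to 1.\<close>

definition grad_approx :: "(pt \<Rightarrow> real) \<Rightarrow> (nat \<Rightarrow> pt \<Rightarrow> real) \<Rightarrow> (nat \<Rightarrow> pt \<Rightarrow> real) \<Rightarrow> real \<Rightarrow> bool" where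
  "grad_approx f d fs B \<longleftrightarrow> (\<forall>k. fs k \<in> FC1) \<and> 0 < B \<and>
     (\<forall>x\<in>Delta_inf. \<forall>k. \<bar>fs k x\<bar> \<le> B \<and> (\<forall>n. \<bar>partial n (fs k) x\<bar> \<le> B)) \<and>
     (\<forall>x\<in>Delta_inf. (\<lambda>k. fs k x) \<longlonglongrightarrow> f x \<and> (\<forall>n. (\<lambda>k. partial n (fs k) x) \<longlonglongrightarrow> d n x))"

text \<open>The derivatives are carried as data, and both \<open>f\<close> and \<open>d\<close> are
  tied to the approximating functions only on \<open>Delta_inf\<close>, where \<open>mu\<close>
  lives.\<close>

definition grad :: "(pt \<Rightarrow> real) \<Rightarrow> (nat \<Rightarrow> pt \<Rightarrow> real) \<Rightarrow> bool" where
  "grad f d \<longleftrightarrow> f \<in> borel_measurable Msp \<and> (\<forall>n. d n \<in> borel_measurable Msp) \<and> (\<exists>fs B. grad_approx f d fs B)"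

lemma grad_measurable: "grad f d \<Longrightarrow> f \<in> borel_measurable Msp" "grad f d \<Longrightarrow> d n \<in> borel_measurable Msp"
  by (auto simp: grad_def)

lemma grad_approxD:
  assumes "grad_approx f d fs B"
  shows "fs k \<in> FC1" "0 < B" "x \<in> Delta_inf \<Longrightarrow> \<bar>fs k x\<bar> \<le> B" "x \<in> Delta_inf \<Longrightarrow> \<bar>partial n (fs k) x\<bar> \<le> B"
    "x \<in> Delta_inf \<Longrightarrow> (\<lambda>k. fs k x) \<longlonglongrightarrow> f x" "x \<in> Delta_inf \<Longrightarrow> (\<lambda>k. partial n (fs k) x) \<longlonglongrightarrow> d n x"
  using assms unfolding grad_approx_def by blast+

lemma grad_approx_bound:
  assumes a: "grad_approx f d fs B" and x: "x \<in> Delta_inf"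
  shows "\<bar>f x\<bar> \<le> B" "\<bar>d n x\<bar> \<le> B"
proof -
  note A = grad_approxD[OF a]
  show "\<bar>f x\<bar> \<le> B" by (rule LIMSEQ_le_const2[OF tendsto_rabs[OF A(5)[OF x]]]) (use A(3)[OF x] in blast)
  show "\<bar>d n x\<bar> \<le> B" by (rule LIMSEQ_le_const2[OF tendsto_rabs[OF A(6)[OF x]]]) (use A(4)[OF x] in blast)
qed

lemma grad_bound:
  assumes "grad f d"
  shows "\<exists>B>0. \<forall>x\<in>Delta_inf. \<bar>f x\<bar> \<le> B \<and> (\<forall>n. \<bar>d n x\<bar> \<le> B)"
proof -
  obtain fs B where a: "grad_approx f d fs B" using assms unfolding grad_def by blast
  show ?thesis using grad_approxD(2)[OF a] grad_approx_bound[OF a] by blast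
qed

lemma grad_bdd: "grad f d \<Longrightarrow> \<exists>B. \<forall>x\<in>Delta_inf. \<bar>f x\<bar> \<le> B"
  using grad_bound by blast

lemma grad_FC1:
  assumes f: "f \<in> FC1" shows "grad f (\<lambda>n. partial n f)"
proof -
  obtain B where B: "0 < B" "\<And>x. x \<in> cube \<Longrightarrow> \<bar>f x\<bar> \<le> B" "\<And>n x. x \<in> cube \<Longrightarrow> \<bar>partial n f x\<bar> \<le> B"
    using FC1_bounded[OF f] by blast
  have "grad_approx f (\<lambda>n. partial n f) (\<lambda>k. f) B"
    unfolding grad_approx_def using f B Delta_subset_cube by auto
  then show ?thesis unfolding grad_def using FC1D(4,5)[OF f] by blast
qed

lemma FC1_partial_sum:
  "(\<lambda>x. \<Sum>i<k. x i) \<in> FC1" "partial n (\<lambda>x. \<Sum>i<k. x i) = (\<lambda>x. if n < k then 1 else 0)"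
proof (induction k)
  case 0
  show "(\<lambda>x. \<Sum>i<0. x i) \<in> FC1" "partial n (\<lambda>x. \<Sum>i<0. x i) = (\<lambda>x. if n < 0 then 1 else 0)"
    using FC1_const(1)[of 0] FC1_const(2)[of n 0] by simp_all
next
  case (Suc k)
  show "(\<lambda>x. \<Sum>i<Suc k. x i) \<in> FC1"
    using FC1_lin(1)[OF Suc(1) FC1_coord(1)[of k], of 1 1] by simp
  show "partial n (\<lambda>x. \<Sum>i<Suc k. x i) = (\<lambda>x. if n < Suc k then 1 else 0)"
    using FC1_lin(2)[OF Suc(1) FC1_coord(1)[of k], of n 1 1] unfolding Suc(2) FC1_coord(2)
    by (auto simp: fun_eq_iff)
qed

lemma grad_suminf: "grad suminf (\<lambda>n x. 1)"
proof -
  have "grad_approx suminf (\<lambda>n x. 1) (\<lambda>k x. \<Sum>i<k. x i) 1"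
    unfolding grad_approx_def
  proof (intro conjI allI ballI)
    fix x k n assume x: "x \<in> Delta_inf"
    show "\<bar>\<Sum>i<k. x i\<bar> \<le> 1"
      using Delta_infD(1,4)[OF x] Delta_infD(6)[OF x, of k] by (simp add: sum_nonneg)
    show "(\<lambda>k. \<Sum>i<k. x i) \<longlonglongrightarrow> suminf x" by (rule summable_LIMSEQ[OF Delta_infD(3)[OF x]])
    show "(\<lambda>k. partial n (\<lambda>x. \<Sum>i<k. x i) x) \<longlonglongrightarrow> 1"
      by (rule tendsto_eventually) (auto simp: FC1_partial_sum eventually_sequentially intro!: exI[of _ "Suc n"])
  qed (auto simp: FC1_partial_sum)
  then show ?thesis unfolding grad_def by (intro conjI allI exI) simp_all
qed

lemma grad_lin:
  assumes f: "grad f d" and g: "grad g e"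
  shows "grad (\<lambda>x. a * f x + b * g x) (\<lambda>n x. a * d n x + b * e n x)"
proof -
  obtain fs B where F: "grad_approx f d fs B" using f unfolding grad_def by blast
  obtain gs C where G: "grad_approx g e gs C" using g unfolding grad_def by blast
  note F = grad_approxD[OF F] and G = grad_approxD[OF G]
  have bd: "\<bar>a * u + b * v\<bar> \<le> \<bar>a\<bar> * B + \<bar>b\<bar> * C + 1" if "\<bar>u\<bar> \<le> B" "\<bar>v\<bar> \<le> C" for u v
  proof -
    have "\<bar>a * u + b * v\<bar> \<le> \<bar>a\<bar> * \<bar>u\<bar> + \<bar>b\<bar> * \<bar>v\<bar>" by (metis abs_mult abs_triangle_ineq)
    also have "\<dots> \<le> \<bar>a\<bar> * B + \<bar>b\<bar> * C" using that by (intro add_mono mult_left_mono) auto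
    finally show ?thesis by simp
  qed
  have "grad_approx (\<lambda>x. a * f x + b * g x) (\<lambda>n x. a * d n x + b * e n x)
      (\<lambda>k x. a * fs k x + b * gs k x) (\<bar>a\<bar> * B + \<bar>b\<bar> * C + 1)"
    unfolding grad_approx_def FC1_lin(2)[OF F(1) G(1)]
  proof (intro conjI allI ballI)
    show "(\<lambda>x. a * fs k x + b * gs k x) \<in> FC1" for k by (rule FC1_lin(1)[OF F(1) G(1)])
    show "0 < \<bar>a\<bar> * B + \<bar>b\<bar> * C + 1" using F(2) G(2) by (simp add: add_nonneg_pos)
    fix x assume x: "x \<in> Delta_inf"
    show "\<bar>a * fs k x + b * gs k x\<bar> \<le> \<bar>a\<bar> * B + \<bar>b\<bar> * C + 1"
      "\<bar>a * partial n (fs k) x + b * partial n (gs k) x\<bar> \<le> \<bar>a\<bar> * B + \<bar>b\<bar> * C + 1" for n k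
      by (intro bd F(3,4)[OF x] G(3,4)[OF x])+
    show "(\<lambda>k. a * fs k x + b * gs k x) \<longlonglongrightarrow> a * f x + b * g x"
      "(\<lambda>k. a * partial n (fs k) x + b * partial n (gs k) x) \<longlonglongrightarrow> a * d n x + b * e n x" for n
      by (intro tendsto_intros F(5,6)[OF x] G(5,6)[OF x])+
  qed
  moreover have "(\<lambda>x. a * f x + b * g x) \<in> borel_measurable Msp" "(\<lambda>x. a * d n x + b * e n x) \<in> borel_measurable Msp" for n
    using grad_measurable[OF f] grad_measurable[OF g] by measurable
  ultimately show ?thesis unfolding grad_def by blast
qed

lemma grad_mult:
  assumes f: "grad f d" and g: "grad g e"
  shows "grad (\<lambda>x. f x * g x) (\<lambda>n x. f x * e n x + d n x * g x)"
proof -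
  obtain fs B where F: "grad_approx f d fs B" using f unfolding grad_def by blast
  obtain gs C where G: "grad_approx g e gs C" using g unfolding grad_def by blast
  note F = grad_approxD[OF F] and G = grad_approxD[OF G]
  have bd: "\<bar>u * v\<bar> \<le> B * C" if "\<bar>u\<bar> \<le> B" "\<bar>v\<bar> \<le> C" for u v
    unfolding abs_mult using that F(2) by (intro mult_mono) auto
  have BC: "0 < B * C" using F(2) G(2) by simp
  have "grad_approx (\<lambda>x. f x * g x) (\<lambda>n x. f x * e n x + d n x * g x)
      (\<lambda>k x. fs k x * gs k x) (2 * (B * C))"
    unfolding grad_approx_def FC1_mult(2)[OF F(1) G(1)]
  proof (intro conjI allI ballI)
    show "(\<lambda>x. fs k x * gs k x) \<in> FC1" for k by (rule FC1_mult(1)[OF F(1) G(1)])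
    show "0 < 2 * (B * C)" using BC by simp
    fix x assume x: "x \<in> Delta_inf"
    show "\<bar>fs k x * gs k x\<bar> \<le> 2 * (B * C)" for k
      using bd[OF F(3)[OF x] G(3)[OF x], of k k] BC by linarith
    show "\<bar>fs k x * partial n (gs k) x + partial n (fs k) x * gs k x\<bar> \<le> 2 * (B * C)" for n k
      using bd[OF F(3)[OF x] G(4)[OF x], of k n k] bd[OF F(4)[OF x] G(3)[OF x], of n k k] by linarith
    show "(\<lambda>k. fs k x * gs k x) \<longlonglongrightarrow> f x * g x"
      "(\<lambda>k. fs k x * partial n (gs k) x + partial n (fs k) x * gs k x) \<longlonglongrightarrow> f x * e n x + d n x * g x" for n
      by (intro tendsto_intros F(5,6)[OF x] G(5,6)[OF x])+
  qed
  moreover have "(\<lambda>x. f x * g x) \<in> borel_measurable Msp" "(\<lambda>x. f x * e n x + d n x * g x) \<in> borel_measurable Msp" for n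
    using grad_measurable[OF f] grad_measurable[OF g] by measurable
  ultimately show ?thesis unfolding grad_def by blast
qed

text \<open>The carre du champ operator, taken on derivative families instead of functions so that
  it applies to \<open>grad\<close> pairs.\<close>

definition Gam :: "(nat \<Rightarrow> pt \<Rightarrow> real) \<Rightarrow> (nat \<Rightarrow> pt \<Rightarrow> real) \<Rightarrow> pt \<Rightarrow> real" where
  "Gam d e x = (1 - suminf x) * (\<Sum>n. x n * d n x * e n x)"

lemma Gam_commute: "Gam d e x = Gam e d x"
  by (simp add: Gam_def mult_ac)

lemma Gam_measurable [measurable]:
  assumes [measurable]: "\<And>n. d n \<in> borel_measurable Msp" "\<And>n. e n \<in> borel_measurable Msp"
  shows "Gam d e \<in> borel_measurable Msp"
  unfolding Gam_def by measurable

lemma Gam_terms: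
  assumes x: "x \<in> Delta_inf" and d: "\<And>n. \<bar>d n x\<bar> \<le> B" and e: "\<And>n. \<bar>e n x\<bar> \<le> C"
  shows "\<bar>x n * d n x * e n x\<bar> \<le> B * C * x n" "summable (\<lambda>n. x n * d n x * e n x)" "\<bar>Gam d e x\<bar> \<le> B * C"
proof -
  have BC: "0 \<le> B" "0 \<le> C" using d[of 0] e[of 0] by linarith+
  show t: "\<bar>x n * d n x * e n x\<bar> \<le> B * C * x n" for n
  proof -
    have "\<bar>d n x\<bar> * \<bar>e n x\<bar> \<le> B * C" using BC d e by (intro mult_mono) auto
    then have "x n * (\<bar>d n x\<bar> * \<bar>e n x\<bar>) \<le> x n * (B * C)" using Delta_infD(1)[OF x] by (intro mult_left_mono)
    then show ?thesis using Delta_infD(1)[OF x, of n] by (simp add: abs_mult mult_ac)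
  qed
  show s: "summable (\<lambda>n. x n * d n x * e n x)"
    by (rule summable_comparison_test'[OF summable_mult[OF Delta_infD(3)[OF x]], of 0 _ "B * C"]) (use t in simp)
  have sa: "summable (\<lambda>n. \<bar>x n * d n x * e n x\<bar>)"
    by (rule summable_comparison_test'[OF summable_mult[OF Delta_infD(3)[OF x]], of 0 _ "B * C"]) (use t in simp)
  have "\<bar>\<Sum>n. x n * d n x * e n x\<bar> \<le> (\<Sum>n. \<bar>x n * d n x * e n x\<bar>)" by (rule summable_rabs[OF sa])
  also have "\<dots> \<le> (\<Sum>n. B * C * x n)" by (rule suminf_le[OF t sa summable_mult[OF Delta_infD(3)[OF x]]])
  also have "\<dots> = B * C * suminf x" by (rule suminf_mult[OF Delta_infD(3)[OF x]])
  also have "\<dots> \<le> B * C" using Delta_infD(4,5)[OF x] BC by (simp add: mult_left_le)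
  finally have "\<bar>1 - suminf x\<bar> * \<bar>\<Sum>n. x n * d n x * e n x\<bar> \<le> 1 * (B * C)"
    using Delta_infD(4,5)[OF x] BC by (intro mult_mono) auto
  then show "\<bar>Gam d e x\<bar> \<le> B * C" by (simp add: Gam_def abs_mult)
qed

lemma Gam_summable:
  assumes x: "x \<in> Delta_inf" and f: "grad f d" and g: "grad g e"
  shows "summable (\<lambda>n. x n * d n x * e n x)"
proof -
  obtain B where B: "\<And>n. \<bar>d n x\<bar> \<le> B" using grad_bound[OF f] x by blast
  obtain C where C: "\<And>n. \<bar>e n x\<bar> \<le> C" using grad_bound[OF g] x by blast
  show ?thesis by (rule Gam_terms(2)[of x d B e C, OF x B C])
qed

lemma Gam_bound:
  assumes f: "grad f d" and g: "grad g e"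
  shows "\<exists>B. \<forall>x\<in>Delta_inf. \<bar>Gam d e x\<bar> \<le> B"
proof -
  obtain B where B: "\<And>n x. x \<in> Delta_inf \<Longrightarrow> \<bar>d n x\<bar> \<le> B" using grad_bound[OF f] by blast
  obtain C where C: "\<And>n x. x \<in> Delta_inf \<Longrightarrow> \<bar>e n x\<bar> \<le> C" using grad_bound[OF g] by blast
  have "\<bar>Gam d e x\<bar> \<le> B * C" if "x \<in> Delta_inf" for x
    by (rule Gam_terms(3)[of x d B e C, OF that B[OF that] C[OF that]])
  then show ?thesis by blast
qed

text \<open>The coefficients may depend on the point, which is what the Leibniz rules below
  need.\<close>

lemma Gam_lin:
  assumes x: "x \<in> Delta_inf" and f: "grad f d" and g: "grad g e" and h: "grad h r"
  shows "Gam (\<lambda>n x. a x * d n x + b x * e n x) r x = a x * Gam d r x + b x * Gam e r x"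
proof -
  note s1 = Gam_summable[OF x f h] and s2 = Gam_summable[OF x g h]
  have "(\<Sum>n. x n * (a x * d n x + b x * e n x) * r n x) = (\<Sum>n. a x * (x n * d n x * r n x) + b x * (x n * e n x * r n x))"
    by (simp add: algebra_simps)
  also have "\<dots> = (\<Sum>n. a x * (x n * d n x * r n x)) + (\<Sum>n. b x * (x n * e n x * r n x))"
    by (rule suminf_add[symmetric, OF summable_mult[OF s1] summable_mult[OF s2]])
  also have "\<dots> = a x * (\<Sum>n. x n * d n x * r n x) + b x * (\<Sum>n. x n * e n x * r n x)"
    by (simp only: suminf_mult[OF s1] suminf_mult[OF s2])
  finally show ?thesis unfolding Gam_def by (simp add: algebra_simps)
qed

lemma Gam_unit:
  assumes x: "x \<in> Delta_inf"
  shows "Gam d (\<lambda>i x. if i = n then 1 else 0) x = (1 - suminf x) * (x n * d n x)"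
proof -
  have "(\<Sum>i. x i * d i x * (if i = n then 1 else 0)) = x n * d n x"
    using sums_single[of n "\<lambda>i. x i * d i x"] by (simp add: sums_iff if_distrib cong: if_cong)
  then show ?thesis by (simp add: Gam_def)
qed

lemma Gam_one: "Gam (\<lambda>i x. 1) (\<lambda>i x. 1) x = (1 - suminf x) * suminf x"
  by (simp add: Gam_def)

lemma Gam_nonneg:
  assumes x: "x \<in> Delta_inf" and f: "grad f d"
  shows "0 \<le> Gam d d x" "(1 - suminf x) * (x n * (d n x)\<^sup>2) \<le> Gam d d x"
proof -
  note s = Gam_summable[OF x f f]
  have nn: "0 \<le> x n * d n x * d n x" for n using Delta_infD(1)[OF x, of n] by (simp add: mult.assoc)
  have "x n * (d n x)\<^sup>2 \<le> (\<Sum>n. x n * d n x * d n x)"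
    using sum_le_suminf[OF s, of "{n}"] nn by (simp add: power2_eq_square mult.assoc)
  then show "(1 - suminf x) * (x n * (d n x)\<^sup>2) \<le> Gam d d x"
    unfolding Gam_def using Delta_infD(4)[OF x] by (intro mult_left_mono) auto
  moreover have "0 \<le> (1 - suminf x) * (x n * (d n x)\<^sup>2)"
    using Delta_infD(1,4)[OF x] by (intro mult_nonneg_nonneg) auto
  ultimately show "0 \<le> Gam d d x" by linarith
qed

subsection \<open>The weak generator\<close>

context simplex_params
begin

lemma mm: "borel_measurable mu = borel_measurable Msp"
  by (rule measurable_cong_sets[OF sets_mu refl])

lemma integrable_bounded:
  fixes f :: "pt \<Rightarrow> real"
  assumes "f \<in> borel_measurable Msp" "\<And>x. x \<in> Delta_inf \<Longrightarrow> \<bar>f x\<bar> \<le> B"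
  shows "integrable mu f"
proof (rule mu.integrable_const_bound)
  show "AE x in mu. norm (f x) \<le> B" using AE_mu by eventually_elim (simp add: assms(2))
qed (simp add: mm assms(1))

lemma L2_bounded_Delta:
  fixes f :: "pt \<Rightarrow> real"
  assumes "f \<in> borel_measurable Msp" "\<And>x. x \<in> Delta_inf \<Longrightarrow> \<bar>f x\<bar> \<le> B"
  shows "f \<in> L2 mu"
proof (rule mu.L2_bounded)
  show "AE x in mu. \<bar>f x\<bar> \<le> B" using AE_mu by eventually_elim (simp add: assms(2))
qed (simp add: mm assms(1))

lemma integral_cong_Delta:
  fixes f g :: "pt \<Rightarrow> real"
  assumes "f \<in> borel_measurable Msp" "g \<in> borel_measurable Msp" "\<And>x. x \<in> Delta_inf \<Longrightarrow> f x = g x"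
  shows "(\<integral>x. f x \<partial>mu) = (\<integral>x. g x \<partial>mu)"
proof (rule integral_cong_AE)
  show "AE x in mu. f x = g x" using AE_mu by eventually_elim (rule assms(3))
qed (simp_all add: mm assms)

lemma dominated_Delta:
  fixes f :: "pt \<Rightarrow> real"
  assumes "f \<in> borel_measurable Msp" "\<And>k. fs k \<in> borel_measurable Msp"
    "\<And>x. x \<in> Delta_inf \<Longrightarrow> (\<lambda>k. fs k x) \<longlonglongrightarrow> f x" "\<And>k x. x \<in> Delta_inf \<Longrightarrow> \<bar>fs k x\<bar> \<le> B"
  shows "(\<lambda>k. \<integral>x. fs k x \<partial>mu) \<longlonglongrightarrow> (\<integral>x. f x \<partial>mu)"
proof (rule integral_dominated_convergence[where w="\<lambda>_. B"])
  show "AE x in mu. (\<lambda>k. fs k x) \<longlonglongrightarrow> f x" using AE_mu by eventually_elim (rule assms(3))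
  show "AE x in mu. norm (fs k x) \<le> B" for k using AE_mu by eventually_elim (simp add: assms(4))
qed (simp_all add: mm assms)

lemma grad_L2: "grad f d \<Longrightarrow> f \<in> L2 mu"
  using grad_bound[of f d] grad_measurable(1)[of f d] L2_bounded_Delta by blast

definition Q :: "(nat \<Rightarrow> pt \<Rightarrow> real) \<Rightarrow> (nat \<Rightarrow> pt \<Rightarrow> real) \<Rightarrow> real" where
  "Q d e = (\<integral>x. Gam d e x \<partial>mu)"

lemma Q_commute: "Q d e = Q e d"
  unfolding Q_def Gam_commute[of d e] ..

lemma Gam_meas:
  assumes "grad f d" "grad g e" shows "Gam d e \<in> borel_measurable Msp"
  by (rule Gam_measurable; rule grad_measurable; rule assms)

lemma Gam_integrable:
  assumes "grad f d" "grad g e" shows "integrable mu (Gam d e)"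
  using Gam_bound[OF assms] integrable_bounded[OF Gam_meas[OF assms]] by blast

lemma Q_lin:
  assumes f: "grad f d" and g: "grad g e" and h: "grad h r"
  shows "Q (\<lambda>n x. a * d n x + b * e n x) r = a * Q d r + b * Q e r"
proof -
  have "Q (\<lambda>n x. a * d n x + b * e n x) r = (\<integral>x. a * Gam d r x + b * Gam e r x \<partial>mu)"
    unfolding Q_def
  proof (rule integral_cong_Delta)
    show "Gam (\<lambda>n x. a * d n x + b * e n x) r \<in> borel_measurable Msp"
      by (rule Gam_meas[OF grad_lin[OF f g] h])
    show "(\<lambda>x. a * Gam d r x + b * Gam e r x) \<in> borel_measurable Msp"
      using Gam_meas[OF f h] Gam_meas[OF g h] by measurable
    show "Gam (\<lambda>n x. a * d n x + b * e n x) r x = a * Gam d r x + b * Gam e r x" if "x \<in> Delta_inf" for x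
      by (rule Gam_lin[OF that f g h])
  qed
  also have "\<dots> = a * Q d r + b * Q e r"
    unfolding Q_def using Gam_integrable[OF f h] Gam_integrable[OF g h] by simp
  finally show ?thesis .
qed

lemma Q_nonneg: "grad f d \<Longrightarrow> 0 \<le> Q d d"
  unfolding Q_def using AE_mu by (intro integral_nonneg_AE) (auto elim!: eventually_mono intro: Gam_nonneg)

lemma drift_bound:
  assumes x: "x \<in> Delta_inf"
  shows "\<bar>\<alpha> n * (1 - suminf x) - ainf * x n\<bar> \<le> \<alpha> n + ainf"
proof -
  note D = Delta_infD[OF x]
  have "0 \<le> \<alpha> n * (1 - suminf x)" "\<alpha> n * (1 - suminf x) \<le> \<alpha> n" "0 \<le> ainf * x n" "ainf * x n \<le> ainf"
    using D(1,2)[of n] D(4,5) pos[of n] ainf_pos by (auto simp: mult_left_le)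
  then show ?thesis using pos[of n] ainf_pos unfolding abs_le_iff by linarith
qed

lemma ibp_grad:
  assumes F: "grad F d"
  shows "(\<integral>x. x n * (1 - suminf x) * d n x + (\<alpha> n * (1 - suminf x) - ainf * x n) * F x \<partial>mu) = 0"
proof -
  obtain fs B where A0: "grad_approx F d fs B" using F unfolding grad_def by blast
  note A = grad_approxD[OF A0]
  note [measurable] = grad_measurable[OF F] FC1D(4,5)[OF A(1)]
  have "(\<lambda>k. \<integral>x. x n * (1 - suminf x) * partial n (fs k) x + (\<alpha> n * (1 - suminf x) - ainf * x n) * fs k x \<partial>mu)
     \<longlonglongrightarrow> (\<integral>x. x n * (1 - suminf x) * d n x + (\<alpha> n * (1 - suminf x) - ainf * x n) * F x \<partial>mu)"
  proof (rule dominated_Delta)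
    fix k x assume x: "x \<in> Delta_inf"
    note D = Delta_infD[OF x]
    have "\<bar>x n * (1 - suminf x)\<bar> * \<bar>partial n (fs k) x\<bar> \<le> 1 * B"
      using A(4)[OF x, of n k] D(1,2)[of n] D(4,5) by (intro mult_mono) (auto simp: abs_mult mult_le_one)
    moreover have "\<bar>\<alpha> n * (1 - suminf x) - ainf * x n\<bar> * \<bar>fs k x\<bar> \<le> (\<alpha> n + ainf) * B"
      using A(3)[OF x, of k] pos[of n] ainf_pos by (intro mult_mono drift_bound[OF x]) auto
    ultimately show "\<bar>x n * (1 - suminf x) * partial n (fs k) x + (\<alpha> n * (1 - suminf x) - ainf * x n) * fs k x\<bar> \<le> 1 * B + (\<alpha> n + ainf) * B"
      unfolding abs_mult[symmetric] by (intro order_trans[OF abs_triangle_ineq] add_mono)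
  next
    fix x assume x: "x \<in> Delta_inf"
    show "(\<lambda>k. x n * (1 - suminf x) * partial n (fs k) x + (\<alpha> n * (1 - suminf x) - ainf * x n) * fs k x)
       \<longlonglongrightarrow> x n * (1 - suminf x) * d n x + (\<alpha> n * (1 - suminf x) - ainf * x n) * F x"
      by (intro tendsto_intros A(5,6)[OF x])
  qed measurable
  then have "(\<lambda>k::nat. 0::real) \<longlonglongrightarrow> (\<integral>x. x n * (1 - suminf x) * d n x + (\<alpha> n * (1 - suminf x) - ainf * x n) * F x \<partial>mu)"
    unfolding ibp_FC1[OF A(1)] .
  then show ?thesis by (simp add: LIMSEQ_const_iff)
qed

lemma ibp_split:
  assumes F: "grad F d"
  shows "(\<integral>x. (1 - suminf x) * (x n * d n x) \<partial>mu) = - (\<integral>x. F x * (\<alpha> n * (1 - suminf x) - ainf * x n) \<partial>mu)"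
    "integrable mu (\<lambda>x. (1 - suminf x) * (x n * d n x))"
    "integrable mu (\<lambda>x. F x * (\<alpha> n * (1 - suminf x) - ainf * x n))"
proof -
  obtain B where B: "0 < B" "\<And>x. x \<in> Delta_inf \<Longrightarrow> \<bar>F x\<bar> \<le> B" "\<And>n x. x \<in> Delta_inf \<Longrightarrow> \<bar>d n x\<bar> \<le> B"
    using grad_bound[OF F] by blast
  note [measurable] = grad_measurable[OF F]
  show i1: "integrable mu (\<lambda>x. (1 - suminf x) * (x n * d n x))"
  proof (rule integrable_bounded)
    fix x assume x: "x \<in> Delta_inf"
    have "\<bar>1 - suminf x\<bar> * (\<bar>x n\<bar> * \<bar>d n x\<bar>) \<le> 1 * (1 * B)"
      using Delta_infD(1,2)[OF x, of n] Delta_infD(4,5)[OF x] B(3)[OF x, of n] B(1) by (intro mult_mono) auto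
    then show "\<bar>(1 - suminf x) * (x n * d n x)\<bar> \<le> B" by (simp add: abs_mult)
  qed measurable
  show i2: "integrable mu (\<lambda>x. F x * (\<alpha> n * (1 - suminf x) - ainf * x n))"
  proof (rule integrable_bounded)
    fix x assume x: "x \<in> Delta_inf"
    show "\<bar>F x * (\<alpha> n * (1 - suminf x) - ainf * x n)\<bar> \<le> B * (\<alpha> n + ainf)"
      unfolding abs_mult using B(1) by (intro mult_mono B(2)[OF x] drift_bound[OF x]) auto
  qed measurable
  have "(\<integral>x. (1 - suminf x) * (x n * d n x) + F x * (\<alpha> n * (1 - suminf x) - ainf * x n) \<partial>mu) = 0"
    using ibp_grad[OF F, of n] by (simp add: mult_ac)
  then show "(\<integral>x. (1 - suminf x) * (x n * d n x) \<partial>mu) = - (\<integral>x. F x * (\<alpha> n * (1 - suminf x) - ainf * x n) \<partial>mu)"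
    using i1 i2 by simp
qed

text \<open>A weak generator: \<open>w\<close> represents the energy functional of \<open>g\<close>
  on all \<open>grad\<close> functions. Testing beyond \<open>FC1\<close> makes the relation
  symmetric, see \<open>gen_symmetric\<close>, and admits products with non-cylindrical factors as
  test functions.\<close>

definition gen :: "(pt \<Rightarrow> real) \<Rightarrow> (nat \<Rightarrow> pt \<Rightarrow> real) \<Rightarrow> (pt \<Rightarrow> real) \<Rightarrow> bool" where
  "gen g d w \<longleftrightarrow> grad g d \<and> w \<in> borel_measurable Msp \<and> (\<exists>B. \<forall>x\<in>Delta_inf. \<bar>w x\<bar> \<le> B) \<and>
     (\<forall>f r. grad f r \<longrightarrow> Q r d = - (\<integral>x. f x * w x \<partial>mu))"

lemma genD:
  assumes "gen g d w"
  shows "grad g d" "w \<in> borel_measurable Msp" "\<exists>B. \<forall>x\<in>Delta_inf. \<bar>w x\<bar> \<le> B"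
    "\<And>f r. grad f r \<Longrightarrow> Q r d = - (\<integral>x. f x * w x \<partial>mu)"
  using assms unfolding gen_def by blast+

lemma gen_L2: assumes "gen g d w" shows "g \<in> L2 mu" "w \<in> L2 mu"
  using genD[OF assms] grad_L2 L2_bounded_Delta by blast+

lemma gen_const: "gen (\<lambda>x. c) (\<lambda>n x. 0) (\<lambda>x. 0)"
  unfolding gen_def using grad_FC1[OF FC1_const(1)[of c]] FC1_const(2)[of _ c] by (auto simp: Q_def Gam_def)

lemma gen_coord: "gen (\<lambda>x. x n) (\<lambda>i x. if i = n then 1 else 0) (\<lambda>x. \<alpha> n * (1 - suminf x) - ainf * x n)"
  unfolding gen_def
proof (intro conjI allI impI)
  show g: "grad (\<lambda>x. x n) (\<lambda>i x. if i = n then 1 else 0)"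
    using grad_FC1[OF FC1_coord(1)[of n]] unfolding FC1_coord(2) .
  show "\<exists>B. \<forall>x\<in>Delta_inf. \<bar>\<alpha> n * (1 - suminf x) - ainf * x n\<bar> \<le> B" using drift_bound[of _ n] by blast
  fix f r assume f: "grad f r"
  note [measurable] = grad_measurable[OF f]
  have "Q r (\<lambda>i x. if i = n then 1 else 0) = (\<integral>x. (1 - suminf x) * (x n * r n x) \<partial>mu)"
    unfolding Q_def by (rule integral_cong_Delta[OF Gam_meas[OF f g] _ Gam_unit]) measurable
  then show "Q r (\<lambda>i x. if i = n then 1 else 0) = - (\<integral>x. f x * (\<alpha> n * (1 - suminf x) - ainf * x n) \<partial>mu)"
    using ibp_split(1)[OF f] by simp
qed measurable

lemma bounded_mult_integrable:
  fixes f g :: "pt \<Rightarrow> real"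
  assumes "f \<in> borel_measurable Msp" "g \<in> borel_measurable Msp"
    "\<exists>B. \<forall>x\<in>Delta_inf. \<bar>f x\<bar> \<le> B" "\<exists>B. \<forall>x\<in>Delta_inf. \<bar>g x\<bar> \<le> B"
  shows "integrable mu (\<lambda>x. f x * g x)"
  using L2_integrable_mult[of f mu g] L2_bounded_Delta assms by blast

lemma grad_mult_integrable: "grad f r \<Longrightarrow> gen g d w \<Longrightarrow> integrable mu (\<lambda>x. f x * w x)"
  by (rule L2_integrable_mult[OF grad_L2 gen_L2(2)])

lemma gen_lin:
  assumes f: "gen f d v" and g: "gen g e w"
  shows "gen (\<lambda>x. a * f x + b * g x) (\<lambda>n x. a * d n x + b * e n x) (\<lambda>x. a * v x + b * w x)"
  unfolding gen_def
proof (intro conjI allI impI)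
  note F = genD[OF f] and G = genD[OF g]
  note [measurable] = F(2) G(2)
  show gr: "grad (\<lambda>x. a * f x + b * g x) (\<lambda>n x. a * d n x + b * e n x)" by (rule grad_lin[OF F(1) G(1)])
  show "(\<lambda>x. a * v x + b * w x) \<in> borel_measurable Msp" by measurable
  obtain B C where BC: "\<And>x. x \<in> Delta_inf \<Longrightarrow> \<bar>v x\<bar> \<le> B" "\<And>x. x \<in> Delta_inf \<Longrightarrow> \<bar>w x\<bar> \<le> C" using F(3) G(3) by blast
  have "\<bar>a * v x + b * w x\<bar> \<le> \<bar>a\<bar> * B + \<bar>b\<bar> * C" if "x \<in> Delta_inf" for x
  proof -
    have "\<bar>a * v x + b * w x\<bar> \<le> \<bar>a\<bar> * \<bar>v x\<bar> + \<bar>b\<bar> * \<bar>w x\<bar>" by (metis abs_mult abs_triangle_ineq)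
    also have "\<dots> \<le> \<bar>a\<bar> * B + \<bar>b\<bar> * C" using BC that by (intro add_mono mult_left_mono) auto
    finally show ?thesis .
  qed
  then show "\<exists>B. \<forall>x\<in>Delta_inf. \<bar>a * v x + b * w x\<bar> \<le> B" by blast
  fix h r assume h: "grad h r"
  have "Q r (\<lambda>n x. a * d n x + b * e n x) = a * Q r d + b * Q r e"
    using Q_lin[OF F(1) G(1) h, of a b] by (simp only: Q_commute[of r])
  also have "\<dots> = - (\<integral>x. a * (h x * v x) + b * (h x * w x) \<partial>mu)"
    using grad_mult_integrable[OF h f] grad_mult_integrable[OF h g] by (simp add: F(4)[OF h] G(4)[OF h])
  also have "(\<lambda>x. a * (h x * v x) + b * (h x * w x)) = (\<lambda>x. h x * (a * v x + b * w x))"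
    by (rule ext) (simp add: algebra_simps)
  finally show "Q r (\<lambda>n x. a * d n x + b * e n x) = - (\<integral>x. h x * (a * v x + b * w x) \<partial>mu)" .
qed

text \<open>The diffusion property \<open>L (f g) = f L g + g L f + 2 \<Gamma> (f, g)\<close> in weak form; second derivatives never appear.\<close>

lemma gen_mult:
  assumes f: "gen f d v" and g: "gen g e w"
  shows "gen (\<lambda>x. f x * g x) (\<lambda>n x. f x * e n x + d n x * g x) (\<lambda>x. f x * w x + g x * v x + 2 * Gam d e x)"
  unfolding gen_def
proof (intro conjI allI impI)
  note F = genD[OF f] and G = genD[OF g]
  note [measurable] = F(2) G(2) grad_measurable(1)[OF F(1)] grad_measurable(1)[OF G(1)] Gam_meas[OF F(1) G(1)]
  show gr: "grad (\<lambda>x. f x * g x) (\<lambda>n x. f x * e n x + d n x * g x)" by (rule grad_mult[OF F(1) G(1)])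
  show "(\<lambda>x. f x * w x + g x * v x + 2 * Gam d e x) \<in> borel_measurable Msp" by measurable
  obtain B C where BC: "\<And>x. x \<in> Delta_inf \<Longrightarrow> \<bar>v x\<bar> \<le> B" "\<And>x. x \<in> Delta_inf \<Longrightarrow> \<bar>w x\<bar> \<le> C" using F(3) G(3) by blast
  obtain B' C' where BC': "0 < B'" "\<And>x. x \<in> Delta_inf \<Longrightarrow> \<bar>f x\<bar> \<le> B'" "0 < C'" "\<And>x. x \<in> Delta_inf \<Longrightarrow> \<bar>g x\<bar> \<le> C'"
    using grad_bound[OF F(1)] grad_bound[OF G(1)] by blast
  obtain K where K: "\<And>x. x \<in> Delta_inf \<Longrightarrow> \<bar>Gam d e x\<bar> \<le> K" using Gam_bound[OF F(1) G(1)] by blast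
  have "\<bar>f x * w x + g x * v x + 2 * Gam d e x\<bar> \<le> B' * C + C' * B + 2 * K" if x: "x \<in> Delta_inf" for x
  proof -
    have "\<bar>f x * w x\<bar> \<le> B' * C" unfolding abs_mult using BC'(1) by (intro mult_mono BC'(2) BC(2) x) auto
    moreover have "\<bar>g x * v x\<bar> \<le> C' * B" unfolding abs_mult using BC'(3) by (intro mult_mono BC'(4) BC(1) x) auto
    ultimately show ?thesis using K[OF x] by linarith
  qed
  then show "\<exists>B. \<forall>x\<in>Delta_inf. \<bar>f x * w x + g x * v x + 2 * Gam d e x\<bar> \<le> B" by blast
  fix h r assume h: "grad h r"
  note [measurable] = grad_measurable(1)[OF h]
  have hf: "grad (\<lambda>x. h x * f x) (\<lambda>n x. h x * d n x + r n x * f x)" by (rule grad_mult[OF h F(1)])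
  have hg: "grad (\<lambda>x. h x * g x) (\<lambda>n x. h x * e n x + r n x * g x)" by (rule grad_mult[OF h G(1)])
  \<comment> \<open>The identity \<open>\<Gamma>(h, f g) = \<Gamma>(h f, g) + \<Gamma>(h g, f) - 2 h
    \<Gamma>(f, g)\<close>: the first two terms become tests of \<open>g\<close> and
    \<open>f\<close> against products.\<close>
  have pt: "Gam r (\<lambda>n x. f x * e n x + d n x * g x) x =
      Gam (\<lambda>n x. h x * d n x + r n x * f x) e x + Gam (\<lambda>n x. h x * e n x + r n x * g x) d x - 2 * h x * Gam d e x"
    if x: "x \<in> Delta_inf" for x
  proof -
    have 1: "Gam (\<lambda>n x. f x * e n x + g x * d n x) r x = f x * Gam e r x + g x * Gam d r x"
      by (rule Gam_lin[OF x G(1) F(1) h])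
    have 2: "Gam (\<lambda>n x. h x * d n x + f x * r n x) e x = h x * Gam d e x + f x * Gam r e x"
      by (rule Gam_lin[OF x F(1) h G(1)])
    have 3: "Gam (\<lambda>n x. h x * e n x + g x * r n x) d x = h x * Gam e d x + g x * Gam r d x"
      by (rule Gam_lin[OF x G(1) h F(1)])
    show ?thesis using 1 2 3 by (simp add: mult.commute Gam_commute[of r] Gam_commute[of e d])
  qed
  have ig: "integrable mu (\<lambda>x. h x * Gam d e x)"
    by (rule bounded_mult_integrable[OF grad_measurable(1)[OF h] Gam_meas[OF F(1) G(1)] grad_bdd[OF h] Gam_bound[OF F(1) G(1)]])
  have "Q r (\<lambda>n x. f x * e n x + d n x * g x) = (\<integral>x. Gam (\<lambda>n x. h x * d n x + r n x * f x) e x + Gam (\<lambda>n x. h x * e n x + r n x * g x) d x - 2 * (h x * Gam d e x) \<partial>mu)"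
    unfolding Q_def
  proof (rule integral_cong_Delta)
    note [measurable] = Gam_meas[OF hf G(1)] Gam_meas[OF hg F(1)]
    show "(\<lambda>x. Gam (\<lambda>n x. h x * d n x + r n x * f x) e x + Gam (\<lambda>n x. h x * e n x + r n x * g x) d x - 2 * (h x * Gam d e x)) \<in> borel_measurable Msp"
      by measurable
  qed (use Gam_meas[OF h gr] pt in \<open>simp_all add: mult.assoc\<close>)
  also have "\<dots> = Q (\<lambda>n x. h x * d n x + r n x * f x) e + Q (\<lambda>n x. h x * e n x + r n x * g x) d - 2 * (\<integral>x. h x * Gam d e x \<partial>mu)"
    unfolding Q_def using Gam_integrable[OF hf G(1)] Gam_integrable[OF hg F(1)] ig by simp
  also have "\<dots> = - (\<integral>x. (h x * f x) * w x \<partial>mu) - (\<integral>x. (h x * g x) * v x \<partial>mu) - 2 * (\<integral>x. h x * Gam d e x \<partial>mu)"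
    by (simp add: G(4)[OF hf] F(4)[OF hg])
  also have "\<dots> = - (\<integral>x. (h x * f x) * w x + (h x * g x) * v x + 2 * (h x * Gam d e x) \<partial>mu)"
    using grad_mult_integrable[OF hf g] grad_mult_integrable[OF hg f] ig by simp
  also have "(\<lambda>x. (h x * f x) * w x + (h x * g x) * v x + 2 * (h x * Gam d e x)) = (\<lambda>x. h x * (f x * w x + g x * v x + 2 * Gam d e x))"
    by (rule ext) (simp add: algebra_simps)
  finally show "Q r (\<lambda>n x. f x * e n x + d n x * g x) = - (\<integral>x. h x * (f x * w x + g x * v x + 2 * Gam d e x) \<partial>mu)" .
qed

text \<open>The identities for single coordinates are summed over \<open>n < k\<close>; summability
  of \<open>\<alpha>\<close> and the bound 1 on \<open>|x|\<close> provide the dominating constants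
  for the limit.\<close>

lemma gen_suminf: "gen suminf (\<lambda>n x. 1) (\<lambda>x. suminf \<alpha> * (1 - suminf x) - ainf * suminf x)"
  unfolding gen_def
proof (intro conjI allI impI)
  show g: "grad suminf (\<lambda>n x. 1)" by (rule grad_suminf)
  have A: "0 \<le> suminf \<alpha>" using pos by (intro suminf_nonneg summ) (auto intro: less_imp_le)
  have bd: "\<bar>a * (1 - suminf x) - ainf * t\<bar> \<le> suminf \<alpha> + ainf"
    if "x \<in> Delta_inf" "0 \<le> a" "a \<le> suminf \<alpha>" "0 \<le> t" "t \<le> 1" for a t x
  proof -
    have "0 \<le> a * (1 - suminf x)" "a * (1 - suminf x) \<le> a" "0 \<le> ainf * t" "ainf * t \<le> ainf"
      using that Delta_infD(4,5)[OF that(1)] ainf_pos by (auto simp: mult_left_le)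
    then show ?thesis using that(3) A ainf_pos unfolding abs_le_iff by linarith
  qed
  show "\<exists>B. \<forall>x\<in>Delta_inf. \<bar>suminf \<alpha> * (1 - suminf x) - ainf * suminf x\<bar> \<le> B"
    using bd[OF _ A order_refl] Delta_infD(4,5) by blast
  fix f r assume f: "grad f r"
  note [measurable] = grad_measurable[OF f]
  obtain B where B: "0 < B" "\<And>x. x \<in> Delta_inf \<Longrightarrow> \<bar>f x\<bar> \<le> B" "\<And>n x. x \<in> Delta_inf \<Longrightarrow> \<bar>r n x\<bar> \<le> B"
    using grad_bound[OF f] by blast
  have 1: "(\<lambda>k. \<integral>x. (\<Sum>n<k. (1 - suminf x) * (x n * r n x)) \<partial>mu) \<longlonglongrightarrow> Q r (\<lambda>n x. 1)"
    unfolding Q_def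
  proof (rule dominated_Delta[OF Gam_meas[OF f g]])
    fix x assume x: "x \<in> Delta_inf"
    note s = Gam_summable[OF x f g]
    have "(\<lambda>k. (1 - suminf x) * (\<Sum>n<k. x n * r n x * 1)) \<longlonglongrightarrow> (1 - suminf x) * (\<Sum>n. x n * r n x * 1)"
      by (intro tendsto_intros summable_LIMSEQ s)
    then show "(\<lambda>k. \<Sum>n<k. (1 - suminf x) * (x n * r n x)) \<longlonglongrightarrow> Gam r (\<lambda>n x. 1) x"
      by (simp add: Gam_def sum_distrib_left)
  next
    fix k x assume x: "x \<in> Delta_inf"
    have "\<bar>\<Sum>n<k. (1 - suminf x) * (x n * r n x)\<bar> \<le> (\<Sum>n<k. \<bar>(1 - suminf x) * (x n * r n x)\<bar>)" by (rule sum_abs)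
    also have "\<dots> \<le> (\<Sum>n<k. x n * B)"
    proof (rule sum_mono)
      fix n
      have "\<bar>1 - suminf x\<bar> * (\<bar>x n\<bar> * \<bar>r n x\<bar>) \<le> 1 * (x n * B)"
        using Delta_infD(1)[OF x, of n] Delta_infD(4,5)[OF x] B(1) by (intro mult_mono B(3)[OF x]) auto
      then show "\<bar>(1 - suminf x) * (x n * r n x)\<bar> \<le> x n * B" by (simp add: abs_mult)
    qed
    also have "\<dots> = (\<Sum>n<k. x n) * B" by (simp add: sum_distrib_right)
    also have "\<dots> \<le> 1 * B" using Delta_infD(4)[OF x] Delta_infD(6)[OF x, of k] B(1) by (intro mult_right_mono) auto
    finally show "\<bar>\<Sum>n<k. (1 - suminf x) * (x n * r n x)\<bar> \<le> B" by simp
  qed measurable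
  have 2: "(\<integral>x. (\<Sum>n<k. (1 - suminf x) * (x n * r n x)) \<partial>mu) =
     - (\<integral>x. f x * ((\<Sum>n<k. \<alpha> n) * (1 - suminf x) - ainf * (\<Sum>n<k. x n)) \<partial>mu)" for k
  proof -
    have "(\<integral>x. (\<Sum>n<k. (1 - suminf x) * (x n * r n x)) \<partial>mu) = - (\<Sum>n<k. \<integral>x. f x * (\<alpha> n * (1 - suminf x) - ainf * x n) \<partial>mu)"
      using ibp_split(1,2)[OF f] by (simp add: sum_negf)
    also have "(\<Sum>n<k. \<integral>x. f x * (\<alpha> n * (1 - suminf x) - ainf * x n) \<partial>mu) = (\<integral>x. (\<Sum>n<k. f x * (\<alpha> n * (1 - suminf x) - ainf * x n)) \<partial>mu)"
      using ibp_split(3)[OF f] by simp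
    also have "(\<lambda>x. \<Sum>n<k. f x * (\<alpha> n * (1 - suminf x) - ainf * x n)) = (\<lambda>x. f x * ((\<Sum>n<k. \<alpha> n) * (1 - suminf x) - ainf * (\<Sum>n<k. x n)))"
      by (rule ext) (simp add: sum_distrib_left[symmetric] sum_subtractf sum_distrib_right)
    finally show ?thesis .
  qed
  have 3: "(\<lambda>k. \<integral>x. f x * ((\<Sum>n<k. \<alpha> n) * (1 - suminf x) - ainf * (\<Sum>n<k. x n)) \<partial>mu) \<longlonglongrightarrow>
     (\<integral>x. f x * (suminf \<alpha> * (1 - suminf x) - ainf * suminf x) \<partial>mu)"
  proof (rule dominated_Delta)
    fix x assume x: "x \<in> Delta_inf"
    show "(\<lambda>k. f x * ((\<Sum>n<k. \<alpha> n) * (1 - suminf x) - ainf * (\<Sum>n<k. x n))) \<longlonglongrightarrow> f x * (suminf \<alpha> * (1 - suminf x) - ainf * suminf x)"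
      by (intro tendsto_intros summable_LIMSEQ summ Delta_infD(3)[OF x])
  next
    fix k x assume x: "x \<in> Delta_inf"
    have a: "0 \<le> (\<Sum>n<k. \<alpha> n)" "(\<Sum>n<k. \<alpha> n) \<le> suminf \<alpha>"
      by (intro sum_nonneg less_imp_le[OF pos]) (rule sum_le_suminf[OF summ], auto intro: less_imp_le[OF pos])
    have t: "0 \<le> (\<Sum>n<k. x n)" "(\<Sum>n<k. x n) \<le> 1"
      using Delta_infD(1,4)[OF x] Delta_infD(6)[OF x, of k] by (auto simp: sum_nonneg)
    show "\<bar>f x * ((\<Sum>n<k. \<alpha> n) * (1 - suminf x) - ainf * (\<Sum>n<k. x n))\<bar> \<le> B * (suminf \<alpha> + ainf)"
      unfolding abs_mult using B(1) by (intro mult_mono B(2)[OF x] bd[OF x a t]) auto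
  qed measurable
  show "Q r (\<lambda>n x. 1) = - (\<integral>x. f x * (suminf \<alpha> * (1 - suminf x) - ainf * suminf x) \<partial>mu)"
    by (rule LIMSEQ_unique[OF 1[unfolded 2] tendsto_minus[OF 3]])
qed measurable

text \<open>Integration by parts is applied to \<open>h * partial n f\<close>, one coordinate at a
  time: the product rule yields the energy integrand and the second-order term of
  \<open>Lop\<close>. Only \<open>n < m\<close> contribute, so all series are finite sums.\<close>

lemma gen_FC2:
  assumes f: "f \<in> FC2" shows "gen f (\<lambda>n. partial n f) (Lop \<alpha> ainf f)"
proof -
  note f1 = FC2_FC1(1)[OF f] and pf = FC2_FC1(2)[OF f]
  obtain m where m: "\<forall>n\<ge>m. partial n f = (\<lambda>x. 0)" using FC1_dep[OF f1] by blast
  let ?t = "\<lambda>n x. (1 - suminf x) * (x n * partial n (partial n f) x) + partial n f x * (\<alpha> n * (1 - suminf x) - ainf * x n)"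
  have L: "Lop \<alpha> ainf f x = (\<Sum>n<m. ?t n x)" for x
  proof -
    have "Lop \<alpha> ainf f x = (\<Sum>n. ?t n x)" unfolding Lop_def by (simp add: mult_ac)
    also have "\<dots> = (\<Sum>n<m. ?t n x)"
      by (rule suminf_finite) (use m FC1_const(2)[of _ 0] in auto)
    finally show ?thesis .
  qed
  have pfm [measurable]: "partial n f \<in> borel_measurable Msp" "partial i (partial n f) \<in> borel_measurable Msp" for n i
    by (rule FC1D(4)[OF pf], rule FC1D(5)[OF pf])
  show ?thesis unfolding gen_def
  proof (intro conjI allI impI)
    show gf: "grad f (\<lambda>n. partial n f)" by (rule grad_FC1[OF f1])
    have Lm: "(\<lambda>x. \<Sum>n<m. ?t n x) \<in> borel_measurable Msp" by measurable
    then show "Lop \<alpha> ainf f \<in> borel_measurable Msp" using L by (subst measurable_cong[of _ _ "\<lambda>x. \<Sum>n<m. ?t n x"]) auto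
    have "\<exists>B. \<forall>x\<in>Delta_inf. \<bar>?t n x\<bar> \<le> B" for n
    proof -
      obtain B where B: "0 < B" "\<And>x. x \<in> Delta_inf \<Longrightarrow> \<bar>partial n f x\<bar> \<le> B" "\<And>i x. x \<in> Delta_inf \<Longrightarrow> \<bar>partial i (partial n f) x\<bar> \<le> B"
        using grad_bound[OF grad_FC1[OF pf[of n]]] by blast
      have "\<bar>?t n x\<bar> \<le> B + B * (\<alpha> n + ainf)" if x: "x \<in> Delta_inf" for x
      proof -
        have "\<bar>1 - suminf x\<bar> * (\<bar>x n\<bar> * \<bar>partial n (partial n f) x\<bar>) \<le> 1 * (1 * B)"
          using Delta_infD(1,2)[OF x, of n] Delta_infD(4,5)[OF x] B(3)[OF x, of n] B(1) by (intro mult_mono) auto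
        moreover have "\<bar>partial n f x * (\<alpha> n * (1 - suminf x) - ainf * x n)\<bar> \<le> B * (\<alpha> n + ainf)"
          unfolding abs_mult using B(1) by (intro mult_mono B(2)[OF x] drift_bound[OF x]) auto
        ultimately show ?thesis
          unfolding abs_mult[symmetric] by linarith
      qed
      then show ?thesis by blast
    qed
    then obtain B where B: "\<And>n x. x \<in> Delta_inf \<Longrightarrow> \<bar>?t n x\<bar> \<le> B n" by metis
    have "\<bar>Lop \<alpha> ainf f x\<bar> \<le> (\<Sum>n<m. B n)" if "x \<in> Delta_inf" for x
      unfolding L by (rule order_trans[OF sum_abs sum_mono]) (rule B[OF that])
    then show "\<exists>B. \<forall>x\<in>Delta_inf. \<bar>Lop \<alpha> ainf f x\<bar> \<le> B" by blast
    fix h r assume h: "grad h r"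
    note [measurable] = grad_measurable[OF h]
    note hp = grad_mult[OF h grad_FC1[OF pf]]
    let ?u = "\<lambda>n x. (1 - suminf x) * (x n * (r n x * partial n f x))"
    let ?w = "\<lambda>n x. h x * ?t n x"
    have ih: "integrable mu (\<lambda>x. (1 - suminf x) * (x n * (h x * partial n (partial n f) x)))" for n
    proof -
      obtain B where B: "0 < B" "\<And>i x. x \<in> Delta_inf \<Longrightarrow> \<bar>partial i (partial n f) x\<bar> \<le> B"
        using grad_bound[OF grad_FC1[OF pf[of n]]] by blast
      have "\<bar>(1 - suminf x) * (x n * partial n (partial n f) x)\<bar> \<le> B" if x: "x \<in> Delta_inf" for x
      proof -
        have "\<bar>1 - suminf x\<bar> * (\<bar>x n\<bar> * \<bar>partial n (partial n f) x\<bar>) \<le> 1 * (1 * B)"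
          using Delta_infD(1,2)[OF x, of n] Delta_infD(4,5)[OF x] B(2)[OF x, of n] B(1) by (intro mult_mono) auto
        then show ?thesis by (simp add: abs_mult)
      qed
      then have "integrable mu (\<lambda>x. h x * ((1 - suminf x) * (x n * partial n (partial n f) x)))"
        by (intro bounded_mult_integrable[OF grad_measurable(1)[OF h] _ grad_bdd[OF h]]) (measurable, blast)
      then show ?thesis by (simp add: mult_ac)
    qed
    have split: "(1 - suminf x) * (x n * (h x * partial n (partial n f) x + r n x * partial n f x)) =
       (1 - suminf x) * (x n * (h x * partial n (partial n f) x)) + ?u n x" for n x by (simp add: algebra_simps)
    have iu: "integrable mu (?u n)" for n
      using Bochner_Integration.integrable_diff[OF ibp_split(2)[OF hp, of n n] ih[of n]] unfolding split by simp
    have e: "(\<integral>x. ?u n x \<partial>mu) = - (\<integral>x. ?w n x \<partial>mu)" and iw: "integrable mu (?w n)" for n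
    proof -
      have i3: "integrable mu (\<lambda>x. h x * partial n f x * (\<alpha> n * (1 - suminf x) - ainf * x n))" by (rule ibp_split(3)[OF hp])
      have w: "?w n = (\<lambda>x. (1 - suminf x) * (x n * (h x * partial n (partial n f) x)) + h x * partial n f x * (\<alpha> n * (1 - suminf x) - ainf * x n))"
        by (rule ext) (simp add: algebra_simps)
      show "integrable mu (?w n)" unfolding w by (rule Bochner_Integration.integrable_add[OF ih i3])
      have "(\<integral>x. (1 - suminf x) * (x n * (h x * partial n (partial n f) x)) \<partial>mu) + (\<integral>x. ?u n x \<partial>mu) =
         - (\<integral>x. h x * partial n f x * (\<alpha> n * (1 - suminf x) - ainf * x n) \<partial>mu)"
        using ibp_split(1)[OF hp, of n n] unfolding split using ih[of n] iu[of n] by simp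
      then show "(\<integral>x. ?u n x \<partial>mu) = - (\<integral>x. ?w n x \<partial>mu)"
        unfolding w using ih[of n] i3 by simp
    qed
    have "Q r (\<lambda>n. partial n f) = (\<integral>x. (\<Sum>n<m. ?u n x) \<partial>mu)"
      unfolding Q_def
    proof (rule integral_cong_Delta[OF Gam_meas[OF h gf]])
      fix x :: pt
      have "(\<Sum>n. x n * r n x * partial n f x) = (\<Sum>n<m. x n * r n x * partial n f x)"
        by (rule suminf_finite) (use m in auto)
      then show "Gam r (\<lambda>n. partial n f) x = (\<Sum>n<m. ?u n x)" by (simp add: Gam_def sum_distrib_left mult_ac)
    qed measurable
    also have "\<dots> = - (\<Sum>n<m. \<integral>x. ?w n x \<partial>mu)" using iu by (simp add: e sum_negf)
    also have "(\<Sum>n<m. \<integral>x. ?w n x \<partial>mu) = (\<integral>x. (\<Sum>n<m. ?w n x) \<partial>mu)" using iw by simp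
    also have "(\<lambda>x. \<Sum>n<m. ?w n x) = (\<lambda>x. h x * Lop \<alpha> ainf f x)" unfolding L by (simp add: sum_distrib_left)
    finally show "Q r (\<lambda>n. partial n f) = - (\<integral>x. h x * Lop \<alpha> ainf f x \<partial>mu)" .
  qed
qed

lemma gen_symmetric:
  assumes "gen f d v" "gen g e w"
  shows "(\<integral>x. g x * v x \<partial>mu) = (\<integral>x. f x * w x \<partial>mu)"
  using genD(4)[OF assms(1) genD(1)[OF assms(2)]] genD(4)[OF assms(2) genD(1)[OF assms(1)]] Q_commute[of d e] by simp

end

subsection \<open>Monomials indexed by their prime code\<close>

definition odd_prime :: "nat \<Rightarrow> nat" where
  "odd_prime = enumerate {q. prime q \<and> 2 < q}"

lemma infinite_odd_primes: "infinite {q::nat. prime q \<and> 2 < q}"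
proof
  assume "finite {q::nat. prime q \<and> 2 < q}"
  then have "finite ({q::nat. prime q \<and> 2 < q} \<union> {..2})" by simp
  moreover have "{p::nat. prime p} \<subseteq> {q. prime q \<and> 2 < q} \<union> {..2}" by auto
  ultimately show False using primes_infinite finite_subset by blast
qed

lemma odd_prime: "prime (odd_prime n)" "2 < odd_prime n"
  using enumerate_in_set[OF infinite_odd_primes, of n] by (auto simp: odd_prime_def)

lemma bij_odd_prime: "bij_betw odd_prime UNIV {q. prime q \<and> 2 < q}"
  unfolding odd_prime_def by (rule bij_enumerate[OF infinite_odd_primes])

definition var :: "nat \<Rightarrow> pt \<Rightarrow> real" where
  "var q x = (if q = 2 then suminf x else x (inv odd_prime q))"

lemma var_odd_prime: "var (odd_prime n) x = x n"
proof -
  have "inv odd_prime (odd_prime n) = n"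
    using bij_odd_prime by (intro inv_f_f) (simp add: bij_betw_def)
  then show ?thesis using odd_prime(2)[of n] by (simp add: var_def)
qed

lemma odd_prime_surj:
  assumes "prime q" "q \<noteq> 2" obtains n where "q = odd_prime n"
proof -
  have "2 < q" using assms prime_ge_2_nat[of q] by simp
  then have "q \<in> range odd_prime" using assms(1) bij_odd_prime unfolding bij_betw_def by blast
  then show thesis using that by blast
qed

text \<open>The code of \<open>|x|\<close> is 2, the smallest prime: the generator then maps every monomial to a
  combination of monomials with smaller or equal codes. The value at code 0 keeps \<open>cmono\<close> completely multiplicative.\<close>

definition cmono :: "nat \<Rightarrow> pt \<Rightarrow> real" where
  "cmono N x = (if N = 0 then 0 else \<Prod>q\<in>#prime_factorization N. var q x)"

lemma cmono_0 [simp]: "cmono 0 x = 0"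
  by (simp add: cmono_def)

lemma cmono_1 [simp]: "cmono (Suc 0) x = 1"
  by (simp add: cmono_def)

lemma cmono_mult: "cmono (a * b) x = cmono a x * cmono b x"
  by (simp add: cmono_def prime_factorization_mult)

lemma cmono_2: "cmono 2 x = suminf x"
proof -
  have "prime_factorization (2::nat) = {#2#}" by (rule prime_factorization_prime) (simp add: two_is_prime_nat)
  then show ?thesis by (simp add: cmono_def var_def)
qed

lemma cmono_odd_prime: "cmono (odd_prime n) x = x n"
  using odd_prime[of n] by (simp add: cmono_def prime_factorization_prime var_odd_prime)

text \<open>The set \<open>A\<close> is \<open>Delta_inf\<close> for identities involving the
  generator, which hold only there, and \<open>UNIV\<close> where functions have to agree
  exactly.\<close>

definition mspan :: "pt set \<Rightarrow> nat \<Rightarrow> (pt \<Rightarrow> real) \<Rightarrow> bool" where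
  "mspan A N f \<longleftrightarrow> (\<exists>c. \<forall>x\<in>A. f x = (\<Sum>j<N. c j * cmono j x))"

lemma mspan_cong: "mspan A N f \<Longrightarrow> (\<And>x. x \<in> A \<Longrightarrow> g x = f x) \<Longrightarrow> mspan A N g"
  by (simp add: mspan_def)

lemma mspan_subset: "mspan A N f \<Longrightarrow> B \<subseteq> A \<Longrightarrow> mspan B N f"
  unfolding mspan_def by blast

lemma mspan_lin:
  assumes "mspan A N f" "mspan A N g" shows "mspan A N (\<lambda>x. a * f x + b * g x)"
proof -
  obtain c where c: "\<And>x. x \<in> A \<Longrightarrow> f x = (\<Sum>j<N. c j * cmono j x)" using assms(1) unfolding mspan_def by blast
  obtain d where d: "\<And>x. x \<in> A \<Longrightarrow> g x = (\<Sum>j<N. d j * cmono j x)" using assms(2) unfolding mspan_def by blast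
  show ?thesis unfolding mspan_def
  proof (intro exI[of _ "\<lambda>j. a * c j + b * d j"] ballI)
    fix x assume "x \<in> A"
    then show "a * f x + b * g x = (\<Sum>j<N. (a * c j + b * d j) * cmono j x)"
      by (simp add: c d sum_distrib_left sum.distrib[symmetric] algebra_simps)
  qed
qed

lemma mspan_zero: "mspan A N (\<lambda>x. 0)"
  unfolding mspan_def by (intro exI[of _ "\<lambda>_. 0"]) simp

lemma mspan_cmult: "mspan A N f \<Longrightarrow> mspan A N (\<lambda>x. a * f x)"
  using mspan_lin[of A N f f a 0] by simp

lemma mspan_sum:
  "(\<And>i. i \<in> I \<Longrightarrow> mspan A N (f i)) \<Longrightarrow> mspan A N (\<lambda>x. \<Sum>i\<in>I. c i * f i x)"
proof (induction I rule: infinite_finite_induct)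
  case (insert i I)
  have "mspan A N (\<lambda>x. \<Sum>i\<in>I. c i * f i x)" using insert by blast
  from mspan_lin[OF insert.prems[of i] this, of "c i" 1] show ?case using insert by simp
qed (simp_all add: mspan_zero)

lemma mspan_mono:
  assumes "j < N" shows "mspan A N (cmono j)"
  unfolding mspan_def
proof (intro exI[of _ "\<lambda>i. if i = j then 1 else 0"] ballI)
  fix x
  have "(\<Sum>i<N. (if i = j then 1 else 0) * cmono i x) = (\<Sum>i<N. if i = j then cmono j x else 0)"
    by (rule sum.cong) auto
  then show "cmono j x = (\<Sum>i<N. (if i = j then 1 else 0) * cmono i x)" using assms by simp
qed

lemma mspan_le:
  assumes "mspan A N f" "N \<le> N'" shows "mspan A N' f"
proof -
  obtain c where c: "\<And>x. x \<in> A \<Longrightarrow> f x = (\<Sum>j<N. c j * cmono j x)" using assms(1) unfolding mspan_def by blast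
  have "mspan A N' (\<lambda>x. \<Sum>j<N. c j * cmono j x)" by (rule mspan_sum, rule mspan_mono) (use assms(2) in auto)
  then show ?thesis by (rule mspan_cong) (rule c)
qed

text \<open>The point of integer codes: multiplying monomials multiplies codes, so products respect
  the order.\<close>

lemma mspan_times:
  assumes "mspan A N f" "0 < q" shows "mspan A (q * N) (\<lambda>x. cmono q x * f x)"
proof -
  obtain c where c: "\<And>x. x \<in> A \<Longrightarrow> f x = (\<Sum>j<N. c j * cmono j x)" using assms(1) unfolding mspan_def by blast
  have "mspan A (q * N) (\<lambda>x. \<Sum>j<N. c j * cmono (q * j) x)" by (rule mspan_sum, rule mspan_mono) (use assms(2) in auto)
  then show ?thesis by (rule mspan_cong) (simp add: c sum_distrib_left cmono_mult mult_ac)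
qed

lemma mspan_exact: "mspan UNIV N f \<Longrightarrow> \<exists>c. f = (\<lambda>x. \<Sum>j<N. c j * cmono j x)"
  unfolding mspan_def fun_eq_iff by blast

abbreviation unit :: "nat \<Rightarrow> nat \<Rightarrow> pt \<Rightarrow> real" where
  "unit n \<equiv> (\<lambda>i x. if i = n then 1 else 0)"

abbreviation ones :: "nat \<Rightarrow> pt \<Rightarrow> real" where
  "ones \<equiv> (\<lambda>i x. 1)"

lemma grad_unit: "grad (\<lambda>x. x n) (unit n)"
  using grad_FC1[OF FC1_coord(1)[of n]] unfolding FC1_coord(2) .

lemma Gam_prod:
  assumes "x \<in> Delta_inf" "grad f d" "grad g e" "grad h r"
  shows "Gam (\<lambda>n x. f x * e n x + d n x * g x) r x = f x * Gam e r x + g x * Gam d r x"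
  using Gam_lin[OF assms(1,3,2,4), of f g] by (simp add: mult.commute)

section \<open>Triangularity of the generator on monomials\<close>

context simplex_params
begin

text \<open>The induction hypothesis along the prime factors of \<open>N\<close>. Attaching a
  variable to a monomial produces a cross term \<open>Gam\<close> with that variable, so
  triangularity is recorded for these terms too. Their constants are nonnegative because
  \<open>1 - |x|\<close> contributes its top part with a minus sign: as built below, the constant
  for a coordinate counts the factors \<open>|x|\<close> of the monomial, and the one for
  \<open>|x|\<close> counts all its factors.\<close>

definition good :: "nat \<Rightarrow> (nat \<Rightarrow> pt \<Rightarrow> real) \<Rightarrow> (pt \<Rightarrow> real) \<Rightarrow> real \<Rightarrow> bool" where
  "good N d w l \<longleftrightarrow> gen (cmono N) d w \<and> mspan Delta_inf N (\<lambda>x. w x + l * cmono N x) \<and> 0 \<le> l \<and>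
     (N = 1 \<longrightarrow> l = 0) \<and> (2 \<le> N \<longrightarrow> ainf \<le> l) \<and>
     (\<forall>n. \<exists>c\<ge>0. mspan Delta_inf (odd_prime n * N) (\<lambda>x. Gam d (unit n) x + c * cmono (odd_prime n * N) x)) \<and>
     (\<exists>c\<ge>0. mspan Delta_inf (2 * N) (\<lambda>x. Gam d ones x + c * cmono (2 * N) x))"

lemma goodD:
  assumes "good N d w l"
  shows "gen (cmono N) d w" "mspan Delta_inf N (\<lambda>x. w x + l * cmono N x)" "0 \<le> l"
    "N = 1 \<longrightarrow> l = 0" "2 \<le> N \<longrightarrow> ainf \<le> l"
    "\<exists>C. \<forall>n. 0 \<le> C n \<and> mspan Delta_inf (odd_prime n * N) (\<lambda>x. Gam d (unit n) x + C n * cmono (odd_prime n * N) x)"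
    "\<exists>c\<ge>0. mspan Delta_inf (2 * N) (\<lambda>x. Gam d ones x + c * cmono (2 * N) x)"
proof -
  note g = assms[unfolded good_def]
  show "gen (cmono N) d w" by (rule g[THEN conjunct1])
  note g = g[THEN conjunct2]
  show "mspan Delta_inf N (\<lambda>x. w x + l * cmono N x)" by (rule g[THEN conjunct1])
  note g = g[THEN conjunct2]
  show "0 \<le> l" by (rule g[THEN conjunct1])
  note g = g[THEN conjunct2]
  show "N = 1 \<longrightarrow> l = 0" by (rule g[THEN conjunct1])
  note g = g[THEN conjunct2]
  show "2 \<le> N \<longrightarrow> ainf \<le> l" by (rule g[THEN conjunct1])
  note g = g[THEN conjunct2]
  show "\<exists>C. \<forall>n. 0 \<le> C n \<and> mspan Delta_inf (odd_prime n * N) (\<lambda>x. Gam d (unit n) x + C n * cmono (odd_prime n * N) x)"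
    by (rule choice[OF g[THEN conjunct1]])
  show "\<exists>c\<ge>0. mspan Delta_inf (2 * N) (\<lambda>x. Gam d ones x + c * cmono (2 * N) x)"
    by (rule g[THEN conjunct2])
qed

lemma good_1: "good 1 (\<lambda>n x. 0) (\<lambda>x. 0) 0"
proof -
  have m: "cmono 1 = (\<lambda>x. 1)" by (rule ext) simp
  show ?thesis unfolding good_def m
    using gen_const[of 1] mspan_zero by (auto simp: Gam_def intro!: exI[of _ 0])
qed

text \<open>The product rule adds to \<open>l\<close> the entry \<open>ainf\<close> from the drift
  of \<open>x k\<close> and \<open>2 * C k\<close> from the cross term. The rest of the drift,
  \<open>\<alpha> k * (1 - |x|)\<close> times the old monomial, has the smaller codes
  \<open>N\<close> and \<open>2 * N\<close>.\<close>

lemma good_step_odd: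
  assumes N: "1 \<le> N" and g: "good N d w l"
  shows "\<exists>d' w' l'. good (odd_prime k * N) d' w' l'"
proof -
  let ?q = "odd_prime k"
  note q = odd_prime[of k]
  have gN: "gen (cmono N) d w" and W: "mspan Delta_inf N (\<lambda>x. w x + l * cmono N x)" and l: "0 \<le> l"
    by (rule goodD[OF g])+
  obtain C where C: "\<And>n. 0 \<le> C n" "\<And>n. mspan Delta_inf (odd_prime n * N) (\<lambda>x. Gam d (unit n) x + C n * cmono (odd_prime n * N) x)"
    using goodD(6)[OF g] by (elim exE) blast
  obtain c where c: "0 \<le> c" "mspan Delta_inf (2 * N) (\<lambda>x. Gam d ones x + c * cmono (2 * N) x)"
    using goodD(7)[OF g] by (elim exE conjE)
  note gd = genD(1)[OF gN]
  let ?d = "\<lambda>n x. x k * d n x + unit k n x * cmono N x"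
  let ?w = "\<lambda>x. x k * w x + cmono N x * (\<alpha> k * (1 - suminf x) - ainf * x k) + 2 * Gam (unit k) d x"
  have eq: "(\<lambda>x. x k * cmono N x) = cmono (?q * N)" by (rule ext) (simp add: cmono_mult cmono_odd_prime)
  have gen': "gen (cmono (?q * N)) ?d ?w"
    using gen_mult[OF gen_coord[of k] gN] unfolding eq by (simp add: add_ac)
  \<comment> \<open>\<open>2 * N < odd_prime k * N\<close> is where the smaller code of
    \<open>|x|\<close>, compared with every coordinate, enters.\<close>
  have lt: "N < ?q * N" "2 * N < ?q * N" using N q(2) by auto
  have "good (?q * N) ?d ?w (l + ainf + 2 * C k)"
    unfolding good_def
  proof (intro conjI allI impI)
    show "gen (cmono (?q * N)) ?d ?w" by (rule gen')
    show "mspan Delta_inf (?q * N) (\<lambda>x. ?w x + (l + ainf + 2 * C k) * cmono (?q * N) x)"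
    proof (rule mspan_cong)
      show "mspan Delta_inf (?q * N) (\<lambda>x. 1 * (1 * (cmono ?q x * (w x + l * cmono N x)) + 2 * (Gam d (unit k) x + C k * cmono (?q * N) x))
         + 1 * (\<alpha> k * cmono N x + (- \<alpha> k) * cmono (2 * N) x))"
        by (intro mspan_lin mspan_times[OF W] C(2) mspan_mono lt) (use q in auto)
      show "?w x + (l + ainf + 2 * C k) * cmono (?q * N) x =
         1 * (1 * (cmono ?q x * (w x + l * cmono N x)) + 2 * (Gam d (unit k) x + C k * cmono (?q * N) x))
         + 1 * (\<alpha> k * cmono N x + (- \<alpha> k) * cmono (2 * N) x)" for x
        unfolding cmono_mult cmono_odd_prime cmono_2 Gam_commute[of d] by (simp add: algebra_simps)
    qed
    show "0 \<le> l + ainf + 2 * C k" using l ainf_pos C(1)[of k] by simp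
    show "l + ainf + 2 * C k = 0" if "?q * N = 1" using that lt N by simp
    show "ainf \<le> l + ainf + 2 * C k" using l C(1)[of k] by simp
    fix n
    let ?r = "odd_prime n"
    note r = odd_prime[of n]
    have "mspan Delta_inf (?r * (?q * N)) (\<lambda>x. Gam ?d (unit n) x + C n * cmono (?r * (?q * N)) x)"
    proof (rule mspan_cong)
      have 1: "mspan Delta_inf (?r * (?q * N)) (\<lambda>x. cmono ?q x * (Gam d (unit n) x + C n * cmono (?r * N) x))"
        using mspan_times[OF C(2)[of n], of ?q] q by (simp add: mult_ac)
      have b: "?r * N < ?r * (?q * N)" "?r * (2 * N) < ?r * (?q * N)" using r(2) lt by auto
      show "mspan Delta_inf (?r * (?q * N)) (\<lambda>x. 1 * (cmono ?q x * (Gam d (unit n) x + C n * cmono (?r * N) x)) +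
         (if n = k then 1 else 0) * (1 * cmono (?r * N) x + (-1) * cmono (?r * (2 * N)) x))"
        by (intro mspan_lin 1 mspan_mono b)
      fix x assume x: "x \<in> Delta_inf"
      have "Gam ?d (unit n) x = x k * Gam d (unit n) x + cmono N x * Gam (unit k) (unit n) x"
        by (rule Gam_prod[OF x grad_unit gd grad_unit])
      also have "Gam (unit k) (unit n) x = (if n = k then (1 - suminf x) * x n else 0)"
        unfolding Gam_unit[OF x] by simp
      finally show "Gam ?d (unit n) x + C n * cmono (?r * (?q * N)) x =
         1 * (cmono ?q x * (Gam d (unit n) x + C n * cmono (?r * N) x)) +
         (if n = k then 1 else 0) * (1 * cmono (?r * N) x + (-1) * cmono (?r * (2 * N)) x)"
        unfolding cmono_mult cmono_odd_prime cmono_2 by (simp add: algebra_simps)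
    qed
    then show "\<exists>c\<ge>0. mspan Delta_inf (?r * (?q * N)) (\<lambda>x. Gam ?d (unit n) x + c * cmono (?r * (?q * N)) x)"
      using C(1)[of n] by blast
  next
    have "mspan Delta_inf (2 * (?q * N)) (\<lambda>x. Gam ?d ones x + (c + 1) * cmono (2 * (?q * N)) x)"
    proof (rule mspan_cong)
      have 1: "mspan Delta_inf (2 * (?q * N)) (\<lambda>x. cmono ?q x * (Gam d ones x + c * cmono (2 * N) x))"
        using mspan_times[OF c(2), of ?q] q by (simp add: mult_ac)
      have b: "?q * N < 2 * (?q * N)" using lt N by simp
      show "mspan Delta_inf (2 * (?q * N)) (\<lambda>x. 1 * (cmono ?q x * (Gam d ones x + c * cmono (2 * N) x)) + 1 * cmono (?q * N) x)"
        by (intro mspan_lin 1 mspan_mono b)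
      fix x assume x: "x \<in> Delta_inf"
      have "Gam ?d ones x = x k * Gam d ones x + cmono N x * Gam (unit k) ones x"
        by (rule Gam_prod[OF x grad_unit gd grad_suminf])
      also have "Gam (unit k) ones x = (1 - suminf x) * x k"
        unfolding Gam_commute[of "unit k"] Gam_unit[OF x] by simp
      finally show "Gam ?d ones x + (c + 1) * cmono (2 * (?q * N)) x =
         1 * (cmono ?q x * (Gam d ones x + c * cmono (2 * N) x)) + 1 * cmono (?q * N) x"
        unfolding cmono_mult cmono_odd_prime cmono_2 by (simp add: algebra_simps)
    qed
    then show "\<exists>c\<ge>0. mspan Delta_inf (2 * (?q * N)) (\<lambda>x. Gam ?d ones x + c * cmono (2 * (?q * N)) x)"
      using c(1) by (intro exI[of _ "c + 1"]) simp
  qed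
  then show ?thesis by blast
qed

text \<open>The drift of \<open>|x|\<close> is
  \<open>suminf \<alpha> - (suminf \<alpha> + ainf) * |x|\<close>, so the diagonal increment also
  contains \<open>suminf \<alpha>\<close>, while the constant part has the old code
  \<open>N\<close>.\<close>

lemma good_step_2:
  assumes N: "1 \<le> N" and g: "good N d w l"
  shows "\<exists>d' w' l'. good (2 * N) d' w' l'"
proof -
  have gN: "gen (cmono N) d w" and W: "mspan Delta_inf N (\<lambda>x. w x + l * cmono N x)" and l: "0 \<le> l"
    by (rule goodD[OF g])+
  obtain C where C: "\<And>n. 0 \<le> C n" "\<And>n. mspan Delta_inf (odd_prime n * N) (\<lambda>x. Gam d (unit n) x + C n * cmono (odd_prime n * N) x)"
    using goodD(6)[OF g] by (elim exE) blast
  obtain c where c: "0 \<le> c" "mspan Delta_inf (2 * N) (\<lambda>x. Gam d ones x + c * cmono (2 * N) x)"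
    using goodD(7)[OF g] by (elim exE conjE)
  note gd = genD(1)[OF gN]
  let ?A = "suminf \<alpha>"
  let ?d = "\<lambda>n x. suminf x * d n x + ones n x * cmono N x"
  let ?w = "\<lambda>x. suminf x * w x + cmono N x * (?A * (1 - suminf x) - ainf * suminf x) + 2 * Gam ones d x"
  have A: "0 \<le> ?A" using pos by (intro suminf_nonneg summ) (auto intro: less_imp_le)
  have eq: "(\<lambda>x. suminf x * cmono N x) = cmono (2 * N)" by (rule ext) (simp add: cmono_mult cmono_2)
  have gen': "gen (cmono (2 * N)) ?d ?w"
    using gen_mult[OF gen_suminf gN] unfolding eq by (simp add: add_ac)
  have lt: "N < 2 * N" using N by auto
  have "good (2 * N) ?d ?w (l + ?A + ainf + 2 * c)"
    unfolding good_def
  proof (intro conjI allI impI)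
    show "gen (cmono (2 * N)) ?d ?w" by (rule gen')
    show "mspan Delta_inf (2 * N) (\<lambda>x. ?w x + (l + ?A + ainf + 2 * c) * cmono (2 * N) x)"
    proof (rule mspan_cong)
      show "mspan Delta_inf (2 * N) (\<lambda>x. 1 * (1 * (cmono 2 x * (w x + l * cmono N x)) + 2 * (Gam d ones x + c * cmono (2 * N) x))
         + ?A * cmono N x)"
        by (intro mspan_lin mspan_times[OF W] c(2) mspan_mono lt) auto
      show "?w x + (l + ?A + ainf + 2 * c) * cmono (2 * N) x =
         1 * (1 * (cmono 2 x * (w x + l * cmono N x)) + 2 * (Gam d ones x + c * cmono (2 * N) x)) + ?A * cmono N x" for x
        unfolding cmono_mult cmono_2 Gam_commute[of d] by (simp add: algebra_simps)
    qed
    show "0 \<le> l + ?A + ainf + 2 * c" using l A ainf_pos c(1) by simp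
    show "l + ?A + ainf + 2 * c = 0" if "2 * N = 1" using that lt N by simp
    show "ainf \<le> l + ?A + ainf + 2 * c" using l A c(1) by simp
    fix n
    let ?r = "odd_prime n"
    note r = odd_prime[of n]
    have "mspan Delta_inf (?r * (2 * N)) (\<lambda>x. Gam ?d (unit n) x + (C n + 1) * cmono (?r * (2 * N)) x)"
    proof (rule mspan_cong)
      have 1: "mspan Delta_inf (?r * (2 * N)) (\<lambda>x. cmono 2 x * (Gam d (unit n) x + C n * cmono (?r * N) x))"
        using mspan_times[OF C(2)[of n], of 2] by (simp add: mult_ac)
      have b: "?r * N < ?r * (2 * N)" using r(2) lt by auto
      show "mspan Delta_inf (?r * (2 * N)) (\<lambda>x. 1 * (cmono 2 x * (Gam d (unit n) x + C n * cmono (?r * N) x)) + 1 * cmono (?r * N) x)"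
        by (intro mspan_lin 1 mspan_mono b)
      fix x assume x: "x \<in> Delta_inf"
      have "Gam ?d (unit n) x = suminf x * Gam d (unit n) x + cmono N x * Gam ones (unit n) x"
        by (rule Gam_prod[OF x grad_suminf gd grad_unit])
      also have "Gam ones (unit n) x = (1 - suminf x) * x n"
        unfolding Gam_unit[OF x] by simp
      finally show "Gam ?d (unit n) x + (C n + 1) * cmono (?r * (2 * N)) x =
         1 * (cmono 2 x * (Gam d (unit n) x + C n * cmono (?r * N) x)) + 1 * cmono (?r * N) x"
        unfolding cmono_mult cmono_odd_prime cmono_2 by (simp add: algebra_simps)
    qed
    then show "\<exists>c\<ge>0. mspan Delta_inf (?r * (2 * N)) (\<lambda>x. Gam ?d (unit n) x + c * cmono (?r * (2 * N)) x)"
      using C(1)[of n] by (intro exI[of _ "C n + 1"]) simp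
  next
    have "mspan Delta_inf (2 * (2 * N)) (\<lambda>x. Gam ?d ones x + (c + 1) * cmono (2 * (2 * N)) x)"
    proof (rule mspan_cong)
      have 1: "mspan Delta_inf (2 * (2 * N)) (\<lambda>x. cmono 2 x * (Gam d ones x + c * cmono (2 * N) x))"
        using mspan_times[OF c(2), of 2] by simp
      have b: "2 * N < 2 * (2 * N)" using N by simp
      show "mspan Delta_inf (2 * (2 * N)) (\<lambda>x. 1 * (cmono 2 x * (Gam d ones x + c * cmono (2 * N) x)) + 1 * cmono (2 * N) x)"
        by (intro mspan_lin 1 mspan_mono b)
      fix x assume x: "x \<in> Delta_inf"
      have "Gam ?d ones x = suminf x * Gam d ones x + cmono N x * Gam ones ones x"
        by (rule Gam_prod[OF x grad_suminf gd grad_suminf])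
      then show "Gam ?d ones x + (c + 1) * cmono (2 * (2 * N)) x =
         1 * (cmono 2 x * (Gam d ones x + c * cmono (2 * N) x)) + 1 * cmono (2 * N) x"
        unfolding cmono_mult cmono_2 Gam_one by (simp add: algebra_simps)
    qed
    then show "\<exists>c\<ge>0. mspan Delta_inf (2 * (2 * N)) (\<lambda>x. Gam ?d ones x + c * cmono (2 * (2 * N)) x)"
      using c(1) by (intro exI[of _ "c + 1"]) simp
  qed
  then show ?thesis by blast
qed

lemma good_exists: "1 \<le> N \<Longrightarrow> \<exists>d w l. good N d w l"
proof (induction N rule: less_induct)
  case (less N)
  show ?case
  proof (cases "N = 1")
    case True
    then show ?thesis using good_1 by blast
  next
    case False
    then obtain q where q: "prime q" "q dvd N" using prime_factor_nat by blast
    then obtain N' where N': "N = q * N'" by (auto elim: dvdE)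
    have "1 \<le> N'" "N' < N" using N' less.prems prime_ge_2_nat[OF q(1)] by (auto intro: Suc_leI gr0I)
    then obtain d w l where g: "good N' d w l" using less.IH by blast
    show ?thesis
    proof (cases "q = 2")
      case True
      then show ?thesis using good_step_2[OF \<open>1 \<le> N'\<close> g] N' by simp
    next
      case False
      then obtain k where "q = odd_prime k" using odd_prime_surj[OF q(1)] by blast
      then show ?thesis using good_step_odd[OF \<open>1 \<le> N'\<close> g] N' by simp
    qed
  qed
qed

text \<open>Code 0, the zero function, is included so that the system is indexed by all natural
  numbers; Gram--Schmidt turns it into a vanishing vector.\<close>

lemma mono_generator:
  "\<exists>d w l. gen (cmono N) d w \<and> mspan Delta_inf N (\<lambda>x. w x + l * cmono N x) \<and> 0 \<le> l \<and>
     (N = 1 \<longrightarrow> l = 0) \<and> (2 \<le> N \<longrightarrow> ainf \<le> l)"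
proof (cases "N = 0")
  case True
  have "cmono N = (\<lambda>x. 0)" using True by auto
  then show ?thesis using gen_const[of 0] True mspan_zero
    by (intro exI[of _ "\<lambda>n x. 0"] exI[of _ "\<lambda>x. 0"] exI[of _ 0]) auto
next
  case False
  then obtain d w l where "good N d w l" using good_exists[of N] by auto
  from goodD(1-5)[OF this] show ?thesis by (intro exI conjI)
qed

subsection \<open>The eigenbasis by Gram--Schmidt\<close>

lemma mono_L2: "cmono N \<in> L2 mu"
  using mono_generator[of N] gen_L2(1) by blast

text \<open>Unnormalized Gram--Schmidt. For a null vector \<open>gs j\<close> the quotient has
  denominator 0 and is 0 by convention, so that vector is skipped.\<close>

function gs :: "nat \<Rightarrow> pt \<Rightarrow> real" where
  "gs N = (\<lambda>x. cmono N x - (\<Sum>j<N. l2ip mu (cmono N) (gs j) / l2ip mu (gs j) (gs j) * gs j x))"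
  by auto
termination by (relation "Wellfounded.measure id") auto

declare gs.simps [simp del]

definition gsc :: "nat \<Rightarrow> nat \<Rightarrow> real" where
  "gsc N j = l2ip mu (cmono N) (gs j) / l2ip mu (gs j) (gs j)"

lemma gs_eq: "gs N x = cmono N x - (\<Sum>j<N. gsc N j * gs j x)"
  by (subst gs.simps) (simp add: gsc_def)

lemma mono_eq_gs: "cmono N = (\<lambda>x. gs N x + (\<Sum>j<N. gsc N j * gs j x))"
  by (rule ext) (simp add: gs_eq[of N])

lemma gs_L2: "gs N \<in> L2 mu"
proof (induction N rule: less_induct)
  case (less N)
  have "(\<lambda>x. cmono N x - (\<Sum>j<N. gsc N j * gs j x)) \<in> L2 mu"
    by (intro L2_diff mono_L2 L2_sum L2_cmult less.IH) simp
  then show ?case by (simp add: gs_eq[symmetric])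
qed

lemma gs_mspan: "mspan UNIV N (\<lambda>x. gs N x - cmono N x)" "mspan UNIV (Suc N) (gs N)"
proof (induction N rule: less_induct)
  case (less N)
  have "mspan UNIV N (\<lambda>x. \<Sum>j<N. (- gsc N j) * gs j x)"
    by (rule mspan_sum, rule mspan_le[OF less.IH(2)]) auto
  then show 1: "mspan UNIV N (\<lambda>x. gs N x - cmono N x)"
    by (rule mspan_cong) (simp add: gs_eq[of N] sum_negf)
  have "mspan UNIV (Suc N) (\<lambda>x. 1 * (gs N x - cmono N x) + 1 * cmono N x)"
    by (intro mspan_lin mspan_le[OF 1] mspan_mono) auto
  then show "mspan UNIV (Suc N) (gs N)" by (rule mspan_cong) simp
qed

lemma gs_orth: "i < N \<Longrightarrow> l2ip mu (gs N) (gs i) = 0"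
proof (induction N arbitrary: i rule: less_induct)
  case (less N)
  have orth: "l2ip mu (gs j) (gs i) = 0" if "j < N" "j \<noteq> i" for j
    using less.IH[of i j] less.IH[of j i] that less.prems l2ip_commute[of mu "gs i" "gs j"]
    by (cases "j < i") auto
  have "gs N = (\<lambda>x. cmono N x - (\<Sum>j<N. gsc N j * gs j x))" by (rule ext) (rule gs_eq)
  then have "l2ip mu (gs N) (gs i) = l2ip mu (cmono N) (gs i) - l2ip mu (\<lambda>x. \<Sum>j<N. gsc N j * gs j x) (gs i)"
    using l2ip_diff_left[OF mono_L2 L2_sum[OF L2_cmult[OF gs_L2]] gs_L2] by simp
  also have "l2ip mu (\<lambda>x. \<Sum>j<N. gsc N j * gs j x) (gs i) = (\<Sum>j<N. gsc N j * l2ip mu (gs j) (gs i))"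
    by (rule l2ip_sum_left) (rule gs_L2)+
  also have "\<dots> = (\<Sum>j<N. if j = i then gsc N i * l2ip mu (gs i) (gs i) else 0)"
    by (rule sum.cong) (auto simp: orth)
  also have "\<dots> = gsc N i * l2ip mu (gs i) (gs i)" using less.prems by simp
  \<comment> \<open>For a null vector \<open>gs i\<close> both sides vanish, the right one by
    Cauchy--Schwarz.\<close>
  also have "\<dots> = l2ip mu (cmono N) (gs i)"
  proof (cases "l2ip mu (gs i) (gs i) = 0")
    case True
    then have "(l2ip mu (cmono N) (gs i))\<^sup>2 \<le> 0"
      using l2_cauchy_schwarz_sq[OF mono_L2[of N] gs_L2[of i]] unfolding l2ip_same by simp
    then show ?thesis using True by simp
  qed (simp add: gsc_def)
  finally show ?case by simp
qed

lemma orth_mono: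
  assumes f: "f \<in> L2 mu" and o: "\<And>i. i \<le> N \<Longrightarrow> l2ip mu f (gs i) = 0"
  shows "l2ip mu f (cmono N) = 0"
proof -
  have o': "l2ip mu (gs i) f = 0" if "i \<le> N" for i
    using o[OF that] by (simp only: l2ip_commute[of mu "gs i" f])
  have e: "cmono N = (\<lambda>x. 1 * gs N x + 1 * (\<Sum>j<N. gsc N j * gs j x))"
    by (simp only: mult_1) (rule mono_eq_gs)
  have "l2ip mu (cmono N) f = 1 * l2ip mu (gs N) f + 1 * l2ip mu (\<lambda>x. \<Sum>j<N. gsc N j * gs j x) f"
    by (subst e) (rule l2ip_lin_left[OF gs_L2 L2_sum[OF L2_cmult[OF gs_L2]] f])
  also have "l2ip mu (\<lambda>x. \<Sum>j<N. gsc N j * gs j x) f = (\<Sum>j<N. gsc N j * l2ip mu (gs j) f)"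
    by (rule l2ip_sum_left) (rule gs_L2 f)+
  finally have "l2ip mu (cmono N) f = 0" using o' by simp
  then show ?thesis by (simp only: l2ip_commute[of mu f])
qed

lemma orth_mspan:
  assumes f: "f \<in> L2 mu" and g: "g \<in> L2 mu" and o: "\<And>i. i < N \<Longrightarrow> l2ip mu f (gs i) = 0"
    and s: "mspan Delta_inf N g"
  shows "l2ip mu f g = 0"
proof -
  obtain c where c: "\<And>x. x \<in> Delta_inf \<Longrightarrow> g x = (\<Sum>j<N. c j * cmono j x)" using s unfolding mspan_def by blast
  have L: "(\<lambda>x. \<Sum>j<N. c j * cmono j x) \<in> L2 mu" by (intro L2_sum L2_cmult mono_L2)
  have "AE x in mu. g x = (\<Sum>j<N. c j * cmono j x)" using AE_mu by eventually_elim (rule c)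
  then have "l2ip mu g f = l2ip mu (\<lambda>x. \<Sum>j<N. c j * cmono j x) f" by (rule l2ip_cong_AE[OF _ g L f])
  also have "\<dots> = (\<Sum>j<N. c j * l2ip mu (cmono j) f)" by (rule l2ip_sum_left) (rule mono_L2 f)+
  also have "\<dots> = 0"
  proof (rule sum.neutral, rule ballI)
    fix j assume "j \<in> {..<N}"
    then have "l2ip mu f (cmono j) = 0" by (intro orth_mono[OF f] o) simp
    then show "c j * l2ip mu (cmono j) f = 0" by (simp only: l2ip_commute[of mu "cmono j" f] mult_zero_right)
  qed
  finally show ?thesis by (simp only: l2ip_commute[of mu f])
qed

text \<open>A symmetric operator that is triangular in an ordered system is diagonal after
  Gram--Schmidt: \<open>gw N + ml N * gs N\<close> lies in the span of the codes below
  \<open>N\<close>, while symmetry makes it orthogonal to every \<open>gs i\<close> with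
  \<open>i < N\<close>, so its norm is 0.\<close>

lemma eigenbasis:
  obtains e :: "nat \<Rightarrow> pt \<Rightarrow> real" and D :: "nat \<Rightarrow> nat \<Rightarrow> pt \<Rightarrow> real" and lam :: "nat \<Rightarrow> real"
  where "\<And>i. grad (e i) (D i)" "\<And>i f r. grad f r \<Longrightarrow> Q r (D i) = lam i * l2ip mu f (e i)"
    "\<And>i j. i \<noteq> j \<Longrightarrow> l2ip mu (e i) (e j) = 0" "\<And>i. l2ip mu (e i) (e i) = 0 \<or> l2ip mu (e i) (e i) = 1"
    "\<And>i. 0 \<le> lam i" "e 1 = (\<lambda>x. 1)" "lam 1 = 0" "\<And>i. i \<noteq> 1 \<Longrightarrow> l2ip mu (e i) (e i) \<noteq> 0 \<Longrightarrow> ainf \<le> lam i"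
    "\<And>f N. f \<in> L2 mu \<Longrightarrow> (\<And>i. l2ip mu f (e i) = 0) \<Longrightarrow> l2ip mu f (cmono N) = 0"
proof -
  obtain md mw ml where M: "\<And>N. gen (cmono N) (md N) (mw N)" "\<And>N. mspan Delta_inf N (\<lambda>x. mw N x + ml N * cmono N x)"
    "\<And>N. 0 \<le> ml N" "ml 1 = 0" "\<And>N. 2 \<le> N \<Longrightarrow> ainf \<le> ml N" using mono_generator by metis
  have Wj: "mspan Delta_inf (Suc j) (mw j)" for j
  proof (rule mspan_cong)
    show "mspan Delta_inf (Suc j) (\<lambda>x. 1 * (mw j x + ml j * cmono j x) + (- ml j) * cmono j x)"
      by (intro mspan_lin mspan_le[OF M(2)] mspan_mono) auto
  qed simp
  have gsum: "gen (\<lambda>x. \<Sum>j<N. c j * cmono j x) (\<lambda>n x. \<Sum>j<N. c j * md j n x) (\<lambda>x. \<Sum>j<N. c j * mw j x)" for c N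
  proof (induction N)
    case 0
    show ?case using gen_const[of 0] by simp
  next
    case (Suc N)
    from gen_lin[OF this M(1)[of N], of 1 "c N"] show ?case by simp
  qed
  have "\<exists>d w. gen (gs N) d w \<and> mspan Delta_inf N (\<lambda>x. w x + ml N * gs N x)" for N
  proof -
    obtain c where c: "(\<lambda>x. gs N x - cmono N x) = (\<lambda>x. \<Sum>j<N. c j * cmono j x)"
      using mspan_exact[OF gs_mspan(1)[of N]] by blast
    have e: "(\<lambda>x. 1 * cmono N x + 1 * (\<Sum>j<N. c j * cmono j x)) = gs N"
      using fun_cong[OF c] by (intro ext) (simp add: algebra_simps)
    have "gen (gs N) (\<lambda>n x. 1 * md N n x + 1 * (\<Sum>j<N. c j * md j n x)) (\<lambda>x. 1 * mw N x + 1 * (\<Sum>j<N. c j * mw j x))"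
      using gen_lin[OF M(1)[of N] gsum[of c N], of 1 1] unfolding e .
    moreover have "mspan Delta_inf N (\<lambda>x. (1 * mw N x + 1 * (\<Sum>j<N. c j * mw j x)) + ml N * gs N x)"
    proof (rule mspan_cong)
      show "mspan Delta_inf N (\<lambda>x. 1 * (1 * (mw N x + ml N * cmono N x) + 1 * (\<Sum>j<N. c j * mw j x)) + ml N * (gs N x - cmono N x))"
        by (intro mspan_lin M(2) mspan_sum mspan_le[OF Wj] mspan_subset[OF gs_mspan(1)]) auto
    qed (simp add: algebra_simps)
    ultimately show ?thesis by blast
  qed
  then obtain gd gw where G: "\<And>N. gen (gs N) (gd N) (gw N)" "\<And>N. mspan Delta_inf N (\<lambda>x. gw N x + ml N * gs N x)" by metis
  have gwL: "gw N \<in> L2 mu" for N by (rule gen_L2(2)[OF G(1)])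
  have gwspan: "mspan Delta_inf (Suc i) (gw i)" for i
  proof (rule mspan_cong)
    show "mspan Delta_inf (Suc i) (\<lambda>x. 1 * (gw i x + ml i * gs i x) + (- ml i) * gs i x)"
      by (intro mspan_lin mspan_le[OF G(2)] mspan_subset[OF gs_mspan(2)]) auto
  qed simp
  have gorth: "l2ip mu (gs i) (gs j) = 0" if "i \<noteq> j" for i j
    using gs_orth[of i j] gs_orth[of j i] that l2ip_commute[of mu "gs i" "gs j"] by (cases "i < j") auto
  have eig: "l2ip mu f (gw N) = - ml N * l2ip mu f (gs N)" if f: "f \<in> L2 mu" for f N
  proof -
    let ?v = "\<lambda>x. 1 * gw N x + ml N * gs N x"
    have vL: "?v \<in> L2 mu" by (rule L2_lincomb[OF gwL gs_L2])
    have vo: "l2ip mu ?v (gs i) = 0" if "i < N" for i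
    proof -
      have "l2ip mu ?v (gs i) = 1 * l2ip mu (gw N) (gs i) + ml N * l2ip mu (gs N) (gs i)"
        by (rule l2ip_lin_left[OF gwL gs_L2 gs_L2])
      also have "l2ip mu (gw N) (gs i) = l2ip mu (gs N) (gw i)"
        using gen_symmetric[OF G(1)[of N] G(1)[of i]] by (simp add: l2ip_def mult.commute)
      also have "l2ip mu (gs N) (gw i) = 0"
        by (rule orth_mspan[OF gs_L2 gwL gs_orth mspan_le[OF gwspan]]) (use that in auto)
      finally show ?thesis using gs_orth[OF that] by simp
    qed
    have "l2ip mu ?v ?v = 0"
      by (rule orth_mspan[OF vL vL vo]) (use G(2)[of N] in simp_all)
    then have v0: "l2norm mu ?v = 0" by (simp add: l2ip_same)
    have "\<bar>l2ip mu ?v f\<bar> \<le> 0" using l2_cauchy_schwarz[OF vL f] v0 by simp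
    then have "1 * l2ip mu (gw N) f + ml N * l2ip mu (gs N) f = 0"
      using l2ip_lin_left[OF gwL[of N] gs_L2[of N] f, of 1 "ml N"] by simp
    then show ?thesis by (simp add: l2ip_commute[of mu f])
  qed
  \<comment> \<open>For a null vector \<open>1 / 0 = 0\<close> turns \<open>e i\<close> into the
    zero function itself. The summands with factor 0 below bring the definitions into the shape of
    the linearity lemmas.\<close>
  define z where "z i = 1 / l2norm mu (gs i)" for i
  define e where "e i = (\<lambda>x. z i * gs i x + 0 * gs i x)" for i
  define D where "D i = (\<lambda>n x. z i * gd i n x + 0 * gd i n x)" for i
  have gg: "grad (gs i) (gd i)" for i by (rule genD(1)[OF G(1)])
  have ge: "grad (e i) (D i)" for i unfolding e_def D_def by (rule grad_lin[OF gg gg])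
  have ipe: "l2ip mu f (e i) = z i * l2ip mu f (gs i)" if "f \<in> L2 mu" for f i
  proof -
    have "l2ip mu (e i) f = z i * l2ip mu (gs i) f + 0 * l2ip mu (gs i) f"
      unfolding e_def by (rule l2ip_lin_left[OF gs_L2 gs_L2 that])
    then show ?thesis by (simp only: l2ip_commute[of mu f] mult_zero_left add_0_right)
  qed
  have eL: "e i \<in> L2 mu" for i by (rule grad_L2[OF ge])
  have ee: "l2ip mu (e i) (e j) = z i * z j * l2ip mu (gs i) (gs j)" for i j
  proof -
    have "l2ip mu (e i) (e j) = z j * l2ip mu (gs j) (e i)"
      unfolding ipe[OF eL] l2ip_commute[of mu "e i" "gs j"] ..
    also have "l2ip mu (gs j) (e i) = z i * l2ip mu (gs i) (gs j)"
      unfolding ipe[OF gs_L2] by (simp only: l2ip_commute[of mu "gs j" "gs i"])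
    finally show ?thesis by (simp only: mult_ac)
  qed
  have g1: "gs 1 = (\<lambda>x. 1)"
  proof
    fix x
    have "gs 0 x = 0" for x using gs_eq[of 0 x] by simp
    then show "gs 1 x = 1" using gs_eq[of 1 x] by simp
  qed
  show thesis
  proof (rule that[of e D ml])
    show "grad (e i) (D i)" for i by (rule ge)
    show "Q r (D i) = ml i * l2ip mu f (e i)" if f: "grad f r" for f r i
    proof -
      have "Q r (D i) = z i * Q r (gd i)"
        using Q_lin[OF gg[of i] gg[of i] f, of "z i" 0] unfolding D_def by (simp add: Q_commute[of r])
      also have "Q r (gd i) = - l2ip mu f (gw i)" using genD(4)[OF G(1) f] by (simp add: l2ip_def)
      also have "\<dots> = ml i * l2ip mu f (gs i)" by (simp add: eig[OF grad_L2[OF f]])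
      finally show ?thesis by (simp add: ipe[OF grad_L2[OF f]])
    qed
    show "l2ip mu (e i) (e j) = 0" if "i \<noteq> j" for i j using gorth[OF that] by (simp add: ee)
    show "l2ip mu (e i) (e i) = 0 \<or> l2ip mu (e i) (e i) = 1" for i
      unfolding ee unfolding z_def l2ip_same by (simp add: power2_eq_square)
    show "0 \<le> ml i" for i by (rule M(3))
    show "e 1 = (\<lambda>x. 1)" unfolding e_def z_def g1 by (simp add: l2norm_def mu.prob_space[unfolded space_mu])
    show "ml 1 = 0" by (rule M(4))
    show "ainf \<le> ml i" if "i \<noteq> 1" "l2ip mu (e i) (e i) \<noteq> 0" for i
    proof (cases "i = 0")
      case True
      have "gs 0 = (\<lambda>x. 0)" by (rule ext) (simp add: gs_eq[of 0])
      then have "l2ip mu (e 0) (e 0) = 0" by (simp add: e_def l2ip_def)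
      then show ?thesis using that True by simp
    next
      case False
      then show ?thesis using that by (intro M(5)) simp
    qed
    show "l2ip mu f (cmono N) = 0" if f: "f \<in> L2 mu" and o: "\<And>i. l2ip mu f (e i) = 0" for f N
    proof (rule orth_mono[OF f])
      fix i
      show "l2ip mu f (gs i) = 0"
      proof (cases "l2norm mu (gs i) = 0")
        case True
        then show ?thesis using l2_cauchy_schwarz[OF f gs_L2[of i]] by simp
      next
        case False
        then show ?thesis using o[of i] ipe[OF f, of i] by (simp add: z_def)
      qed
    qed
  qed
qed

end

subsection \<open>The spectral representation of the energy\<close>

lemma mspan_mult:
  assumes "mspan A N f" "mspan A N' g" shows "mspan A (N * N') (\<lambda>x. f x * g x)"
proof -
  obtain c where c: "\<And>x. x \<in> A \<Longrightarrow> f x = (\<Sum>j<N. c j * cmono j x)" using assms(1) unfolding mspan_def by blast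
  obtain d where d: "\<And>x. x \<in> A \<Longrightarrow> g x = (\<Sum>j<N'. d j * cmono j x)" using assms(2) unfolding mspan_def by blast
  have "mspan A (N * N') (\<lambda>x. \<Sum>i<N. c i * (\<Sum>j<N'. d j * cmono (i * j) x))"
    by (rule mspan_sum, rule mspan_sum, rule mspan_mono) (auto intro: mult_strict_mono)
  then show ?thesis
  proof (rule mspan_cong)
    fix x assume x: "x \<in> A"
    show "f x * g x = (\<Sum>i<N. c i * (\<Sum>j<N'. d j * cmono (i * j) x))"
      by (simp only: c[OF x] d[OF x] sum_product) (simp add: sum_distrib_left cmono_mult mult_ac)
  qed
qed

lemma cpoly_mspan: "p \<in> cpoly \<Longrightarrow> \<exists>N. mspan UNIV N p"
proof (induction rule: cpoly.induct)
  case (const c)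
  have "mspan UNIV 2 (\<lambda>x. c * cmono 1 x)" by (intro mspan_cmult mspan_mono) simp
  then have "mspan UNIV 2 (\<lambda>x. c)" by (rule mspan_cong) simp
  then show ?case ..
next
  case (coord i)
  have "mspan UNIV (Suc (odd_prime i)) (cmono (odd_prime i))" by (rule mspan_mono) simp
  then have "mspan UNIV (Suc (odd_prime i)) (\<lambda>x. x i)" by (rule mspan_cong) (simp add: cmono_odd_prime)
  then show ?case ..
next
  case (add f g)
  then obtain N N' where "mspan UNIV N f" "mspan UNIV N' g" by blast
  then have "mspan UNIV (max N N') f" "mspan UNIV (max N N') g" by (auto intro: mspan_le)
  from mspan_lin[OF this, of 1 1] have "mspan UNIV (max N N') (\<lambda>x. f x + g x)" by simp
  then show ?case ..
next
  case (mult f g)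
  then obtain N N' where "mspan UNIV N f" "mspan UNIV N' g" by blast
  from mspan_mult[OF this] show ?case ..
qed

lemma FC1_contraction:
  assumes f: "f \<in> FC1" and "0 < \<epsilon>"
  obtains g where "g \<in> FC1" "\<And>x. \<bar>g x - min 1 (max 0 (f x))\<bar> \<le> \<epsilon>"
    "\<And>n x. \<bar>partial n g x\<bar> \<le> \<bar>partial n f x\<bar>"
proof (rule smooth_unit_contraction[OF assms(2)])
  fix \<psi> \<psi>' :: "real \<Rightarrow> real"
  assume d: "\<And>t. (\<psi> has_real_derivative \<psi>' t) (at t)" and c: "continuous_on UNIV \<psi>'"
    and b: "\<And>t. 0 \<le> \<psi>' t \<and> \<psi>' t \<le> 1" and a: "\<And>t. \<bar>\<psi> t - min 1 (max 0 t)\<bar> \<le> \<epsilon>"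
  show thesis
  proof (rule that[of "\<lambda>x. \<psi> (f x)"])
    show "(\<lambda>x. \<psi> (f x)) \<in> FC1" by (rule FC1_compose(1)[OF f d c])
    show "\<bar>\<psi> (f x) - min 1 (max 0 (f x))\<bar> \<le> \<epsilon>" for x by (rule a)
    show "\<bar>partial n (\<lambda>x. \<psi> (f x)) x\<bar> \<le> \<bar>partial n f x\<bar>" for n x
      unfolding FC1_compose(2)[OF f d c] abs_mult using b[of "f x"] by (intro mult_left_le_one_le) auto
  qed
qed

section \<open>Totality of the monomials in L2\<close>

context simplex_params
begin

lemma continuous_L2:
  assumes "continuous_on UNIV g" shows "g \<in> L2 mu"
proof -
  obtain B where B: "\<forall>x\<in>cube. \<bar>g x\<bar> \<le> B" using bounded_on_cube[OF assms] by blast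
  show ?thesis
    by (rule L2_bounded_Delta[OF borel_measurable_Msp_continuous[OF assms], of B]) (use B Delta_subset_cube in blast)
qed

lemma orth_continuous:
  assumes f: "f \<in> L2 mu" and o: "\<And>N. l2ip mu f (cmono N) = 0" and g: "continuous_on UNIV g"
  shows "l2ip mu f g = 0"
proof -
  have gL: "g \<in> L2 mu" by (rule continuous_L2[OF g])
  have le: "\<bar>l2ip mu f g\<bar> \<le> l2norm mu f * \<epsilon>" if "0 < \<epsilon>" for \<epsilon>
  proof -
    obtain p where p: "p \<in> cpoly" "\<forall>x\<in>cube. \<bar>g x - p x\<bar> < \<epsilon>" using cpoly_approx[OF g \<open>0 < \<epsilon>\<close>] by blast
    have pL: "p \<in> L2 mu" by (rule continuous_L2[OF FC1D(1)[OF cpoly_FC1[OF p(1)]]])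
    obtain N where "mspan UNIV N p" using cpoly_mspan[OF p(1)] by blast
    from mspan_exact[OF this] obtain c where c: "p = (\<lambda>x. \<Sum>j<N. c j * cmono j x)" by blast
    have o': "l2ip mu (cmono j) f = 0" for j using o[of j] by (simp only: l2ip_commute[of mu "cmono j" f])
    have "l2ip mu p f = (\<Sum>j<N. c j * l2ip mu (cmono j) f)"
      unfolding c by (rule l2ip_sum_left) (rule mono_L2 f)+
    then have pf: "l2ip mu p f = 0" by (simp add: o')
    have "l2ip mu (\<lambda>x. g x - p x) f = l2ip mu g f" using l2ip_diff_left[OF gL pL f] pf by simp
    moreover have "\<bar>l2ip mu (\<lambda>x. g x - p x) f\<bar> \<le> l2norm mu (\<lambda>x. g x - p x) * l2norm mu f"
      by (rule l2_cauchy_schwarz[OF L2_diff[OF gL pL] f])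
    moreover have "l2norm mu (\<lambda>x. g x - p x) \<le> \<epsilon>"
    proof (rule mu.l2norm_bound)
      show "(\<lambda>x. g x - p x) \<in> borel_measurable mu" by (rule L2_measurable[OF L2_diff[OF gL pL]])
      show "AE x in mu. \<bar>g x - p x\<bar> \<le> \<epsilon>"
        using AE_mu by eventually_elim (use p(2) Delta_subset_cube in \<open>auto intro: less_imp_le\<close>)
    qed
    then have "l2norm mu (\<lambda>x. g x - p x) * l2norm mu f \<le> \<epsilon> * l2norm mu f" by (rule mult_right_mono) simp
    ultimately show ?thesis by (simp add: l2ip_commute[of mu f g] mult.commute)
  qed
  have "\<bar>l2ip mu f g\<bar> \<le> 0"
  proof (rule field_le_epsilon)
    fix \<delta> :: real assume "0 < \<delta>"
    have p: "0 < l2norm mu f + 1" by (simp add: add_nonneg_pos)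
    have "\<bar>l2ip mu f g\<bar> \<le> l2norm mu f * (\<delta> / (l2norm mu f + 1))" using p \<open>0 < \<delta>\<close> by (intro le) simp
    also have "\<dots> \<le> (l2norm mu f + 1) * (\<delta> / (l2norm mu f + 1))"
      using p \<open>0 < \<delta>\<close> by (intro mult_right_mono) auto
    also have "\<dots> = 0 + \<delta>" using p by simp
    finally show "\<bar>l2ip mu f g\<bar> \<le> 0 + \<delta>" .
  qed
  then show ?thesis by simp
qed

text \<open>The continuous functions \<open>max 0 (1 - k * infdist x C)\<close> stay between 0 and 1
  and decrease to the indicator of a nonempty closed set.\<close>

lemma orth_closed:
  assumes f: "f \<in> L2 mu" and o: "\<And>N. l2ip mu f (cmono N) = 0" and C: "closed C"
  shows "(\<integral>x. f x * indicator C x \<partial>mu) = 0"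
proof (cases "C = {}")
  case False
  have fm: "f \<in> borel_measurable mu" by (rule L2_measurable[OF f])
  have Cm: "C \<in> sets mu" using C by (simp add: sets_Msp)
  define g where "g k x = max 0 (1 - real k * infdist x C)" for k x
  have gc: "continuous_on UNIV (g k)" for k unfolding g_def by (intro continuous_intros)
  have "(\<lambda>k. \<integral>x. f x * g k x \<partial>mu) \<longlonglongrightarrow> (\<integral>x. f x * indicator C x \<partial>mu)"
  proof (rule integral_dominated_convergence[where w="\<lambda>x. \<bar>f x\<bar>"])
    show "(\<lambda>x. f x * indicator C x) \<in> borel_measurable mu" using fm Cm by measurable
    show "(\<lambda>x. f x * g k x) \<in> borel_measurable mu" for k
      by (rule borel_measurable_times[OF fm]) (simp add: mm borel_measurable_Msp_continuous[OF gc])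
    show "integrable mu (\<lambda>x. \<bar>f x\<bar>)" using mu.L2_integrable[OF f] by simp
    have g01: "0 \<le> g k x" "g k x \<le> 1" for k x by (auto simp: g_def infdist_nonneg)
    have "\<bar>f x\<bar> * \<bar>g k x\<bar> \<le> \<bar>f x\<bar> * 1" for k x using g01[of k x] by (intro mult_left_mono) auto
    then show "AE x in mu. norm (f x * g k x) \<le> \<bar>f x\<bar>" for k by (simp add: abs_mult)
    have "(\<lambda>k. g k x) \<longlonglongrightarrow> indicator C x" for x
    proof (cases "x \<in> C")
      case True
      then show ?thesis by (simp add: g_def)
    next
      case xC: False
      then have p: "0 < infdist x C" using in_closed_iff_infdist_zero[OF C False] infdist_nonneg[of x C] by (simp add: order_less_le)
      obtain k0 where k0: "1 / infdist x C < real k0" using reals_Archimedean2 by blast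
      have "g k x = 0" if "k \<ge> k0" for k
      proof -
        have "1 / infdist x C < real k" using k0 that by (meson less_le_trans of_nat_le_iff)
        then have "1 < real k * infdist x C" using p by (simp add: field_simps)
        then show ?thesis by (simp add: g_def)
      qed
      then have "\<forall>\<^sub>F k in sequentially. g k x = indicator C x"
        using xC by (auto simp: eventually_sequentially intro!: exI[of _ k0])
      then show ?thesis by (rule tendsto_eventually)
    qed
    then show "AE x in mu. (\<lambda>k. f x * g k x) \<longlonglongrightarrow> f x * indicator C x" by (auto intro!: tendsto_intros)
  qed
  moreover have "(\<integral>x. f x * g k x \<partial>mu) = 0" for k
    using orth_continuous[OF f o gc] by (simp add: l2ip_def)
  ultimately show ?thesis by (simp add: LIMSEQ_const_iff)
qed simp

text \<open>\<open>ennreal\<close> cuts off negative values, so the two densities are the positive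
  and the negative part of \<open>f\<close>. They agree on closed sets, an intersection-stable
  generator of the Borel sets, hence as measures; so the two parts of \<open>f\<close> coincide and
  \<open>f\<close> vanishes almost everywhere.\<close>

lemma cmono_total:
  assumes f: "f \<in> L2 mu" and o: "\<And>N. l2ip mu f (cmono N) = 0"
  shows "l2norm mu f = 0"
proof -
  have fm: "f \<in> borel_measurable mu" by (rule L2_measurable[OF f])
  note [measurable] = fm
  have sf: "sets mu = sigma_sets UNIV (Collect closed)"
    by (simp add: sets_Msp borel_eq_closed sets_measure_of)
  have "density mu (\<lambda>x. ennreal (f x)) = density mu (\<lambda>x. ennreal (- f x))"
  proof (rule measure_eqI_generator_eq[where E="Collect closed" and \<Omega>=UNIV and A="\<lambda>_. UNIV"])
    show "Int_stable (Collect closed :: pt set set)" by (auto simp: Int_stable_def)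
    show "sets (density mu (\<lambda>x. ennreal (f x))) = sigma_sets UNIV (Collect closed)"
      "sets (density mu (\<lambda>x. ennreal (- f x))) = sigma_sets UNIV (Collect closed)" by (simp_all add: sf[symmetric])
    fix C :: "pt set" assume "C \<in> Collect closed"
    then have C: "closed C" by simp
    have Cm [measurable]: "C \<in> sets mu" using C by (simp add: sets_Msp)
    have i: "integrable mu (\<lambda>x. max 0 (f x) * indicator C x)" "integrable mu (\<lambda>x. max 0 (- f x) * indicator C x)"
      by (rule Bochner_Integration.integrable_bound[OF mu.L2_integrable[OF f]]; auto simp: indicator_def abs_mult)+
    have "(\<integral>x. max 0 (f x) * indicator C x \<partial>mu) - (\<integral>x. max 0 (- f x) * indicator C x \<partial>mu) =
      (\<integral>x. max 0 (f x) * indicator C x - max 0 (- f x) * indicator C x \<partial>mu)" using i by simp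
    also have "\<dots> = (\<integral>x. f x * indicator C x \<partial>mu)"
      by (rule Bochner_Integration.integral_cong[OF refl]) (auto simp: indicator_def max_def)
    also have "\<dots> = 0" by (rule orth_closed[OF f o C])
    finally have eq: "(\<integral>x. max 0 (f x) * indicator C x \<partial>mu) = (\<integral>x. max 0 (- f x) * indicator C x \<partial>mu)" by simp
    have em: "emeasure (density mu (\<lambda>x. ennreal (h x))) C = ennreal (\<integral>x. max 0 (h x) * indicator C x \<partial>mu)"
      if "h \<in> borel_measurable mu" "integrable mu (\<lambda>x. max 0 (h x) * indicator C x)" for h :: "pt \<Rightarrow> real"
    proof -
      have "emeasure (density mu (\<lambda>x. ennreal (h x))) C = (\<integral>\<^sup>+x. ennreal (h x) * indicator C x \<partial>mu)"
        by (rule emeasure_density) (use that(1) Cm in simp_all)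
      also have "\<dots> = (\<integral>\<^sup>+x. ennreal (max 0 (h x) * indicator C x) \<partial>mu)"
        by (rule nn_integral_cong) (auto simp: indicator_def max_def ennreal_neg)
      also have "\<dots> = ennreal (\<integral>x. max 0 (h x) * indicator C x \<partial>mu)"
        by (rule nn_integral_eq_integral[OF that(2)]) auto
      finally show ?thesis .
    qed
    show "emeasure (density mu (\<lambda>x. ennreal (f x))) C = emeasure (density mu (\<lambda>x. ennreal (- f x))) C"
      using em[OF fm i(1)] em[of "\<lambda>x. - f x", OF _ i(2)] eq by simp
  next
    fix k :: nat
    have "emeasure (density mu (\<lambda>x. ennreal (f x))) UNIV = (\<integral>\<^sup>+x. ennreal (f x) \<partial>mu)"
      using sets.top[of mu] by (subst emeasure_density) (auto intro: nn_integral_cong)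
    also have "\<dots> \<le> (\<integral>\<^sup>+x. ennreal (norm (f x)) \<partial>mu)" by (intro nn_integral_mono ennreal_leI) simp
    also have "\<dots> < \<infinity>" using mu.L2_integrable[OF f] by (simp add: integrable_iff_bounded)
    finally show "emeasure (density mu (\<lambda>x. ennreal (f x))) UNIV \<noteq> \<infinity>" by simp
  qed auto
  then have "AE x in mu. ennreal (f x) = ennreal (- f x)"
    by (subst (asm) mu.density_unique_iff) auto
  then have "AE x in mu. f x = 0"
  proof eventually_elim
    case (elim x)
    then show ?case by (cases "0 \<le> f x") (auto simp: ennreal_neg ennreal_eq_0_iff)
  qed
  then show ?thesis using l2norm_eq_0_iff[OF f] by simp
qed

section \<open>The Parseval identity for the energy\<close>

lemma Einf_eq_Q: "Einf mu f g = Q (\<lambda>n. partial n f) (\<lambda>n. partial n g)"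
  unfolding Einf_def Q_def Gam_def ..

text \<open>Eigenfunctions may involve \<open>|x|\<close> and so need not be cylindrical; this is
  what places them in the form closure of \<open>FC1\<close>, as \<open>e_approx\<close>
  demands.\<close>

lemma grad_approx_energy:
  assumes f: "grad f d" and a: "grad_approx f d fs B"
  shows "(\<lambda>k. l2norm mu (\<lambda>x. fs k x - f x)) \<longlonglongrightarrow> 0" "(\<lambda>k. Einf mu (fs k) (fs k)) \<longlonglongrightarrow> Q d d"
proof -
  note A = grad_approxD[OF a] and b = grad_approx_bound[OF a]
  note [measurable] = grad_measurable[OF f] FC1D(4)[OF A(1)]
  have "(\<lambda>k. \<integral>x. (fs k x - f x)\<^sup>2 \<partial>mu) \<longlonglongrightarrow> (\<integral>x. 0 \<partial>mu)"
  proof (rule dominated_Delta)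
    fix x assume x: "x \<in> Delta_inf"
    have "(\<lambda>k. (fs k x - f x)\<^sup>2) \<longlonglongrightarrow> (f x - f x)\<^sup>2" by (intro tendsto_intros A(5)[OF x])
    then show "(\<lambda>k. (fs k x - f x)\<^sup>2) \<longlonglongrightarrow> 0" by simp
    fix k
    have "\<bar>fs k x - f x\<bar> \<le> 2 * B" using A(3)[OF x, of k] b(1)[OF x] by linarith
    then show "\<bar>(fs k x - f x)\<^sup>2\<bar> \<le> (2 * B)\<^sup>2" using power_mono[of "\<bar>fs k x - f x\<bar>" "2 * B" 2] by simp
  qed measurable
  then show "(\<lambda>k. l2norm mu (\<lambda>x. fs k x - f x)) \<longlonglongrightarrow> 0" by (simp add: l2norm_tendsto_0_iff)
  show "(\<lambda>k. Einf mu (fs k) (fs k)) \<longlonglongrightarrow> Q d d"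
    unfolding Einf_eq_Q Q_def
  proof (rule dominated_Delta[OF Gam_meas[OF f f] Gam_meas[OF grad_FC1[OF A(1)] grad_FC1[OF A(1)]]])
    fix x assume x: "x \<in> Delta_inf"
    have "(\<lambda>k. \<Sum>n. x n * partial n (fs k) x * partial n (fs k) x) \<longlonglongrightarrow> (\<Sum>n. x n * d n x * d n x)"
    proof (rule tendsto_suminf_dominated)
      show "summable (\<lambda>n. B * B * x n)" by (rule summable_mult[OF Delta_infD(3)[OF x]])
      show "(\<lambda>k. x n * partial n (fs k) x * partial n (fs k) x) \<longlonglongrightarrow> x n * d n x * d n x" for n
        by (intro tendsto_intros A(6)[OF x])
      have "norm (x n * partial n (fs k) x * partial n (fs k) x) \<le> B * B * x n" for n k
        using Gam_terms(1)[of x "\<lambda>n. partial n (fs k)" B "\<lambda>n. partial n (fs k)" B n] x A(4)[OF x] by simp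
      then show "\<forall>\<^sub>F k in sequentially. \<forall>n. norm (x n * partial n (fs k) x * partial n (fs k) x) \<le> B * B * x n"
        by simp
    qed simp
    then show "(\<lambda>k. Gam (\<lambda>n. partial n (fs k)) (\<lambda>n. partial n (fs k)) x) \<longlonglongrightarrow> Gam d d x"
      unfolding Gam_def by (intro tendsto_intros)
    show "\<bar>Gam (\<lambda>n. partial n (fs k)) (\<lambda>n. partial n (fs k)) x\<bar> \<le> B * B" for k
      by (rule Gam_terms(3)[of x "\<lambda>n. partial n (fs k)" B "\<lambda>n. partial n (fs k)" B, OF x A(4)[OF x] A(4)[OF x]])
  qed
qed

text \<open>The continuous weight is replaced by a polynomial, on which one may integrate by parts.\<close>

lemma weak_pairing:
  assumes h: "\<And>R. grad (h R) (r R)" and h0: "(\<lambda>R. l2norm mu (h R)) \<longlonglongrightarrow> 0"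
    and K: "\<And>R::nat. Q (r R) (r R) \<le> K" and \<phi>: "continuous_on UNIV \<phi>"
  shows "(\<lambda>R. \<integral>x. (1 - suminf x) * (x n * (r R n x * \<phi> x)) \<partial>mu) \<longlonglongrightarrow> 0"
proof (rule LIMSEQ_I)
  fix \<epsilon> :: real assume "0 < \<epsilon>"
  have K0: "0 \<le> K" using Q_nonneg[OF h[of 0]] K[of 0] by linarith
  \<comment> \<open>Replacing \<open>\<phi>\<close> by a polynomial costs at most
    \<open>\<eta> * (1 + K)\<close> by the energy bound, so half of \<open>\<epsilon>\<close>
    remains for the polynomial term.\<close>
  define \<eta> where "\<eta> = \<epsilon> / (2 * (1 + K))"
  have \<eta>: "0 < \<eta>" "\<eta> * (1 + K) = \<epsilon> / 2" using K0 \<open>0 < \<epsilon>\<close> by (auto simp: \<eta>_def field_simps)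
  obtain p where p: "p \<in> cpoly" "\<forall>x\<in>cube. \<bar>\<phi> x - p x\<bar> < \<eta>" using cpoly_approx[OF \<phi> \<eta>(1)] by blast
  note pF = cpoly_FC1[OF p(1)]
  note gp = grad_FC1[OF pF]
  note [measurable] = grad_measurable[OF h] FC1D(4)[OF pF] FC1D(5)[OF pF] borel_measurable_Msp_continuous[OF \<phi>]
  \<comment> \<open>Integration by parts moves the derivative from \<open>h R\<close> onto the
    polynomial; \<open>b\<close> is the result up to sign, and it does not depend on
    \<open>R\<close>.\<close>
  define b where "b x = p x * (\<alpha> n * (1 - suminf x) - ainf * x n) + (1 - suminf x) * (x n * partial n p x)" for x
  obtain B where B: "0 < B" "\<And>x. x \<in> Delta_inf \<Longrightarrow> \<bar>p x\<bar> \<le> B" "\<And>i x. x \<in> Delta_inf \<Longrightarrow> \<bar>partial i p x\<bar> \<le> B"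
    using grad_bound[OF gp] by blast
  have bL: "b \<in> L2 mu"
  proof (rule L2_bounded_Delta)
    show "b \<in> borel_measurable Msp" unfolding b_def by measurable
    fix x assume x: "x \<in> Delta_inf"
    have "\<bar>p x * (\<alpha> n * (1 - suminf x) - ainf * x n)\<bar> \<le> B * (\<alpha> n + ainf)"
      unfolding abs_mult using B(1) by (intro mult_mono B(2)[OF x] drift_bound[OF x]) auto
    moreover have "\<bar>1 - suminf x\<bar> * (\<bar>x n\<bar> * \<bar>partial n p x\<bar>) \<le> 1 * (1 * B)"
      using Delta_infD(1,2)[OF x, of n] Delta_infD(4,5)[OF x] B(3)[OF x, of n] B(1) by (intro mult_mono) auto
    ultimately show "\<bar>b x\<bar> \<le> B * (\<alpha> n + ainf) + B" unfolding b_def abs_mult[symmetric] by linarith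
  qed
  have main: "(\<integral>x. (1 - suminf x) * (x n * (r R n x * p x)) \<partial>mu) = - l2ip mu (h R) b"
    and ip1: "integrable mu (\<lambda>x. (1 - suminf x) * (x n * (r R n x * p x)))" for R
  proof -
    note hp = grad_mult[OF h[of R] gp]
    have i1: "integrable mu (\<lambda>x. (1 - suminf x) * (x n * (h R x * partial n p x + r R n x * p x)))" by (rule ibp_split(2)[OF hp])
    have i2: "integrable mu (\<lambda>x. h R x * p x * (\<alpha> n * (1 - suminf x) - ainf * x n))" by (rule ibp_split(3)[OF hp])
    have i3: "integrable mu (\<lambda>x. h R x * b x)" by (rule L2_integrable_mult[OF grad_L2[OF h] bL])
    have e: "(1 - suminf x) * (x n * (r R n x * p x)) = (1 - suminf x) * (x n * (h R x * partial n p x + r R n x * p x))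
       + h R x * p x * (\<alpha> n * (1 - suminf x) - ainf * x n) - h R x * b x" for x
      by (simp add: b_def algebra_simps)
    show "integrable mu (\<lambda>x. (1 - suminf x) * (x n * (r R n x * p x)))" unfolding e using i1 i2 i3 by simp
    show "(\<integral>x. (1 - suminf x) * (x n * (r R n x * p x)) \<partial>mu) = - l2ip mu (h R) b"
      unfolding e l2ip_def using i1 i2 i3 ibp_split(1)[OF hp, of n] by simp
  qed
  have err: "\<bar>\<integral>x. (1 - suminf x) * (x n * (r R n x * (\<phi> x - p x))) \<partial>mu\<bar> \<le> \<epsilon> / 2"
    and ip2: "integrable mu (\<lambda>x. (1 - suminf x) * (x n * (r R n x * (\<phi> x - p x))))" for R
  proof -
    have iG: "integrable mu (\<lambda>x. \<eta> * (1 + Gam (r R) (r R) x))" using Gam_integrable[OF h h, of R R] by simp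
    have ptw: "\<bar>(1 - suminf x) * (x n * (r R n x * (\<phi> x - p x)))\<bar> \<le> \<eta> * (1 + Gam (r R) (r R) x)" if x: "x \<in> Delta_inf" for x
    proof -
      note D = Delta_infD[OF x]
      let ?w = "(1 - suminf x) * x n"
      have w: "0 \<le> ?w" "?w \<le> 1" using D(1,2)[of n] D(4,5) by (auto intro: mult_le_one)
      have G: "?w * (r R n x)\<^sup>2 \<le> Gam (r R) (r R) x" using Gam_nonneg(2)[OF x h, of n R] by (simp add: mult.assoc)
      \<comment> \<open>Trades the derivative for its square, which the energy controls uniformly in
        \<open>R\<close>.\<close>
      have r1: "\<bar>r R n x\<bar> \<le> 1 + (r R n x)\<^sup>2"
        using sum_squares_bound[of 1 "\<bar>r R n x\<bar>"] zero_le_power2[of "r R n x"] by simp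
      have "?w * \<bar>r R n x\<bar> \<le> ?w * (1 + (r R n x)\<^sup>2)" by (rule mult_left_mono[OF r1 w(1)])
      also have "\<dots> \<le> 1 + Gam (r R) (r R) x" using w(2) G by (simp add: distrib_left)
      finally have 1: "?w * \<bar>r R n x\<bar> \<le> 1 + Gam (r R) (r R) x" .
      have "\<bar>\<phi> x - p x\<bar> \<le> \<eta>" using p(2) x Delta_subset_cube by (meson less_imp_le subsetD)
      then have "(?w * \<bar>r R n x\<bar>) * \<bar>\<phi> x - p x\<bar> \<le> (1 + Gam (r R) (r R) x) * \<eta>"
        using 1 Gam_nonneg(1)[OF x h, of R] w(1) by (intro mult_mono) auto
      then show ?thesis using D(1)[of n] D(4) by (simp add: abs_mult mult_ac)
    qed
    show i: "integrable mu (\<lambda>x. (1 - suminf x) * (x n * (r R n x * (\<phi> x - p x))))"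
    proof (rule Bochner_Integration.integrable_bound[OF iG])
      show "(\<lambda>x. (1 - suminf x) * (x n * (r R n x * (\<phi> x - p x)))) \<in> borel_measurable mu" unfolding mm by measurable
      show "AE x in mu. norm ((1 - suminf x) * (x n * (r R n x * (\<phi> x - p x)))) \<le> norm (\<eta> * (1 + Gam (r R) (r R) x))"
        using AE_mu
      proof eventually_elim
        case (elim x)
        show ?case unfolding real_norm_def by (rule order_trans[OF ptw[OF elim] abs_ge_self])
      qed
    qed
    have "\<bar>\<integral>x. (1 - suminf x) * (x n * (r R n x * (\<phi> x - p x))) \<partial>mu\<bar> \<le> (\<integral>x. \<bar>(1 - suminf x) * (x n * (r R n x * (\<phi> x - p x)))\<bar> \<partial>mu)"
      by (rule integral_abs_bound)
    also have "\<dots> \<le> (\<integral>x. \<eta> * (1 + Gam (r R) (r R) x) \<partial>mu)"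
      by (rule integral_mono_AE[OF integrable_abs[OF i] iG eventually_mono[OF AE_mu ptw]])
    also have "\<dots> = \<eta> * (1 + Q (r R) (r R))"
      using Gam_integrable[OF h h, of R R] mu.prob_space by (simp add: Q_def)
    also have "\<dots> \<le> \<eta> * (1 + K)" using K[of R] \<eta>(1) by (intro mult_left_mono) auto
    finally show "\<bar>\<integral>x. (1 - suminf x) * (x n * (r R n x * (\<phi> x - p x))) \<partial>mu\<bar> \<le> \<epsilon> / 2" using \<eta>(2) by simp
  qed
  have "(\<lambda>R. l2norm mu (h R) * l2norm mu b) \<longlonglongrightarrow> 0 * l2norm mu b" by (intro tendsto_intros h0)
  then have "\<forall>\<^sub>F R in sequentially. l2norm mu (h R) * l2norm mu b < \<epsilon> / 2"
    using \<open>0 < \<epsilon>\<close> by (intro order_tendstoD(2)[of _ 0]) auto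
  then obtain R0 where R0: "\<And>R. R \<ge> R0 \<Longrightarrow> l2norm mu (h R) * l2norm mu b < \<epsilon> / 2" by (auto simp: eventually_sequentially)
  have "norm ((\<integral>x. (1 - suminf x) * (x n * (r R n x * \<phi> x)) \<partial>mu) - 0) < \<epsilon>" if "R \<ge> R0" for R
  proof -
    have e: "(1 - suminf x) * (x n * (r R n x * \<phi> x)) = (1 - suminf x) * (x n * (r R n x * p x)) + (1 - suminf x) * (x n * (r R n x * (\<phi> x - p x)))" for x
      by (simp add: algebra_simps)
    have "(\<integral>x. (1 - suminf x) * (x n * (r R n x * \<phi> x)) \<partial>mu) = - l2ip mu (h R) b + (\<integral>x. (1 - suminf x) * (x n * (r R n x * (\<phi> x - p x))) \<partial>mu)"
      unfolding e using ip1 ip2 by (simp add: main)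
    moreover have "\<bar>l2ip mu (h R) b\<bar> < \<epsilon> / 2"
      using l2_cauchy_schwarz[OF grad_L2[OF h[of R]] bL] R0[OF that] by linarith
    ultimately show ?thesis using err[of R] unfolding real_norm_def diff_0_right by linarith
  qed
  then show "\<exists>no. \<forall>R\<ge>no. norm ((\<integral>x. (1 - suminf x) * (x n * (r R n x * \<phi> x)) \<partial>mu) - 0) < \<epsilon>" by blast
qed

text \<open>A cylinder function has finitely many nonzero derivatives, so its pairing is a finite
  sum of weak pairings with the continuous weights \<open>partial n f\<close>.\<close>

lemma energy_pairing_tendsto:
  assumes h: "\<And>R. grad (h R) (r R)" and h0: "(\<lambda>R. l2norm mu (h R)) \<longlonglongrightarrow> 0"
    and K: "\<And>R::nat. Q (r R) (r R) \<le> K" and f: "f \<in> FC1"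
  shows "(\<lambda>R. Q (r R) (\<lambda>n. partial n f)) \<longlonglongrightarrow> 0"
proof -
  obtain m where m: "\<forall>n\<ge>m. partial n f = (\<lambda>x. 0)" using FC1_dep[OF f] by blast
  note gf = grad_FC1[OF f]
  note [measurable] = grad_measurable[OF h] FC1D(5)[OF f]
  let ?t = "\<lambda>R n x. (1 - suminf x) * (x n * (r R n x * partial n f x))"
  have it: "integrable mu (?t R n)" for R n
  proof -
    obtain B where B: "0 < B" "\<And>i x. x \<in> Delta_inf \<Longrightarrow> \<bar>partial i f x\<bar> \<le> B" using grad_bound[OF gf] by blast
    obtain C where C: "0 < C" "\<And>i x. x \<in> Delta_inf \<Longrightarrow> \<bar>r R i x\<bar> \<le> C" using grad_bound[OF h[of R]] by blast
    show ?thesis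
    proof (rule integrable_bounded)
      fix x assume x: "x \<in> Delta_inf"
      have "\<bar>1 - suminf x\<bar> * (\<bar>x n\<bar> * (\<bar>r R n x\<bar> * \<bar>partial n f x\<bar>)) \<le> 1 * (1 * (C * B))"
        using Delta_infD(1,2)[OF x, of n] Delta_infD(4,5)[OF x] B(1) B(2)[OF x, of n] C(1) C(2)[OF x, of n] by (intro mult_mono) auto
      then show "\<bar>?t R n x\<bar> \<le> C * B" by (simp add: abs_mult)
    qed measurable
  qed
  have "Q (r R) (\<lambda>n. partial n f) = (\<Sum>n<m. \<integral>x. ?t R n x \<partial>mu)" for R
  proof -
    have "Q (r R) (\<lambda>n. partial n f) = (\<integral>x. (\<Sum>n<m. ?t R n x) \<partial>mu)"
      unfolding Q_def
    proof (rule integral_cong_Delta[OF Gam_meas[OF h gf]])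
      fix x :: pt
      have "(\<Sum>n. x n * r R n x * partial n f x) = (\<Sum>n<m. x n * r R n x * partial n f x)"
        by (rule suminf_finite) (use m in auto)
      then show "Gam (r R) (\<lambda>n. partial n f) x = (\<Sum>n<m. ?t R n x)" by (simp add: Gam_def sum_distrib_left mult_ac)
    qed measurable
    then show ?thesis using it by simp
  qed
  moreover have "(\<lambda>R. \<Sum>n<m. \<integral>x. ?t R n x \<partial>mu) \<longlonglongrightarrow> (\<Sum>n<m. 0)"
    by (intro tendsto_sum weak_pairing[OF h h0 K FC1D(3)[OF f]])
  ultimately show ?thesis by simp
qed

text \<open>The partial sums are energy projections of \<open>f\<close>, so the residual has energy
  \<open>Einf mu f f - T R\<close>, which is bounded, while its L2 norm tends to 0. The same
  difference is the energy pairing of the residual with \<open>f\<close>, which vanishes in the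
  limit; this rules out a strict Bessel inequality.\<close>

lemma energy_expansion:
  assumes on: "orthonormal_system mu e" and ge: "\<And>i. grad (e i) (DD i)"
    and eig: "\<And>i f r. grad f r \<Longrightarrow> Q r (DD i) = lam i * l2ip mu f (e i)"
    and f: "f \<in> FC1"
  shows "(\<lambda>i. lam i * (l2ip mu f (e i))\<^sup>2) sums Einf mu f f"
proof -
  interpret ON: orthonormal_system mu e by (rule on)
  define c where "c i = l2ip mu f (e i)" for i
  note gf = grad_FC1[OF f]
  have fL: "f \<in> L2 mu" by (rule grad_L2[OF gf])
  define S where "S R = (\<lambda>x. \<Sum>i<R. c i * e i x)" for R
  define DS where "DS R = (\<lambda>n x. \<Sum>i<R. c i * DD i n x)" for R
  have gS: "grad (S R) (DS R)" for R
  proof (induction R)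
    case 0
    show ?case using genD(1)[OF gen_const[of 0]] by (simp add: S_def DS_def)
  next
    case (Suc R)
    from grad_lin[OF this ge[of R], of 1 "c R"] show ?case by (simp add: S_def DS_def)
  qed
  have QS: "Q r (DS R) = (\<Sum>i<R. c i * (lam i * l2ip mu g (e i)))" if g: "grad g r" for g r R
  proof (induction R)
    case 0
    show ?case by (simp add: DS_def Q_def Gam_def)
  next
    case (Suc R)
    have "Q (DS (Suc R)) r = Q (\<lambda>n x. 1 * DS R n x + c R * DD R n x) r" by (simp add: DS_def)
    also have "\<dots> = 1 * Q (DS R) r + c R * Q (DD R) r" by (rule Q_lin[OF gS ge g])
    finally show ?case
      unfolding Q_commute[of "DS (Suc R)" r] Q_commute[of "DS R" r] Q_commute[of "DD R" r] Suc eig[OF g, of R] by simp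
  qed
  define T where "T R = (\<Sum>i<R. lam i * (c i)\<^sup>2)" for R
  let ?E = "Einf mu f f"
  have Qf: "Q (\<lambda>n. partial n f) (DS R) = T R" for R
    unfolding QS[OF gf] T_def c_def by (simp add: power2_eq_square mult_ac)
  have QSS: "Q (DS R) (DS R) = T R" for R
  proof -
    have "l2ip mu (S R) (e i) = c i" if "i < R" for i
      using ON.coef_sum[of "{..<R}" c i] ON.coef_nrm[OF fL, of i] that
      by (simp add: ON.coef_def S_def c_def)
    then show ?thesis unfolding QS[OF gS] T_def by (simp add: power2_eq_square mult_ac)
  qed
  define h where "h R = (\<lambda>x. 1 * f x + (-1) * S R x)" for R
  define r where "r R = (\<lambda>n x. 1 * partial n f x + (-1) * DS R n x)" for R
  have gh: "grad (h R) (r R)" for R unfolding h_def r_def by (rule grad_lin[OF gf gS])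
  have Qrf: "Q (r R) (\<lambda>n. partial n f) = ?E - T R" for R
    using Q_lin[OF gf gS gf, of 1 "-1" R] Qf[of R] unfolding r_def Einf_eq_Q Q_commute[of "DS R" "\<lambda>n. partial n f"] by simp
  have QrS: "Q (r R) (DS R) = 0" for R
    using Q_lin[OF gf gS gS, of 1 "-1" R R] Qf[of R] QSS[of R] unfolding r_def by simp
  have Qrr: "Q (r R) (r R) = ?E - T R" for R
    using Q_lin[OF gf gS gh, of 1 "-1" R R] Qrf[of R] QrS[of R] unfolding r_def[symmetric]
    by (simp add: Q_commute[of "\<lambda>n. partial n f" "r R"] Q_commute[of "DS R" "r R"])
  have h0: "(\<lambda>R. l2norm mu (h R)) \<longlonglongrightarrow> 0"
    using ON.partial_tendsto[OF fL] unfolding h_def S_def c_def ON.coef_def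
    by (subst (asm) l2norm_minus_commute) simp
  have T0: "0 \<le> T R" for R using Q_nonneg[OF gS[of R]] unfolding QSS .
  have "Q (r R) (r R) \<le> ?E" for R unfolding Qrr using T0[of R] by simp
  from energy_pairing_tendsto[OF gh h0 this f] have "(\<lambda>R. ?E - T R) \<longlonglongrightarrow> 0" unfolding Qrf .
  then have "(\<lambda>R. ?E - (?E - T R)) \<longlonglongrightarrow> ?E - 0" by (intro tendsto_intros)
  then show ?thesis by (simp add: sums_def T_def c_def)
qed

section \<open>Polarization, contraction, the attained gap and the conclusion\<close>

lemma energy_polarization:
  assumes "f \<in> FC1" "g \<in> FC1"
  shows "Einf mu (\<lambda>x. 1 * f x + b * g x) (\<lambda>x. 1 * f x + b * g x) =
    Einf mu f f + 2 * b * Einf mu f g + b\<^sup>2 * Einf mu g g"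
proof -
  note gf = grad_FC1[OF assms(1)] and gg = grad_FC1[OF assms(2)]
  let ?d = "\<lambda>n x. 1 * partial n f x + b * partial n g x"
  have d: "(\<lambda>n. partial n (\<lambda>x. 1 * f x + b * g x)) = ?d" using FC1_lin(2)[OF assms, of _ 1 b] by blast
  have gd: "grad (\<lambda>x. 1 * f x + b * g x) ?d" by (rule grad_lin[OF gf gg])
  have "Q ?d ?d = 1 * Q (\<lambda>n. partial n f) ?d + b * Q (\<lambda>n. partial n g) ?d" by (rule Q_lin[OF gf gg gd])
  also have "Q (\<lambda>n. partial n f) ?d = 1 * Q (\<lambda>n. partial n f) (\<lambda>n. partial n f) + b * Q (\<lambda>n. partial n g) (\<lambda>n. partial n f)"
    unfolding Q_commute[of _ ?d] by (rule Q_lin[OF gf gg gf])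
  also have "Q (\<lambda>n. partial n g) ?d = 1 * Q (\<lambda>n. partial n f) (\<lambda>n. partial n g) + b * Q (\<lambda>n. partial n g) (\<lambda>n. partial n g)"
    unfolding Q_commute[of _ ?d] by (rule Q_lin[OF gf gg gg])
  finally show ?thesis
    unfolding Einf_eq_Q d Q_commute[of "\<lambda>n. partial n g" "\<lambda>n. partial n f"] by (simp add: algebra_simps power2_eq_square)
qed

lemma energy_contraction:
  assumes f: "f \<in> FC1" and g: "g \<in> FC1" and le: "\<And>n x. \<bar>partial n g x\<bar> \<le> \<bar>partial n f x\<bar>"
  shows "Einf mu g g \<le> Einf mu f f"
  unfolding Einf_eq_Q Q_def
proof (rule integral_mono_AE)
  note gf = grad_FC1[OF f] and gg = grad_FC1[OF g]
  show "integrable mu (Gam (\<lambda>n. partial n g) (\<lambda>n. partial n g))" by (rule Gam_integrable[OF gg gg])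
  show "integrable mu (Gam (\<lambda>n. partial n f) (\<lambda>n. partial n f))" by (rule Gam_integrable[OF gf gf])
  show "AE x in mu. Gam (\<lambda>n. partial n g) (\<lambda>n. partial n g) x \<le> Gam (\<lambda>n. partial n f) (\<lambda>n. partial n f) x"
    using AE_mu
  proof eventually_elim
    case (elim x)
    have "(\<Sum>n. x n * partial n g x * partial n g x) \<le> (\<Sum>n. x n * partial n f x * partial n f x)"
    proof (rule suminf_le[OF _ Gam_summable[OF elim gg gg] Gam_summable[OF elim gf gf]])
      fix n
      have "(partial n g x)\<^sup>2 \<le> (partial n f x)\<^sup>2" by (rule abs_le_square_iff[THEN iffD1, OF le])
      then have "x n * (partial n g x)\<^sup>2 \<le> x n * (partial n f x)\<^sup>2" using Delta_infD(1)[OF elim] by (rule mult_left_mono)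
      then show "x n * partial n g x * partial n g x \<le> x n * partial n f x * partial n f x"
        by (simp add: power2_eq_square mult.assoc)
    qed
    then show ?case unfolding Gam_def using Delta_infD(4)[OF elim] by (intro mult_left_mono) auto
  qed
qed

text \<open>In the difference of \<open>x 0 / \<alpha> 0\<close> and \<open>x 1 / \<alpha> 1\<close>
  the drift terms with \<open>1 - |x|\<close> cancel, which leaves an exact eigenfunction for
  \<open>- ainf\<close>. Its mean vanishes by testing against a constant.\<close>

lemma gap_attained:
  obtains f where "f \<in> FC1" "(\<integral>x. f x \<partial>mu) = 0" "l2norm mu f \<noteq> 0" "Einf mu f f = ainf * (l2norm mu f)\<^sup>2"
proof -
  let ?f = "\<lambda>x::pt. 1 / \<alpha> 0 * x 0 + (- 1 / \<alpha> 1) * x 1"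
  let ?d = "\<lambda>i x. 1 / \<alpha> 0 * unit 0 i x + (- 1 / \<alpha> 1) * unit 1 i x"
  let ?w = "\<lambda>x. 1 / \<alpha> 0 * (\<alpha> 0 * (1 - suminf x) - ainf * x 0) + (- 1 / \<alpha> 1) * (\<alpha> 1 * (1 - suminf x) - ainf * x 1)"
  have p: "0 < \<alpha> 0" "0 < \<alpha> 1" using pos by auto
  have g: "gen ?f ?d ?w" by (rule gen_lin[OF gen_coord gen_coord])
  have w: "?w x = - ainf * ?f x" for x using p by (simp add: field_simps)
  have fF: "?f \<in> FC1" by (rule FC1_lin(1)[OF FC1_coord(1) FC1_coord(1)])
  have d: "(\<lambda>n. partial n ?f) = ?d"
    using FC1_lin(2)[OF FC1_coord(1)[of 0] FC1_coord(1)[of 1], of _ "1 / \<alpha> 0" "- 1 / \<alpha> 1"] unfolding FC1_coord(2) by blast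
  have fL: "?f \<in> L2 mu" by (rule gen_L2(1)[OF g])
  have "Q (\<lambda>n x. 0) ?d = - (\<integral>x. 1 * ?w x \<partial>mu)" by (rule genD(4)[OF g genD(1)[OF gen_const]])
  then have "(\<integral>x. ?w x \<partial>mu) = 0" by (simp add: Q_def Gam_def)
  then have "- ainf * (\<integral>x. ?f x \<partial>mu) = 0" unfolding w by (simp only: integral_mult_right_zero)
  then have mean: "(\<integral>x. ?f x \<partial>mu) = 0" using ainf_pos by (simp only: mult_eq_0_iff) simp
  have "Q ?d ?d = - (\<integral>x. ?f x * ?w x \<partial>mu)" by (rule genD(4)[OF g genD(1)[OF g]])
  also have "\<dots> = - (\<integral>x. - ainf * (?f x)\<^sup>2 \<partial>mu)" unfolding w by (simp only: power2_eq_square mult.left_commute)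
  also have "\<dots> = ainf * (l2norm mu ?f)\<^sup>2" unfolding l2norm_sq by (simp only: integral_mult_right_zero)
  finally have E: "Einf mu ?f ?f = ainf * (l2norm mu ?f)\<^sup>2" unfolding Einf_eq_Q d .
  \<comment> \<open>A null eigenfunction would have no energy, so the \<open>x 0\<close> term of
    \<open>Gam\<close> integrates to 0. Integration by parts then gives \<open>x 0 = 0\<close>
    almost everywhere, hence mean missing mass \<open>s = 0\<close>, hence mean 0 for every
    coordinate and so \<open>s = 1\<close>.\<close>
  have "l2norm mu ?f \<noteq> 0"
  proof
    assume "l2norm mu ?f = 0"
    then have "AE x in mu. ?f x = 0" using l2norm_eq_0_iff[OF fL] by simp
    define a where "a n = (\<integral>x. x n \<partial>mu)" for n :: nat
    define s where "s = (\<integral>x. (1 - suminf x) \<partial>mu)"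
    have Q0: "Q ?d ?d = 0" using E \<open>l2norm mu ?f = 0\<close> unfolding Einf_eq_Q d by simp
    have i1: "integrable mu (\<lambda>x. (1 - suminf x) * x 0)"
      using ibp_split(2)[OF grad_unit[of 0], of 0] by simp
    have "(\<integral>x. (1 - suminf x) * (x 0 * (?d 0 x)\<^sup>2) \<partial>mu) \<le> Q ?d ?d"
      unfolding Q_def
    proof (rule integral_mono_AE)
      show "integrable mu (\<lambda>x. (1 - suminf x) * (x 0 * (?d 0 x)\<^sup>2))"
        using integrable_mult_right[OF i1, of "(1 / \<alpha> 0)\<^sup>2"] by (simp add: mult_ac)
      show "integrable mu (Gam ?d ?d)" by (rule Gam_integrable[OF genD(1)[OF g] genD(1)[OF g]])
      show "AE x in mu. (1 - suminf x) * (x 0 * (?d 0 x)\<^sup>2) \<le> Gam ?d ?d x"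
        using AE_mu by eventually_elim (rule Gam_nonneg(2)[OF _ genD(1)[OF g]])
    qed
    also have "(\<integral>x. (1 - suminf x) * (x 0 * (?d 0 x)\<^sup>2) \<partial>mu) = (1 / \<alpha> 0)\<^sup>2 * (\<integral>x. (1 - suminf x) * x 0 \<partial>mu)"
      by (subst integral_mult_right_zero[symmetric], rule Bochner_Integration.integral_cong[OF refl]) (simp add: mult_ac)
    finally have "(\<integral>x. (1 - suminf x) * x 0 \<partial>mu) \<le> 0"
      unfolding Q0 using p(1) by (simp add: mult_le_0_iff)
    moreover have n1: "AE x in mu. 0 \<le> (1 - suminf x) * x 0"
      using AE_mu by eventually_elim (use Delta_infD(1,4) in auto)
    ultimately have z1: "(\<integral>x. (1 - suminf x) * x 0 \<partial>mu) = 0" using integral_nonneg_AE[OF n1] by linarith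
    have sint: "integrable mu (\<lambda>x. 1 - suminf x)"
      by (rule integrable_bounded[of _ 1], measurable) (use Delta_infD(4,5) in \<open>force simp: abs_le_iff\<close>)
    have xint: "integrable mu (\<lambda>x. x n)" for n
      by (rule integrable_bounded[of _ 1]) (auto dest: Delta_infD(1,2)[where i=n] simp: abs_le_iff)
    have sm: "\<alpha> n * s = ainf * a n" for n
    proof -
      have "(\<integral>x. (1::real) * (\<alpha> n * (1 - suminf x) - ainf * x n) \<partial>mu) = 0"
        using ibp_split(1)[OF genD(1)[OF gen_const[of 1]], of n] by simp
      then show ?thesis unfolding s_def a_def using sint xint[of n] by simp
    qed
    have "(\<integral>x. (1 - suminf x) * (x 0 * 1) \<partial>mu) = - (\<integral>x. x 0 * (\<alpha> 0 * (1 - suminf x) - ainf * x 0) \<partial>mu)"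
      using ibp_split(1)[OF grad_unit[of 0], of 0] by simp
    moreover have sq: "integrable mu (\<lambda>x. x 0 * x 0)"
      by (rule L2_integrable_mult; rule gen_L2(1)[OF gen_coord])
    moreover have "(\<integral>x. x 0 * (\<alpha> 0 * (1 - suminf x) - ainf * x 0) \<partial>mu) =
        (\<integral>x. \<alpha> 0 * ((1 - suminf x) * x 0) - ainf * (x 0 * x 0) \<partial>mu)"
      by (rule Bochner_Integration.integral_cong[OF refl]) (simp add: algebra_simps)
    moreover have "\<dots> = \<alpha> 0 * (\<integral>x. (1 - suminf x) * x 0 \<partial>mu) - ainf * (\<integral>x. x 0 * x 0 \<partial>mu)"
      using i1 sq by simp
    ultimately have "(\<integral>x. x 0 * x 0 \<partial>mu) = 0" using z1 ainf_pos by simp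
    then have "AE x in mu. x 0 * x 0 = 0" using sq by (subst (asm) integral_nonneg_eq_0_iff_AE) auto
    then have "AE x in mu. x 0 = 0" by eventually_elim simp
    then have "a 0 = (\<integral>x. 0 \<partial>mu)" unfolding a_def by (intro integral_cong_AE) (auto simp: mm)
    then have "s = 0" using sm[of 0] p(1) by simp
    then have an: "a n = 0" for n using sm[of n] ainf_pos by simp
    have "(\<lambda>k. \<integral>x. (\<Sum>n<k. x n) \<partial>mu) \<longlonglongrightarrow> (\<integral>x. suminf x \<partial>mu)"
    proof (rule dominated_Delta)
      fix x assume x: "x \<in> Delta_inf"
      show "(\<lambda>k. \<Sum>n<k. x n) \<longlonglongrightarrow> suminf x" by (rule summable_LIMSEQ[OF Delta_infD(3)[OF x]])
      show "\<bar>\<Sum>n<k. x n\<bar> \<le> 1" for k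
        using Delta_infD(1,4)[OF x] Delta_infD(6)[OF x, of k] by (simp add: sum_nonneg)
    qed measurable
    moreover have "(\<integral>x. (\<Sum>n<k. x n) \<partial>mu) = 0" for k using an xint by (simp add: a_def)
    ultimately have "(\<integral>x. suminf x \<partial>mu) = 0" by (simp add: LIMSEQ_const_iff)
    moreover have "integrable mu (\<lambda>x. suminf x)"
      by (rule integrable_bounded[of _ 1]) (auto dest: Delta_infD(4,5) simp: abs_le_iff)
    ultimately have "s = 1" unfolding s_def using mu.prob_space by simp
    with \<open>s = 0\<close> show False by simp
  qed
  with fF mean E show thesis by (intro that)
qed

lemma dirichlet_form_properties:
  "closable mu FC1 (Einf mu) \<and>
    dirichlet_form mu (closure_dom mu FC1 (Einf mu)) (closure_form mu FC1 (Einf mu)) \<and>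
    (\<forall>f\<in>FC2. generator_rel mu (closure_dom mu FC1 (Einf mu)) (closure_form mu FC1 (Einf mu))
                 f (Lop \<alpha> ainf f)) \<and>
    spectral_gap mu (closure_dom mu FC1 (Einf mu)) (closure_form mu FC1 (Einf mu)) = ainf \<and>
    (\<exists>P. semigroup_of mu (closure_dom mu FC1 (Einf mu)) (closure_form mu FC1 (Einf mu)) P) \<and>
    (\<forall>P. semigroup_of mu (closure_dom mu FC1 (Einf mu)) (closure_form mu FC1 (Einf mu)) P \<longrightarrow>
       (\<forall>t\<ge>0. \<forall>f\<in>L2 mu.
          sqrt (\<integral>x. (P t f x - (\<integral>y. f y \<partial>mu))\<^sup>2 \<partial>mu)
            \<le> exp (- ainf * t) * sqrt (\<integral>x. (f x)\<^sup>2 \<partial>mu))) \<and>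
    (\<forall>f\<in>FC1. (\<integral>x. f x \<partial>mu) = 0 \<longrightarrow>
       (\<integral>x. (f x)\<^sup>2 \<partial>mu) \<le> 1 / ainf * Einf mu f f)"
proof (rule eigenbasis)
  fix e :: "nat \<Rightarrow> pt \<Rightarrow> real" and DD :: "nat \<Rightarrow> nat \<Rightarrow> pt \<Rightarrow> real" and lam :: "nat \<Rightarrow> real"
  assume ge: "\<And>i. grad (e i) (DD i)" and eig: "\<And>i f r. grad f r \<Longrightarrow> Q r (DD i) = lam i * l2ip mu f (e i)"
    and orth: "\<And>i j. i \<noteq> j \<Longrightarrow> l2ip mu (e i) (e j) = 0" and unit: "\<And>i. l2ip mu (e i) (e i) = 0 \<or> l2ip mu (e i) (e i) = 1"
    and lam0: "\<And>i. 0 \<le> lam i" and e1: "e 1 = (\<lambda>x. 1)" "lam 1 = 0"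
    and gap: "\<And>i. i \<noteq> 1 \<Longrightarrow> l2ip mu (e i) (e i) \<noteq> 0 \<Longrightarrow> ainf \<le> lam i"
    and tot: "\<And>f N. f \<in> L2 mu \<Longrightarrow> (\<And>i. l2ip mu f (e i) = 0) \<Longrightarrow> l2ip mu f (cmono N) = 0"
  have on: "orthonormal_system mu e"
  proof
    show "e i \<in> L2 mu" for i by (rule grad_L2[OF ge])
    show "l2norm mu f = 0" if "f \<in> L2 mu" "\<And>i. l2ip mu f (e i) = 0" for f
      by (rule cmono_total[OF that(1)]) (rule tot[OF that])
  qed (fact orth unit)+
  interpret ON: orthonormal_system mu e by (rule on)
  interpret SF: spectral_form mu e lam FC1 "Einf mu"
  proof
    show "0 \<le> lam i" for i by (rule lam0)
    show L: "f \<in> L2 mu" if "f \<in> FC1" for f by (rule grad_L2[OF grad_FC1[OF that]])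
    show "(\<lambda>x. a * f x + b * g x) \<in> FC1" if "f \<in> FC1" "g \<in> FC1" for f g a b by (rule FC1_lin(1)[OF that])
    show "(\<lambda>i. lam i * ON.coef f i * ON.coef g i) sums Einf mu f g" if f: "f \<in> FC1" and g: "g \<in> FC1" for f g
    proof -
      \<comment> \<open>\<open>energy_expansion\<close> treats a single function; polarization
        extends it to pairs.\<close>
      let ?p = "\<lambda>x. 1 * f x + 1 * g x" and ?m = "\<lambda>x. 1 * f x + (-1) * g x"
      have s: "(\<lambda>i. 1/4 * (lam i * (l2ip mu ?p (e i))\<^sup>2 - lam i * (l2ip mu ?m (e i))\<^sup>2)) sums (1/4 * (Einf mu ?p ?p - Einf mu ?m ?m))"
        by (intro sums_mult sums_diff energy_expansion[OF on ge eig] FC1_lin(1)[OF f g])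
      have c: "l2ip mu ?p (e i) = 1 * ON.coef f i + 1 * ON.coef g i" "l2ip mu ?m (e i) = 1 * ON.coef f i + (-1) * ON.coef g i" for i
        unfolding ON.coef_def by (rule l2ip_lin_left[OF L[OF f] L[OF g] ON.e_L2])+
      have "1/4 * (Einf mu ?p ?p - Einf mu ?m ?m) = Einf mu f g"
        unfolding energy_polarization[OF f g] by simp
      moreover have "1/4 * (lam i * (l2ip mu ?p (e i))\<^sup>2 - lam i * (l2ip mu ?m (e i))\<^sup>2) = lam i * ON.coef f i * ON.coef g i" for i
        unfolding c by (simp add: power2_eq_square algebra_simps)
      ultimately show ?thesis using s by simp
    qed
    show "\<exists>gs. (\<forall>k. gs k \<in> FC1) \<and> (\<lambda>k. l2norm mu (\<lambda>x. gs k x - e i x)) \<longlonglongrightarrow> 0 \<and>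
          (\<lambda>k. Einf mu (gs k) (gs k)) \<longlonglongrightarrow> lam i * ON.nrm i" for i
    proof -
      obtain fs B where a: "grad_approx (e i) (DD i) fs B" using ge[of i] unfolding grad_def by blast
      show ?thesis
        using grad_approx_energy[OF ge a] grad_approxD(1)[OF a] unfolding eig[OF ge] ON.nrm_def by blast
    qed
    show "\<exists>g\<in>FC1. Einf mu g g \<le> Einf mu f f \<and> (\<forall>x. \<bar>g x - min 1 (max 0 (f x))\<bar> \<le> \<epsilon>)" if "f \<in> FC1" "0 < \<epsilon>" for f \<epsilon>
    proof (rule FC1_contraction[OF that])
      fix g assume g: "g \<in> FC1" "\<And>x. \<bar>g x - min 1 (max 0 (f x))\<bar> \<le> \<epsilon>" "\<And>n x. \<bar>partial n g x\<bar> \<le> \<bar>partial n f x\<bar>"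
      show ?thesis using g(1,2) energy_contraction[OF that(1) g(1,3)] by blast
    qed
  qed
  \<comment> \<open>Index 1 is the code of the empty product, so \<open>e 1\<close> is the constant
    eigenvector.\<close>
  have i1: "AE x in mu. e 1 x = 1" unfolding e1 by simp
  have gap': "ainf \<le> lam i" if "i \<noteq> 1" "ON.nrm i \<noteq> 0" for i using gap[of i] that unfolding ON.nrm_def by blast
  show ?thesis
  proof (intro conjI ballI allI impI)
    show "closable mu FC1 (Einf mu)" by (rule SF.closable_form)
    show "dirichlet_form mu (closure_dom mu FC1 (Einf mu)) (closure_form mu FC1 (Einf mu))"
      by (rule SF.dirichlet_form_closure)
    show "generator_rel mu (closure_dom mu FC1 (Einf mu)) (closure_form mu FC1 (Einf mu)) f (Lop \<alpha> ainf f)"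
      if f: "f \<in> FC2" for f
      unfolding SF.generator_rel_iff
    proof (intro conjI allI)
      note g = gen_FC2[OF f]
      show "f \<in> L2 mu" "Lop \<alpha> ainf f \<in> L2 mu" by (rule gen_L2[OF g])+
      fix i
      have "ON.coef (Lop \<alpha> ainf f) i = (\<integral>x. e i x * Lop \<alpha> ainf f x \<partial>mu)" by (simp add: ON.coef_def l2ip_def mult.commute)
      also have "\<dots> = - Q (DD i) (\<lambda>n. partial n f)" using genD(4)[OF g ge[of i]] by simp
      also have "\<dots> = - lam i * ON.coef f i"
        unfolding Q_commute[of "DD i"] eig[OF genD(1)[OF g]] ON.coef_def by simp
      finally show "ON.coef (Lop \<alpha> ainf f) i = - lam i * ON.coef f i" .
    qed
    show "spectral_gap mu (closure_dom mu FC1 (Einf mu)) (closure_form mu FC1 (Einf mu)) = ainf"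
    proof (rule gap_attained)
      fix f assume f: "f \<in> FC1" "(\<integral>x. f x \<partial>mu) = 0" "l2norm mu f \<noteq> 0" "Einf mu f f = ainf * (l2norm mu f)\<^sup>2"
      show ?thesis
        by (rule SF.spectral_gap_eq[OF i1 gap' SF.C_D[OF f(1)] f(2,3)]) (use f(4) SF.E_eq_q[OF f(1) f(1)] in auto)
    qed
    show "\<exists>P. semigroup_of mu (closure_dom mu FC1 (Einf mu)) (closure_form mu FC1 (Einf mu)) P"
      using SF.heat_semigroup by blast
    show "sqrt (\<integral>x. (P t f x - (\<integral>y. f y \<partial>mu))\<^sup>2 \<partial>mu) \<le> exp (- ainf * t) * sqrt (\<integral>x. (f x)\<^sup>2 \<partial>mu)"
      if "semigroup_of mu (closure_dom mu FC1 (Einf mu)) (closure_form mu FC1 (Einf mu)) P" "0 \<le> t" "f \<in> L2 mu" for P t f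
      using SF.semigroup_decay[OF that i1 e1(2) gap'] unfolding l2norm_def .
    show "(\<integral>x. (f x)\<^sup>2 \<partial>mu) \<le> 1 / ainf * Einf mu f f" if f: "f \<in> FC1" "(\<integral>x. f x \<partial>mu) = 0" for f
    proof -
      have "ainf * (l2norm mu f)\<^sup>2 \<le> Einf mu f f"
        using SF.poincare_D[OF SF.C_D[OF f(1)] f(2) i1 gap'] SF.E_eq_q[OF f(1) f(1)] by simp
      then show ?thesis using ainf_pos unfolding l2norm_sq by (simp add: pos_le_divide_eq mult.commute)
    qed
  qed
qed

end

theorem theorem2p2:
  fixes \<alpha> :: "nat \<Rightarrow> real" and ainf :: real
  assumes pos: "\<forall>i. 0 < \<alpha> i" and summ: "summable \<alpha>" and ainf_pos: "0 < ainf"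
  shows "\<exists>\<mu>. prob_space \<mu> \<and> sets \<mu> = sets Msp \<and> emeasure \<mu> Delta_inf = 1 \<and>
    weak_conv_Delta (\<lambda>n. mu_n (Suc n) \<alpha> ainf) \<mu> \<and>
    closable \<mu> FC1 (Einf \<mu>) \<and>
    dirichlet_form \<mu> (closure_dom \<mu> FC1 (Einf \<mu>)) (closure_form \<mu> FC1 (Einf \<mu>)) \<and>
    (\<forall>f\<in>FC2. generator_rel \<mu> (closure_dom \<mu> FC1 (Einf \<mu>)) (closure_form \<mu> FC1 (Einf \<mu>))
                 f (Lop \<alpha> ainf f)) \<and>
    spectral_gap \<mu> (closure_dom \<mu> FC1 (Einf \<mu>)) (closure_form \<mu> FC1 (Einf \<mu>)) = ainf \<and>
    (\<exists>P. semigroup_of \<mu> (closure_dom \<mu> FC1 (Einf \<mu>)) (closure_form \<mu> FC1 (Einf \<mu>)) P) \<and>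
    (\<forall>P. semigroup_of \<mu> (closure_dom \<mu> FC1 (Einf \<mu>)) (closure_form \<mu> FC1 (Einf \<mu>)) P \<longrightarrow>
       (\<forall>t\<ge>0. \<forall>f\<in>L2 \<mu>.
          sqrt (\<integral>x. (P t f x - (\<integral>y. f y \<partial>\<mu>))\<^sup>2 \<partial>\<mu>)
            \<le> exp (- ainf * t) * sqrt (\<integral>x. (f x)\<^sup>2 \<partial>\<mu>))) \<and>
    (\<forall>f\<in>FC1. (\<integral>x. f x \<partial>\<mu>) = 0 \<longrightarrow>
       (\<integral>x. (f x)\<^sup>2 \<partial>\<mu>) \<le> 1 / ainf * Einf \<mu> f f)"
proof -
  interpret simplex_params \<alpha> ainf
    by standard (use pos summ ainf_pos in auto)
  show ?thesis
    by (intro exI[of _ mu] conjI[OF prob_mu] conjI[OF sets_mu] conjI[OF emeasure_mu_Delta]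
        conjI[OF weak_convergence] dirichlet_form_properties)
qed

end
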